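(* Let $f:[0,1]\to\mathbb{R}$ be a function such that $f(0)\cdot f(1)\leqslant 0$, and let $\varepsilon>0$. Then there exists $z\in[0,1]$ such that either (1) $|f(z)|<\varepsilon$, or (2) there exists a sequence $(x_n)_{n\geqslant 1}$ in $[0,1]$ with $x_n\to z$ such that $f(z)\cdot f(x_n)<-\frac{\varepsilon^2}{8}$ for all $n$. Furthermore, in case the second alternative holds, WLPO holds; and if in addition $f$ is strongly extensional, then in that case LPO holds.
   Context: The setting is Bishop-style constructive mathematics: intuitionistic logic (no law of excluded middle), with countable and dependent choice allowed. "Either $A$ or $B$" is the constructive disjunction $A\lor B$. No continuity of $f$ is assumed. LPO is the statement: for every binary sequence $(a_n)_{n\geqslant1}$, either $a_n=0$ for all $n$ or there exists $n$ with $a_n=1$. WLPO is the statement: for every binary sequence $(a_n)_{n\geqslant1}$, either $\forall n\,(a_n=0)$ or $\neg\forall n\,(a_n=0)$. A function $f:[0,1]\to\mathbb{R}$ is strongly extensional if for all $x,y$, $|f(x)-f(y)|>0$ implies $|x-y|>0$. *)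

theory Defs
  imports Main
begin

text \<open>
  The proposition is about intuitionistic provability: in the classical logic of HOL, LPO and WLPO
  are trivially true. We therefore formalize Bishop-style mathematics as a formal system, namely
  intuitionistic arithmetic in all finite types (HA-omega in the style of Troelstra, with
  intensional equality) extended by countable choice and dependent choice at all finite types, and
  speak about derivability in it. There is no excluded middle, no extensionality and no continuity
  axiom. For convenience the rational numbers are a second base type, characterized as the discrete
  ordered field whose elements are quotients of differences of natural numbers; this is a
  definitional extension of the usual coding of rationals by natural numbers.
\<close>

section \<open>The formal system\<close>

subsection \<open>Syntax\<close>

datatype ty = Nt | Qt | Fn ty ty (infixr "\<rightarrow>" 70)

datatype cst =
    Zero | Succ
  | Kc ty ty | Sc ty ty ty
  | Rec ty
  | Iota
  | Plus | Minus | Times | Inv | Absv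

text \<open>Variables are de Bruijn indices; terms contain no binders.\<close>

datatype tm = Var nat | Con cst | App tm tm (infixl "\<bullet>" 90)

datatype fm =
    Eq tm tm (infix "\<^bold>=" 50)
  | Lt tm tm (infix "\<^bold><" 50)
  | Fls
  | And fm fm (infixr "\<^bold>\<and>" 35)
  | Or fm fm (infixr "\<^bold>\<or>" 30)
  | Imp fm fm (infixr "\<^bold>\<longrightarrow>" 25)
  | All ty fm
  | Ex ty fm

abbreviation Neg :: "fm \<Rightarrow> fm" ("\<^bold>\<not> _" [40] 40)
  where "\<^bold>\<not> A \<equiv> A \<^bold>\<longrightarrow> Fls"

primrec cty :: "cst \<Rightarrow> ty" where
  "cty Zero = Nt"
| "cty Succ = Nt \<rightarrow> Nt"
| "cty (Kc \<sigma> \<tau>) = \<sigma> \<rightarrow> \<tau> \<rightarrow> \<sigma>"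
| "cty (Sc \<rho> \<sigma> \<tau>) = (\<rho> \<rightarrow> \<sigma> \<rightarrow> \<tau>) \<rightarrow> (\<rho> \<rightarrow> \<sigma>) \<rightarrow> \<rho> \<rightarrow> \<tau>"
| "cty (Rec \<sigma>) = \<sigma> \<rightarrow> (Nt \<rightarrow> \<sigma> \<rightarrow> \<sigma>) \<rightarrow> Nt \<rightarrow> \<sigma>"
| "cty Iota = Nt \<rightarrow> Qt"
| "cty Plus = Qt \<rightarrow> Qt \<rightarrow> Qt"
| "cty Minus = Qt \<rightarrow> Qt"
| "cty Times = Qt \<rightarrow> Qt \<rightarrow> Qt"
| "cty Inv = Qt \<rightarrow> Qt"
| "cty Absv = Qt \<rightarrow> Qt"

text \<open>A typing context lists the types of the free variables, index 0 first.\<close>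

inductive has_ty :: "ty list \<Rightarrow> tm \<Rightarrow> ty \<Rightarrow> bool" where
  ty_Var: "i < length \<Gamma> \<Longrightarrow> has_ty \<Gamma> (Var i) (\<Gamma> ! i)"
| ty_Con: "has_ty \<Gamma> (Con c) (cty c)"
| ty_App: "has_ty \<Gamma> t (\<sigma> \<rightarrow> \<tau>) \<Longrightarrow> has_ty \<Gamma> u \<sigma> \<Longrightarrow> has_ty \<Gamma> (t \<bullet> u) \<tau>"

primrec wff :: "ty list \<Rightarrow> fm \<Rightarrow> bool" where
  "wff \<Gamma> (t \<^bold>= u) \<longleftrightarrow> (\<exists>\<sigma>. has_ty \<Gamma> t \<sigma> \<and> has_ty \<Gamma> u \<sigma>)"
| "wff \<Gamma> (t \<^bold>< u) \<longleftrightarrow> has_ty \<Gamma> t Qt \<and> has_ty \<Gamma> u Qt"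
| "wff \<Gamma> Fls \<longleftrightarrow> True"
| "wff \<Gamma> (A \<^bold>\<and> B) \<longleftrightarrow> wff \<Gamma> A \<and> wff \<Gamma> B"
| "wff \<Gamma> (A \<^bold>\<or> B) \<longleftrightarrow> wff \<Gamma> A \<and> wff \<Gamma> B"
| "wff \<Gamma> (A \<^bold>\<longrightarrow> B) \<longleftrightarrow> wff \<Gamma> A \<and> wff \<Gamma> B"
| "wff \<Gamma> (All \<sigma> A) \<longleftrightarrow> wff (\<sigma> # \<Gamma>) A"
| "wff \<Gamma> (Ex \<sigma> A) \<longleftrightarrow> wff (\<sigma> # \<Gamma>) A"

text \<open>Simultaneous substitution.\<close>

primrec subst_tm :: "(nat \<Rightarrow> tm) \<Rightarrow> tm \<Rightarrow> tm" where
  "subst_tm s (Var i) = s i"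
| "subst_tm s (Con c) = Con c"
| "subst_tm s (t \<bullet> u) = subst_tm s t \<bullet> subst_tm s u"

abbreviation shift :: "nat \<Rightarrow> tm \<Rightarrow> tm"
  where "shift k \<equiv> subst_tm (\<lambda>i. Var (i + k))"

definition up :: "(nat \<Rightarrow> tm) \<Rightarrow> nat \<Rightarrow> tm"
  where "up s = case_nat (Var 0) (\<lambda>i. shift 1 (s i))"

primrec subst_fm :: "(nat \<Rightarrow> tm) \<Rightarrow> fm \<Rightarrow> fm" where
  "subst_fm s (t \<^bold>= u) = (subst_tm s t \<^bold>= subst_tm s u)"
| "subst_fm s (t \<^bold>< u) = (subst_tm s t \<^bold>< subst_tm s u)"
| "subst_fm s Fls = Fls"
| "subst_fm s (A \<^bold>\<and> B) = (subst_fm s A \<^bold>\<and> subst_fm s B)"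
| "subst_fm s (A \<^bold>\<or> B) = (subst_fm s A \<^bold>\<or> subst_fm s B)"
| "subst_fm s (A \<^bold>\<longrightarrow> B) = (subst_fm s A \<^bold>\<longrightarrow> subst_fm s B)"
| "subst_fm s (All \<sigma> A) = All \<sigma> (subst_fm (up s) A)"
| "subst_fm s (Ex \<sigma> A) = Ex \<sigma> (subst_fm (up s) A)"

abbreviation shift_fm :: "nat \<Rightarrow> fm \<Rightarrow> fm"
  where "shift_fm k \<equiv> subst_fm (\<lambda>i. Var (i + k))"

abbreviation inst :: "fm \<Rightarrow> tm \<Rightarrow> fm"
  where "inst A t \<equiv> subst_fm (case_nat t Var) A"

subsection \<open>Terms for natural and rational numbers\<close>

abbreviation zero :: tm where "zero \<equiv> Con Zero"
abbreviation succ :: "tm \<Rightarrow> tm" where "succ t \<equiv> Con Succ \<bullet> t"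
abbreviation iota :: "tm \<Rightarrow> tm" where "iota t \<equiv> Con Iota \<bullet> t"
abbreviation plus_q :: "tm \<Rightarrow> tm \<Rightarrow> tm" (infixl "\<^bold>+" 65)
  where "t \<^bold>+ u \<equiv> Con Plus \<bullet> t \<bullet> u"
abbreviation neg_q :: "tm \<Rightarrow> tm" ("\<^bold>- _" [81] 80)
  where "\<^bold>- t \<equiv> Con Minus \<bullet> t"
abbreviation times_q :: "tm \<Rightarrow> tm \<Rightarrow> tm" (infixl "\<^bold>*" 70)
  where "t \<^bold>* u \<equiv> Con Times \<bullet> t \<bullet> u"
abbreviation inv_q :: "tm \<Rightarrow> tm" where "inv_q t \<equiv> Con Inv \<bullet> t"
abbreviation abs_q :: "tm \<Rightarrow> tm" where "abs_q t \<equiv> Con Absv \<bullet> t"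

definition num :: "nat \<Rightarrow> tm" where "num k = (succ ^^ k) zero"

abbreviation qnum :: "nat \<Rightarrow> tm" where "qnum k \<equiv> iota (num k)"

abbreviation le_q :: "tm \<Rightarrow> tm \<Rightarrow> fm" (infix "\<^bold>\<le>" 50)
  where "t \<^bold>\<le> u \<equiv> (t \<^bold>< u) \<^bold>\<or> (t \<^bold>= u)"

text \<open>\<open>le_n\<close> compares natural numbers through the embedding into the rationals.\<close>

abbreviation le_n :: "tm \<Rightarrow> tm \<Rightarrow> fm"
  where "le_n t u \<equiv> iota t \<^bold>\<le> iota u"

text \<open>\<open>eps_q k\<close> is the rational \<open>1 / (k + 1)\<close>.\<close>

abbreviation eps_q :: "tm \<Rightarrow> tm" where "eps_q k \<equiv> inv_q (iota (succ k))"

subsection \<open>Non-logical axioms\<close>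

inductive ax :: "ty list \<Rightarrow> fm \<Rightarrow> bool" where
  ax_K: "has_ty \<Gamma> x \<sigma> \<Longrightarrow> has_ty \<Gamma> y \<tau> \<Longrightarrow> ax \<Gamma> (Con (Kc \<sigma> \<tau>) \<bullet> x \<bullet> y \<^bold>= x)"
| ax_S: "has_ty \<Gamma> x (\<rho> \<rightarrow> \<sigma> \<rightarrow> \<tau>) \<Longrightarrow> has_ty \<Gamma> y (\<rho> \<rightarrow> \<sigma>) \<Longrightarrow> has_ty \<Gamma> z \<rho> \<Longrightarrow>
    ax \<Gamma> (Con (Sc \<rho> \<sigma> \<tau>) \<bullet> x \<bullet> y \<bullet> z \<^bold>= x \<bullet> z \<bullet> (y \<bullet> z))"
| ax_Rec_0: "has_ty \<Gamma> x \<sigma> \<Longrightarrow> has_ty \<Gamma> y (Nt \<rightarrow> \<sigma> \<rightarrow> \<sigma>) \<Longrightarrow>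
    ax \<Gamma> (Con (Rec \<sigma>) \<bullet> x \<bullet> y \<bullet> zero \<^bold>= x)"
| ax_Rec_S: "has_ty \<Gamma> x \<sigma> \<Longrightarrow> has_ty \<Gamma> y (Nt \<rightarrow> \<sigma> \<rightarrow> \<sigma>) \<Longrightarrow> has_ty \<Gamma> n Nt \<Longrightarrow>
    ax \<Gamma> (Con (Rec \<sigma>) \<bullet> x \<bullet> y \<bullet> succ n \<^bold>= y \<bullet> n \<bullet> (Con (Rec \<sigma>) \<bullet> x \<bullet> y \<bullet> n))"

| ax_succ_neq: "has_ty \<Gamma> n Nt \<Longrightarrow> ax \<Gamma> (\<^bold>\<not> succ n \<^bold>= zero)"
| ax_succ_inj: "has_ty \<Gamma> n Nt \<Longrightarrow> has_ty \<Gamma> m Nt \<Longrightarrow> ax \<Gamma> (succ n \<^bold>= succ m \<^bold>\<longrightarrow> n \<^bold>= m)"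
| ax_induct: "wff (Nt # \<Gamma>) A \<Longrightarrow>
    ax \<Gamma> (inst A zero
          \<^bold>\<and> All Nt (A \<^bold>\<longrightarrow> subst_fm (case_nat (succ (Var 0)) (\<lambda>i. Var (i + 1))) A)
          \<^bold>\<longrightarrow> All Nt A)"

| ax_add_assoc: "has_ty \<Gamma> p Qt \<Longrightarrow> has_ty \<Gamma> q Qt \<Longrightarrow> has_ty \<Gamma> r Qt \<Longrightarrow>
    ax \<Gamma> ((p \<^bold>+ q) \<^bold>+ r \<^bold>= p \<^bold>+ (q \<^bold>+ r))"
| ax_add_comm: "has_ty \<Gamma> p Qt \<Longrightarrow> has_ty \<Gamma> q Qt \<Longrightarrow> ax \<Gamma> (p \<^bold>+ q \<^bold>= q \<^bold>+ p)"
| ax_add_0: "has_ty \<Gamma> p Qt \<Longrightarrow> ax \<Gamma> (p \<^bold>+ qnum 0 \<^bold>= p)"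
| ax_add_neg: "has_ty \<Gamma> p Qt \<Longrightarrow> ax \<Gamma> (p \<^bold>+ \<^bold>- p \<^bold>= qnum 0)"
| ax_mult_assoc: "has_ty \<Gamma> p Qt \<Longrightarrow> has_ty \<Gamma> q Qt \<Longrightarrow> has_ty \<Gamma> r Qt \<Longrightarrow>
    ax \<Gamma> ((p \<^bold>* q) \<^bold>* r \<^bold>= p \<^bold>* (q \<^bold>* r))"
| ax_mult_comm: "has_ty \<Gamma> p Qt \<Longrightarrow> has_ty \<Gamma> q Qt \<Longrightarrow> ax \<Gamma> (p \<^bold>* q \<^bold>= q \<^bold>* p)"
| ax_mult_1: "has_ty \<Gamma> p Qt \<Longrightarrow> ax \<Gamma> (p \<^bold>* qnum 1 \<^bold>= p)"
| ax_distrib: "has_ty \<Gamma> p Qt \<Longrightarrow> has_ty \<Gamma> q Qt \<Longrightarrow> has_ty \<Gamma> r Qt \<Longrightarrow>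
    ax \<Gamma> (p \<^bold>* (q \<^bold>+ r) \<^bold>= p \<^bold>* q \<^bold>+ p \<^bold>* r)"
| ax_inverse: "has_ty \<Gamma> p Qt \<Longrightarrow> ax \<Gamma> (\<^bold>\<not> p \<^bold>= qnum 0 \<^bold>\<longrightarrow> p \<^bold>* inv_q p \<^bold>= qnum 1)"

| ax_lt_irrefl: "has_ty \<Gamma> p Qt \<Longrightarrow> ax \<Gamma> (\<^bold>\<not> p \<^bold>< p)"
| ax_lt_trans: "has_ty \<Gamma> p Qt \<Longrightarrow> has_ty \<Gamma> q Qt \<Longrightarrow> has_ty \<Gamma> r Qt \<Longrightarrow>
    ax \<Gamma> (p \<^bold>< q \<^bold>\<and> q \<^bold>< r \<^bold>\<longrightarrow> p \<^bold>< r)"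
| ax_lt_trichotomy: "has_ty \<Gamma> p Qt \<Longrightarrow> has_ty \<Gamma> q Qt \<Longrightarrow>
    ax \<Gamma> (p \<^bold>< q \<^bold>\<or> p \<^bold>= q \<^bold>\<or> q \<^bold>< p)"
| ax_lt_add: "has_ty \<Gamma> p Qt \<Longrightarrow> has_ty \<Gamma> q Qt \<Longrightarrow> has_ty \<Gamma> r Qt \<Longrightarrow>
    ax \<Gamma> (p \<^bold>< q \<^bold>\<longrightarrow> p \<^bold>+ r \<^bold>< q \<^bold>+ r)"
| ax_lt_mult: "has_ty \<Gamma> p Qt \<Longrightarrow> has_ty \<Gamma> q Qt \<Longrightarrow>
    ax \<Gamma> (qnum 0 \<^bold>< p \<^bold>\<and> qnum 0 \<^bold>< q \<^bold>\<longrightarrow> qnum 0 \<^bold>< p \<^bold>* q)"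
| ax_abs_nonneg: "has_ty \<Gamma> p Qt \<Longrightarrow> ax \<Gamma> (qnum 0 \<^bold>\<le> p \<^bold>\<longrightarrow> abs_q p \<^bold>= p)"
| ax_abs_neg: "has_ty \<Gamma> p Qt \<Longrightarrow> ax \<Gamma> (p \<^bold>< qnum 0 \<^bold>\<longrightarrow> abs_q p \<^bold>= \<^bold>- p)"
| ax_zero_lt_one: "ax \<Gamma> (qnum 0 \<^bold>< qnum 1)"
| ax_iota_succ: "has_ty \<Gamma> n Nt \<Longrightarrow> ax \<Gamma> (iota (succ n) \<^bold>= iota n \<^bold>+ qnum 1)"
    \<comment> \<open>every rational \<open>q\<close> satisfies \<open>q * (k + 1) = m - n\<close> for some natural numbers;
        in particular the order is Archimedean\<close>
| ax_rational: "ax \<Gamma> (All Qt (Ex Nt (Ex Nt (Ex Nt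
    (Var 3 \<^bold>* iota (succ (Var 0)) \<^bold>= iota (Var 2) \<^bold>+ \<^bold>- iota (Var 1))))))"

    \<comment> \<open>\<open>(\<forall>n \<exists>x A(n,x)) \<longrightarrow> (\<exists>g \<forall>n A(n,g n))\<close>; in \<open>A\<close>, index 0 is \<open>x\<close> and index 1 is \<open>n\<close>\<close>
| ax_countable_choice: "wff (\<sigma> # Nt # \<Gamma>) A \<Longrightarrow>
    ax \<Gamma> (All Nt (Ex \<sigma> A) \<^bold>\<longrightarrow>
          Ex (Nt \<rightarrow> \<sigma>) (All Nt
            (subst_fm (case_nat (Var 1 \<bullet> Var 0) (case_nat (Var 0) (\<lambda>i. Var (i + 2)))) A)))"

    \<comment> \<open>dependent choice for the set \<open>{x. D x}\<close>: from \<open>\<forall>x (D x \<longrightarrow> \<exists>y (D y \<and> A(x,y)))\<close> and \<open>D x\<close> obtain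
        \<open>g\<close> with \<open>g 0 = x\<close> and \<open>\<forall>n (D(g n) \<and> A(g n, g(n+1)))\<close>; in \<open>A\<close>, index 0 is \<open>y\<close> and index 1
        is \<open>x\<close>\<close>
| ax_dependent_choice: "wff (\<sigma> # \<Gamma>) D \<Longrightarrow> wff (\<sigma> # \<sigma> # \<Gamma>) A \<Longrightarrow>
    ax \<Gamma> (All \<sigma> (D \<^bold>\<longrightarrow> Ex \<sigma> (subst_fm (case_nat (Var 0) (\<lambda>i. Var (i + 2))) D \<^bold>\<and> A)) \<^bold>\<longrightarrow>
          All \<sigma> (D \<^bold>\<longrightarrow>
            Ex (Nt \<rightarrow> \<sigma>) (Var 0 \<bullet> zero \<^bold>= Var 1 \<^bold>\<and>
              All Nt
               (subst_fm (case_nat (Var 1 \<bullet> Var 0) (\<lambda>i. Var (i + 3))) D \<^bold>\<and>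
                subst_fm (case_nat (Var 1 \<bullet> succ (Var 0))
                           (case_nat (Var 1 \<bullet> Var 0) (\<lambda>i. Var (i + 3)))) A))))"

subsection \<open>Derivability\<close>

text \<open>Natural deduction for many-sorted intuitionistic predicate logic with equality;
  \<open>\<Gamma>; \<Delta> \<turnstile> A\<close> says that \<open>A\<close> is derivable from the assumptions \<open>\<Delta>\<close>, with free variables typed
  by \<open>\<Gamma>\<close>.\<close>

inductive derives :: "ty list \<Rightarrow> fm list \<Rightarrow> fm \<Rightarrow> bool" ("_; _ \<turnstile> _" [20, 20, 20] 19) where
  Ax: "ax \<Gamma> A \<Longrightarrow> \<Gamma>; \<Delta> \<turnstile> A"
| Hyp: "A \<in> set \<Delta> \<Longrightarrow> wff \<Gamma> A \<Longrightarrow> \<Gamma>; \<Delta> \<turnstile> A"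
| FlsE: "\<Gamma>; \<Delta> \<turnstile> Fls \<Longrightarrow> wff \<Gamma> A \<Longrightarrow> \<Gamma>; \<Delta> \<turnstile> A"
| AndI: "\<Gamma>; \<Delta> \<turnstile> A \<Longrightarrow> \<Gamma>; \<Delta> \<turnstile> B \<Longrightarrow> \<Gamma>; \<Delta> \<turnstile> A \<^bold>\<and> B"
| AndE1: "\<Gamma>; \<Delta> \<turnstile> A \<^bold>\<and> B \<Longrightarrow> \<Gamma>; \<Delta> \<turnstile> A"
| AndE2: "\<Gamma>; \<Delta> \<turnstile> A \<^bold>\<and> B \<Longrightarrow> \<Gamma>; \<Delta> \<turnstile> B"
| OrI1: "\<Gamma>; \<Delta> \<turnstile> A \<Longrightarrow> wff \<Gamma> B \<Longrightarrow> \<Gamma>; \<Delta> \<turnstile> A \<^bold>\<or> B"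
| OrI2: "\<Gamma>; \<Delta> \<turnstile> B \<Longrightarrow> wff \<Gamma> A \<Longrightarrow> \<Gamma>; \<Delta> \<turnstile> A \<^bold>\<or> B"
| OrE: "\<Gamma>; \<Delta> \<turnstile> A \<^bold>\<or> B \<Longrightarrow> \<Gamma>; A # \<Delta> \<turnstile> C \<Longrightarrow> \<Gamma>; B # \<Delta> \<turnstile> C \<Longrightarrow> \<Gamma>; \<Delta> \<turnstile> C"
| ImpI: "\<Gamma>; A # \<Delta> \<turnstile> B \<Longrightarrow> wff \<Gamma> A \<Longrightarrow> \<Gamma>; \<Delta> \<turnstile> A \<^bold>\<longrightarrow> B"
| ImpE: "\<Gamma>; \<Delta> \<turnstile> A \<^bold>\<longrightarrow> B \<Longrightarrow> \<Gamma>; \<Delta> \<turnstile> A \<Longrightarrow> \<Gamma>; \<Delta> \<turnstile> B"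
| AllI: "\<sigma> # \<Gamma>; map (shift_fm 1) \<Delta> \<turnstile> A \<Longrightarrow> \<Gamma>; \<Delta> \<turnstile> All \<sigma> A"
| AllE: "\<Gamma>; \<Delta> \<turnstile> All \<sigma> A \<Longrightarrow> has_ty \<Gamma> t \<sigma> \<Longrightarrow> \<Gamma>; \<Delta> \<turnstile> inst A t"
| ExI: "\<Gamma>; \<Delta> \<turnstile> inst A t \<Longrightarrow> has_ty \<Gamma> t \<sigma> \<Longrightarrow> wff (\<sigma> # \<Gamma>) A \<Longrightarrow> \<Gamma>; \<Delta> \<turnstile> Ex \<sigma> A"
| ExE: "\<Gamma>; \<Delta> \<turnstile> Ex \<sigma> A \<Longrightarrow> \<sigma> # \<Gamma>; A # map (shift_fm 1) \<Delta> \<turnstile> shift_fm 1 C \<Longrightarrow> \<Gamma>; \<Delta> \<turnstile> C"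
| EqI: "has_ty \<Gamma> t \<sigma> \<Longrightarrow> \<Gamma>; \<Delta> \<turnstile> t \<^bold>= t"
| EqE: "\<Gamma>; \<Delta> \<turnstile> t \<^bold>= u \<Longrightarrow> \<Gamma>; \<Delta> \<turnstile> inst A t \<Longrightarrow>
    has_ty \<Gamma> t \<sigma> \<Longrightarrow> has_ty \<Gamma> u \<sigma> \<Longrightarrow> wff (\<sigma> # \<Gamma>) A \<Longrightarrow> \<Gamma>; \<Delta> \<turnstile> inst A u"

section \<open>Real analysis inside the system\<close>

subsection \<open>Real numbers\<close>

text \<open>A real number is given by a Cauchy sequence of rationals; equality and order are those of the
  limits, and the arithmetic operations act pointwise. Every macro below shifts its arguments by
  the number of quantifiers it puts in front of them, so arguments may be arbitrary terms.\<close>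

abbreviation Rt :: ty where "Rt \<equiv> Nt \<rightarrow> Qt"

text \<open>\<open>x\<close> is a Cauchy sequence: \<open>\<forall>k \<exists>N \<forall>m \<ge> N \<forall>n \<ge> N. |x m - x n| < 1/(k+1)\<close>\<close>

definition is_real :: "tm \<Rightarrow> fm" where
  "is_real x = All Nt (Ex Nt (All Nt (All Nt
     (le_n (Var 2) (Var 1) \<^bold>\<and> le_n (Var 2) (Var 0) \<^bold>\<longrightarrow>
      abs_q (shift 4 x \<bullet> Var 1 \<^bold>+ \<^bold>- (shift 4 x \<bullet> Var 0)) \<^bold>< eps_q (Var 3)))))"

text \<open>\<open>\<forall>k \<exists>N \<forall>n \<ge> N. |x n - y n| < 1/(k+1)\<close>\<close>

definition req :: "tm \<Rightarrow> tm \<Rightarrow> fm" where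
  "req x y = All Nt (Ex Nt (All Nt
     (le_n (Var 1) (Var 0) \<^bold>\<longrightarrow>
      abs_q (shift 3 x \<bullet> Var 0 \<^bold>+ \<^bold>- (shift 3 y \<bullet> Var 0)) \<^bold>< eps_q (Var 2))))"

text \<open>\<open>\<exists>k \<exists>N \<forall>n \<ge> N. x n + 1/(k+1) < y n\<close>\<close>

definition rlt :: "tm \<Rightarrow> tm \<Rightarrow> fm" where
  "rlt x y = Ex Nt (Ex Nt (All Nt
     (le_n (Var 1) (Var 0) \<^bold>\<longrightarrow>
      shift 3 x \<bullet> Var 0 \<^bold>+ eps_q (Var 2) \<^bold>< shift 3 y \<bullet> Var 0)))"

definition rle :: "tm \<Rightarrow> tm \<Rightarrow> fm" where
  "rle x y = (\<^bold>\<not> rlt y x)"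

text \<open>Pointwise operations, abstracted by combinators: \<open>pw1 c x\<close> is \<open>\<lambda>n. c (x n)\<close> and
  \<open>pw2 c x y\<close> is \<open>\<lambda>n. c (x n) (y n)\<close>.\<close>

definition pw1 :: "cst \<Rightarrow> tm \<Rightarrow> tm" where
  "pw1 c x = Con (Sc Nt Qt Qt) \<bullet> (Con (Kc (Qt \<rightarrow> Qt) Nt) \<bullet> Con c) \<bullet> x"

definition pw2 :: "cst \<Rightarrow> tm \<Rightarrow> tm \<Rightarrow> tm" where
  "pw2 c x y = Con (Sc Nt Qt Qt) \<bullet>
     (Con (Sc Nt Qt (Qt \<rightarrow> Qt)) \<bullet> (Con (Kc (Qt \<rightarrow> Qt \<rightarrow> Qt) Nt) \<bullet> Con c) \<bullet> x) \<bullet> y"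

abbreviation rconst :: "tm \<Rightarrow> tm" where "rconst q \<equiv> Con (Kc Qt Nt) \<bullet> q"
abbreviation rneg :: "tm \<Rightarrow> tm" where "rneg x \<equiv> pw1 Minus x"
abbreviation rabs :: "tm \<Rightarrow> tm" where "rabs x \<equiv> pw1 Absv x"
abbreviation rmul :: "tm \<Rightarrow> tm \<Rightarrow> tm" where "rmul x y \<equiv> pw2 Times x y"
abbreviation rsub :: "tm \<Rightarrow> tm \<Rightarrow> tm" where "rsub x y \<equiv> pw2 Plus x (rneg y)"

abbreviation r0 :: tm where "r0 \<equiv> rconst (qnum 0)"
abbreviation r1 :: tm where "r1 \<equiv> rconst (qnum 1)"

definition in01 :: "tm \<Rightarrow> fm" where
  "in01 x = (is_real x \<^bold>\<and> rle r0 x \<^bold>\<and> rle x r1)"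

text \<open>\<open>X\<close> of type \<open>Nt \<rightarrow> Rt\<close> converges to \<open>z\<close>: \<open>\<forall>k \<exists>N \<forall>n \<ge> N. |X n - z| < 1/(k+1)\<close>\<close>

definition rconv :: "tm \<Rightarrow> tm \<Rightarrow> fm" where
  "rconv X z = All Nt (Ex Nt (All Nt
     (le_n (Var 1) (Var 0) \<^bold>\<longrightarrow>
      rlt (rabs (rsub (shift 3 X \<bullet> Var 0) (shift 3 z))) (rconst (eps_q (Var 2))))))"

subsection \<open>Functions on the unit interval and omniscience principles\<close>

text \<open>A function from \<open>[0,1]\<close> to the reals is an operation on representatives that respects equality
  of reals; its values outside \<open>[0,1]\<close> are irrelevant.\<close>

definition is_fun01 :: "tm \<Rightarrow> fm" where
  "is_fun01 f =
    (All Rt (in01 (Var 0) \<^bold>\<longrightarrow> is_real (shift 1 f \<bullet> Var 0)) \<^bold>\<and>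
     All Rt (All Rt (in01 (Var 1) \<^bold>\<and> in01 (Var 0) \<^bold>\<and> req (Var 1) (Var 0) \<^bold>\<longrightarrow>
       req (shift 2 f \<bullet> Var 1) (shift 2 f \<bullet> Var 0))))"

definition strongly_ext :: "tm \<Rightarrow> fm" where
  "strongly_ext f = All Rt (All Rt (in01 (Var 1) \<^bold>\<and> in01 (Var 0) \<^bold>\<longrightarrow>
     rlt r0 (rabs (rsub (shift 2 f \<bullet> Var 1) (shift 2 f \<bullet> Var 0))) \<^bold>\<longrightarrow>
     rlt r0 (rabs (rsub (Var 1) (Var 0)))))"

text \<open>There is a sequence \<open>X\<close> in \<open>[0,1]\<close> with \<open>X n \<longlonglongrightarrow> z\<close> and \<open>f z * f (X n) < - (e\<^sup>2 / 8)\<close> for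
  all \<open>n\<close>. Sequences are indexed from 0.\<close>

definition jump_seq :: "tm \<Rightarrow> tm \<Rightarrow> tm \<Rightarrow> fm" where
  "jump_seq f e z = Ex (Nt \<rightarrow> Rt)
    (All Nt (in01 (Var 1 \<bullet> Var 0)) \<^bold>\<and>
     rconv (Var 0) (shift 1 z) \<^bold>\<and>
     All Nt (rlt (rmul (shift 2 f \<bullet> shift 2 z) (shift 2 f \<bullet> (Var 1 \<bullet> Var 0)))
                 (rneg (rmul (rmul (shift 2 e) (shift 2 e)) (rconst (inv_q (qnum 8)))))))"

definition binary :: "tm \<Rightarrow> fm" where
  "binary a = All Nt (shift 1 a \<bullet> Var 0 \<^bold>= zero \<^bold>\<or> shift 1 a \<bullet> Var 0 \<^bold>= num 1)"

definition LPO :: fm where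
  "LPO = All (Nt \<rightarrow> Nt) (binary (Var 0) \<^bold>\<longrightarrow>
     All Nt (Var 1 \<bullet> Var 0 \<^bold>= zero) \<^bold>\<or> Ex Nt (Var 1 \<bullet> Var 0 \<^bold>= num 1))"

definition WLPO :: fm where
  "WLPO = All (Nt \<rightarrow> Nt) (binary (Var 0) \<^bold>\<longrightarrow>
     All Nt (Var 1 \<bullet> Var 0 \<^bold>= zero) \<^bold>\<or> \<^bold>\<not> All Nt (Var 1 \<bullet> Var 0 \<^bold>= zero))"

end

theory Submission
  imports Defs "HOL-Library.Countable_Set" "HOL-Algebra.FiniteProduct" Complex_Main
begin

unbundle no funcset_syntax

text \<open>
  The calculus is complete for its canonical Kripke model, whose worlds are the consistent prime
  theories with witnesses, so it suffices to reason classically about what a world forces. The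
  rational terms of a world form a countable ordered abelian group. Fourier-Motzkin elimination solves
  every finite part of its order over the rationals, hence the group embeds into an ultrapower of the
  rationals, and inequalities between rational terms become inequalities in a linearly ordered field.

  For the alternative, take a rational \<open>r\<close> with \<open>8 r < \<epsilon> < 16 r\<close>. At every rational point \<open>f\<close> is
  smaller than \<open>7 r\<close> in absolute value, or greater than \<open>6 r\<close>, or less than \<open>- 6 r\<close>; halving intervals
  with dependent choice gives a point \<open>z\<close>. Either \<open>\<bar>f z\<bar> < 8 r < \<epsilon>\<close>, or \<open>\<bar>f z\<bar> > 7 r\<close> and there are points
  arbitrarily close to \<open>z\<close> at which \<open>f\<close> has the other sign and exceeds \<open>6 r\<close> in absolute value, where
  \<open>42 r\<^sup>2 > (16 r)\<^sup>2 / 8\<close>.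

  For the omniscience principles, let \<open>y\<close> be the limit of the sequence that stays at \<open>z\<close> while the
  binary sequence \<open>a\<close> vanishes and stays at \<open>x\<^sub>n\<close> once \<open>a\<close> takes the value \<open>1\<close> first at \<open>n\<close>. Either
  \<open>\<bar>f y - f z\<bar> > 0\<close>, and then \<open>a\<close> is not zero throughout because \<open>y\<close> differs from \<open>z\<close>, or \<open>f y\<close> is so
  close to \<open>f z\<close> that \<open>f z \<cdot> f y\<close> exceeds the bound on \<open>f z \<cdot> f x\<^sub>n\<close>, and then \<open>y\<close> is none of the \<open>x\<^sub>n\<close>. In
  the former case strong extensionality yields \<open>\<bar>y - z\<bar> > 0\<close>, which bounds the search for a \<open>1\<close>.
\<close>

section \<open>Ordered abelian groups with a unit in a linearly ordered field\<close>

text \<open>HOL is classical and the object system is not, so the argument cannot be carried out on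
  HOL's own reals, and explicit natural deductions of this size would be unmanageable. Inside a
  world the order of the rationals is decided, because trichotomy is an axiom and worlds are prime;
  statements that quantify or imply, such as inequalities of reals, depend on the extensions of the
  world. The rationals of each world have a carrier of their own, whereas automated linear
  arithmetic needs one fixed type; this is why all of them are mapped to a common field. The
  embedding is only additive: the value of a product need not be the product of the values and is
  handled through bilinearity and monotonicity. The embeddings of different worlds are chosen
  independently, so a bound that is carried to the extensions of a world has to be a term, not an
  element of the field. The natural numbers of a world are terms as well and need not be numerals;
  induction over them goes through the induction axiom for an explicit formula.\<close>

lemma ultrafilter_exists:
  fixes F :: "'a filter"
  assumes "F \<noteq> bot"
  obtains U where "U \<le> F" "U \<noteq> bot" "\<And>P. eventually P U \<or> eventually (\<lambda>x. \<not> P x) U"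
proof -
  define A where "A = {G::'a filter. G \<noteq> bot \<and> G \<le> F}"
  have po: "partial_order_on A (relation_of (\<lambda>a b. b \<le> a) A)"
    by (rule partial_order_on_relation_ofI) auto
  have "\<exists>m\<in>A. \<forall>a\<in>A. m \<ge> a \<longrightarrow> a = m"
  proof (rule Zorn.predicate_Zorn[OF po])
    fix C assume "C \<in> Chains (relation_of (\<lambda>a b. b \<le> a) A)"
    then have CA: "C \<subseteq> A" and tot: "\<And>a b. a \<in> C \<Longrightarrow> b \<in> C \<Longrightarrow> a \<le> b \<or> b \<le> a"
      by (auto simp: Chains_def relation_of_def)
    show "\<exists>u\<in>A. \<forall>a\<in>C. u \<le> a"
    proof (cases "C = {}")
      case True
      then show ?thesis using assms by (auto simp: A_def intro!: bexI[of _ F])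
    next
      case False
      \<comment> \<open>A chain is directed, so what holds eventually for its infimum does so
        already for a member; hence an infimum of proper filters is proper.\<close>
      have "Inf C = bot \<longleftrightarrow> (\<exists>x\<in>C. x = bot)"
        unfolding trivial_limit_def using False tot
      proof (intro eventually_Inf_base)
        fix F G assume "F \<in> C" "G \<in> C"
        then show "\<exists>x\<in>C. x \<le> inf F G"
          using tot[of F G] by (auto intro: bexI[of _ F] bexI[of _ G])
      qed (use False in auto)
      then have "Inf C \<noteq> bot" using CA by (auto simp: A_def)
      moreover obtain c where "c \<in> C" using False by auto
      then have "Inf C \<le> F" using CA by (auto simp: A_def intro: Inf_lower2)
      ultimately show ?thesis by (auto simp: A_def intro!: bexI[of _ "Inf C"] Inf_lower)
    qed
  qed
  then obtain U where U: "U \<noteq> bot" "U \<le> F" and mx: "\<And>G. G \<noteq> bot \<Longrightarrow> G \<le> U \<Longrightarrow> G = U"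
    unfolding A_def by (auto dest: order_trans)
  have "eventually P U \<or> eventually (\<lambda>x. \<not> P x) U" for P
  proof (rule disjCI)
    assume "\<not> (\<forall>\<^sub>F x in U. \<not> P x)"
    \<comment> \<open>Restricting \<open>U\<close> to \<open>P\<close> is proper unless
      \<open>U\<close> contains the complement of \<open>P\<close>; minimality then forces the
      restriction to be \<open>U\<close> itself.\<close>
    then have "inf U (principal {x. P x}) \<noteq> bot"
      by (simp add: trivial_limit_def eventually_inf_principal)
    then have "inf U (principal {x. P x}) = U" by (rule mx) simp
    moreover have "eventually P (inf U (principal {x. P x}))"
      by (simp add: eventually_inf_principal)
    ultimately show "eventually P U" by simp
  qed
  with U show thesis by (intro that)
qed

section \<open>The ultrapower of the rationals\<close>

definition Uf :: "nat filter" where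
  "Uf = (SOME U. U \<le> sequentially \<and> U \<noteq> bot \<and> (\<forall>P. eventually P U \<or> eventually (\<lambda>x. \<not> P x) U))"

lemma Uf: "Uf \<le> sequentially" "Uf \<noteq> bot" "eventually P Uf \<or> eventually (\<lambda>x. \<not> P x) Uf"
proof -
  have "\<exists>U. U \<le> sequentially \<and> U \<noteq> bot \<and> (\<forall>P. eventually P U \<or> eventually (\<lambda>x. \<not> P x) U)"
    by (rule ultrafilter_exists[OF sequentially_bot]) blast
  from someI_ex[OF this, folded Uf_def]
  show "Uf \<le> sequentially" "Uf \<noteq> bot" "eventually P Uf \<or> eventually (\<lambda>x. \<not> P x) Uf"
    by auto
qed

text \<open>Negation commutes with an ultrafilter. A nonzero class is therefore nonzero almost
  everywhere, hence invertible, and strict order is the negation of the reversed weak order.\<close>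

lemma Uf_not: "(\<forall>\<^sub>F n in Uf. \<not> P n) \<longleftrightarrow> \<not> (\<forall>\<^sub>F n in Uf. P n)"
proof
  assume "\<forall>\<^sub>F n in Uf. \<not> P n"
  show "\<not> (\<forall>\<^sub>F n in Uf. P n)"
  proof
    assume "\<forall>\<^sub>F n in Uf. P n"
    with \<open>\<forall>\<^sub>F n in Uf. \<not> P n\<close> have "\<forall>\<^sub>F n in Uf. False" by eventually_elim auto
    then show False using Uf(2) by simp
  qed
qed (use Uf(3)[of P] in auto)

lemma Uf_seq: "eventually P sequentially \<Longrightarrow> eventually P Uf"
  using Uf(1) by (simp add: le_filter_def)

definition Ueq :: "(nat \<Rightarrow> rat) \<Rightarrow> (nat \<Rightarrow> rat) \<Rightarrow> bool" where
  "Ueq f g \<longleftrightarrow> (\<forall>\<^sub>F n in Uf. f n = g n)"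

quotient_type hyp = "nat \<Rightarrow> rat" / Ueq
  morphisms rep_seq class_of_seq
proof (rule equivpI)
  show "reflp Ueq" by (simp add: reflp_def Ueq_def)
  show "symp Ueq" by (auto simp: symp_def Ueq_def elim: eventually_mono)
  show "transp Ueq" by (auto simp: transp_def Ueq_def elim: eventually_elim2)
qed

instantiation hyp :: linordered_field
begin
lift_definition zero_hyp :: hyp is "\<lambda>n. 0" .
lift_definition one_hyp :: hyp is "\<lambda>n. 1" .
lift_definition plus_hyp :: "hyp \<Rightarrow> hyp \<Rightarrow> hyp" is "\<lambda>f g n. f n + g n"
  unfolding Ueq_def by (erule (1) eventually_elim2, simp)
lift_definition minus_hyp :: "hyp \<Rightarrow> hyp \<Rightarrow> hyp" is "\<lambda>f g n. f n - g n"
  unfolding Ueq_def by (erule (1) eventually_elim2, simp)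
lift_definition times_hyp :: "hyp \<Rightarrow> hyp \<Rightarrow> hyp" is "\<lambda>f g n. f n * g n"
  unfolding Ueq_def by (erule (1) eventually_elim2, simp)
lift_definition uminus_hyp :: "hyp \<Rightarrow> hyp" is "\<lambda>f n. - f n"
  unfolding Ueq_def by (auto elim: eventually_mono)
lift_definition inverse_hyp :: "hyp \<Rightarrow> hyp" is "\<lambda>f n. inverse (f n)"
  unfolding Ueq_def by (auto elim: eventually_mono)
lift_definition divide_hyp :: "hyp \<Rightarrow> hyp \<Rightarrow> hyp" is "\<lambda>f g n. f n / g n"
  unfolding Ueq_def by (erule (1) eventually_elim2, simp)
lift_definition less_eq_hyp :: "hyp \<Rightarrow> hyp \<Rightarrow> bool" is "\<lambda>f g. \<forall>\<^sub>F n in Uf. f n \<le> g n"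
proof -
  fix f f' g g' assume "Ueq f f'" "Ueq g g'"
  then have "\<forall>\<^sub>F n in Uf. (f n \<le> g n) = (f' n \<le> g' n)"
    unfolding Ueq_def by eventually_elim auto
  then show "(\<forall>\<^sub>F n in Uf. f n \<le> g n) = (\<forall>\<^sub>F n in Uf. f' n \<le> g' n)" by (rule eventually_subst)
qed
lift_definition less_hyp :: "hyp \<Rightarrow> hyp \<Rightarrow> bool" is "\<lambda>f g. \<forall>\<^sub>F n in Uf. f n < g n"
proof -
  fix f f' g g' assume "Ueq f f'" "Ueq g g'"
  then have "\<forall>\<^sub>F n in Uf. (f n < g n) = (f' n < g' n)"
    unfolding Ueq_def by eventually_elim auto
  then show "(\<forall>\<^sub>F n in Uf. f n < g n) = (\<forall>\<^sub>F n in Uf. f' n < g' n)" by (rule eventually_subst)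
qed
definition abs_hyp_def: "\<bar>a::hyp\<bar> = (if a < 0 then - a else a)"
definition sgn_hyp_def: "sgn (a::hyp) = (if a = 0 then 0 else if 0 < a then 1 else -1)"

instance
proof
  fix a b c :: hyp
  show "a + b + c = a + (b + c)" "a + b = b + a" "0 + a = a" "- a + a = 0" "a - b = a + - b"
    "a * b * c = a * (b * c)" "a * b = b * a" "1 * a = a" "(a + b) * c = a * c + b * c"
    "a + b - a = b" "a - b - c = a - (b + c)" "0 * a = 0" "a * 0 = 0"
    "a div b = a * inverse b" "inverse (0::hyp) = 0"
    by (transfer; simp add: Ueq_def algebra_simps divide_inverse)+
  show "(0::hyp) \<noteq> 1" by transfer (simp add: Ueq_def Uf(2))
  show "inverse a * a = 1" if "a \<noteq> 0"
    using that by transfer (unfold Ueq_def Uf_not[symmetric], erule eventually_mono, simp)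
  show "a \<le> a" by transfer simp
  show "a \<le> c" if "a \<le> b" "b \<le> c" using that by transfer (erule (1) eventually_elim2, simp)
  show "a = b" if "a \<le> b" "b \<le> a" using that
    by transfer (unfold Ueq_def, erule (1) eventually_elim2, simp)
  show "a \<le> b \<or> b \<le> a"
  proof transfer
    fix a b :: "nat \<Rightarrow> rat"
    show "(\<forall>\<^sub>F n in Uf. a n \<le> b n) \<or> (\<forall>\<^sub>F n in Uf. b n \<le> a n)"
      using Uf(3)[of "\<lambda>n. a n \<le> b n"]
    proof
      assume "\<forall>\<^sub>F n in Uf. \<not> a n \<le> b n"
      then have "\<forall>\<^sub>F n in Uf. b n \<le> a n" by (rule eventually_mono) simp
      then show ?thesis ..
    qed simp
  qed
  show "(a < b) = (a \<le> b \<and> \<not> b \<le> a)"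
  proof transfer
    fix a b :: "nat \<Rightarrow> rat"
    have "(\<forall>\<^sub>F n in Uf. a n < b n) \<longleftrightarrow> (\<not> (\<forall>\<^sub>F n in Uf. b n \<le> a n))"
      by (simp add: Uf_not[symmetric] not_le)
    then show "(\<forall>\<^sub>F n in Uf. a n < b n) =
        ((\<forall>\<^sub>F n in Uf. a n \<le> b n) \<and> \<not> (\<forall>\<^sub>F n in Uf. b n \<le> a n))"
      by (auto elim!: eventually_mono)
  qed
  show "c + a \<le> c + b" if "a \<le> b" using that by transfer (auto elim: eventually_mono)
  show "c * a < c * b" if "a < b" "0 < c" using that by transfer (erule (1) eventually_elim2, simp)
  show "\<bar>a\<bar> = (if a < 0 then - a else a)" by (simp add: abs_hyp_def)
  show "sgn a = (if a = 0 then 0 else if 0 < a then 1 else - 1)" by (simp add: sgn_hyp_def)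
qed
end

section \<open>Fourier-Motzkin elimination\<close>

text \<open>Density of the rationals; it supplies the value of an eliminated variable between its
  lower and upper bounds.\<close>

lemma finite_gap:
  fixes A B :: "rat set"
  assumes "finite A" "finite B" "\<And>a b. a \<in> A \<Longrightarrow> b \<in> B \<Longrightarrow> a < b"
  shows "\<exists>m. (\<forall>a\<in>A. a < m) \<and> (\<forall>b\<in>B. m < b)"
proof -
  \<comment> \<open>The inserted element, \<open>Min B - 1\<close> or \<open>0\<close>, keeps the
    set of lower bounds nonempty, so that \<open>Max\<close> is meaningful, and violates no upper
    bound.\<close>
  define A' where "A' = insert (if B = {} then 0 else Min B - 1) A"
  define m where "m = (if B = {} then Max A' + 1 else (Max A' + Min B) / 2)"
  have fin: "finite A'" and ne: "A' \<noteq> {}" using assms by (auto simp: A'_def)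
  have "Max A' < Min B" if "B \<noteq> {}"
  proof -
    have "Max A' \<in> A'" "Min B \<in> B" using fin ne that assms by auto
    then have "Max A' = Min B - 1 \<or> Max A' \<in> A" using that by (auto simp: A'_def)
    then show ?thesis
    proof
      assume "Max A' = Min B - 1"
      then show ?thesis by linarith
    next
      assume "Max A' \<in> A"
      then show ?thesis using \<open>Min B \<in> B\<close> by (rule assms(3))
    qed
  qed
  then have m: "Max A' < m" "B \<noteq> {} \<Longrightarrow> m < Min B" by (auto simp: m_def)
  have "a < m" if "a \<in> A" for a
  proof -
    have "a \<le> Max A'" using that fin by (intro Max_ge) (auto simp: A'_def)
    then show ?thesis using m(1) by simp
  qed
  moreover have "m < b" if "b \<in> B" for b
  proof -
    have "Min B \<le> b" using that assms by (intro Min_le) auto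
    then show ?thesis using m(2) that by fastforce
  qed
  ultimately show ?thesis by blast
qed

text \<open>\<open>pos\<close> and \<open>zer\<close> are the strictly positive and the null integer combinations of finitely many
  elements of a linearly ordered abelian group.\<close>

locale cone =
  fixes pos zer :: "(nat \<Rightarrow> int) \<Rightarrow> bool"
  assumes pp: "pos c \<Longrightarrow> pos d \<Longrightarrow> pos (\<lambda>i. c i + d i)"
    and pz: "pos c \<Longrightarrow> zer d \<Longrightarrow> pos (\<lambda>i. c i + d i)"
    and zz: "zer c \<Longrightarrow> zer d \<Longrightarrow> zer (\<lambda>i. c i + d i)"
    and zn: "zer c \<Longrightarrow> zer (\<lambda>i. - c i)"
    and z0: "zer (\<lambda>i. 0)"
    and np: "\<not> pos (\<lambda>i. 0)"
    and tri: "pos c \<or> zer c \<or> pos (\<lambda>i. - c i)"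
begin

lemma pos_scale: "pos c \<Longrightarrow> k > 0 \<Longrightarrow> pos (\<lambda>i. int k * c i)"
proof (induction k)
  case (Suc k)
  then show ?case using pp[of c "\<lambda>i. int k * c i"] by (cases "k = 0") (auto simp: algebra_simps)
qed simp

lemma zer_scale: "zer c \<Longrightarrow> zer (\<lambda>i. k * c i)"
proof -
  have *: "zer (\<lambda>i. int m * c i)" if "zer c" for c m
    using that
  proof (induction m)
    case (Suc k)
    then show ?case using zz[of c "\<lambda>i. int k * c i"] by (auto simp: algebra_simps)
  qed (simp add: z0)
  assume "zer c"
  then show ?thesis using *[of c "nat k"] zn[OF *[of c "nat (- k)"]]
    by (cases "k \<ge> 0") auto
qed

lemma pos_scale_int: "pos c \<Longrightarrow> k > 0 \<Longrightarrow> pos (\<lambda>i. k * c i)"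
  using pos_scale[of c "nat k"] by simp

text \<open>Fourier-Motzkin elimination: finitely many strict inequalities and equations that hold in the
  group are solvable in the rationals.\<close>

lemma solvable:
  "finite C \<Longrightarrow> \<forall>c\<in>C. \<forall>i\<ge>n. c i = 0 \<Longrightarrow>
   \<exists>q::nat \<Rightarrow> rat. \<forall>c\<in>C. (pos c \<longrightarrow> 0 < (\<Sum>i<n. of_int (c i) * q i)) \<and>
      (zer c \<longrightarrow> (\<Sum>i<n. of_int (c i) * q i) = 0)"
proof -
  have ex: "\<not> (pos c \<and> pos (\<lambda>i. - c i))" for c using pp[of c "\<lambda>i. - c i"] np by auto
  have ez: "\<not> (pos c \<and> zer c)" for c using pz[of c "\<lambda>i. - c i"] zn[of c] np by auto
  show "finite C \<Longrightarrow> \<forall>c\<in>C. \<forall>i\<ge>n. c i = 0 \<Longrightarrow> ?thesis"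
  proof (induction n arbitrary: C)
    case 0
    have "\<not> pos c" if "c \<in> C" for c
    proof -
      have "c = (\<lambda>i. 0)" using 0 that by auto
      then show ?thesis using np by simp
    qed
    then show ?case by auto
  next
    case (Suc n)
    show ?case
    \<comment> \<open>Either a null combination involves the last variable and can be solved for it,
      or that variable is restricted by strict inequalities only.\<close>
    proof (cases "\<exists>e. zer e \<and> e n \<noteq> 0 \<and> (\<forall>i\<ge>Suc n. e i = 0)")
      case True
      then obtain e0 where e0: "zer e0" "e0 n \<noteq> 0" "\<forall>i\<ge>Suc n. e0 i = 0" by auto
      define e where "e = (\<lambda>i. sgn (e0 n) * e0 i)"
      have e: "zer e" "e n > 0" "\<forall>i\<ge>Suc n. e i = 0" using e0 zer_scale
        by (auto simp: e_def sgn_if)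
      \<comment> \<open>Cancels the last coordinate of \<open>d\<close> against \<open>e\<close>; as
        \<open>e\<close> is null and \<open>e n\<close> is positive, the sign of \<open>d\<close> is
        preserved.\<close>
      define r where "r d = (\<lambda>i. e n * d i + (- d n) * e i)" for d :: "nat \<Rightarrow> int"
      have rp: "pos (r d)" if "pos d" for d
        unfolding r_def by (rule pz[OF pos_scale_int[OF that e(2)] zer_scale[OF e(1)]])
      have rz: "zer (r d)" if "zer d" for d
        unfolding r_def by (rule zz[OF zer_scale[OF that] zer_scale[OF e(1)]])
      have "\<forall>c\<in>r ` C. \<forall>i\<ge>n. c i = 0"
      proof safe
        fix d i assume "d \<in> C" "i \<ge> n"
        then show "r d i = 0" using Suc.prems e by (cases "i = n") (auto simp: r_def)
      qed
      from Suc.IH[OF _ this] Suc.prems obtain q :: "nat \<Rightarrow> rat" where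
        q: "\<And>c. c \<in> C \<Longrightarrow> (pos (r c) \<longrightarrow> 0 < (\<Sum>i<n. of_int (r c i) * q i)) \<and>
          (zer (r c) \<longrightarrow> (\<Sum>i<n. of_int (r c i) * q i) = 0)" by auto
      define s where "s d = (\<Sum>i<n. of_int (d i) * q i)" for d :: "nat \<Rightarrow> int"
      \<comment> \<open>The value of the last variable that makes the combination \<open>e\<close>
        vanish.\<close>
      define q' where "q' = q(n := - s e / of_int (e n))"
      have sr: "s (r d) = of_int (e n) * s d - of_int (d n) * s e" for d
        by (simp add: s_def r_def sum_distrib_left sum.distrib sum_subtractf algebra_simps)
      have "(\<Sum>i<Suc n. of_int (d i) * q' i) = s d + of_int (d n) * (- s e / of_int (e n))" for d
        by (simp add: q'_def s_def)
      then have *: "(\<Sum>i<Suc n. of_int (d i) * q' i) = s (r d) / of_int (e n)" for d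
        using e(2) by (simp add: sr field_simps)
      show ?thesis
        by (rule exI[of _ q'], unfold *) (use q rp rz e(2) in \<open>auto simp: s_def[symmetric]\<close>)
    next
      case False
      define s where "s q d = (\<Sum>i<n. of_int (d i) * q i)" for d :: "nat \<Rightarrow> int" and q :: "nat \<Rightarrow> rat"
      define C' where "C' = C \<union> (\<lambda>c i. - c i) ` C"
      define L where "L = {c \<in> C'. pos c \<and> c n > 0}"
      define H where "H = {c \<in> C'. pos c \<and> c n < 0}"
      \<comment> \<open>A combination, with positive coefficients, of a lower bound \<open>d\<close>
        (\<open>d n > 0\<close>) and an upper bound \<open>u\<close> (\<open>u n < 0\<close>) in
        which the last variable cancels.\<close>
      define pr where "pr d u = (\<lambda>i. (- u n) * d i + d n * u i)" for d u :: "nat \<Rightarrow> int"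
      define D where "D = {c \<in> C'. c n = 0} \<union> (\<lambda>(d, u). pr d u) ` (L \<times> H)"
      have fin: "finite C'" "finite L" "finite H" "finite D"
        using Suc.prems by (auto simp: C'_def L_def H_def D_def)
      have C': "\<forall>c\<in>C'. \<forall>i\<ge>Suc n. c i = 0" using Suc.prems by (auto simp: C'_def)
      have "\<forall>c\<in>D. \<forall>i\<ge>n. c i = 0"
      proof safe
        fix c i assume "c \<in> D" "i \<ge> n"
        show "c i = 0"
        proof (cases "i = n")
          case True
          then show ?thesis using \<open>c \<in> D\<close> by (auto simp: D_def pr_def)
        next
          case False
          then have "\<forall>d\<in>C'. d i = 0" using C' \<open>i \<ge> n\<close> by auto
          then show ?thesis using \<open>c \<in> D\<close>
            by (auto simp: D_def pr_def L_def H_def) (metis mult_zero_right)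
        qed
      qed
      from Suc.IH[OF fin(4) this] obtain q :: "nat \<Rightarrow> rat" where
        q: "\<And>c. c \<in> D \<Longrightarrow> (pos c \<longrightarrow> 0 < s q c) \<and> (zer c \<longrightarrow> s q c = 0)"
        by (auto simp: s_def)
      \<comment> \<open>Positivity of \<open>pr d u\<close> says exactly that the lower bound from
        \<open>d\<close> lies below the upper bound from \<open>u\<close>.\<close>
      have lt: "- s q d / of_int (d n) < s q u / of_int (- u n)" if "d \<in> L" "u \<in> H" for d u
      proof -
        have "pos (pr d u)" unfolding pr_def using that
          by (intro pp pos_scale_int) (auto simp: L_def H_def)
        then have "0 < s q (pr d u)" using q[of "pr d u"] that by (auto simp: D_def)
        also have "s q (pr d u) = of_int (- u n) * s q d + of_int (d n) * s q u"
          by (simp add: s_def pr_def sum_distrib_left sum.distrib sum_subtractf sum_negf algebra_simps)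
        finally show ?thesis using that by (simp add: L_def H_def field_simps)
      qed
      have "\<exists>m. (\<forall>a\<in>(\<lambda>d. - s q d / of_int (d n)) ` L. a < m) \<and>
          (\<forall>b\<in>(\<lambda>u. s q u / of_int (- u n)) ` H. m < b)"
        by (rule finite_gap) (use fin lt in auto)
      then obtain m where m: "\<And>d. d \<in> L \<Longrightarrow> - s q d / of_int (d n) < m"
        "\<And>u. u \<in> H \<Longrightarrow> m < s q u / of_int (- u n)" by auto
      define q' where "q' = q(n := m)"
      have s': "(\<Sum>i<Suc n. of_int (d i) * q' i) = s q d + of_int (d n) * m" for d
        by (simp add: q'_def s_def)
      have pos': "0 < s q d + of_int (d n) * m" if "d \<in> C'" "pos d" for d
      proof -
        consider "d n > 0" | "d n < 0" | "d n = 0" by linarith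
        then show ?thesis
        proof cases
          case 1
          then show ?thesis using m(1)[of d] that by (auto simp: L_def field_simps)
        next
          case 2
          then show ?thesis using m(2)[of d] that by (auto simp: H_def field_simps)
        next
          case 3
          then show ?thesis using q[of d] that by (auto simp: D_def)
        qed
      qed
      show ?thesis
      proof (intro exI[of _ q'] ballI conjI impI, unfold s')
        fix c assume c: "c \<in> C"
        show "0 < s q c + of_int (c n) * m" if "pos c"
          using pos' c that by (auto simp: C'_def)
        show "s q c + of_int (c n) * m = 0" if "zer c"
        proof -
          \<comment> \<open>In this case no null combination involves the last variable, so
            \<open>c\<close> was already satisfied by \<open>q\<close>.\<close>
          have "c n = 0" using False that c Suc.prems by auto
          then show ?thesis using q[of c] c that by (auto simp: D_def C'_def)
        qed
      qed
    qed
  qed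
qed

end

section \<open>Substitution\<close>

lemma subst_tm_comp: "subst_tm s (subst_tm s' t) = subst_tm (\<lambda>i. subst_tm s (s' i)) t"
  by (induction t) auto

lemma up_0 [simp]: "up s 0 = Var 0" and up_Suc [simp]: "up s (Suc i) = shift 1 (s i)"
  by (simp_all add: up_def)

lemma up_comp: "up (\<lambda>i. subst_tm s (s' i)) = (\<lambda>i. subst_tm (up s) (up s' i))"
proof
  show "up (\<lambda>i. subst_tm s (s' i)) i = subst_tm (up s) (up s' i)" for i
    by (cases i) (simp_all add: subst_tm_comp)
qed

lemma subst_fm_comp: "subst_fm s (subst_fm s' A) = subst_fm (\<lambda>i. subst_tm s (s' i)) A"
  by (induction A arbitrary: s s') (simp_all add: subst_tm_comp up_comp)

lemma subst_tm_Var: "subst_tm Var t = t"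
  by (induction t) auto

lemma up_Var: "up Var = Var"
proof
  show "up Var i = Var i" for i by (cases i) auto
qed

lemma subst_fm_Var: "subst_fm Var A = A"
  by (induction A) (simp_all add: subst_tm_Var up_Var)

lemma subst_fm_eqI: "(\<And>i. s i = s' i) \<Longrightarrow> subst_fm s A = subst_fm s' A"
  by (metis ext)

lemma subst_inst: "subst_fm s (inst A t) = inst (subst_fm (up s) A) (subst_tm s t)"
  unfolding subst_fm_comp
  by (rule subst_fm_eqI) (simp add: subst_tm_comp subst_tm_Var split: nat.split)

lemma subst_shift: "subst_fm (up s) (shift_fm 1 A) = shift_fm 1 (subst_fm s A)"
  unfolding subst_fm_comp by (rule subst_fm_eqI) (simp add: subst_tm_comp)

lemma subst_num [simp]: "subst_tm s (num k) = num k"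
  by (induction k) (simp_all add: num_def)

section \<open>Free variables\<close>

primrec fvt :: "tm \<Rightarrow> nat set" where
  "fvt (Var i) = {i}"
| "fvt (Con c) = {}"
| "fvt (t \<bullet> u) = fvt t \<union> fvt u"

primrec fvf :: "fm \<Rightarrow> nat set" where
  "fvf (t \<^bold>= u) = fvt t \<union> fvt u"
| "fvf (t \<^bold>< u) = fvt t \<union> fvt u"
| "fvf Fls = {}"
| "fvf (A \<^bold>\<and> B) = fvf A \<union> fvf B"
| "fvf (A \<^bold>\<or> B) = fvf A \<union> fvf B"
| "fvf (A \<^bold>\<longrightarrow> B) = fvf A \<union> fvf B"
| "fvf (All \<sigma> A) = {i. Suc i \<in> fvf A}"
| "fvf (Ex \<sigma> A) = {i. Suc i \<in> fvf A}"

lemma finite_fvt: "finite (fvt t)"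
  by (induction t) auto

lemma finite_Suc_vimage: "finite S \<Longrightarrow> finite {i. Suc i \<in> S}"
  using finite_vimageI[of S Suc] by (simp add: vimage_def)

lemma finite_fvf: "finite (fvf A)"
  by (induction A) (simp_all add: finite_fvt finite_Suc_vimage)

lemma subst_tm_cong: "(\<And>i. i \<in> fvt t \<Longrightarrow> s i = s' i) \<Longrightarrow> subst_tm s t = subst_tm s' t"
  by (induction t) auto

lemma subst_fm_cong: "(\<forall>i\<in>fvf A. s i = s' i) \<Longrightarrow> subst_fm s A = subst_fm s' A"
proof (induction A arbitrary: s s')
  case (All \<sigma> A)
  have "\<forall>i\<in>fvf A. up s i = up s' i"
  proof
    fix i assume "i \<in> fvf A"
    then show "up s i = up s' i" using All.prems by (cases i) auto
  qed
  then show ?case using All.IH by auto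
next
  case (Ex \<sigma> A)
  have "\<forall>i\<in>fvf A. up s i = up s' i"
  proof
    fix i assume "i \<in> fvf A"
    then show "up s i = up s' i" using Ex.prems by (cases i) auto
  qed
  then show ?case using Ex.IH by auto
next
  case (And A B)
  show ?case using And.IH(1)[of s s'] And.IH(2)[of s s'] And.prems by simp
next
  case (Or A B)
  show ?case using Or.IH(1)[of s s'] Or.IH(2)[of s s'] Or.prems by simp
next
  case (Imp A B)
  show ?case using Imp.IH(1)[of s s'] Imp.IH(2)[of s s'] Imp.prems by simp
next
  case (Eq t u)
  show ?case using subst_tm_cong[of t s s'] subst_tm_cong[of u s s'] Eq.prems by auto
next
  case (Lt t u)
  show ?case using subst_tm_cong[of t s s'] subst_tm_cong[of u s s'] Lt.prems by auto
qed simp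

section \<open>Typing\<close>

text \<open>Type inference against a partial environment on all variables: a world has infinitely
  many variables at its disposal, whereas the calculus types a derivation in a finite list.\<close>

primrec tyof :: "(nat \<Rightarrow> ty option) \<Rightarrow> tm \<Rightarrow> ty option" where
  "tyof e (Var i) = e i"
| "tyof e (Con c) = Some (cty c)"
| "tyof e (t \<bullet> u) = (case tyof e t of Some (\<sigma> \<rightarrow> \<tau>) \<Rightarrow> if tyof e u = Some \<sigma> then Some \<tau> else None | _ \<Rightarrow> None)"

lemma tyof_App: "tyof e (t \<bullet> u) = Some \<tau> \<longleftrightarrow> (\<exists>\<sigma>. tyof e t = Some (\<sigma> \<rightarrow> \<tau>) \<and> tyof e u = Some \<sigma>)"
  by (auto split: option.splits ty.splits)

primrec wfe :: "(nat \<Rightarrow> ty option) \<Rightarrow> fm \<Rightarrow> bool" where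
  "wfe e (t \<^bold>= u) \<longleftrightarrow> (\<exists>\<sigma>. tyof e t = Some \<sigma> \<and> tyof e u = Some \<sigma>)"
| "wfe e (t \<^bold>< u) \<longleftrightarrow> tyof e t = Some Qt \<and> tyof e u = Some Qt"
| "wfe e Fls \<longleftrightarrow> True"
| "wfe e (A \<^bold>\<and> B) \<longleftrightarrow> wfe e A \<and> wfe e B"
| "wfe e (A \<^bold>\<or> B) \<longleftrightarrow> wfe e A \<and> wfe e B"
| "wfe e (A \<^bold>\<longrightarrow> B) \<longleftrightarrow> wfe e A \<and> wfe e B"
| "wfe e (All \<sigma> A) \<longleftrightarrow> wfe (case_nat (Some \<sigma>) e) A"
| "wfe e (Ex \<sigma> A) \<longleftrightarrow> wfe (case_nat (Some \<sigma>) e) A"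

definition env_of :: "ty list \<Rightarrow> nat \<Rightarrow> ty option" where
  "env_of \<Gamma> i = (if i < length \<Gamma> then Some (\<Gamma> ! i) else None)"

lemma env_of_Cons: "env_of (\<sigma> # \<Gamma>) = case_nat (Some \<sigma>) (env_of \<Gamma>)"
  by (rule ext) (simp add: env_of_def split: nat.split)

lemma has_ty_iff: "has_ty \<Gamma> t \<sigma> \<longleftrightarrow> tyof (env_of \<Gamma>) t = Some \<sigma>"
proof
  show "has_ty \<Gamma> t \<sigma> \<Longrightarrow> tyof (env_of \<Gamma>) t = Some \<sigma>"
    by (induction rule: has_ty.induct) (auto simp: env_of_def)
  show "tyof (env_of \<Gamma>) t = Some \<sigma> \<Longrightarrow> has_ty \<Gamma> t \<sigma>"
  proof (induction t arbitrary: \<sigma>)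
    case (App t u)
    then show ?case unfolding tyof_App by (auto intro: ty_App)
  qed (auto simp: env_of_def ty_Con ty_Var split: if_splits)
qed

lemma wff_iff: "wff \<Gamma> A \<longleftrightarrow> wfe (env_of \<Gamma>) A"
  by (induction A arbitrary: \<Gamma>) (simp_all add: has_ty_iff env_of_Cons)

lemma tyof_mono:
  "tyof e t = Some \<sigma> \<Longrightarrow> (\<And>i \<tau>. i \<in> fvt t \<Longrightarrow> e i = Some \<tau> \<Longrightarrow> e' i = Some \<tau>) \<Longrightarrow> tyof e' t = Some \<sigma>"
proof (induction t arbitrary: \<sigma>)
  case (App t u)
  from App.prems(1) obtain \<rho> where "tyof e t = Some (\<rho> \<rightarrow> \<sigma>)" "tyof e u = Some \<rho>"
    unfolding tyof_App by auto
  with App show ?case unfolding tyof_App by auto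
qed auto

lemma wfe_mono:
  "wfe e A \<Longrightarrow> (\<And>i \<tau>. i \<in> fvf A \<Longrightarrow> e i = Some \<tau> \<Longrightarrow> e' i = Some \<tau>) \<Longrightarrow> wfe e' A"
proof (induction A arbitrary: e e')
  case (All \<sigma> A)
  have "case_nat (Some \<sigma>) e' i = Some \<tau>" if "i \<in> fvf A" "case_nat (Some \<sigma>) e i = Some \<tau>" for i \<tau>
    using that All.prems(2) by (cases i) auto
  with All.IH All.prems(1) show ?case by auto
next
  case (Ex \<sigma> A)
  have "case_nat (Some \<sigma>) e' i = Some \<tau>" if "i \<in> fvf A" "case_nat (Some \<sigma>) e i = Some \<tau>" for i \<tau>
    using that Ex.prems(2) by (cases i) auto
  with Ex.IH Ex.prems(1) show ?case by auto
next
  case (Eq t u)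
  then show ?case using tyof_mono[of e t _ e'] tyof_mono[of e u _ e'] by fastforce
next
  case (Lt t u)
  then show ?case using tyof_mono[of e t _ e'] tyof_mono[of e u _ e'] by simp
next
  case (And A B)
  then show ?case using And.IH[of e e'] by simp
next
  case (Or A B)
  then show ?case using Or.IH[of e e'] by simp
next
  case (Imp A B)
  then show ?case using Imp.IH[of e e'] by simp
qed simp

lemma tyof_subst:
  "tyof e t = Some \<sigma> \<Longrightarrow> (\<And>i \<tau>. e i = Some \<tau> \<Longrightarrow> tyof e' (s i) = Some \<tau>) \<Longrightarrow>
   tyof e' (subst_tm s t) = Some \<sigma>"
proof (induction t arbitrary: \<sigma>)
  case (App t u)
  from App.prems(1) obtain \<rho> where "tyof e t = Some (\<rho> \<rightarrow> \<sigma>)" "tyof e u = Some \<rho>"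
    unfolding tyof_App by auto
  with App.IH App.prems(2) show ?case unfolding subst_tm.simps tyof_App by auto
qed auto

lemma tyof_rename: "tyof e (subst_tm (\<lambda>i. Var (f i)) t) = tyof (\<lambda>i. e (f i)) t"
  by (induction t) (auto split: option.splits ty.splits)

lemma up_typed:
  assumes "\<And>i \<tau>. e i = Some \<tau> \<Longrightarrow> tyof e' (s i) = Some \<tau>"
  shows "case_nat (Some \<sigma>) e i = Some \<tau> \<Longrightarrow> tyof (case_nat (Some \<sigma>) e') (up s i) = Some \<tau>"
  using assms by (cases i) (auto simp: tyof_rename)

lemma wfe_subst:
  "wfe e A \<Longrightarrow> (\<And>i \<tau>. e i = Some \<tau> \<Longrightarrow> tyof e' (s i) = Some \<tau>) \<Longrightarrow> wfe e' (subst_fm s A)"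
proof (induction A arbitrary: e e' s)
  case (Eq t u)
  then show ?case using tyof_subst[of e t _ e' s] tyof_subst[of e u _ e' s] by fastforce
next
  case (Lt t u)
  then show ?case using tyof_subst[of e t _ e' s] tyof_subst[of e u _ e' s] by simp
next
  case (All \<sigma> A)
  show ?case using All.IH[OF _ up_typed[OF All.prems(2)]] All.prems(1) by simp
next
  case (Ex \<sigma> A)
  show ?case using Ex.IH[OF _ up_typed[OF Ex.prems(2)]] Ex.prems(1) by simp
qed auto

section \<open>Derivability is closed under substitution and weakening\<close>

definition typed_subst :: "ty list \<Rightarrow> (nat \<Rightarrow> tm) \<Rightarrow> ty list \<Rightarrow> bool" where
  "typed_subst \<Gamma>' s \<Gamma> \<longleftrightarrow> (\<forall>i<length \<Gamma>. has_ty \<Gamma>' (s i) (\<Gamma> ! i))"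

lemma typed_substD: "typed_subst \<Gamma>' s \<Gamma> \<Longrightarrow> env_of \<Gamma> i = Some \<tau> \<Longrightarrow> tyof (env_of \<Gamma>') (s i) = Some \<tau>"
  by (auto simp: typed_subst_def has_ty_iff env_of_def split: if_splits)

lemma has_ty_subst: "typed_subst \<Gamma>' s \<Gamma> \<Longrightarrow> has_ty \<Gamma> t \<sigma> \<Longrightarrow> has_ty \<Gamma>' (subst_tm s t) \<sigma>"
  unfolding has_ty_iff by (blast intro: tyof_subst typed_substD)

lemma wff_subst: "typed_subst \<Gamma>' s \<Gamma> \<Longrightarrow> wff \<Gamma> A \<Longrightarrow> wff \<Gamma>' (subst_fm s A)"
  unfolding wff_iff by (blast intro: wfe_subst typed_substD)

lemma typed_subst_up: "typed_subst \<Gamma>' s \<Gamma> \<Longrightarrow> typed_subst (\<sigma> # \<Gamma>') (up s) (\<sigma> # \<Gamma>)"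
  unfolding typed_subst_def
proof (intro allI impI)
  fix i assume *: "\<forall>i<length \<Gamma>. has_ty \<Gamma>' (s i) (\<Gamma> ! i)" "i < length (\<sigma> # \<Gamma>)"
  show "has_ty (\<sigma> # \<Gamma>') (up s i) ((\<sigma> # \<Gamma>) ! i)"
    using * by (cases i) (auto simp: has_ty_iff env_of_Cons tyof_rename)
qed

text \<open>The schemata have arbitrary terms and formulas as parameters; those that themselves
  substitute into a formula, induction and choice, need the two substitutions to commute.\<close>

lemma ax_subst: "ax \<Gamma> A \<Longrightarrow> typed_subst \<Gamma>' s \<Gamma> \<Longrightarrow> ax \<Gamma>' (subst_fm s A)"
proof (induction rule: ax.induct)
  case (ax_induct \<Gamma> A)
  have "wff (Nt # \<Gamma>') (subst_fm (up s) A)"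
    using ax_induct by (blast intro: wff_subst typed_subst_up)
  from ax.ax_induct[OF this]
  have "ax \<Gamma>' (inst (subst_fm (up s) A) zero \<^bold>\<and>
     All Nt (subst_fm (up s) A \<^bold>\<longrightarrow>
       subst_fm (case_nat (succ (Var 0)) (\<lambda>i. Var (i + 1))) (subst_fm (up s) A)) \<^bold>\<longrightarrow>
     All Nt (subst_fm (up s) A))" .
  moreover have "subst_fm (case_nat (succ (Var 0)) (\<lambda>i. Var (i + 1))) (subst_fm (up s) A) =
     subst_fm (up s) (subst_fm (case_nat (succ (Var 0)) (\<lambda>i. Var (i + 1))) A)"
    unfolding subst_fm_comp
    by (rule subst_fm_eqI) (simp add: subst_tm_comp split: nat.split)
  ultimately show ?case by (simp add: subst_inst)
next
  case (ax_countable_choice \<sigma> \<Gamma> A)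
  have "wff (\<sigma> # Nt # \<Gamma>') (subst_fm (up (up s)) A)"
    using ax_countable_choice by (blast intro: wff_subst typed_subst_up)
  from ax.ax_countable_choice[OF this]
  have "ax \<Gamma>' (All Nt (Ex \<sigma> (subst_fm (up (up s)) A)) \<^bold>\<longrightarrow>
     Ex (Nt \<rightarrow> \<sigma>) (All Nt
       (subst_fm (case_nat (Var 1 \<bullet> Var 0) (case_nat (Var 0) (\<lambda>i. Var (i + 2))))
         (subst_fm (up (up s)) A))))" .
  moreover have "subst_fm (case_nat (Var 1 \<bullet> Var 0) (case_nat (Var 0) (\<lambda>i. Var (i + 2))))
        (subst_fm (up (up s)) A) =
     subst_fm (up (up s)) (subst_fm (case_nat (Var 1 \<bullet> Var 0) (case_nat (Var 0) (\<lambda>i. Var (i + 2)))) A)"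
    unfolding subst_fm_comp
    by (rule subst_fm_eqI) (simp add: subst_tm_comp split: nat.split)
  ultimately show ?case by simp
next
  case (ax_dependent_choice \<sigma> \<Gamma> D A)
  let ?D = "subst_fm (up s) D" and ?A = "subst_fm (up (up s)) A"
  have "wff (\<sigma> # \<Gamma>') ?D" "wff (\<sigma> # \<sigma> # \<Gamma>') ?A"
    using ax_dependent_choice by (blast intro: wff_subst typed_subst_up)+
  note ax.ax_dependent_choice[OF this]
  moreover have "subst_fm (case_nat (Var 0) (\<lambda>i. Var (i + 2))) ?D =
      subst_fm (up (up s)) (subst_fm (case_nat (Var 0) (\<lambda>i. Var (i + 2))) D)"
    unfolding subst_fm_comp
    by (rule subst_fm_eqI) (simp add: subst_tm_comp split: nat.split)
  moreover have "subst_fm (case_nat (Var 1 \<bullet> Var 0) (\<lambda>i. Var (i + 3))) ?D =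
      subst_fm (up (up (up s))) (subst_fm (case_nat (Var 1 \<bullet> Var 0) (\<lambda>i. Var (i + 3))) D)"
    unfolding subst_fm_comp
    by (rule subst_fm_eqI) (simp add: subst_tm_comp numeral_3_eq_3 split: nat.split)
  moreover have "subst_fm (case_nat (Var 1 \<bullet> succ (Var 0))
           (case_nat (Var 1 \<bullet> Var 0) (\<lambda>i. Var (i + 3)))) ?A =
      subst_fm (up (up (up s))) (subst_fm (case_nat (Var 1 \<bullet> succ (Var 0))
           (case_nat (Var 1 \<bullet> Var 0) (\<lambda>i. Var (i + 3)))) A)"
    unfolding subst_fm_comp
    by (rule subst_fm_eqI) (simp add: subst_tm_comp numeral_3_eq_3 split: nat.split)
  ultimately show ?case by simp
next
  case (ax_rational \<Gamma>)
  have "subst_fm s (All Qt (Ex Nt (Ex Nt (Ex Nt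
      (Var 3 \<^bold>* iota (succ (Var 0)) \<^bold>= iota (Var 2) \<^bold>+ \<^bold>- iota (Var 1)))))) =
    All Qt (Ex Nt (Ex Nt (Ex Nt
      (Var 3 \<^bold>* iota (succ (Var 0)) \<^bold>= iota (Var 2) \<^bold>+ \<^bold>- iota (Var 1)))))"
    by (simp add: numeral_3_eq_3 numeral_2_eq_2)
  then show ?case using ax.ax_rational by simp
qed (simp_all add: ax.intros has_ty_subst del: One_nat_def)

text \<open>One induction covers the enlargement of context and assumptions, the binding of a fresh
  variable, and the instantiation of leftover variables by closed terms.\<close>

theorem derives_subst:
  "\<Gamma>; \<Delta> \<turnstile> A \<Longrightarrow> typed_subst \<Gamma>' s \<Gamma> \<Longrightarrow> subst_fm s ` set \<Delta> \<subseteq> set \<Delta>' \<Longrightarrow> \<Gamma>'; \<Delta>' \<turnstile> subst_fm s A"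
proof (induction arbitrary: \<Gamma>' \<Delta>' s rule: derives.induct)
  case (Ax \<Gamma> A \<Delta>)
  then show ?case by (blast intro: derives.Ax ax_subst)
next
  case (Hyp A \<Delta> \<Gamma>)
  then show ?case by (blast intro: derives.Hyp wff_subst)
next
  case (FlsE \<Gamma> \<Delta> A)
  then show ?case using derives.FlsE[of \<Gamma>' \<Delta>' "subst_fm s A"] wff_subst[of \<Gamma>' s \<Gamma> A] by auto
next
  case (AndI \<Gamma> \<Delta> A B)
  then show ?case by (auto intro: derives.AndI)
next
  case (AndE1 \<Gamma> \<Delta> A B)
  show ?case using AndE1.IH[OF AndE1.prems] by simp (rule derives.AndE1)
next
  case (AndE2 \<Gamma> \<Delta> A B)
  show ?case using AndE2.IH[OF AndE2.prems] by simp (rule derives.AndE2)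
next
  case (OrI1 \<Gamma> \<Delta> A B)
  then show ?case by (auto intro: derives.OrI1 wff_subst)
next
  case (OrI2 \<Gamma> \<Delta> B A)
  then show ?case by (auto intro: derives.OrI2 wff_subst)
next
  case (OrE \<Gamma> \<Delta> A B C)
  show ?case
  proof (rule derives.OrE)
    show "\<Gamma>'; \<Delta>' \<turnstile> subst_fm s A \<^bold>\<or> subst_fm s B" using OrE.IH(1)[OF OrE.prems] by simp
    show "\<Gamma>'; subst_fm s A # \<Delta>' \<turnstile> subst_fm s C" using OrE.prems by (intro OrE.IH(2)) auto
    show "\<Gamma>'; subst_fm s B # \<Delta>' \<turnstile> subst_fm s C" using OrE.prems by (intro OrE.IH(3)) auto
  qed
next
  case (ImpI \<Gamma> A \<Delta> B)
  have "\<Gamma>'; subst_fm s A # \<Delta>' \<turnstile> subst_fm s B" using ImpI.prems by (intro ImpI.IH) auto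
  then show ?case using ImpI by (auto intro: derives.ImpI wff_subst)
next
  case (ImpE \<Gamma> \<Delta> A B)
  show ?case using ImpE.IH[OF ImpE.prems] by simp (rule derives.ImpE)
next
  case (AllI \<sigma> \<Gamma> \<Delta> A)
  have "\<sigma> # \<Gamma>'; map (shift_fm 1) \<Delta>' \<turnstile> subst_fm (up s) A"
    using AllI.prems by (intro AllI.IH) (auto simp: typed_subst_up subst_shift[simplified])
  then show ?case by (simp add: derives.AllI)
next
  case (AllE \<Gamma> \<Delta> \<sigma> A t)
  then show ?case unfolding subst_inst
    by (intro derives.AllE[of _ _ \<sigma>] has_ty_subst[of \<Gamma>' s \<Gamma>]) auto
next
  case (ExI \<Gamma> \<Delta> A t \<sigma>)
  have "\<Gamma>'; \<Delta>' \<turnstile> Ex \<sigma> (subst_fm (up s) A)"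
  proof (rule derives.ExI)
    show "\<Gamma>'; \<Delta>' \<turnstile> inst (subst_fm (up s) A) (subst_tm s t)"
      using ExI.IH[OF ExI.prems] by (simp add: subst_inst)
  qed (use ExI in \<open>blast intro: has_ty_subst wff_subst typed_subst_up\<close>)+
  then show ?case by simp
next
  case (ExE \<Gamma> \<Delta> \<sigma> A C)
  show ?case
  proof (rule derives.ExE)
    show "\<Gamma>'; \<Delta>' \<turnstile> Ex \<sigma> (subst_fm (up s) A)" using ExE.IH(1)[OF ExE.prems] by simp
    have "\<sigma> # \<Gamma>'; subst_fm (up s) A # map (shift_fm 1) \<Delta>' \<turnstile> subst_fm (up s) (shift_fm 1 C)"
      using ExE.prems by (intro ExE.IH(2)) (auto simp: typed_subst_up subst_shift[simplified])
    then show "\<sigma> # \<Gamma>'; subst_fm (up s) A # map (shift_fm 1) \<Delta>' \<turnstile> shift_fm 1 (subst_fm s C)"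
      by (simp add: subst_shift[simplified])
  qed
next
  case (EqI \<Gamma> t \<sigma> \<Delta>)
  then show ?case by (auto intro: derives.EqI has_ty_subst)
next
  case (EqE \<Gamma> \<Delta> t u A \<sigma>)
  have "\<Gamma>'; \<Delta>' \<turnstile> inst (subst_fm (up s) A) (subst_tm s u)"
  proof (rule derives.EqE)
    show "\<Gamma>'; \<Delta>' \<turnstile> subst_tm s t \<^bold>= subst_tm s u" using EqE.IH(1)[OF EqE.prems] by simp
    show "\<Gamma>'; \<Delta>' \<turnstile> inst (subst_fm (up s) A) (subst_tm s t)"
      using EqE.IH(2)[OF EqE.prems] by (simp add: subst_inst)
  qed (use EqE in \<open>blast intro: has_ty_subst wff_subst typed_subst_up\<close>)+
  then show ?case by (simp add: subst_inst)
qed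

section \<open>Completeness for a canonical Kripke model\<close>

instance ty :: countable by countable_datatype
instance cst :: countable by countable_datatype
instance tm :: countable by countable_datatype
instance fm :: countable by countable_datatype

text \<open>The variable \<open>i\<close> has the fixed type \<open>var_ty i\<close> and the level \<open>lev i\<close>, and there are infinitely
  many variables of every type at every level. A world of level \<open>l\<close> uses the variables up to level
  \<open>l\<close>, so that the next level provides fresh witnesses for its extensions.\<close>

definition var_ty :: "nat \<Rightarrow> ty" where "var_ty i = from_nat (fst (prod_decode i))"
definition lev :: "nat \<Rightarrow> nat" where "lev i = fst (prod_decode (snd (prod_decode i)))"
definition env :: "nat \<Rightarrow> nat \<Rightarrow> ty option" where
  "env l i = (if lev i \<le> l then Some (var_ty i) else None)"

lemma infinite_vars: "infinite {i. var_ty i = \<sigma> \<and> lev i = l}"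
proof
  assume fin: "finite {i. var_ty i = \<sigma> \<and> lev i = l}"
  define f where "f j = prod_encode (to_nat \<sigma>, prod_encode (l, j))" for j :: nat
  have "inj f" by (simp add: f_def inj_def)
  moreover have "range f \<subseteq> {i. var_ty i = \<sigma> \<and> lev i = l}"
    by (auto simp: f_def var_ty_def lev_def)
  ultimately show False using fin by (meson finite_subset finite_imageD infinite_UNIV_nat)
qed

lemma fresh_var:
  assumes "finite S"
  obtains c where "var_ty c = \<sigma>" "lev c = l" "c \<notin> S"
proof -
  have "\<not> {i. var_ty i = \<sigma> \<and> lev i = l} \<subseteq> S"
    using infinite_vars[of \<sigma> l] finite_subset[of _ S] assms by auto
  then show thesis using that by blast
qed

lemma env_lev: "env l i = Some \<tau> \<Longrightarrow> lev i \<le> l \<and> var_ty i = \<tau>"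
  by (simp add: env_def split: if_splits)

lemma env_mono: "l \<le> m \<Longrightarrow> env l i = Some \<tau> \<Longrightarrow> env m i = Some \<tau>"
  by (auto simp: env_def split: if_splits)

text \<open>Finite initial segments of the fixed typing of variables. They contain variables of
  several levels, and finitely many well-typed formulas always fit into a long enough one.\<close>

abbreviation ctx :: "nat \<Rightarrow> ty list" where "ctx n \<equiv> map var_ty [0..<n]"

lemma env_of_ctx: "env_of (ctx n) i = (if i < n then Some (var_ty i) else None)"
  by (simp add: env_of_def)

lemma tyof_fvt: "tyof e t = Some \<sigma> \<Longrightarrow> i \<in> fvt t \<Longrightarrow> \<exists>\<tau>. e i = Some \<tau>"
proof (induction t arbitrary: \<sigma>)
  case (App t u)
  then show ?case unfolding tyof_App by auto
qed auto

lemma wfe_fvf: "wfe e A \<Longrightarrow> i \<in> fvf A \<Longrightarrow> \<exists>\<tau>. e i = Some \<tau>"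
proof (induction A arbitrary: e i)
  case (All \<sigma> A)
  then show ?case using All.IH[of "case_nat (Some \<sigma>) e" "Suc i"] by auto
next
  case (Ex \<sigma> A)
  then show ?case using Ex.IH[of "case_nat (Some \<sigma>) e" "Suc i"] by auto
qed (auto dest: tyof_fvt)

lemma wfe_lev: "wfe (env l) A \<Longrightarrow> i \<in> fvf A \<Longrightarrow> lev i \<le> l"
  using wfe_fvf env_lev by blast

lemma has_ty_ctx:
  assumes "tyof (env l) t = Some \<sigma>"
  shows "\<exists>n0. \<forall>n\<ge>n0. has_ty (ctx n) t \<sigma>"
proof -
  obtain n0 where n0: "\<forall>i\<in>fvt t. i < n0" using finite_fvt finite_nat_set_iff_bounded by blast
  have "tyof (env_of (ctx n)) t = Some \<sigma>" if "n \<ge> n0" for n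
    by (rule tyof_mono[OF assms]) (use n0 that in \<open>force simp: env_of_ctx dest: env_lev\<close>)
  then show ?thesis by (auto simp: has_ty_iff)
qed

lemma wff_ctx:
  assumes "wfe (env l) A"
  shows "\<exists>n0. \<forall>n\<ge>n0. wff (ctx n) A"
proof -
  obtain n0 where n0: "\<forall>i\<in>fvf A. i < n0" using finite_fvf finite_nat_set_iff_bounded by blast
  have "wfe (env_of (ctx n)) A" if "n \<ge> n0" for n
    by (rule wfe_mono[OF assms]) (use n0 that in \<open>force simp: env_of_ctx dest: env_lev\<close>)
  then show ?thesis by (auto simp: wff_iff)
qed

section \<open>Provability from infinite theories\<close>

text \<open>Any context length is allowed, so a derivation is not limited to variables of the level
  of the theory.\<close>

definition proves :: "fm set \<Rightarrow> fm \<Rightarrow> bool" where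
  "proves \<Theta> A \<longleftrightarrow> (\<exists>n \<Delta>. set \<Delta> \<subseteq> \<Theta> \<and> (ctx n; \<Delta> \<turnstile> A))"

lemma weaken: "ctx n; \<Delta> \<turnstile> A \<Longrightarrow> n \<le> m \<Longrightarrow> set \<Delta> \<subseteq> set \<Delta>' \<Longrightarrow> ctx m; \<Delta>' \<turnstile> A"
  using derives_subst[of "ctx n" \<Delta> A "ctx m" Var \<Delta>']
  by (auto simp: typed_subst_def has_ty_iff env_of_ctx subst_fm_Var)

lemma provesI: "set \<Delta> \<subseteq> \<Theta> \<Longrightarrow> ctx n; \<Delta> \<turnstile> A \<Longrightarrow> proves \<Theta> A"
  by (auto simp: proves_def)

text \<open>Weakening lets the witnesses grow, so that several derivations can be brought to one
  context and one assumption list before a rule is applied.\<close>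

lemma provesE:
  assumes "proves \<Theta> A"
  obtains n0 \<Delta>0 where "set \<Delta>0 \<subseteq> \<Theta>" "\<And>n \<Delta>. n \<ge> n0 \<Longrightarrow> set \<Delta>0 \<subseteq> set \<Delta> \<Longrightarrow> ctx n; \<Delta> \<turnstile> A"
proof -
  from assms obtain n \<Delta> where "set \<Delta> \<subseteq> \<Theta>" "ctx n; \<Delta> \<turnstile> A" by (auto simp: proves_def)
  then show thesis by (intro that[of \<Delta> n]) (auto intro: weaken)
qed

lemma proves_mono: "proves \<Theta> A \<Longrightarrow> \<Theta> \<subseteq> \<Theta>' \<Longrightarrow> proves \<Theta>' A"
  unfolding proves_def by blast

text \<open>The threshold \<open>n1\<close> absorbs side conditions which ask that a term or formula
  be typed in the context.\<close>

lemma proves_rule1: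
  assumes "proves \<Theta> A" "\<And>n \<Delta>. n \<ge> n1 \<Longrightarrow> ctx n; \<Delta> \<turnstile> A \<Longrightarrow> ctx n; \<Delta> \<turnstile> B"
  shows "proves \<Theta> B"
proof -
  from assms(1) obtain n0 \<Delta>0 where "set \<Delta>0 \<subseteq> \<Theta>"
    "\<And>n \<Delta>. n \<ge> n0 \<Longrightarrow> set \<Delta>0 \<subseteq> set \<Delta> \<Longrightarrow> ctx n; \<Delta> \<turnstile> A" by (rule provesE) (rule that, assumption+)
  then show ?thesis using assms(2)[of "max n0 n1" \<Delta>0] provesI by simp
qed

lemma proves_rule2:
  assumes "proves \<Theta> A" "proves \<Theta> B"
    "\<And>n \<Delta>. n \<ge> n1 \<Longrightarrow> ctx n; \<Delta> \<turnstile> A \<Longrightarrow> ctx n; \<Delta> \<turnstile> B \<Longrightarrow> ctx n; \<Delta> \<turnstile> C"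
  shows "proves \<Theta> C"
proof -
  from assms(1) obtain n0 \<Delta>0 where 0: "set \<Delta>0 \<subseteq> \<Theta>"
    "\<And>n \<Delta>. n \<ge> n0 \<Longrightarrow> set \<Delta>0 \<subseteq> set \<Delta> \<Longrightarrow> ctx n; \<Delta> \<turnstile> A" by (rule provesE) (rule that, assumption+)
  from assms(2) obtain n2 \<Delta>2 where 2: "set \<Delta>2 \<subseteq> \<Theta>"
    "\<And>n \<Delta>. n \<ge> n2 \<Longrightarrow> set \<Delta>2 \<subseteq> set \<Delta> \<Longrightarrow> ctx n; \<Delta> \<turnstile> B" by (rule provesE) (rule that, assumption+)
  define n where "n = max n0 (max n1 n2)"
  have "ctx n; \<Delta>0 @ \<Delta>2 \<turnstile> C"
    by (rule assms(3)) (auto simp: n_def intro!: 0 2)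
  then show ?thesis using 0 2 by (intro provesI[of "\<Delta>0 @ \<Delta>2"]) auto
qed

lemma proves_base:
  assumes "\<And>n. n \<ge> n0 \<Longrightarrow> ctx n; [] \<turnstile> A"
  shows "proves \<Theta> A"
  using assms[of n0] provesI[of "[]"] by simp

lemma proves_hyp: "A \<in> \<Theta> \<Longrightarrow> wfe (env l) A \<Longrightarrow> proves \<Theta> A"
proof -
  assume "A \<in> \<Theta>" "wfe (env l) A"
  moreover from this(2) obtain n where "wff (ctx n) A" using wff_ctx by blast
  ultimately show ?thesis by (intro provesI[of "[A]" \<Theta> n] Hyp) auto
qed

lemma proves_insertE:
  assumes "proves (insert A \<Theta>) B"
  obtains n0 \<Delta>0 where "set \<Delta>0 \<subseteq> \<Theta>"
    "\<And>n \<Delta>. n \<ge> n0 \<Longrightarrow> set \<Delta>0 \<subseteq> set \<Delta> \<Longrightarrow> ctx n; A # \<Delta> \<turnstile> B"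
proof -
  from assms obtain n0 \<Delta>0 where 0: "set \<Delta>0 \<subseteq> insert A \<Theta>"
    "\<And>n \<Delta>. n \<ge> n0 \<Longrightarrow> set \<Delta>0 \<subseteq> set \<Delta> \<Longrightarrow> ctx n; \<Delta> \<turnstile> B" by (rule provesE) (rule that, assumption+)
  show thesis
  proof (rule that[of "removeAll A \<Delta>0" n0])
    show "ctx n; A # \<Delta> \<turnstile> B" if "n \<ge> n0" "set (removeAll A \<Delta>0) \<subseteq> set \<Delta>" for n \<Delta>
      by (rule 0(2)) (use that in auto)
  qed (use 0(1) in auto)
qed

lemma proves_ImpI:
  assumes "proves (insert A \<Theta>) B" "wfe (env l) A"
  shows "proves \<Theta> (A \<^bold>\<longrightarrow> B)"
proof -
  from assms(1) obtain n0 \<Delta>0 where 0: "set \<Delta>0 \<subseteq> \<Theta>"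
    "\<And>n \<Delta>. n \<ge> n0 \<Longrightarrow> set \<Delta>0 \<subseteq> set \<Delta> \<Longrightarrow> ctx n; A # \<Delta> \<turnstile> B" by (rule proves_insertE) (rule that, assumption+)
  from wff_ctx[OF assms(2)] obtain n1 where n1: "\<And>n. n \<ge> n1 \<Longrightarrow> wff (ctx n) A" by auto
  have "ctx (max n0 n1); \<Delta>0 \<turnstile> A \<^bold>\<longrightarrow> B" by (intro ImpI 0 n1) auto
  with 0 show ?thesis by (blast intro: provesI)
qed

lemma proves_ImpE: "proves \<Theta> (A \<^bold>\<longrightarrow> B) \<Longrightarrow> proves \<Theta> A \<Longrightarrow> proves \<Theta> B"
  by (erule (1) proves_rule2) (rule ImpE)

lemma proves_cut: "proves (insert A \<Theta>) B \<Longrightarrow> proves \<Theta> A \<Longrightarrow> wfe (env l) A \<Longrightarrow> proves \<Theta> B"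
  by (blast intro: proves_ImpI proves_ImpE)

lemma proves_OrE:
  assumes "proves \<Theta> (A \<^bold>\<or> B)" "proves (insert A \<Theta>) C" "proves (insert B \<Theta>) C"
  shows "proves \<Theta> C"
proof -
  from assms(1) obtain n0 \<Delta>0 where 0: "set \<Delta>0 \<subseteq> \<Theta>"
    "\<And>n \<Delta>. n \<ge> n0 \<Longrightarrow> set \<Delta>0 \<subseteq> set \<Delta> \<Longrightarrow> ctx n; \<Delta> \<turnstile> A \<^bold>\<or> B" by (rule provesE) (rule that, assumption+)
  from assms(2) obtain n1 \<Delta>1 where 1: "set \<Delta>1 \<subseteq> \<Theta>"
    "\<And>n \<Delta>. n \<ge> n1 \<Longrightarrow> set \<Delta>1 \<subseteq> set \<Delta> \<Longrightarrow> ctx n; A # \<Delta> \<turnstile> C" by (rule proves_insertE) (rule that, assumption+)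
  from assms(3) obtain n2 \<Delta>2 where 2: "set \<Delta>2 \<subseteq> \<Theta>"
    "\<And>n \<Delta>. n \<ge> n2 \<Longrightarrow> set \<Delta>2 \<subseteq> set \<Delta> \<Longrightarrow> ctx n; B # \<Delta> \<turnstile> C" by (rule proves_insertE) (rule that, assumption+)
  have "ctx (max n0 (max n1 n2)); \<Delta>0 @ \<Delta>1 @ \<Delta>2 \<turnstile> C"
    by (rule OrE[OF 0(2) 1(2) 2(2)]) auto
  then show ?thesis using 0 1 2 by (intro provesI[of "\<Delta>0 @ \<Delta>1 @ \<Delta>2"]) auto
qed

text \<open>Moving the variable \<open>c\<close> to the index \<open>0\<close> turns a derivation about a fresh \<open>c\<close> into one about
  a bound variable.\<close>

definition bind_var :: "nat \<Rightarrow> nat \<Rightarrow> tm" where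
  "bind_var c i = (if i = c then Var 0 else Var (Suc i))"

lemma bind_var_inst: "Suc c \<notin> fvf A \<Longrightarrow> subst_fm (bind_var c) (inst A (Var c)) = A"
proof -
  assume "Suc c \<notin> fvf A"
  then have "subst_fm (\<lambda>i. subst_tm (bind_var c) (case_nat (Var c) Var i)) A = subst_fm Var A"
    by (intro subst_fm_cong) (auto simp: bind_var_def split: nat.split)
  then show ?thesis by (simp add: subst_fm_comp subst_fm_Var)
qed

lemma bind_var_shift: "c \<notin> fvf A \<Longrightarrow> subst_fm (bind_var c) A = shift_fm 1 A"
  by (intro subst_fm_cong) (auto simp: bind_var_def)

lemma typed_bind_var: "var_ty c = \<sigma> \<Longrightarrow> typed_subst (\<sigma> # ctx n) (bind_var c) (ctx n)"
  by (auto simp: typed_subst_def has_ty_iff env_of_Cons env_of_ctx bind_var_def)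

lemma proves_AllI:
  assumes "proves \<Theta> (inst A (Var c))" "var_ty c = \<sigma>" "\<And>B. B \<in> \<Theta> \<Longrightarrow> c \<notin> fvf B" "Suc c \<notin> fvf A"
  shows "proves \<Theta> (All \<sigma> A)"
proof -
  from assms(1) obtain n \<Delta> where 0: "set \<Delta> \<subseteq> \<Theta>" "ctx n; \<Delta> \<turnstile> inst A (Var c)"
    by (auto simp: proves_def)
  have "\<sigma> # ctx n; map (shift_fm 1) \<Delta> \<turnstile> subst_fm (bind_var c) (inst A (Var c))"
  proof (rule derives_subst[OF 0(2) typed_bind_var[OF assms(2)]])
    show "subst_fm (bind_var c) ` set \<Delta> \<subseteq> set (map (shift_fm 1) \<Delta>)"
      using 0(1) assms(3) by (auto simp: bind_var_shift)
  qed
  then have "ctx n; \<Delta> \<turnstile> All \<sigma> A" by (intro AllI) (simp add: bind_var_inst[OF assms(4)])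
  with 0 show ?thesis by (blast intro: provesI)
qed

lemma proves_ExE:
  assumes "proves \<Theta> (Ex \<sigma> A)" "proves (insert (inst A (Var c)) \<Theta>) C" "var_ty c = \<sigma>"
    "\<And>B. B \<in> \<Theta> \<Longrightarrow> c \<notin> fvf B" "Suc c \<notin> fvf A" "c \<notin> fvf C"
  shows "proves \<Theta> C"
proof -
  from assms(1) obtain n0 \<Delta>0 where 0: "set \<Delta>0 \<subseteq> \<Theta>"
    "\<And>n \<Delta>. n \<ge> n0 \<Longrightarrow> set \<Delta>0 \<subseteq> set \<Delta> \<Longrightarrow> ctx n; \<Delta> \<turnstile> Ex \<sigma> A" by (rule provesE) (rule that, assumption+)
  from assms(2) obtain n1 \<Delta>1 where 1: "set \<Delta>1 \<subseteq> \<Theta>"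
    "\<And>n \<Delta>. n \<ge> n1 \<Longrightarrow> set \<Delta>1 \<subseteq> set \<Delta> \<Longrightarrow> ctx n; inst A (Var c) # \<Delta> \<turnstile> C" by (rule proves_insertE) (rule that, assumption+)
  define n where "n = max n0 n1"
  define \<Delta> where "\<Delta> = \<Delta>0 @ \<Delta>1"
  have "ctx n; inst A (Var c) # \<Delta> \<turnstile> C" by (rule 1) (auto simp: n_def \<Delta>_def)
  then have "\<sigma> # ctx n; A # map (shift_fm 1) \<Delta> \<turnstile> subst_fm (bind_var c) C"
  proof (rule derives_subst[OF _ typed_bind_var[OF assms(3)]])
    show "subst_fm (bind_var c) ` set (inst A (Var c) # \<Delta>) \<subseteq> set (A # map (shift_fm 1) \<Delta>)"
      using 0(1) 1(1) assms(4) by (auto simp: bind_var_shift bind_var_inst[OF assms(5)] \<Delta>_def)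
  qed
  then have "ctx n; \<Delta> \<turnstile> C"
    by (intro ExE[OF 0(2)[of n \<Delta>]]) (auto simp: n_def \<Delta>_def bind_var_shift[OF assms(6)])
  then show ?thesis using 0 1 by (intro provesI[of \<Delta>]) (auto simp: \<Delta>_def)
qed

text \<open>Worlds are consistent, deductively closed, prime theories with witnesses.\<close>

definition world :: "nat \<times> fm set \<Rightarrow> bool" where
  "world w \<longleftrightarrow> (\<forall>A\<in>snd w. wfe (env (fst w)) A) \<and>
     (\<forall>A. proves (snd w) A \<longrightarrow> wfe (env (fst w)) A \<longrightarrow> A \<in> snd w) \<and>
     Fls \<notin> snd w \<and>
     (\<forall>A B. (A \<^bold>\<or> B) \<in> snd w \<longrightarrow> A \<in> snd w \<or> B \<in> snd w) \<and>
     (\<forall>\<sigma> A. Ex \<sigma> A \<in> snd w \<longrightarrow> (\<exists>t. tyof (env (fst w)) t = Some \<sigma> \<and> inst A t \<in> snd w))"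

text \<open>Lindenbaum's construction relative to \<open>C\<close>: formulas are added one by one as
  long as \<open>C\<close> stays unprovable, an existential one together with a fresh variable as
  witness. Maximality among theories omitting \<open>C\<close> yields primeness and leaves
  \<open>C\<close> out.\<close>

lemma extend_to_world:
  assumes \<Theta>: "\<And>A. A \<in> \<Theta> \<Longrightarrow> wfe (env l) A" and C: "wfe (env l) C" and nC: "\<not> proves \<Theta> C"
  obtains w where "world w" "fst w = Suc l" "\<Theta> \<subseteq> snd w" "C \<notin> snd w"
proof -
  \<comment> \<open>Only finitely many variables of the new level occur at any stage, so a fresh
    witness is always available; the initial theory contains none of them.\<close>
  define used where "used \<Phi> = {i. lev i = Suc l \<and> (\<exists>A\<in>\<Phi>. i \<in> fvf A)}" for \<Phi>
  define good where "good \<Phi> \<longleftrightarrow> \<not> proves \<Phi> C \<and> finite (used \<Phi>) \<and> (\<forall>A\<in>\<Phi>. wfe (env (Suc l)) A)" for \<Phi>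
  define ok where "ok \<Phi> \<phi> \<longleftrightarrow> wfe (env (Suc l)) \<phi> \<and> \<not> proves (insert \<phi> \<Phi>) C" for \<Phi> \<phi>
  have C': "i \<notin> fvf C" if "lev i = Suc l" for i using wfe_lev[OF C, of i] that by auto
  have step: "\<exists>\<Phi>'. good \<Phi>' \<and> \<Phi> \<subseteq> \<Phi>' \<and> (ok \<Phi> \<phi> \<longrightarrow> \<phi> \<in> \<Phi>' \<and>
      (\<forall>\<sigma> A. \<phi> = Ex \<sigma> A \<longrightarrow> (\<exists>c. tyof (env (Suc l)) (Var c) = Some \<sigma> \<and> inst A (Var c) \<in> \<Phi>')))"
    if g: "good \<Phi>" for \<Phi> \<phi>
  proof (cases "ok \<Phi> \<phi>")
    case False
    then show ?thesis using g by blast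
  next
    case ok: True
    have u1: "used (insert \<phi> \<Phi>) \<subseteq> used \<Phi> \<union> fvf \<phi>" by (auto simp: used_def)
    have fin: "finite (used (insert \<phi> \<Phi>))"
      using g by (intro finite_subset[OF u1]) (auto simp: good_def finite_fvf)
    show ?thesis
    proof (cases "\<exists>\<sigma> A. \<phi> = Ex \<sigma> A")
      case False
      then show ?thesis using g ok fin
        by (intro exI[of _ "insert \<phi> \<Phi>"]) (auto simp: good_def ok_def)
    next
      case True
      then obtain \<sigma> A where \<phi>: "\<phi> = Ex \<sigma> A" by auto
      have "finite (used (insert \<phi> \<Phi>) \<union> fvf \<phi>)" using fin by (simp add: finite_fvf)
      then obtain c where c: "var_ty c = \<sigma>" "lev c = Suc l" "c \<notin> used (insert \<phi> \<Phi>) \<union> fvf \<phi>"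
        by (rule fresh_var)
      define \<Phi>' where "\<Phi>' = insert (inst A (Var c)) (insert \<phi> \<Phi>)"
      have w\<phi>: "wfe (env (Suc l)) \<phi>" using ok by (simp add: ok_def)
      have tc: "tyof (env (Suc l)) (Var c) = Some \<sigma>" using c by (simp add: env_def)
      have wA: "wfe (env (Suc l)) (inst A (Var c))"
      proof (rule wfe_subst)
        show "wfe (case_nat (Some \<sigma>) (env (Suc l))) A" using w\<phi> \<phi> by simp
        show "tyof (env (Suc l)) (case_nat (Var c) Var i) = Some \<tau>"
          if "case_nat (Some \<sigma>) (env (Suc l)) i = Some \<tau>" for i \<tau>
          using that tc by (cases i) auto
      qed
      \<comment> \<open>By existential elimination, a fresh witness makes nothing provable that does
        not mention it.\<close>
      have "\<not> proves \<Phi>' C"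
      proof
        assume "proves \<Phi>' C"
        then have "proves (insert \<phi> \<Phi>) C" unfolding \<Phi>'_def
        proof (rule proves_ExE[rotated])
          show "proves (insert \<phi> \<Phi>) (Ex \<sigma> A)" using w\<phi> \<phi> by (intro proves_hyp) auto
          show "c \<notin> fvf B" if "B \<in> insert \<phi> \<Phi>" for B using c that by (auto simp: used_def)
        qed (use c \<phi> C' in auto)
        then show False using ok by (simp add: ok_def)
      qed
      moreover have "used \<Phi>' \<subseteq> used (insert \<phi> \<Phi>) \<union> fvf (inst A (Var c))" by (auto simp: used_def \<Phi>'_def)
      then have "finite (used \<Phi>')" by (rule finite_subset) (simp add: fin finite_fvf)
      ultimately have "good \<Phi>'" using g w\<phi> wA by (auto simp: good_def \<Phi>'_def)
      then show ?thesis using tc \<phi> by (intro exI[of _ \<Phi>']) (auto simp: \<Phi>'_def)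
    qed
  qed
  define next_th where "next_th \<Phi> \<phi> = (SOME \<Phi>'. good \<Phi>' \<and> \<Phi> \<subseteq> \<Phi>' \<and> (ok \<Phi> \<phi> \<longrightarrow> \<phi> \<in> \<Phi>' \<and>
      (\<forall>\<sigma> A. \<phi> = Ex \<sigma> A \<longrightarrow> (\<exists>c. tyof (env (Suc l)) (Var c) = Some \<sigma> \<and> inst A (Var c) \<in> \<Phi>'))))" for \<Phi> \<phi>
  have nx: "good (next_th \<Phi> \<phi>) \<and> \<Phi> \<subseteq> next_th \<Phi> \<phi> \<and> (ok \<Phi> \<phi> \<longrightarrow> \<phi> \<in> next_th \<Phi> \<phi> \<and>
      (\<forall>\<sigma> A. \<phi> = Ex \<sigma> A \<longrightarrow> (\<exists>c. tyof (env (Suc l)) (Var c) = Some \<sigma> \<and> inst A (Var c) \<in> next_th \<Phi> \<phi>)))"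
    if "good \<Phi>" for \<Phi> \<phi>
    unfolding next_th_def by (rule someI_ex[OF step[OF that]])
  define T where "T = rec_nat \<Theta> (\<lambda>n \<Phi>. next_th \<Phi> (from_nat n))"
  have T0: "T 0 = \<Theta>" and TS: "T (Suc n) = next_th (T n) (from_nat n)" for n by (simp_all add: T_def)
  have wl: "wfe (env (Suc l)) A" if "wfe (env l) A" for A
    by (rule wfe_mono[OF that]) (auto intro: env_mono[of l "Suc l"])
  have "used \<Theta> = {}" using \<Theta> wfe_lev by (fastforce simp: used_def)
  then have "good \<Theta>" using \<Theta> nC wl by (auto simp: good_def)
  then have gT: "good (T n)" for n by (induction n) (use nx in \<open>auto simp: T0 TS\<close>)
  have Tmono: "n \<le> m \<Longrightarrow> T n \<subseteq> T m" for n m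
    by (rule lift_Suc_mono_le[of T]) (use nx gT in \<open>auto simp: TS\<close>)
  define U where "U = (\<Union>n. T n)"
  have fin_sub: "\<exists>n. set \<Delta> \<subseteq> T n" if "set \<Delta> \<subseteq> U" for \<Delta>
    using that
  proof (induction \<Delta>)
    case (Cons A \<Delta>)
    then obtain n m where "set \<Delta> \<subseteq> T n" "A \<in> T m" by (auto simp: U_def)
    then have "set (A # \<Delta>) \<subseteq> T (max n m)" using Tmono[of n "max n m"] Tmono[of m "max n m"] by auto
    then show ?case by blast
  qed simp
  have UC: "\<not> proves U C"
  proof
    assume "proves U C"
    then obtain n \<Delta> where "set \<Delta> \<subseteq> U" "ctx n; \<Delta> \<turnstile> C" by (auto simp: proves_def)
    with fin_sub obtain m where "proves (T m) C" by (meson provesI)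
    then show False using gT by (simp add: good_def)
  qed
  \<comment> \<open>A formula left out was rejected at its own stage, where it would have made
    \<open>C\<close> provable.\<close>
  have dich: "proves (insert \<phi> U) C" if "wfe (env (Suc l)) \<phi>" "\<phi> \<notin> U" for \<phi>
  proof -
    have "\<phi> \<notin> T (Suc (to_nat \<phi>))" using that by (auto simp: U_def)
    then have "\<not> ok (T (to_nat \<phi>)) \<phi>" using nx[OF gT, of "to_nat \<phi>" \<phi>] by (auto simp: TS)
    then have "proves (insert \<phi> (T (to_nat \<phi>))) C" using that by (simp add: ok_def)
    then show ?thesis by (rule proves_mono) (auto simp: U_def)
  qed
  have Uwf: "wfe (env (Suc l)) A" if "A \<in> U" for A using that gT by (auto simp: U_def good_def)
  have Ucl: "A \<in> U" if "proves U A" "wfe (env (Suc l)) A" for A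
    using proves_cut[OF dich that(1)] that UC by blast
  have "world (Suc l, U)"
    unfolding world_def fst_conv snd_conv
  proof (intro conjI allI impI ballI)
    show "Fls \<notin> U"
    proof
      assume "Fls \<in> U"
      then have "proves U Fls" by (rule proves_hyp) simp
      moreover obtain n1 where "\<And>n. n \<ge> n1 \<Longrightarrow> wff (ctx n) C" using wff_ctx[OF C] by auto
      ultimately have "proves U C" by (elim proves_rule1) (blast intro: FlsE)
      then show False using UC by simp
    qed
    show "A \<in> U \<or> B \<in> U" if "(A \<^bold>\<or> B) \<in> U" for A B
    proof (rule ccontr)
      assume n: "\<not> (A \<in> U \<or> B \<in> U)"
      have w: "wfe (env (Suc l)) (A \<^bold>\<or> B)" using Uwf that by blast
      \<comment> \<open>If both disjuncts are missing, each of them proves \<open>C\<close>, and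
        hence so does the disjunction.\<close>
      then have "proves (insert A U) C" "proves (insert B U) C" using n dich[of A] dich[of B] by auto
      then have "proves U C" by (rule proves_OrE[OF proves_hyp[OF that w]])
      then show False using UC by simp
    qed
    show "\<exists>t. tyof (env (Suc l)) t = Some \<sigma> \<and> inst A t \<in> U" if "Ex \<sigma> A \<in> U" for \<sigma> A
    proof -
      let ?n = "to_nat (Ex \<sigma> A)"
      have "\<not> proves (insert (Ex \<sigma> A) (T ?n)) C"
        using UC proves_mono[of "insert (Ex \<sigma> A) (T ?n)" C U] that by (auto simp: U_def)
      then have "ok (T ?n) (Ex \<sigma> A)" using Uwf[OF that] by (simp add: ok_def)
      then obtain c where "tyof (env (Suc l)) (Var c) = Some \<sigma>" "inst A (Var c) \<in> T (Suc ?n)"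
        using nx[OF gT, of ?n "Ex \<sigma> A"] by (auto simp: TS)
      then show ?thesis by (intro exI[of _ "Var c"]) (auto simp: U_def)
    qed
  qed (use Uwf Ucl in auto)
  moreover have "\<Theta> \<subseteq> U" using T0 by (auto simp: U_def)
  moreover have "C \<notin> U" using UC proves_hyp[OF _ wl[OF C]] by blast
  ultimately show thesis using that by simp
qed

text \<open>Closed terms of all types, used to instantiate the variables that a derivation leaves in
  its context.\<close>

primrec inhabitant :: "ty \<Rightarrow> tm" where
  "inhabitant Nt = zero"
| "inhabitant Qt = iota zero"
| "inhabitant (\<sigma> \<rightarrow> \<tau>) = Con (Kc \<tau> \<sigma>) \<bullet> inhabitant \<tau>"

lemma tyof_inhabitant: "tyof e (inhabitant \<sigma>) = Some \<sigma>"
  by (induction \<sigma>) auto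

theorem completeness:
  assumes "wfe (\<lambda>_. None) C" "\<And>w. world w \<Longrightarrow> C \<in> snd w"
  shows "[]; [] \<turnstile> C"
proof -
  have "proves {} C"
  proof (rule ccontr)
    have "wfe (env 0) C" by (rule wfe_mono[OF assms(1)]) auto
    moreover assume "\<not> proves {} C"
    ultimately obtain w where "world w" "C \<notin> snd w" by (rule extend_to_world[of "{}" 0 C, rotated]) auto
    then show False using assms by blast
  qed
  then obtain n where "ctx n; [] \<turnstile> C" by (auto simp: proves_def)
  \<comment> \<open>Closed terms for the context variables empty the context; \<open>C\<close> has
    no free variables and is left unchanged.\<close>
  then have "[]; [] \<turnstile> subst_fm (\<lambda>i. inhabitant (var_ty i)) C"
    by (rule derives_subst) (auto simp: typed_subst_def has_ty_iff tyof_inhabitant)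
  also have "subst_fm (\<lambda>i. inhabitant (var_ty i)) C = subst_fm Var C"
    by (rule subst_fm_cong) (use wfe_fvf[OF assms(1)] in auto)
  finally show ?thesis by (simp add: subst_fm_Var)
qed

section \<open>Embedding countable ordered abelian groups\<close>

text \<open>\<open>P\<close> is the strictly positive cone and \<open>u\<close> the element to be
  sent to 1. The multiplicative notation of abstract groups will stand for the addition of
  rationals.\<close>

locale ordered_comm_group = comm_group G for G (structure) +
  fixes P :: "'a set" and u
  assumes P_sub: "P \<subseteq> carrier G"
    and P_mult: "x \<in> P \<Longrightarrow> y \<in> P \<Longrightarrow> x \<otimes> y \<in> P"
    and P_one: "\<one> \<notin> P"
    and P_tri: "x \<in> carrier G \<Longrightarrow> x \<in> P \<or> x = \<one> \<or> inv x \<in> P"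
    and u: "u \<in> P"
    and ctble: "countable (carrier G)"
begin

definition elt :: "nat \<Rightarrow> 'a" where "elt = from_nat_into (carrier G)"
definition idx :: "'a \<Rightarrow> nat" where "idx x = (SOME i. elt i = x)"

lemma elt_closed [simp]: "elt i \<in> carrier G"
  unfolding elt_def using one_closed by (intro from_nat_into) auto

lemma elt_idx: "x \<in> carrier G \<Longrightarrow> elt (idx x) = x"
  unfolding idx_def elt_def by (rule someI_ex) (metis from_nat_into_surj[OF ctble])

definition lin :: "nat \<Rightarrow> (nat \<Rightarrow> int) \<Rightarrow> 'a" where
  "lin n c = (\<Otimes>i\<in>{..<n}. elt i [^] c i)"

lemma lin_closed [simp]: "lin n c \<in> carrier G"
  unfolding lin_def by (intro finprod_closed) auto

lemma lin_add: "lin n (\<lambda>i. c i + d i) = lin n c \<otimes> lin n d"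
  unfolding lin_def by (subst finprod_multf[symmetric]) (auto simp: int_pow_mult)

lemma lin_0: "lin n (\<lambda>i. 0) = \<one>"
  unfolding lin_def by simp

lemma lin_neg: "lin n (\<lambda>i. - c i) = inv (lin n c)"
  using lin_add[of n "\<lambda>i. - c i" c] by (simp add: lin_0 inv_equality)

definition unit_vec :: "nat \<Rightarrow> nat \<Rightarrow> int" where "unit_vec k i = (if i = k then 1 else 0)"

lemma lin_unit: "k < n \<Longrightarrow> lin n (unit_vec k) = elt k"
proof -
  assume k: "k < n"
  have "lin n (unit_vec k) = (\<Otimes>i\<in>{..<n}. if i = k then elt i else \<one>)"
    unfolding lin_def by (intro finprod_cong') (auto simp: unit_vec_def)
  also have "\<dots> = elt k" using k by (intro finprod_singleton_swap) auto
  finally show ?thesis .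
qed

lemma cone_lin: "cone (\<lambda>c. lin n c \<in> P) (\<lambda>c. lin n c = \<one>)"
proof
  show "lin n c \<in> P \<or> lin n c = \<one> \<or> lin n (\<lambda>i. - c i) \<in> P" for c
    using P_tri[OF lin_closed] by (simp add: lin_neg)
qed (use P_sub in \<open>auto simp: lin_add lin_neg lin_0 P_mult P_one\<close>)

text \<open>Positivity of an element and additivity on a triple are a positive and a null integer
  combination of the first \<open>n\<close> elements, so Fourier-Motzkin solves all of them
  together.\<close>

lemma local_embedding:
  "\<exists>q :: nat \<Rightarrow> rat. (\<forall>i<n. elt i \<in> P \<longrightarrow> 0 < q i) \<and>
     (\<forall>i<n. \<forall>j<n. \<forall>k<n. elt i \<otimes> elt j = elt k \<longrightarrow> q i + q j = q k)"
proof -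
  interpret cone "\<lambda>c. lin n c \<in> P" "\<lambda>c. lin n c = \<one>" by (rule cone_lin)
  define tri where "tri = (\<lambda>(i, j, k) l. (unit_vec i l + unit_vec j l) + - unit_vec k l)"
  define C where "C = unit_vec ` {..<n} \<union> tri ` ({..<n} \<times> {..<n} \<times> {..<n})"
  have "\<forall>c\<in>C. \<forall>i\<ge>n. c i = 0" by (auto simp: C_def tri_def unit_vec_def)
  moreover have "finite C" by (simp add: C_def)
  ultimately obtain q :: "nat \<Rightarrow> rat" where
    q: "\<And>c. c \<in> C \<Longrightarrow> (lin n c \<in> P \<longrightarrow> 0 < (\<Sum>i<n. of_int (c i) * q i)) \<and>
      (lin n c = \<one> \<longrightarrow> (\<Sum>i<n. of_int (c i) * q i) = 0)"
    using solvable[of C n] by blast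
  have unit: "(\<Sum>i<n. of_int (unit_vec k i) * q i) = q k" if "k < n" for k
  proof -
    have "(\<Sum>i<n. of_int (unit_vec k i) * q i) = (\<Sum>i<n. if i = k then q i else 0)"
      by (intro sum.cong) (auto simp: unit_vec_def)
    then show ?thesis using that by simp
  qed
  show ?thesis
  proof (intro exI[of _ q] conjI allI impI)
    fix i assume "i < n" "elt i \<in> P"
    then show "0 < q i" using q[of "unit_vec i"] by (auto simp: C_def unit lin_unit)
  next
    fix i j k assume *: "i < n" "j < n" "k < n" "elt i \<otimes> elt j = elt k"
    then have "lin n (tri (i, j, k)) = \<one>"
      by (simp add: tri_def lin_add lin_neg lin_unit del: add_uminus_conv_diff)
    then have "(\<Sum>l<n. of_int (tri (i, j, k) l) * q l) = 0"
      using q[of "tri (i, j, k)"] * by (auto simp: C_def)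
    then show "q i + q j = q k"
      using * unit by (simp add: tri_def sum.distrib algebra_simps sum_subtractf)
  qed
qed

text \<open>An element is sent to the class of the sequence of its values in the finite solutions,
  normalised at \<open>u\<close>. Every single constraint is among the solved ones for all large
  \<open>n\<close>, hence holds in the ultrapower.\<close>

lemma embedding:
  "\<exists>\<phi> :: 'a \<Rightarrow> hyp. (\<forall>x\<in>carrier G. \<forall>y\<in>carrier G. \<phi> (x \<otimes> y) = \<phi> x + \<phi> y) \<and>
     (\<forall>x\<in>P. 0 < \<phi> x) \<and> \<phi> u = 1"
proof -
  obtain q :: "nat \<Rightarrow> nat \<Rightarrow> rat" where
    pos: "\<And>n i. i < n \<Longrightarrow> elt i \<in> P \<Longrightarrow> 0 < q n i" and
    add: "\<And>n i j k. i < n \<Longrightarrow> j < n \<Longrightarrow> k < n \<Longrightarrow> elt i \<otimes> elt j = elt k \<Longrightarrow> q n i + q n j = q n k"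
    using local_embedding by metis
  define \<phi> where "\<phi> x = class_of_seq (\<lambda>n. q n (idx x) / q n (idx u))" for x
  have eventually_gt: "\<forall>\<^sub>F n in Uf. m < n" for m
    by (rule Uf_seq) (rule eventually_gt_at_top)
  have uu: "elt (idx u) \<in> P" using u P_sub by (auto simp: elt_idx)
  show ?thesis
  proof (intro exI[of _ \<phi>] conjI ballI)
    fix x y assume xy: "x \<in> carrier G" "y \<in> carrier G"
    have "\<forall>\<^sub>F n in Uf. q n (idx (x \<otimes> y)) / q n (idx u) =
        q n (idx x) / q n (idx u) + q n (idx y) / q n (idx u)"
      using eventually_gt[of "max (idx (x \<otimes> y)) (max (idx x) (idx y))"]
    proof eventually_elim
      case (elim n)
      then have "q n (idx x) + q n (idx y) = q n (idx (x \<otimes> y))"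
        using xy by (intro add) (auto simp: elt_idx)
      then show ?case by (simp flip: add_divide_distrib)
    qed
    then show "\<phi> (x \<otimes> y) = \<phi> x + \<phi> y"
      unfolding \<phi>_def plus_hyp.abs_eq by (simp add: hyp.abs_eq_iff Ueq_def)
  next
    fix x assume x: "x \<in> P"
    then have xx: "elt (idx x) \<in> P" using P_sub by (auto simp: elt_idx)
    have "\<forall>\<^sub>F n in Uf. 0 < q n (idx x) / q n (idx u)"
      using eventually_gt[of "max (idx x) (idx u)"]
    proof eventually_elim
      case (elim n)
      then show ?case using pos[of _ n] xx uu by simp
    qed
    then show "0 < \<phi> x" unfolding \<phi>_def zero_hyp_def less_hyp.abs_eq .
  next
    have "\<forall>\<^sub>F n in Uf. q n (idx u) / q n (idx u) = 1"
      using eventually_gt[of "idx u"]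
    proof eventually_elim
      case (elim n)
      then show ?case using pos[of "idx u" n] uu by simp
    qed
    then show "\<phi> u = 1" unfolding \<phi>_def one_hyp_def by (simp add: hyp.abs_eq_iff Ueq_def)
  qed
qed

end

section \<open>Forcing\<close>

text \<open>A relational wrapper around \<open>tyof\<close>, so that typing judgements simplify
  along the shape of a term without exposing the option type.\<close>

definition ht :: "(nat \<Rightarrow> ty option) \<Rightarrow> tm \<Rightarrow> ty \<Rightarrow> bool" where
  "ht e t \<sigma> \<longleftrightarrow> tyof e t = Some \<sigma>"

abbreviation has :: "nat \<times> fm set \<Rightarrow> tm \<Rightarrow> ty \<Rightarrow> bool" where
  "has w \<equiv> ht (env (fst w))"

abbreviation lang :: "nat \<times> fm set \<Rightarrow> fm \<Rightarrow> bool" where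
  "lang w \<equiv> wfe (env (fst w))"

text \<open>Forcing is membership in the theory; the clauses of Kripke semantics are lemmas, and
  those for implication and universal quantification rest on \<open>extend_to_world\<close>.\<close>

definition forces :: "nat \<times> fm set \<Rightarrow> fm \<Rightarrow> bool" ("_ \<tturnstile> _" [51, 46] 45) where
  "w \<tturnstile> A \<longleftrightarrow> A \<in> snd w"

definition extends :: "nat \<times> fm set \<Rightarrow> nat \<times> fm set \<Rightarrow> bool" (infix "\<sqsubseteq>" 50) where
  "w \<sqsubseteq> w' \<longleftrightarrow> world w' \<and> fst w \<le> fst w' \<and> snd w \<subseteq> snd w'"

lemma ht_Var [simp]: "ht e (Var i) \<sigma> \<longleftrightarrow> e i = Some \<sigma>"
  by (simp add: ht_def)

lemma ht_Con [simp]: "ht e (Con c) \<sigma> \<longleftrightarrow> \<sigma> = cty c"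
  by (auto simp: ht_def)

lemma ht_App: "ht e (t \<bullet> u) \<tau> \<longleftrightarrow> (\<exists>\<sigma>. ht e t (\<sigma> \<rightarrow> \<tau>) \<and> ht e u \<sigma>)"
  unfolding ht_def by (rule tyof_App)

lemma ht_rename [simp]: "ht e (subst_tm (\<lambda>i. Var (f i)) t) \<sigma> \<longleftrightarrow> ht (\<lambda>i. e (f i)) t \<sigma>"
  by (simp add: ht_def tyof_rename)

lemma ht_fun: "ht e t \<sigma> \<Longrightarrow> ht e t \<tau> \<Longrightarrow> \<sigma> = \<tau>"
  by (simp add: ht_def)

lemma ht_simps [simp]:
  "ht e (succ t) \<sigma> \<longleftrightarrow> \<sigma> = Nt \<and> ht e t Nt"
  "ht e (iota t) \<sigma> \<longleftrightarrow> \<sigma> = Qt \<and> ht e t Nt"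
  "ht e (t \<^bold>+ u) \<sigma> \<longleftrightarrow> \<sigma> = Qt \<and> ht e t Qt \<and> ht e u Qt"
  "ht e (t \<^bold>* u) \<sigma> \<longleftrightarrow> \<sigma> = Qt \<and> ht e t Qt \<and> ht e u Qt"
  "ht e (\<^bold>- t) \<sigma> \<longleftrightarrow> \<sigma> = Qt \<and> ht e t Qt"
  "ht e (inv_q t) \<sigma> \<longleftrightarrow> \<sigma> = Qt \<and> ht e t Qt"
  "ht e (abs_q t) \<sigma> \<longleftrightarrow> \<sigma> = Qt \<and> ht e t Qt"
  "ht e (Con (Kc \<rho> \<tau>) \<bullet> t) \<sigma> \<longleftrightarrow> \<sigma> = (\<tau> \<rightarrow> \<rho>) \<and> ht e t \<rho>"
  by (auto simp: ht_App)

lemma ht_num [simp]: "ht e (num k) \<sigma> \<longleftrightarrow> \<sigma> = Nt"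
  by (induction k) (auto simp: num_def)

lemma ht_app_Nt [simp]: "ht e x (Nt \<rightarrow> \<sigma>) \<Longrightarrow> ht e n Nt \<Longrightarrow> ht e (x \<bullet> n) \<sigma>"
  and ht_app_Rt [simp]: "ht e x (Rt \<rightarrow> \<sigma>) \<Longrightarrow> ht e y Rt \<Longrightarrow> ht e (x \<bullet> y) \<sigma>"
  by (auto simp: ht_App)

lemma ht_pw [simp]:
  "cty c = Qt \<rightarrow> Qt \<Longrightarrow> ht e (pw1 c x) \<sigma> \<longleftrightarrow> \<sigma> = Rt \<and> ht e x Rt"
  "cty c = Qt \<rightarrow> Qt \<rightarrow> Qt \<Longrightarrow> ht e (pw2 c x y) \<sigma> \<longleftrightarrow> \<sigma> = Rt \<and> ht e x Rt \<and> ht e y Rt"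
  by (auto simp: ht_App pw1_def pw2_def)

lemma wfe_Lt [simp]: "wfe e (t \<^bold>< u) \<longleftrightarrow> ht e t Qt \<and> ht e u Qt"
  and wfe_Eq: "wfe e (t \<^bold>= u) \<longleftrightarrow> (\<exists>\<sigma>. ht e t \<sigma> \<and> ht e u \<sigma>)"
  by (simp_all add: ht_def)

declare wfe.simps(1,2) [simp del]

lemma wfe_Eq_simps [simp]:
  "ht e t Nt \<Longrightarrow> wfe e (t \<^bold>= u) \<longleftrightarrow> ht e u Nt"
  "ht e t Qt \<Longrightarrow> wfe e (t \<^bold>= u) \<longleftrightarrow> ht e u Qt"
  "ht e t Rt \<Longrightarrow> wfe e (t \<^bold>= u) \<longleftrightarrow> ht e u Rt"
  by (auto simp: wfe_Eq dest: ht_fun)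

lemma Var_add [simp]: "Var (i + 3) = Var (Suc (Suc (Suc i)))"
   "Var (i + 4) = Var (Suc (Suc (Suc (Suc i))))"
  by (simp_all add: eval_nat_numeral)

lemmas [simp] = subst_tm_comp

lemma subst_id [simp]: "subst_tm Var t = t" "subst_tm (\<lambda>i. Var i) t = t"
  using subst_tm_Var by simp_all

lemma subst_pw [simp]:
  "subst_tm s (pw1 c x) = pw1 c (subst_tm s x)"
  "subst_tm s (pw2 c x y) = pw2 c (subst_tm s x) (subst_tm s y)"
  by (simp_all add: pw1_def pw2_def)

lemma extendsD:
  assumes "w \<sqsubseteq> w'"
  shows "world w'" "has w t \<sigma> \<Longrightarrow> has w' t \<sigma>" "w \<tturnstile> A \<Longrightarrow> w' \<tturnstile> A"
    "lang w A \<Longrightarrow> lang w' A"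
proof -
  show "has w t \<sigma> \<Longrightarrow> has w' t \<sigma>" unfolding ht_def
    using assms by (elim tyof_mono) (auto simp: extends_def intro: env_mono)
  show "lang w A \<Longrightarrow> lang w' A"
    using assms by (elim wfe_mono) (auto simp: extends_def intro: env_mono)
qed (use assms in \<open>auto simp: extends_def forces_def\<close>)

lemma extends_refl [simp]: "world w \<Longrightarrow> w \<sqsubseteq> w"
  by (simp add: extends_def)

lemma extends_trans: "w \<sqsubseteq> w' \<Longrightarrow> w' \<sqsubseteq> w'' \<Longrightarrow> w \<sqsubseteq> w''"
  by (auto simp: extends_def)

lemma forces_lang: "world w \<Longrightarrow> w \<tturnstile> A \<Longrightarrow> lang w A"
  by (simp add: world_def forces_def)

lemma forces_proves: "world w \<Longrightarrow> w \<tturnstile> A \<Longrightarrow> proves (snd w) A"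
  using forces_lang unfolding forces_def by (blast intro: proves_hyp)

lemma forcesI: "world w \<Longrightarrow> proves (snd w) A \<Longrightarrow> lang w A \<Longrightarrow> w \<tturnstile> A"
  by (simp add: world_def forces_def)

section \<open>The Kripke clauses\<close>

lemma not_forces_Fls: "world w \<Longrightarrow> \<not> w \<tturnstile> Fls"
  by (simp add: world_def forces_def)

lemma forces_And: "world w \<Longrightarrow> w \<tturnstile> (A \<^bold>\<and> B) \<longleftrightarrow> w \<tturnstile> A \<and> w \<tturnstile> B"
proof (intro iffI conjI)
  assume w: "world w" and AB: "w \<tturnstile> (A \<^bold>\<and> B)"
  show "w \<tturnstile> A"
    by (rule forcesI[OF w proves_rule1[OF forces_proves[OF w AB] AndE1]])
      (use forces_lang[OF w AB] in simp_all)
  show "w \<tturnstile> B"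
    by (rule forcesI[OF w proves_rule1[OF forces_proves[OF w AB] AndE2]])
      (use forces_lang[OF w AB] in simp_all)
next
  assume w: "world w" and AB: "w \<tturnstile> A \<and> w \<tturnstile> B"
  then have "proves (snd w) A" "proves (snd w) B" by (simp_all add: forces_proves)
  then have "proves (snd w) (A \<^bold>\<and> B)" by (rule proves_rule2) (rule AndI)
  then show "w \<tturnstile> (A \<^bold>\<and> B)" by (rule forcesI[OF w]) (use AB forces_lang[OF w] in simp)
qed

lemma forces_OrD: "world w \<Longrightarrow> w \<tturnstile> (A \<^bold>\<or> B) \<Longrightarrow> w \<tturnstile> A \<or> w \<tturnstile> B"
  by (simp add: world_def forces_def)

lemma forces_Or:
  assumes w: "world w" and L: "lang w A" "lang w B"
  shows "w \<tturnstile> (A \<^bold>\<or> B) \<longleftrightarrow> w \<tturnstile> A \<or> w \<tturnstile> B"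
proof
  assume "w \<tturnstile> A \<or> w \<tturnstile> B"
  then have "proves (snd w) (A \<^bold>\<or> B)"
  proof
    assume "w \<tturnstile> A"
    obtain n0 where "\<forall>n\<ge>n0. wff (ctx n) B" using wff_ctx[OF L(2)] by auto
    then show ?thesis
      using proves_rule1[OF forces_proves[OF w \<open>w \<tturnstile> A\<close>], of n0 "A \<^bold>\<or> B"] OrI1 by blast
  next
    assume "w \<tturnstile> B"
    obtain n0 where "\<forall>n\<ge>n0. wff (ctx n) A" using wff_ctx[OF L(1)] by auto
    then show ?thesis
      using proves_rule1[OF forces_proves[OF w \<open>w \<tturnstile> B\<close>], of n0 "A \<^bold>\<or> B"] OrI2 by blast
  qed
  then show "w \<tturnstile> (A \<^bold>\<or> B)" by (rule forcesI[OF w]) (use L in simp)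
qed (rule forces_OrD[OF w])

lemma forces_ImpD:
  assumes w: "world w" and "w \<tturnstile> (A \<^bold>\<longrightarrow> B)" "w \<tturnstile> A"
  shows "w \<tturnstile> B"
  by (rule forcesI[OF w proves_ImpE[OF forces_proves[OF w assms(2)] forces_proves[OF w assms(3)]]])
    (use forces_lang[OF w assms(2)] in simp)

text \<open>If the implication were not provable, \<open>A\<close> could be added without making
  \<open>B\<close> provable, and some extension would force \<open>A\<close> but not
  \<open>B\<close>.\<close>

lemma forces_ImpI:
  assumes w: "world w" and L: "lang w A" "lang w B"
    and *: "\<And>w'. w \<sqsubseteq> w' \<Longrightarrow> w' \<tturnstile> A \<Longrightarrow> w' \<tturnstile> B"
  shows "w \<tturnstile> (A \<^bold>\<longrightarrow> B)"
proof (rule forcesI[OF w])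
  show "proves (snd w) (A \<^bold>\<longrightarrow> B)"
  proof (rule proves_ImpI[OF _ L(1)], rule ccontr)
    assume "\<not> proves (insert A (snd w)) B"
    then obtain w' where "world w'" "fst w' = Suc (fst w)" "insert A (snd w) \<subseteq> snd w'" "B \<notin> snd w'"
      using extend_to_world[of "insert A (snd w)" "fst w" B] w L unfolding world_def by blast
    then show False using *[of w'] by (auto simp: extends_def forces_def)
  qed
qed (use L in simp)

lemma forces_AllD:
  assumes w: "world w" and A: "w \<tturnstile> All \<sigma> A" and t: "has w t \<sigma>"
  shows "w \<tturnstile> inst A t"
proof (rule forcesI[OF w])
  obtain n0 where "\<forall>n\<ge>n0. has_ty (ctx n) t \<sigma>" using has_ty_ctx t unfolding ht_def by blast
  then show "proves (snd w) (inst A t)"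
    by (intro proves_rule1[OF forces_proves[OF w A], of n0] AllE) auto
  show "lang w (inst A t)"
  proof (rule wfe_subst)
    show "wfe (case_nat (Some \<sigma>) (env (fst w))) A" using forces_lang[OF w A] by simp
    show "tyof (env (fst w)) (case_nat t Var i) = Some \<tau>"
      if "case_nat (Some \<sigma>) (env (fst w)) i = Some \<tau>" for i \<tau>
      using that t by (cases i) (auto simp: ht_def)
  qed
qed

text \<open>A variable of the next level is a generic element: it is fresh for the theory, so its
  instance is provable only if the generalisation is.\<close>

lemma forces_AllI:
  assumes w: "world w" and L: "lang w (All \<sigma> A)"
    and *: "\<And>w' t. w \<sqsubseteq> w' \<Longrightarrow> has w' t \<sigma> \<Longrightarrow> w' \<tturnstile> inst A t"
  shows "w \<tturnstile> All \<sigma> A"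
proof (rule forcesI[OF w _ L])
  obtain c where c: "var_ty c = \<sigma>" "lev c = Suc (fst w)" by (rule fresh_var[of "{}"]) auto
  have fresh: "c \<notin> fvf B" if "lang w B" for B using wfe_lev[OF that, of c] c by auto
  have tc: "tyof (env (Suc (fst w))) (Var c) = Some \<sigma>" using c by (simp add: env_def)
  show "proves (snd w) (All \<sigma> A)"
  proof (rule ccontr)
    assume n: "\<not> proves (snd w) (All \<sigma> A)"
    have "\<not> proves (snd w) (inst A (Var c))"
    proof
      assume "proves (snd w) (inst A (Var c))"
      then have "proves (snd w) (All \<sigma> A)"
        by (rule proves_AllI[OF _ c(1)])
          (use fresh[OF L] fresh w in \<open>auto simp: world_def\<close>)
      then show False using n by simp
    qed
    moreover have "wfe (env (Suc (fst w))) (inst A (Var c))"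
    proof (rule wfe_subst)
      show "wfe (case_nat (Some \<sigma>) (env (fst w))) A" using L by simp
      show "tyof (env (Suc (fst w))) (case_nat (Var c) Var i) = Some \<tau>"
        if "case_nat (Some \<sigma>) (env (fst w)) i = Some \<tau>" for i \<tau>
        using that tc env_mono[of "fst w" "Suc (fst w)"] by (cases i) auto
    qed
    moreover have "wfe (env (Suc (fst w))) B" if "B \<in> snd w" for B
    proof (rule wfe_mono)
      show "lang w B" using w that by (simp add: world_def)
      show "env (fst w) i = Some \<tau> \<Longrightarrow> env (Suc (fst w)) i = Some \<tau>" for i \<tau>
        by (rule env_mono[of "fst w"]) simp_all
    qed
    \<comment> \<open>Two levels up: the theory is first read at the level of \<open>c\<close>, and
      the construction adds one more level for its own witnesses.\<close>
    ultimately obtain w' where w': "world w'" "fst w' = Suc (Suc (fst w))" "snd w \<subseteq> snd w'"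
      "inst A (Var c) \<notin> snd w'" using extend_to_world[of "snd w" "Suc (fst w)" "inst A (Var c)"] by blast
    have "w' \<tturnstile> inst A (Var c)"
      by (rule *) (use w' c in \<open>auto simp: extends_def env_def\<close>)
    then show False using w' by (simp add: forces_def)
  qed
qed

lemma forces_ExD: "world w \<Longrightarrow> w \<tturnstile> Ex \<sigma> A \<Longrightarrow> \<exists>t. has w t \<sigma> \<and> w \<tturnstile> inst A t"
  by (simp add: world_def forces_def ht_def)

lemma forces_ExI:
  assumes w: "world w" and L: "lang w (Ex \<sigma> A)" and t: "has w t \<sigma>" and A: "w \<tturnstile> inst A t"
  shows "w \<tturnstile> Ex \<sigma> A"
proof (rule forcesI[OF w _ L])
  obtain n0 where n0: "\<forall>n\<ge>n0. has_ty (ctx n) t \<sigma>" using has_ty_ctx t unfolding ht_def by blast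
  obtain n1 where n1: "\<forall>n\<ge>n1. wff (ctx n) (Ex \<sigma> A)" using wff_ctx[OF L] by auto
  show "proves (snd w) (Ex \<sigma> A)"
    by (rule proves_rule1[OF forces_proves[OF w A], of "max n0 n1"])
      (use n0 n1 in \<open>auto intro: ExI[where t = t]\<close>)
qed

text \<open>Serves axioms with up to three typed parameters; those with fewer repeat one.\<close>

lemma forces_ax:
  assumes w: "world w" and "has w p \<rho>" "has w q \<sigma>" "has w r \<tau>"
    and *: "\<And>n. has_ty (ctx n) p \<rho> \<Longrightarrow> has_ty (ctx n) q \<sigma> \<Longrightarrow> has_ty (ctx n) r \<tau> \<Longrightarrow> ax (ctx n) A"
    and L: "lang w A"
  shows "w \<tturnstile> A"
proof (rule forcesI[OF w _ L])
  obtain n0 n1 n2 where "\<forall>n\<ge>n0. has_ty (ctx n) p \<rho>" "\<forall>n\<ge>n1. has_ty (ctx n) q \<sigma>"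
    "\<forall>n\<ge>n2. has_ty (ctx n) r \<tau>"
    using has_ty_ctx assms(2-4) unfolding ht_def by metis
  then have "ax (ctx n) A" if "n \<ge> max n0 (max n1 n2)" for n using that by (intro *) auto
  then show "proves (snd w) A" by (rule proves_base[OF Ax])
qed

section \<open>Equality\<close>

lemma forces_refl: "world w \<Longrightarrow> has w t \<sigma> \<Longrightarrow> w \<tturnstile> t \<^bold>= t"
proof (rule forcesI)
  assume "has w t \<sigma>"
  then obtain n0 where "\<And>n. n \<ge> n0 \<Longrightarrow> has_ty (ctx n) t \<sigma>" using has_ty_ctx unfolding ht_def by blast
  then show "proves (snd w) (t \<^bold>= t)" by (rule proves_base[OF EqI])
qed (auto simp: wfe_Eq)

lemma forces_subst:
  assumes w: "world w" and eq: "w \<tturnstile> t \<^bold>= u" and A: "w \<tturnstile> inst A t"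
    and t: "has w t \<sigma>" and u: "has w u \<sigma>" and L: "lang w (All \<sigma> A)"
  shows "w \<tturnstile> inst A u"
proof (rule forcesI[OF w])
  obtain n0 n1 n2 where "\<forall>n\<ge>n0. has_ty (ctx n) t \<sigma>" "\<forall>n\<ge>n1. has_ty (ctx n) u \<sigma>"
    "\<forall>n\<ge>n2. wff (ctx n) (All \<sigma> A)"
    using has_ty_ctx t u wff_ctx[OF L] unfolding ht_def by metis
  then show "proves (snd w) (inst A u)"
    by (intro proves_rule2[OF forces_proves[OF w eq] forces_proves[OF w A], of "max n0 (max n1 n2)"])
      (auto intro: EqE)
  show "lang w (inst A u)"
  proof (rule wfe_subst)
    show "wfe (case_nat (Some \<sigma>) (env (fst w))) A" using L by simp
    show "tyof (env (fst w)) (case_nat u Var i) = Some \<tau>"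
      if "case_nat (Some \<sigma>) (env (fst w)) i = Some \<tau>" for i \<tau>
      using that u by (cases i) (auto simp: ht_def)
  qed
qed

lemma forces_Eq_ty: "world w \<Longrightarrow> w \<tturnstile> t \<^bold>= u \<Longrightarrow> has w t \<sigma> \<Longrightarrow> has w u \<sigma>"
  using forces_lang[of w "t \<^bold>= u"] by (auto simp: wfe_Eq dest: ht_fun)

lemma forces_sym: "world w \<Longrightarrow> w \<tturnstile> t \<^bold>= u \<Longrightarrow> w \<tturnstile> u \<^bold>= t"
proof -
  assume w: "world w" and tu: "w \<tturnstile> t \<^bold>= u"
  obtain \<sigma> where \<sigma>: "has w t \<sigma>" "has w u \<sigma>" using forces_lang[OF w tu] by (auto simp: wfe_Eq)
  show ?thesis
    using forces_subst[OF w tu _ \<sigma>, of "Var 0 \<^bold>= shift 1 t"] forces_refl[OF w \<sigma>(1)] \<sigma>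
    by (auto simp: wfe_Eq)
qed

lemma forces_trans: "world w \<Longrightarrow> w \<tturnstile> t \<^bold>= u \<Longrightarrow> w \<tturnstile> u \<^bold>= v \<Longrightarrow> w \<tturnstile> t \<^bold>= v"
proof -
  assume w: "world w" and tu: "w \<tturnstile> t \<^bold>= u" and uv: "w \<tturnstile> u \<^bold>= v"
  obtain \<sigma> where \<sigma>: "has w t \<sigma>" "has w u \<sigma>" using forces_lang[OF w tu] by (auto simp: wfe_Eq)
  have "has w v \<sigma>" using forces_Eq_ty[OF w uv] \<sigma> by simp
  then show ?thesis
    using forces_subst[OF w uv _ \<sigma>(2), of "shift 1 t \<^bold>= Var 0"] tu \<sigma> by (auto simp: wfe_Eq)
qed

lemma forces_cong:
  assumes w: "world w" and xy: "w \<tturnstile> x \<^bold>= y" and tu: "w \<tturnstile> t \<^bold>= u"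
    and x: "has w x (\<sigma> \<rightarrow> \<tau>)" and t: "has w t \<sigma>"
  shows "w \<tturnstile> x \<bullet> t \<^bold>= y \<bullet> u"
proof -
  have y: "has w y (\<sigma> \<rightarrow> \<tau>)" and u: "has w u \<sigma>" using forces_Eq_ty[OF w] xy tu x t by auto
  have *: "has w (x \<bullet> t) \<tau>" using x t by (auto simp: ht_App)
  have "w \<tturnstile> x \<bullet> t \<^bold>= y \<bullet> t"
    using forces_subst[OF w xy _ x y, of "shift 1 x \<bullet> shift 1 t \<^bold>= Var 0 \<bullet> shift 1 t"]
      forces_refl[OF w *] x t by (auto simp: wfe_Eq ht_App)
  then show ?thesis
    using forces_subst[OF w tu _ t u, of "shift 1 x \<bullet> shift 1 t \<^bold>= shift 1 y \<bullet> Var 0"] x y t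
    by (auto simp: wfe_Eq ht_App)
qed

lemma forces_Lt_cong:
  assumes w: "world w" and tu: "w \<tturnstile> t \<^bold>= t'" "w \<tturnstile> u \<^bold>= u'" and lt: "w \<tturnstile> t \<^bold>< u"
  shows "w \<tturnstile> t' \<^bold>< u'"
proof -
  have ty: "has w t Qt" "has w u Qt" using forces_lang[OF w lt] by auto
  then have ty': "has w t' Qt" "has w u' Qt" using forces_Eq_ty[OF w] tu by auto
  have "w \<tturnstile> t' \<^bold>< u"
    using forces_subst[OF w tu(1) _ ty(1) ty'(1), of "Var 0 \<^bold>< shift 1 u"] lt ty by simp
  then show ?thesis
    using forces_subst[OF w tu(2) _ ty(2) ty'(2), of "shift 1 t' \<^bold>< Var 0"] ty' by simp
qed

section \<open>The rational numbers of a world\<close>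

definition cls :: "nat \<times> fm set \<Rightarrow> tm \<Rightarrow> tm set" where
  "cls w t = {u. w \<tturnstile> t \<^bold>= u}"

text \<open>Equality in a group is identity of elements, hence classes of terms. The operation picks
  representatives; \<open>mult_cls\<close> shows that the result is independent of the
  choice.\<close>

definition rat_group :: "nat \<times> fm set \<Rightarrow> tm set monoid" where
  "rat_group w = \<lparr>carrier = cls w ` {t. has w t Qt},
     mult = (\<lambda>a b. cls w ((SOME t. t \<in> a) \<^bold>+ (SOME t. t \<in> b))), one = cls w (qnum 0)\<rparr>"

context
  fixes w assumes w: "world w"
begin

lemma cls_eq: "has w t \<sigma> \<Longrightarrow> cls w t = cls w u \<longleftrightarrow> w \<tturnstile> t \<^bold>= u"
  unfolding cls_def using forces_refl[OF w] forces_sym[OF w] forces_trans[OF w] forces_Eq_ty[OF w]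
  by blast

lemma add_cong: "w \<tturnstile> t \<^bold>= t' \<Longrightarrow> w \<tturnstile> u \<^bold>= u' \<Longrightarrow> has w t Qt \<Longrightarrow> has w u Qt \<Longrightarrow> w \<tturnstile> t \<^bold>+ u \<^bold>= t' \<^bold>+ u'"
  by (rule forces_cong[OF w forces_cong[OF w forces_refl[OF w]]]) (auto simp: ht_App)

lemma mult_cls: "has w t Qt \<Longrightarrow> has w u Qt \<Longrightarrow>
  mult (rat_group w) (cls w t) (cls w u) = cls w (t \<^bold>+ u)"
proof -
  assume t: "has w t Qt" and u: "has w u Qt"
  have "(SOME v. v \<in> cls w t) \<in> cls w t" "(SOME v. v \<in> cls w u) \<in> cls w u"
    using forces_refl[OF w t] forces_refl[OF w u] by (auto simp: cls_def intro: someI)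
  then have "w \<tturnstile> t \<^bold>+ u \<^bold>= (SOME v. v \<in> cls w t) \<^bold>+ (SOME v. v \<in> cls w u)"
    using t u by (intro add_cong) (auto simp: cls_def)
  then have "cls w (t \<^bold>+ u) = cls w ((SOME v. v \<in> cls w t) \<^bold>+ (SOME v. v \<in> cls w u))"
    using t u by (subst cls_eq[of _ Qt]) auto
  then show ?thesis by (simp add: rat_group_def)
qed

text \<open>The axioms for the ordered field of rationals and its absolute value, instantiated at
  three terms so that one uniform proof covers them; they are cited by their position in this
  list.\<close>

lemma rat_add:
  assumes "has w p Qt" "has w q Qt" "has w r Qt"
  shows "w \<tturnstile> (p \<^bold>+ q) \<^bold>+ r \<^bold>= p \<^bold>+ (q \<^bold>+ r)" "w \<tturnstile> p \<^bold>+ q \<^bold>= q \<^bold>+ p" "w \<tturnstile> p \<^bold>+ qnum 0 \<^bold>= p"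
    "w \<tturnstile> p \<^bold>+ \<^bold>- p \<^bold>= qnum 0"
    "w \<tturnstile> (p \<^bold>* q) \<^bold>* r \<^bold>= p \<^bold>* (q \<^bold>* r)" "w \<tturnstile> p \<^bold>* q \<^bold>= q \<^bold>* p" "w \<tturnstile> p \<^bold>* qnum 1 \<^bold>= p"
    "w \<tturnstile> p \<^bold>* (q \<^bold>+ r) \<^bold>= p \<^bold>* q \<^bold>+ p \<^bold>* r"
    "w \<tturnstile> (\<^bold>\<not> p \<^bold>= qnum 0 \<^bold>\<longrightarrow> p \<^bold>* inv_q p \<^bold>= qnum 1)"
    "w \<tturnstile> (\<^bold>\<not> p \<^bold>< p)" "w \<tturnstile> (p \<^bold>< q \<^bold>\<and> q \<^bold>< r \<^bold>\<longrightarrow> p \<^bold>< r)"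
    "w \<tturnstile> (p \<^bold>< q \<^bold>\<or> p \<^bold>= q \<^bold>\<or> q \<^bold>< p)" "w \<tturnstile> (p \<^bold>< q \<^bold>\<longrightarrow> p \<^bold>+ r \<^bold>< q \<^bold>+ r)"
    "w \<tturnstile> (qnum 0 \<^bold>< p \<^bold>\<and> qnum 0 \<^bold>< q \<^bold>\<longrightarrow> qnum 0 \<^bold>< p \<^bold>* q)"
    "w \<tturnstile> (qnum 0 \<^bold>\<le> p \<^bold>\<longrightarrow> abs_q p \<^bold>= p)" "w \<tturnstile> (p \<^bold>< qnum 0 \<^bold>\<longrightarrow> abs_q p \<^bold>= \<^bold>- p)"
    "w \<tturnstile> qnum 0 \<^bold>< qnum 1"
  by (rule forces_ax[OF w assms], rule ax.intros; insert assms; simp)+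

text \<open>A world is prime and consistent, so the order axioms become statements about forcing,
  and trichotomy decides every comparison.\<close>

lemma rat_Lt:
  assumes "has w p Qt" "has w q Qt" "has w r Qt"
  shows "\<not> w \<tturnstile> p \<^bold>< p" "w \<tturnstile> p \<^bold>< q \<Longrightarrow> w \<tturnstile> q \<^bold>< r \<Longrightarrow> w \<tturnstile> p \<^bold>< r"
    "w \<tturnstile> p \<^bold>< q \<or> w \<tturnstile> p \<^bold>= q \<or> w \<tturnstile> q \<^bold>< p" "w \<tturnstile> p \<^bold>< q \<Longrightarrow> w \<tturnstile> p \<^bold>+ r \<^bold>< q \<^bold>+ r"
    "w \<tturnstile> qnum 0 \<^bold>< p \<Longrightarrow> w \<tturnstile> qnum 0 \<^bold>< q \<Longrightarrow> w \<tturnstile> qnum 0 \<^bold>< p \<^bold>* q"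
proof -
  note r = rat_add[OF assms]
  show "\<not> w \<tturnstile> p \<^bold>< p" using forces_ImpD[OF w r(10)] not_forces_Fls[OF w] by blast
  show "w \<tturnstile> p \<^bold>< q \<Longrightarrow> w \<tturnstile> q \<^bold>< r \<Longrightarrow> w \<tturnstile> p \<^bold>< r"
    using forces_ImpD[OF w r(11)] forces_And[OF w] by blast
  show "w \<tturnstile> p \<^bold>< q \<or> w \<tturnstile> p \<^bold>= q \<or> w \<tturnstile> q \<^bold>< p" using forces_OrD[OF w] r(12) by blast
  show "w \<tturnstile> p \<^bold>< q \<Longrightarrow> w \<tturnstile> p \<^bold>+ r \<^bold>< q \<^bold>+ r" using forces_ImpD[OF w r(13)] .
  show "w \<tturnstile> qnum 0 \<^bold>< p \<Longrightarrow> w \<tturnstile> qnum 0 \<^bold>< q \<Longrightarrow> w \<tturnstile> qnum 0 \<^bold>< p \<^bold>* q"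
    using forces_ImpD[OF w r(14)] forces_And[OF w] by blast
qed

lemma rat_zero_add: "has w p Qt \<Longrightarrow> w \<tturnstile> qnum 0 \<^bold>+ p \<^bold>= p"
  using rat_add(2)[of "qnum 0" p p] rat_add(3)[of p p p] by (auto intro: forces_trans[OF w])

lemma carrier_rat_group: "a \<in> carrier (rat_group w) \<longleftrightarrow> (\<exists>t. has w t Qt \<and> a = cls w t)"
  by (auto simp: rat_group_def)

lemma cls_carrier [simp]: "has w t Qt \<Longrightarrow> cls w t \<in> carrier (rat_group w)"
  by (auto simp: rat_group_def)

lemma one_rat_group: "one (rat_group w) = cls w (qnum 0)"
  by (simp add: rat_group_def)

lemma comm_group_rat: "comm_group (rat_group w)"
proof (rule comm_groupI)
  show "\<exists>y\<in>carrier (rat_group w). y \<otimes>\<^bsub>rat_group w\<^esub> x = \<one>\<^bsub>rat_group w\<^esub>" if "x \<in> carrier (rat_group w)" for x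
  proof -
    from that obtain t where t: "has w t Qt" "x = cls w t" by (auto simp: carrier_rat_group)
    then have "w \<tturnstile> \<^bold>- t \<^bold>+ t \<^bold>= qnum 0"
      using rat_add(2)[of "\<^bold>- t" t t] rat_add(4)[of t t t] by (auto intro: forces_trans[OF w])
    then show ?thesis using t
      by (intro bexI[of _ "cls w (\<^bold>- t)"])
        (auto simp: one_rat_group mult_cls cls_eq[where \<sigma> = Qt])
  qed
  fix x y z assume "x \<in> carrier (rat_group w)" "y \<in> carrier (rat_group w)" "z \<in> carrier (rat_group w)"
  then obtain p q r where [simp]: "has w p Qt" "x = cls w p" "has w q Qt" "y = cls w q"
    "has w r Qt" "z = cls w r" by (auto simp: carrier_rat_group)
  have "w \<tturnstile> qnum 0 \<^bold>+ p \<^bold>= p"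
    by (rule rat_zero_add) simp
  then show "x \<otimes>\<^bsub>rat_group w\<^esub> y \<in> carrier (rat_group w)"
    "x \<otimes>\<^bsub>rat_group w\<^esub> y \<otimes>\<^bsub>rat_group w\<^esub> z = x \<otimes>\<^bsub>rat_group w\<^esub> (y \<otimes>\<^bsub>rat_group w\<^esub> z)"
    "x \<otimes>\<^bsub>rat_group w\<^esub> y = y \<otimes>\<^bsub>rat_group w\<^esub> x"
    "\<one>\<^bsub>rat_group w\<^esub> \<otimes>\<^bsub>rat_group w\<^esub> x = x"
    using rat_add(1,2)[of p q r]
    by (auto simp: mult_cls cls_eq[where \<sigma> = Qt] one_rat_group)
qed (auto simp: one_rat_group)

lemma inv_rat_group: "has w t Qt \<Longrightarrow> m_inv (rat_group w) (cls w t) = cls w (\<^bold>- t)"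
proof -
  assume t: "has w t Qt"
  interpret comm_group "rat_group w" by (rule comm_group_rat)
  show ?thesis
    using t rat_add(4)[of t t t]
    by (intro inv_equality) (auto simp: mult_cls one_rat_group cls_eq[where \<sigma> = Qt]
      intro: forces_trans[OF w rat_add(2)[of "\<^bold>- t" t t]])
qed

text \<open>Transports addition, order and the unit; multiplication is not captured by linear
  constraints.\<close>

lemma val_exists:
  "\<exists>v :: tm \<Rightarrow> hyp. (\<forall>t u. has w t Qt \<longrightarrow> has w u Qt \<longrightarrow> v (t \<^bold>+ u) = v t + v u \<and>
      (w \<tturnstile> t \<^bold>< u \<longrightarrow> v t < v u) \<and> (w \<tturnstile> t \<^bold>= u \<longrightarrow> v t = v u)) \<and> v (qnum 1) = 1"
proof -
  let ?P = "cls w ` {t. w \<tturnstile> qnum 0 \<^bold>< t}"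
  have pos_ty: "has w t Qt" if "w \<tturnstile> qnum 0 \<^bold>< t" for t using forces_lang[OF w that] by simp
  have pos_cls: "cls w t \<in> ?P \<longleftrightarrow> w \<tturnstile> qnum 0 \<^bold>< t" if t: "has w t Qt" for t
  proof
    assume "cls w t \<in> ?P"
    then obtain u where u: "w \<tturnstile> qnum 0 \<^bold>< u" "cls w t = cls w u" by auto
    then have "w \<tturnstile> u \<^bold>= t" using cls_eq[OF t] forces_sym[OF w] by blast
    then show "w \<tturnstile> qnum 0 \<^bold>< t"
      using u forces_Lt_cong[OF w forces_refl[OF w]] by (metis forces_lang[OF w] wfe_Lt)
  qed auto
  interpret comm_group "rat_group w" by (rule comm_group_rat)
  have neg: "w \<tturnstile> qnum 0 \<^bold>< u \<^bold>+ \<^bold>- t" if "w \<tturnstile> t \<^bold>< u" for t u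
  proof -
    have ty: "has w t Qt" "has w u Qt" using forces_lang[OF w that] by auto
    then have "w \<tturnstile> t \<^bold>+ \<^bold>- t \<^bold>< u \<^bold>+ \<^bold>- t" using rat_Lt(4)[of t u "\<^bold>- t"] that by simp
    then show ?thesis
      using forces_Lt_cong[OF w rat_add(4)[of t t t] forces_refl[OF w]] ty by force
  qed
  interpret ordered_comm_group "rat_group w" ?P "cls w (qnum 1)"
  proof
    show "?P \<subseteq> carrier (rat_group w)" using pos_ty by auto
    show "\<one>\<^bsub>rat_group w\<^esub> \<notin> ?P" using pos_cls[of "qnum 0"] rat_Lt(1)[of "qnum 0" "qnum 0" "qnum 0"] by (simp add: one_rat_group)
    show "cls w (qnum 1) \<in> ?P" using rat_add(17)[of "qnum 0" "qnum 0" "qnum 0"] by simp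
    show "countable (carrier (rat_group w))"
      unfolding rat_group_def by simp
    show "x \<otimes>\<^bsub>rat_group w\<^esub> y \<in> ?P" if xy: "x \<in> ?P" "y \<in> ?P" for x y
    proof -
      from xy obtain p q where pq: "w \<tturnstile> qnum 0 \<^bold>< p" "x = cls w p" "w \<tturnstile> qnum 0 \<^bold>< q" "y = cls w q" by auto
      have [simp]: "has w p Qt" "has w q Qt" using pq pos_ty by auto
      have "w \<tturnstile> qnum 0 \<^bold>+ q \<^bold>< p \<^bold>+ q" using rat_Lt(4)[of "qnum 0" p q] pq by simp
      then have "w \<tturnstile> q \<^bold>< p \<^bold>+ q"
        by (rule forces_Lt_cong[OF w rat_zero_add forces_refl[OF w], rotated 2]) auto
      then have "w \<tturnstile> qnum 0 \<^bold>< p \<^bold>+ q" using rat_Lt(2)[of "qnum 0" q "p \<^bold>+ q"] pq by simp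
      then show ?thesis using pq by (simp add: mult_cls)
    qed
    show "x \<in> ?P \<or> x = \<one>\<^bsub>rat_group w\<^esub> \<or> inv\<^bsub>rat_group w\<^esub> x \<in> ?P" if "x \<in> carrier (rat_group w)" for x
    proof -
      from that obtain t where t: "has w t Qt" "x = cls w t" by (auto simp: carrier_rat_group)
      have "w \<tturnstile> qnum 0 \<^bold>< \<^bold>- t" if "w \<tturnstile> t \<^bold>< qnum 0"
        by (rule forces_Lt_cong[OF w forces_refl[OF w] rat_zero_add neg[OF that]]) (use t in auto)
      then show ?thesis using rat_Lt(3)[of t "qnum 0" t] t
        by (auto simp: inv_rat_group one_rat_group cls_eq[where \<sigma> = Qt])
    qed
  qed
  from embedding obtain \<phi> :: "tm set \<Rightarrow> hyp" where \<phi>: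
    "(\<forall>x\<in>carrier (rat_group w). \<forall>y\<in>carrier (rat_group w). \<phi> (x \<otimes>\<^bsub>rat_group w\<^esub> y) = \<phi> x + \<phi> y) \<and>
     (\<forall>x\<in>?P. 0 < \<phi> x) \<and> \<phi> (cls w (qnum 1)) = 1" by (rule exE)
  note add = \<phi>[THEN conjunct1, rule_format] and pos = \<phi>[THEN conjunct2, THEN conjunct1, rule_format]
    and unit = \<phi>[THEN conjunct2, THEN conjunct2]
  have a: "\<phi> (cls w (t \<^bold>+ u)) = \<phi> (cls w t) + \<phi> (cls w u)" if "has w t Qt" "has w u Qt" for t u
    using add[of "cls w t" "cls w u"] that by (simp add: mult_cls)
  have z: "\<phi> (cls w (qnum 0)) = 0"
    using add[OF one_closed one_closed] by (simp add: one_rat_group[symmetric])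
  have n: "\<phi> (cls w (\<^bold>- t)) = - \<phi> (cls w t)" if "has w t Qt" for t
  proof -
    have "cls w (t \<^bold>+ \<^bold>- t) = cls w (qnum 0)" using rat_add(4)[of t t t] that cls_eq[where \<sigma> = Qt] by simp
    then show ?thesis using a[of t "\<^bold>- t"] that z by (simp add: eq_neg_iff_add_eq_0 add.commute)
  qed
  have "\<phi> (cls w t) < \<phi> (cls w u)" if "w \<tturnstile> t \<^bold>< u" for t u
  proof -
    have ty: "has w t Qt" "has w u Qt" using forces_lang[OF w that] by auto
    have "0 < \<phi> (cls w (u \<^bold>+ \<^bold>- t))" by (rule pos) (simp add: neg[OF that])
    then show ?thesis using ty a n by simp
  qed
  moreover have "\<phi> (cls w t) = \<phi> (cls w u)" if "w \<tturnstile> t \<^bold>= u" "has w t Qt" for t u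
    using cls_eq[of t Qt u] that by simp
  ultimately show ?thesis
    using a unit by (intro exI[of _ "\<lambda>t. \<phi> (cls w t)"]) auto
qed

end

text \<open>The choice is made separately in each world. The values of a term in different worlds
  are unrelated; only comparisons between terms persist.\<close>

definition val :: "nat \<times> fm set \<Rightarrow> tm \<Rightarrow> hyp" where
  "val w = (SOME v. (\<forall>t u. has w t Qt \<longrightarrow> has w u Qt \<longrightarrow> v (t \<^bold>+ u) = v t + v u \<and>
      (w \<tturnstile> t \<^bold>< u \<longrightarrow> v t < v u) \<and> (w \<tturnstile> t \<^bold>= u \<longrightarrow> v t = v u)) \<and> v (qnum 1) = 1)"

lemma val_spec:
  "world w \<Longrightarrow> (\<forall>t u. has w t Qt \<longrightarrow> has w u Qt \<longrightarrow> val w (t \<^bold>+ u) = val w t + val w u \<and>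
      (w \<tturnstile> t \<^bold>< u \<longrightarrow> val w t < val w u) \<and> (w \<tturnstile> t \<^bold>= u \<longrightarrow> val w t = val w u)) \<and> val w (qnum 1) = 1"
  unfolding val_def by (rule someI_ex[OF val_exists])

lemma val_add [simp]: "world w \<Longrightarrow> has w t Qt \<Longrightarrow> has w u Qt \<Longrightarrow> val w (t \<^bold>+ u) = val w t + val w u"
  and val_1 [simp]: "world w \<Longrightarrow> val w (qnum 1) = 1"
  using val_spec by blast+

text \<open>The embedding preserves strict inequality and equality; since a world decides them, it
  also reflects them.\<close>

lemma forces_Lt: "world w \<Longrightarrow> has w t Qt \<Longrightarrow> has w u Qt \<Longrightarrow> w \<tturnstile> t \<^bold>< u \<longleftrightarrow> val w t < val w u"
  using rat_Lt(3)[of w t u t] val_spec[of w] by (metis less_asym less_irrefl)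

lemma forces_Eq: "world w \<Longrightarrow> has w t Qt \<Longrightarrow> has w u Qt \<Longrightarrow> w \<tturnstile> t \<^bold>= u \<longleftrightarrow> val w t = val w u"
  using rat_Lt(3)[of w t u t] val_spec[of w] by (metis less_irrefl)

section \<open>Arithmetic in a world\<close>

lemma num_0: "num 0 = zero" and num_Suc: "num (Suc k) = succ (num k)"
  by (simp_all add: num_def)

context
  fixes w assumes w [simp]: "world w"
begin

lemma val_eqI: "w \<tturnstile> t \<^bold>= u \<Longrightarrow> has w t Qt \<Longrightarrow> val w t = val w u"
  using forces_Eq[OF w] forces_Eq_ty[OF w] by metis

lemma val_qnum_0: "val w (qnum 0) = 0"
  using val_add[OF w, of "qnum 0" "qnum 0"] val_eqI[OF rat_add(3)[OF w, of "qnum 0" "qnum 0" "qnum 0"]] by simp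

lemma val_zero [simp]: "val w (iota zero) = 0"
  using val_qnum_0 by (simp add: num_0)

lemma val_neg [simp]: "has w t Qt \<Longrightarrow> val w (\<^bold>- t) = - val w t"
proof -
  assume t: "has w t Qt"
  then have "val w (t \<^bold>+ \<^bold>- t) = 0" using val_eqI[OF rat_add(4)[OF w t t t]] val_qnum_0 by simp
  then show ?thesis using t by (simp add: eq_neg_iff_add_eq_0 add.commute)
qed

lemma val_succ [simp]: "has w t Nt \<Longrightarrow> val w (iota (succ t)) = val w (iota t) + 1"
proof -
  assume t: "has w t Nt"
  have "w \<tturnstile> iota (succ t) \<^bold>= iota t \<^bold>+ qnum 1"
    by (rule forces_ax[OF w t t t ax_iota_succ]) (use t in simp_all)
  from val_eqI[OF this] t show ?thesis using val_add[OF w, of "iota t" "qnum 1"] val_1[OF w] by simp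
qed

lemma val_num [simp]: "val w (iota (num k)) = of_nat k"
  by (induction k) (simp_all add: num_0 num_Suc)

section \<open>Products of rationals\<close>

text \<open>The value of a product is opaque, but it depends only on the values of the factors; with
  distributivity and monotonicity this takes the place of multiplication in the field.\<close>

lemma val_mult_cong: "val w t = val w t' \<Longrightarrow> val w u = val w u' \<Longrightarrow>
   has w t Qt \<Longrightarrow> has w t' Qt \<Longrightarrow> has w u Qt \<Longrightarrow> has w u' Qt \<Longrightarrow> val w (t \<^bold>* u) = val w (t' \<^bold>* u')"
  by (rule val_eqI, rule forces_cong[OF w forces_cong[OF w forces_refl[OF w]]])
    (auto simp: ht_App forces_Eq)

lemma val_mult_comm: "has w t Qt \<Longrightarrow> has w u Qt \<Longrightarrow> val w (t \<^bold>* u) = val w (u \<^bold>* t)"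
  by (rule val_eqI[OF rat_add(6)[OF w]]) auto

lemma val_mult_assoc: "has w t Qt \<Longrightarrow> has w u Qt \<Longrightarrow> has w v Qt \<Longrightarrow>
    val w (t \<^bold>* u \<^bold>* v) = val w (t \<^bold>* (u \<^bold>* v))"
  by (rule val_eqI[OF rat_add(5)[OF w]]) auto

lemma val_mult_add [simp]:
  assumes "has w t Qt" "has w u Qt" "has w v Qt"
  shows "val w (t \<^bold>* (u \<^bold>+ v)) = val w (t \<^bold>* u) + val w (t \<^bold>* v)"
    "val w ((u \<^bold>+ v) \<^bold>* t) = val w (u \<^bold>* t) + val w (v \<^bold>* t)"
proof -
  show *: "val w (t \<^bold>* (u \<^bold>+ v)) = val w (t \<^bold>* u) + val w (t \<^bold>* v)"
    using val_eqI[OF rat_add(8)[OF w assms]] assms by simp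
  then show "val w ((u \<^bold>+ v) \<^bold>* t) = val w (u \<^bold>* t) + val w (v \<^bold>* t)"
    using assms val_mult_comm[of t] by simp
qed

text \<open>A numeral is a repeated sum of 1, so distributivity and the unit law already make the
  value multiplicative in this case.\<close>

lemma val_mult_num [simp]:
  assumes "has w t Qt"
  shows "val w (t \<^bold>* iota (num k)) = of_nat k * val w t" "val w (iota (num k) \<^bold>* t) = of_nat k * val w t"
proof -
  show *: "val w (t \<^bold>* iota (num k)) = of_nat k * val w t" for k
  proof (induction k)
    case 0
    have "val w (t \<^bold>* (qnum 0 \<^bold>+ qnum 0)) = val w (t \<^bold>* qnum 0)"
      by (rule val_mult_cong) (use assms in simp_all)
    then show ?case using assms by simp
  next
    case (Suc k)
    have "val w (t \<^bold>* iota (num (Suc k))) = val w (t \<^bold>* (iota (num k) \<^bold>+ qnum 1))"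
      by (rule val_mult_cong) (use assms in simp_all)
    also have "val w (t \<^bold>* qnum 1) = val w t" by (rule val_eqI[OF rat_add(7)[OF w]]) (use assms in simp_all)
    then have "val w (t \<^bold>* (iota (num k) \<^bold>+ qnum 1)) = of_nat k * val w t + val w t"
      using Suc assms by simp
    finally show ?case by (simp add: algebra_simps)
  qed
  show "val w (iota (num k) \<^bold>* t) = of_nat k * val w t"
    using * val_mult_comm[OF assms, of "iota (num k)"] by simp
qed

lemma val_mult_neg [simp]:
  assumes "has w t Qt" "has w u Qt"
  shows "val w (t \<^bold>* \<^bold>- u) = - val w (t \<^bold>* u)" "val w (\<^bold>- u \<^bold>* t) = - val w (u \<^bold>* t)"
proof -
  have "val w (t \<^bold>* (u \<^bold>+ \<^bold>- u)) = val w (t \<^bold>* qnum 0)" by (rule val_mult_cong) (use assms in simp_all)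
  then have "val w (t \<^bold>* u) + val w (t \<^bold>* \<^bold>- u) = 0" using assms by simp
  then show *: "val w (t \<^bold>* \<^bold>- u) = - val w (t \<^bold>* u)" by (simp add: eq_neg_iff_add_eq_0 add.commute)
  then show "val w (\<^bold>- u \<^bold>* t) = - val w (u \<^bold>* t)"
    using val_mult_comm[of "\<^bold>- u" t] val_mult_comm[of u t] assms by simp
qed

lemma val_mult_pos: "has w t Qt \<Longrightarrow> has w u Qt \<Longrightarrow> 0 < val w t \<Longrightarrow> 0 < val w u \<Longrightarrow> 0 < val w (t \<^bold>* u)"
  using rat_Lt(5)[OF w, of t u t] by (simp add: forces_Lt)

lemma val_mult_mono:
  assumes "has w t Qt" "has w u Qt" "has w v Qt"
  shows "val w t < val w u \<Longrightarrow> 0 < val w v \<Longrightarrow> val w (t \<^bold>* v) < val w (u \<^bold>* v)"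
    and "val w t \<le> val w u \<Longrightarrow> 0 \<le> val w v \<Longrightarrow> val w (t \<^bold>* v) \<le> val w (u \<^bold>* v)"
proof -
  show 1: "val w (t \<^bold>* v) < val w (u \<^bold>* v)" if "val w t < val w u" "0 < val w v"
    using val_mult_pos[of "u \<^bold>+ \<^bold>- t" v] assms that by simp
  show "val w (t \<^bold>* v) \<le> val w (u \<^bold>* v)" if le: "val w t \<le> val w u" "0 \<le> val w v"
  proof -
    consider "val w t < val w u" "0 < val w v" | "val w t = val w u" | "val w v = val w (qnum 0)" using le by force
    then show ?thesis
    proof cases
      case 2
      then show ?thesis using val_mult_cong[of t u v v] assms by simp
    next
      case 3
      have "val w (s \<^bold>* v) = 0" if "has w s Qt" for s
        using val_mult_cong[OF refl 3, of s] that assms val_mult_num(1)[of s 0] by simp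
      then show ?thesis using assms by simp
    qed (use 1 in simp)
  qed
qed

lemma val_square_nonneg:
  assumes "has w t Qt"
  shows "0 \<le> val w (t \<^bold>* t)"
proof -
  consider "0 < val w t" | "val w t = val w (qnum 0)" | "0 < val w (\<^bold>- t)" using assms by (simp, linarith)
  then show ?thesis
  proof cases
    case 1
    then show ?thesis using val_mult_pos[of t t] assms by simp
  next
    case 2
    then show ?thesis using val_mult_cong[OF 2 2] assms val_mult_num(1)[of "qnum 0" 0] by simp
  next
    case 3
    then show ?thesis using val_mult_pos[of "\<^bold>- t" "\<^bold>- t"] assms by simp
  qed
qed

end

text \<open>The axiom for inverses is guarded by a negation, which has to be checked in all
  extensions: the sign of \<open>t\<close> is decided in \<open>w\<close> and persists.\<close>

lemma val_mult_inv:
  assumes w [simp]: "world w" and t: "has w t Qt" "val w t \<noteq> 0"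
  shows "val w (t \<^bold>* inv_q t) = 1"
proof -
  have *: "w \<tturnstile> t \<^bold>< qnum 0 \<or> w \<tturnstile> qnum 0 \<^bold>< t" using t by (auto simp: forces_Lt)
  have "w \<tturnstile> (\<^bold>\<not> t \<^bold>= qnum 0)"
  proof (rule forces_ImpI[OF w])
    fix w' assume w': "w \<sqsubseteq> w'" and eq: "w' \<tturnstile> t \<^bold>= qnum 0"
    note [simp] = extendsD(1,2)[OF w']
    have "w' \<tturnstile> t \<^bold>< qnum 0 \<or> w' \<tturnstile> qnum 0 \<^bold>< t" using * extendsD(3)[OF w'] by blast
    then show "w' \<tturnstile> Fls" using eq t by (auto simp: forces_Lt forces_Eq)
  qed (use t in auto)
  then have "w \<tturnstile> t \<^bold>* inv_q t \<^bold>= qnum 1"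
    using forces_ImpD[OF w rat_add(9)[OF w t(1) t(1) t(1)]] by simp
  then show ?thesis using val_eqI[OF w] t by fastforce
qed

lemma val_inv_num [simp]:
  assumes w [simp]: "world w" and k: "k > 0"
  shows "val w (inv_q (iota (num k))) = 1 / of_nat k"
  using val_mult_inv[OF w, of "iota (num k)"] k by (simp add: field_simps)

lemma val_div_num [simp]:
  assumes w [simp]: "world w" and t [simp]: "has w t Qt" and k: "k > 0"
  shows "val w (t \<^bold>* inv_q (iota (num k))) = val w t / of_nat k"
proof -
  have "val w (t \<^bold>* inv_q (iota (num k)) \<^bold>* iota (num k)) = val w (t \<^bold>* (iota (num k) \<^bold>* inv_q (iota (num k))))"
    using val_mult_assoc[OF w, of t "inv_q (iota (num k))" "iota (num k)"]
      val_mult_cong[OF w refl val_mult_comm[OF w, of "inv_q (iota (num k))" "iota (num k)"], of t] by simp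
  also have "\<dots> = val w (t \<^bold>* iota (num 1))"
    by (rule val_mult_cong[OF w]) (use val_mult_inv[OF w, of "iota (num k)"] k in simp_all)
  finally show ?thesis using k by (simp add: field_simps)
qed

lemma forces_le:
  "world w \<Longrightarrow> has w t Qt \<Longrightarrow> has w u Qt \<Longrightarrow> w \<tturnstile> (t \<^bold>\<le> u) \<longleftrightarrow> val w t \<le> val w u"
  by (simp add: forces_Or forces_Lt forces_Eq le_less)

lemma val_abs [simp]:
  assumes w [simp]: "world w" and t [simp]: "has w t Qt"
  shows "val w (abs_q t) = \<bar>val w t\<bar>"
proof (cases "0 \<le> val w t")
  case True
  then have "w \<tturnstile> (qnum 0 \<^bold>\<le> t)" by (simp add: forces_le)
  then have "w \<tturnstile> abs_q t \<^bold>= t" using forces_ImpD[OF w rat_add(15)[OF w t t t]] by simp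
  then show ?thesis using True by (simp add: forces_Eq)
next
  case False
  then have "w \<tturnstile> t \<^bold>< qnum 0" by (simp add: forces_Lt)
  then have "w \<tturnstile> abs_q t \<^bold>= \<^bold>- t" using forces_ImpD[OF w rat_add(16)[OF w t t t]] by simp
  then show ?thesis using False by (simp add: forces_Eq)
qed

section \<open>Natural numbers of a world\<close>

text \<open>Reaches every term of type \<open>Nt\<close>, numeral or not. The step is required in
  all extensions, because the induction axiom states it as a universally quantified
  implication.\<close>

lemma forces_induct:
  assumes w [simp]: "world w" and L: "lang w (All Nt A)" and n: "has w n Nt"
    and 0: "w \<tturnstile> inst A zero"
    and S: "\<And>w' n. w \<sqsubseteq> w' \<Longrightarrow> has w' n Nt \<Longrightarrow> w' \<tturnstile> inst A n \<Longrightarrow> w' \<tturnstile> inst A (succ n)"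
  shows "w \<tturnstile> inst A n"
proof -
  let ?S = "subst_fm (case_nat (succ (Var 0)) (\<lambda>i. Var (i + 1))) A"
  have inst_S: "inst ?S t = inst A (succ t)" for t
    unfolding subst_fm_comp by (rule subst_fm_eqI) (simp split: nat.split)
  have LS: "lang w (All Nt ?S)"
  proof (simp, rule wfe_subst)
    show "wfe (case_nat (Some Nt) (env (fst w))) A" using L by simp
    show "tyof (case_nat (Some Nt) (env (fst w))) (case_nat (succ (Var 0)) (\<lambda>i. Var (Suc i)) i) = Some \<tau>"
      if "case_nat (Some Nt) (env (fst w)) i = Some \<tau>" for i \<tau>
      using that by (cases i) auto
  qed
  have L0: "lang w (inst A zero)" using forces_lang[OF w 0] .
  let ?I = "inst A zero \<^bold>\<and> All Nt (A \<^bold>\<longrightarrow> ?S) \<^bold>\<longrightarrow> All Nt A"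
  obtain n0 where n0: "\<forall>n\<ge>n0. wff (ctx n) (All Nt A)" using wff_ctx[OF L] by auto
  have I: "w \<tturnstile> ?I"
  proof (rule forcesI[OF w])
    show "proves (snd w) ?I"
      by (rule proves_base[of n0], rule Ax, rule ax_induct) (use n0 in auto)
    show "lang w ?I" using L L0 LS by simp
  qed
  have "w \<tturnstile> All Nt (A \<^bold>\<longrightarrow> ?S)"
  proof (rule forces_AllI[OF w])
    show "lang w (All Nt (A \<^bold>\<longrightarrow> ?S))" using L LS by simp
    fix w' t assume w': "w \<sqsubseteq> w'" and t: "has w' t Nt"
    have "w' \<tturnstile> (inst A t \<^bold>\<longrightarrow> inst ?S t)"
      unfolding inst_S
    proof (rule forces_ImpI)
      show "w'' \<tturnstile> inst A (succ t)" if "w' \<sqsubseteq> w''" "w'' \<tturnstile> inst A t" for w''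
        using S[OF extends_trans[OF w' that(1)] extendsD(2)[OF that(1) t] that(2)] .
      show "world w'" by (rule extendsD(1)[OF w'])
      have "lang w' (All Nt A)" by (rule extendsD(4)[OF w' L])
      then have L': "wfe (case_nat (Some Nt) (env (fst w'))) A" by simp
      have *: "lang w' (inst A u)" if "has w' u Nt" for u
      proof (rule wfe_subst[OF L'])
        show "tyof (env (fst w')) (case_nat u Var i) = Some \<tau>"
          if "case_nat (Some Nt) (env (fst w')) i = Some \<tau>" for i \<tau>
          using that \<open>has w' u Nt\<close> by (cases i) (auto simp: ht_def)
      qed
      show "lang w' (inst A t)" "lang w' (inst A (succ t))" by (rule *; use t in simp)+
    qed
    then show "w' \<tturnstile> inst (A \<^bold>\<longrightarrow> ?S) t" by simp
  qed
  with 0 have "w \<tturnstile> All Nt A" using forces_ImpD[OF w I] forces_And[OF w] by blast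
  then show ?thesis using forces_AllD[OF w _ n] by blast
qed

lemma nat_nonneg [simp]:
  assumes w [simp]: "world w" and n: "has w n Nt"
  shows "0 \<le> val w (iota n)"
proof -
  have "w \<tturnstile> inst (iota zero \<^bold>\<le> iota (Var 0)) n"
  proof (rule forces_induct[OF w _ n])
    fix w' n assume w': "w \<sqsubseteq> w'" "has w' n Nt" "w' \<tturnstile> inst (iota zero \<^bold>\<le> iota (Var 0)) n"
    note [simp] = extendsD(1,2)[OF w'(1)] w'(2)
    show "w' \<tturnstile> inst (iota zero \<^bold>\<le> iota (Var 0)) (succ n)"
      using w'(3) by (simp add: forces_le)
  qed (simp_all add: forces_le)
  then show ?thesis using n by (simp add: forces_le)
qed

lemma nat_cases:
  assumes w [simp]: "world w" and n: "has w n Nt"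
  shows "w \<tturnstile> n \<^bold>= zero \<or> (\<exists>m. has w m Nt \<and> w \<tturnstile> n \<^bold>= succ m)"
proof -
  let ?A = "Var 0 \<^bold>= zero \<^bold>\<or> Ex Nt (Var 1 \<^bold>= succ (Var 0))"
  have "w \<tturnstile> inst ?A n"
  proof (rule forces_induct[OF w _ n])
    fix w' n assume w': "w \<sqsubseteq> w'" "has w' n Nt"
    note [simp] = extendsD(1,2)[OF w'(1)] w'(2)
    have "w' \<tturnstile> Ex Nt (succ (shift 1 n) \<^bold>= succ (Var 0))"
      by (rule forces_ExI[of _ _ _ n]) (use forces_refl[of w' "succ n" Nt] in simp_all)
    then show "w' \<tturnstile> inst ?A (succ n)"
      by (simp add: forces_Or)
  qed (simp_all add: forces_Or forces_refl[of w zero Nt])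
  then have "w \<tturnstile> n \<^bold>= zero \<or> w \<tturnstile> Ex Nt (shift 1 n \<^bold>= succ (Var 0))"
    using n by (simp add: forces_Or)
  then show ?thesis
    using forces_ExD[OF w, of Nt "shift 1 n \<^bold>= succ (Var 0)"] by auto
qed

lemma nat_eq_val: "world w \<Longrightarrow> w \<tturnstile> n \<^bold>= m \<Longrightarrow> has w n Nt \<Longrightarrow> val w (iota n) = val w (iota m)"
  by (rule val_eqI, assumption, rule forces_cong[of w _ _ _ _ Nt Qt])
    (auto intro: forces_refl)

lemma forces_succ_cong: "world w \<Longrightarrow> w \<tturnstile> n \<^bold>= m \<Longrightarrow> has w n Nt \<Longrightarrow> w \<tturnstile> succ n \<^bold>= succ m"
  by (rule forces_cong[of w _ _ _ _ Nt Nt]) (auto intro: forces_refl)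

text \<open>Natural numbers are compared only through \<open>iota\<close>, so discreteness has to be
  proved: different ones are at least 1 apart. The induction formula quantifies over
  \<open>m\<close>, because the step passes to a predecessor of \<open>m\<close>.\<close>

lemma nat_trichotomy:
  assumes w [simp]: "world w" and n: "has w n Nt" and m: "has w m Nt"
  shows "w \<tturnstile> n \<^bold>= m \<or> val w (iota n) + 1 \<le> val w (iota m) \<or> val w (iota m) + 1 \<le> val w (iota n)"
proof -
  let ?B = "\<lambda>n m. n \<^bold>= m \<^bold>\<or> (iota (succ n) \<^bold>\<le> iota m) \<^bold>\<or> (iota (succ m) \<^bold>\<le> iota n)"
  let ?A = "All Nt (?B (Var 1) (Var 0))"
  have B: "v \<tturnstile> ?B n m \<longleftrightarrow> v \<tturnstile> n \<^bold>= m \<or> val v (iota n) + 1 \<le> val v (iota m) \<or> val v (iota m) + 1 \<le> val v (iota n)"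
    if "world v" "has v n Nt" "has v m Nt" for v n m
    using that by (subst forces_Or, simp, simp, simp, subst forces_Or) (simp_all add: forces_le)
  have inst_B: "inst (?B (shift 1 n) (Var 0)) m = ?B n m" for n m by simp
  have inst_A: "inst ?A n = All Nt (?B (shift 1 n) (Var 0))" for n by simp
  have "w \<tturnstile> inst ?A n"
  proof (rule forces_induct[OF w _ n])
    show "lang w (All Nt ?A)" by simp
    show "w \<tturnstile> inst ?A zero"
      unfolding inst_A
    proof (rule forces_AllI[OF w])
      fix w' m assume w': "w \<sqsubseteq> w'" and m [simp]: "has w' m Nt"
      note [simp] = extendsD(1,2)[OF w']
      from nat_cases[OF extendsD(1)[OF w'] m]
      have "w' \<tturnstile> ?B zero m"
      proof
        assume "w' \<tturnstile> m \<^bold>= zero"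
        then show ?thesis by (simp add: B forces_sym)
      next
        assume "\<exists>p. has w' p Nt \<and> w' \<tturnstile> m \<^bold>= succ p"
        then show ?thesis using nat_eq_val[of w' m] by (auto simp: B)
      qed
      then show "w' \<tturnstile> inst (?B (shift 1 zero) (Var 0)) m" unfolding inst_B .
    qed simp
  next
    fix w' n assume w': "w \<sqsubseteq> w'" "has w' n Nt" and IH: "w' \<tturnstile> inst ?A n"
    note [simp] = extendsD(1,2)[OF w'(1)] w'(2)
    show "w' \<tturnstile> inst ?A (succ n)"
      unfolding inst_A
    proof (rule forces_AllI)
      fix w'' m assume w'': "w' \<sqsubseteq> w''" and m [simp]: "has w'' m Nt"
      note [simp] = extendsD(1,2)[OF w'']
      from nat_cases[OF extendsD(1)[OF w''] m]
      have "w'' \<tturnstile> ?B (succ n) m"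
      proof
        assume "w'' \<tturnstile> m \<^bold>= zero"
        then show ?thesis using nat_eq_val[of w'' m] by (simp add: B)
      next
        assume "\<exists>p. has w'' p Nt \<and> w'' \<tturnstile> m \<^bold>= succ p"
        then obtain p where p [simp]: "has w'' p Nt" and mp: "w'' \<tturnstile> m \<^bold>= succ p" by auto
        have "w'' \<tturnstile> All Nt (?B (shift 1 n) (Var 0))" using extendsD(3)[OF w'' IH] unfolding inst_A .
        from forces_AllD[OF _ this p] have "w'' \<tturnstile> ?B n p" unfolding inst_B by simp
        then have "w'' \<tturnstile> n \<^bold>= p \<or> val w'' (iota n) + 1 \<le> val w'' (iota p) \<or> val w'' (iota p) + 1 \<le> val w'' (iota n)"
          by (simp add: B)
        moreover have "w'' \<tturnstile> succ n \<^bold>= m" if "w'' \<tturnstile> n \<^bold>= p"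
          using forces_trans[OF _ forces_succ_cong[OF _ that] forces_sym[OF _ mp]] by simp
        ultimately show ?thesis using nat_eq_val[OF _ mp] by (auto simp: B)
      qed
      then show "w'' \<tturnstile> inst (?B (shift 1 (succ n)) (Var 0)) m" unfolding inst_B .
    qed simp_all
  qed
  from forces_AllD[OF w this[unfolded inst_A] m] have "w \<tturnstile> ?B n m" unfolding inst_B .
  then show ?thesis using n m by (simp add: B)
qed

lemma nat_eqI:
  "world w \<Longrightarrow> has w n Nt \<Longrightarrow> has w m Nt \<Longrightarrow> val w (iota n) = val w (iota m) \<Longrightarrow> w \<tturnstile> n \<^bold>= m"
  using nat_trichotomy[of w n m] by auto

lemma nat_max:
  assumes "world w" "has w n Nt" "has w m Nt"
  obtains k where "has w k Nt" "val w (iota n) \<le> val w (iota k)" "val w (iota m) \<le> val w (iota k)"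
  using assms by (metis linear order_refl)

text \<open>By the axiom on rationals, some \<open>p * (c + 1)\<close> is a difference
  \<open>a - b\<close> of natural numbers; for nonnegative \<open>p\<close> this gives
  \<open>p <= a\<close>.\<close>

lemma nat_archimedean:
  assumes w [simp]: "world w" and p [simp]: "has w p Qt"
  obtains n where "has w n Nt" "val w p < val w (iota n)"
proof (cases "val w p < 0")
  case True
  then show thesis by (intro that[of zero]) auto
next
  case False
  let ?R = "Var 3 \<^bold>* iota (succ (Var 0)) \<^bold>= iota (Var 2) \<^bold>+ \<^bold>- iota (Var 1)"
  have "w \<tturnstile> All Qt (Ex Nt (Ex Nt (Ex Nt ?R)))"
    by (rule forces_ax[OF w p p p ax_rational]) (simp add: numeral_3_eq_3 numeral_2_eq_2)
  from forces_AllD[OF w this p]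
  have "w \<tturnstile> Ex Nt (Ex Nt (Ex Nt (shift 3 p \<^bold>* iota (succ (Var 0)) \<^bold>= iota (Var 2) \<^bold>+ \<^bold>- iota (Var 1))))"
    by (simp add: numeral_3_eq_3 numeral_2_eq_2)
  from forces_ExD[OF w this] obtain a where a [simp]: "has w a Nt" and
    "w \<tturnstile> Ex Nt (Ex Nt (shift 2 p \<^bold>* iota (succ (Var 0)) \<^bold>= iota (shift 2 a) \<^bold>+ \<^bold>- iota (Var 1)))"
    by (auto simp: numeral_3_eq_3 numeral_2_eq_2)
  from forces_ExD[OF w this(2)] obtain b where b [simp]: "has w b Nt" and
    "w \<tturnstile> Ex Nt (shift 1 p \<^bold>* iota (succ (Var 0)) \<^bold>= iota (shift 1 a) \<^bold>+ \<^bold>- iota (shift 1 b))"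
    by (auto simp: numeral_3_eq_3 numeral_2_eq_2)
  from forces_ExD[OF w this(2)] obtain c where c [simp]: "has w c Nt" and
    eq: "w \<tturnstile> p \<^bold>* iota (succ c) \<^bold>= iota a \<^bold>+ \<^bold>- iota b"
    by (auto simp: numeral_3_eq_3 numeral_2_eq_2)
  have "val w (p \<^bold>* (iota c \<^bold>+ qnum 1)) = val w (p \<^bold>* iota (succ c))"
    by (rule val_mult_cong) simp_all
  then have "val w (iota c \<^bold>* p) + val w p = val w (iota a) - val w (iota b)"
    using val_eqI[OF w eq] val_mult_comm[OF w, of p "iota c"] by simp
  moreover have "val w (iota zero \<^bold>* p) \<le> val w (iota c \<^bold>* p)"
    using False by (intro val_mult_mono(2)) auto
  moreover have "val w (iota zero \<^bold>* p) = 0" using val_mult_num(2)[OF w p, of 0] by (simp add: num_0)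
  ultimately have "val w p \<le> val w (iota a)" using nat_nonneg[OF w b] by linarith
  then show thesis by (intro that[of "succ a"]) auto
qed

section \<open>Reciprocals of natural numbers\<close>

text \<open>The equation \<open>(k + 1) * eps_q k = 1\<close> in distributed form, where the product
  with \<open>iota k\<close> is an atom for linear arithmetic.\<close>

lemma val_eps:
  assumes w [simp]: "world w" and k [simp]: "has w k Nt"
  shows "val w (iota k \<^bold>* eps_q k) + val w (eps_q k) = 1" "0 < val w (eps_q k)"
proof -
  have pos: "0 < val w (iota k) + 1" using nat_nonneg[OF w k] by linarith
  have "val w ((iota k \<^bold>+ qnum 1) \<^bold>* eps_q k) = val w (iota (succ k) \<^bold>* eps_q k)"
    by (rule val_mult_cong) simp_all
  then show 1: "val w (iota k \<^bold>* eps_q k) + val w (eps_q k) = 1"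
    using val_mult_inv[OF w, of "iota (succ k)"] pos by simp
  have 2: "0 < val w (iota (succ k))" using pos by simp
  show "0 < val w (eps_q k)"
  proof (rule ccontr)
    assume "\<not> 0 < val w (eps_q k)"
    then have "val w (eps_q k \<^bold>* iota (succ k)) \<le> val w (iota zero \<^bold>* iota (succ k))"
      using 2 by (intro val_mult_mono(2)) auto
    moreover have "val w (iota zero \<^bold>* iota (succ k)) = 0"
      using val_mult_num(2)[OF w, of "iota (succ k)" 0] by (simp add: num_0)
    moreover have "val w (eps_q k \<^bold>* iota (succ k)) = 1"
      using val_mult_inv[OF w, of "iota (succ k)"] val_mult_comm[OF w, of "eps_q k" "iota (succ k)"] 2 by simp
    ultimately show False by simp
  qed
qed

lemma eps_mult_nonneg:
  assumes w [simp]: "world w" and "has w k Nt" "has w p Qt" "0 \<le> val w p"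
  shows "0 \<le> val w (iota k \<^bold>* p)"
proof -
  have "val w (iota zero \<^bold>* p) \<le> val w (iota k \<^bold>* p)"
    by (rule val_mult_mono(2)) (use assms in auto)
  then show ?thesis using val_mult_num(2)[OF w, of p 0] assms by (simp add: num_0)
qed

text \<open>Otherwise \<open>l * eps_q l + eps_q l\<close> would exceed
  \<open>k * eps_q k + eps_q k\<close>, but both are 1.\<close>

lemma eps_antimono:
  assumes w [simp]: "world w" and [simp]: "has w k Nt" "has w l Nt" and le: "val w (iota k) \<le> val w (iota l)"
  shows "val w (eps_q l) \<le> val w (eps_q k)"
proof (rule ccontr)
  assume lt: "\<not> val w (eps_q l) \<le> val w (eps_q k)"
  have "val w (iota k \<^bold>* eps_q l) \<le> val w (iota l \<^bold>* eps_q l)"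
    using val_eps(2)[OF w, of l] le by (intro val_mult_mono(2)) (auto simp: less_imp_le)
  moreover have "val w (eps_q k \<^bold>* iota k) \<le> val w (eps_q l \<^bold>* iota k)"
    using lt by (intro val_mult_mono(2)) auto
  ultimately show False
    using lt val_eps(1)[OF w, of k] val_eps(1)[OF w, of l]
      val_mult_comm[OF w, of "iota k" "eps_q k"] val_mult_comm[OF w, of "iota k" "eps_q l"] by simp
qed

text \<open>The induction step by which \<open>n\<close> halvings of the unit interval leave a width
  of at most \<open>1/(n+1)\<close>.\<close>

lemma eps_succ:
  assumes w [simp]: "world w" and k [simp]: "has w k Nt"
  shows "val w (eps_q k) \<le> 2 * val w (eps_q (succ k))"
proof (rule ccontr)
  assume lt: "\<not> ?thesis"
  let ?e = "eps_q (succ k)"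
  have "val w ((?e \<^bold>+ ?e) \<^bold>* iota k) \<le> val w (eps_q k \<^bold>* iota k)"
    using lt by (intro val_mult_mono(2)) auto
  moreover have "val w (iota (succ k) \<^bold>* ?e) = val w ((iota k \<^bold>+ qnum 1) \<^bold>* ?e)"
    by (rule val_mult_cong) simp_all
  ultimately show False
    using lt val_eps(1)[OF w, of k] val_eps(1)[OF w, of "succ k"] eps_mult_nonneg[OF w, of k ?e]
      val_eps(2)[OF w, of "succ k"]
      val_mult_comm[OF w, of "iota k" "eps_q k"] val_mult_comm[OF w, of "iota k" ?e] by simp
qed

lemma eps_archimedean:
  assumes w [simp]: "world w" and p [simp]: "has w p Qt" and pos: "0 < val w p"
  obtains k where "has w k Nt" "val w (eps_q k) < val w p"
proof -
  obtain n where n [simp]: "has w n Nt" and lt: "val w (inv_q p) < val w (iota n)"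
    by (rule nat_archimedean[OF w, of "inv_q p"]) auto
  have "val w (eps_q n) < val w p"
  proof (rule ccontr)
    assume ge: "\<not> val w (eps_q n) < val w p"
    have "val w (inv_q p \<^bold>* p) < val w (iota n \<^bold>* p)"
      using lt pos by (intro val_mult_mono(1)) auto
    moreover have "val w (p \<^bold>* iota n) \<le> val w (eps_q n \<^bold>* iota n)"
      using ge by (intro val_mult_mono(2)) auto
    ultimately show False
      using val_mult_inv[OF w p] pos val_eps[OF w n] val_mult_comm[OF w, of "inv_q p" p]
        val_mult_comm[OF w, of "iota n" p] val_mult_comm[OF w, of "iota n" "eps_q n"] by simp
  qed
  then show thesis by (intro that[of n]) auto
qed

section \<open>Real numbers in a world\<close>

lemma Var_numeral [simp]: "Var 2 = Var (Suc (Suc 0))" "Var 3 = Var (Suc (Suc (Suc 0)))"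
  by (simp_all add: eval_nat_numeral)

lemma subst_real [simp]:
  "subst_fm s (is_real x) = is_real (subst_tm s x)"
  "subst_fm s (req x y) = req (subst_tm s x) (subst_tm s y)"
  "subst_fm s (rlt x y) = rlt (subst_tm s x) (subst_tm s y)"
  by (simp_all add: is_real_def req_def rlt_def)

lemma subst_rle [simp]:
  "subst_fm s (rle x y) = rle (subst_tm s x) (subst_tm s y)"
  "subst_fm s (in01 x) = in01 (subst_tm s x)"
  by (simp_all add: rle_def in01_def)

lemma subst_rconv [simp]:
  "subst_fm s (rconv x y) = rconv (subst_tm s x) (subst_tm s y)"
  "subst_fm s (is_fun01 x) = is_fun01 (subst_tm s x)"
  "subst_fm s (strongly_ext x) = strongly_ext (subst_tm s x)"
  "subst_fm s (binary x) = binary (subst_tm s x)"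
  by (simp_all add: rconv_def is_fun01_def strongly_ext_def binary_def)

lemma subst_jump_seq [simp]:
  "subst_fm s (jump_seq f e z) = jump_seq (subst_tm s f) (subst_tm s e) (subst_tm s z)"
  by (simp add: jump_seq_def)

lemma subst_LPO [simp]: "subst_fm s LPO = LPO" "subst_fm s WLPO = WLPO"
  by (simp_all add: LPO_def WLPO_def)

lemma wfe_is_real [simp]:
  assumes "ht e x Rt"
  shows "wfe e (is_real x)"
  using assms by (simp add: is_real_def)

lemma wfe_rlt [simp]:
  assumes "ht e x Rt" "ht e y Rt"
  shows "wfe e (req x y)" "wfe e (rlt x y)" "wfe e (rle x y)"
  using assms by (simp_all add: req_def rlt_def rle_def)

lemma wfe_in01 [simp]: "ht e x Rt \<Longrightarrow> wfe e (in01 x)"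
  by (simp add: in01_def)

lemma wfe_rconv [simp]: "ht e x (Nt \<rightarrow> Rt) \<Longrightarrow> ht e y Rt \<Longrightarrow> wfe e (rconv x y)"
  by (simp add: rconv_def)

lemma wfe_fun [simp]: "ht e f (Rt \<rightarrow> Rt) \<Longrightarrow> wfe e (is_fun01 f)"
  "ht e f (Rt \<rightarrow> Rt) \<Longrightarrow> wfe e (strongly_ext f)"
  by (simp_all add: is_fun01_def strongly_ext_def)

lemma wfe_jump_seq [simp]:
  "ht e f (Rt \<rightarrow> Rt) \<Longrightarrow> ht e r Rt \<Longrightarrow> ht e z Rt \<Longrightarrow> wfe e (jump_seq f r z)"
  by (simp add: jump_seq_def)

lemma wfe_binary [simp]: "ht e a (Nt \<rightarrow> Nt) \<Longrightarrow> wfe e (binary a)"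
  "wfe e LPO" "wfe e WLPO"
  by (simp_all add: binary_def LPO_def WLPO_def)

text \<open>Comparisons are formulas, and forced formulas persist; this is the link between the
  valuations of different worlds.\<close>

lemma extends_val:
  assumes "world w" "w \<sqsubseteq> w'" "has w t Qt" "has w u Qt"
  shows "val w t < val w u \<Longrightarrow> val w' t < val w' u" "val w t \<le> val w u \<Longrightarrow> val w' t \<le> val w' u"
    "val w t = val w u \<Longrightarrow> val w' t = val w' u"
proof -
  note [simp] = assms extendsD(1,2)[OF assms(2)]
  show "val w t < val w u \<Longrightarrow> val w' t < val w' u"
    using extendsD(3)[OF assms(2), of "t \<^bold>< u"] by (simp add: forces_Lt)
  show "val w t \<le> val w u \<Longrightarrow> val w' t \<le> val w' u"
    using extendsD(3)[OF assms(2), of "t \<^bold>\<le> u"] by (simp add: forces_le)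
  show "val w t = val w u \<Longrightarrow> val w' t = val w' u"
    using extendsD(3)[OF assms(2), of "t \<^bold>= u"] by (simp add: forces_Eq)
qed

lemma val_pos_up: "world w \<Longrightarrow> w \<sqsubseteq> w' \<Longrightarrow> has w t Qt \<Longrightarrow> 0 < val w t \<Longrightarrow> 0 < val w' t"
  using extends_val(1)[of w w' "iota zero" t] extendsD(1)[of w w'] by simp

text \<open>\<open>ev w P\<close> says that \<open>P\<close> holds for all sufficiently large \<open>n\<close>, also in the extensions of \<open>w\<close>.\<close>

definition ev :: "nat \<times> fm set \<Rightarrow> (nat \<times> fm set \<Rightarrow> tm \<Rightarrow> bool) \<Rightarrow> bool" where
  "ev w P \<longleftrightarrow> (\<exists>N. has w N Nt \<and>
     (\<forall>w' n. w \<sqsubseteq> w' \<longrightarrow> has w' n Nt \<longrightarrow> val w' (iota N) \<le> val w' (iota n) \<longrightarrow> P w' n))"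

lemma evI:
  assumes "has w N Nt"
    "\<And>w' n. w \<sqsubseteq> w' \<Longrightarrow> world w' \<Longrightarrow> has w' N Nt \<Longrightarrow> has w' n Nt \<Longrightarrow> val w' (iota N) \<le> val w' (iota n) \<Longrightarrow> P w' n"
  shows "ev w P"
  unfolding ev_def using assms extendsD(1,2) by blast

lemma ev_up: "ev w P \<Longrightarrow> w \<sqsubseteq> w' \<Longrightarrow> ev w' P"
  unfolding ev_def using extendsD(2) extends_trans by blast

lemma ev_conj:
  assumes w: "world w" and P: "ev w P" and Q: "ev w Q"
  shows "ev w (\<lambda>w' n. P w' n \<and> Q w' n)"
proof -
  from P obtain N where N: "has w N Nt"
    "\<And>w' n. w \<sqsubseteq> w' \<Longrightarrow> has w' n Nt \<Longrightarrow> val w' (iota N) \<le> val w' (iota n) \<Longrightarrow> P w' n"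
    unfolding ev_def by auto
  from Q obtain M where M: "has w M Nt"
    "\<And>w' n. w \<sqsubseteq> w' \<Longrightarrow> has w' n Nt \<Longrightarrow> val w' (iota M) \<le> val w' (iota n) \<Longrightarrow> Q w' n"
    unfolding ev_def by auto
  obtain K where K: "has w K Nt" "val w (iota N) \<le> val w (iota K)" "val w (iota M) \<le> val w (iota K)"
    by (rule nat_max[OF w N(1) M(1)])
  show ?thesis
  proof (rule evI[OF K(1)])
    fix w' n assume w': "w \<sqsubseteq> w'" "has w' n Nt" "val w' (iota K) \<le> val w' (iota n)"
    have "val w' (iota N) \<le> val w' (iota K)" "val w' (iota M) \<le> val w' (iota K)"
      using extends_val(2)[OF w w'(1)] K N(1) M(1) by auto
    then show "P w' n \<and> Q w' n" using w' N(2) M(2) by (meson order_trans)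
  qed
qed

lemma ev_mono:
  assumes "ev w P" "\<And>w' n. w \<sqsubseteq> w' \<Longrightarrow> world w' \<Longrightarrow> has w' n Nt \<Longrightarrow> P w' n \<Longrightarrow> Q w' n"
  shows "ev w Q"
  using assms unfolding ev_def by (meson extendsD(1))

lemma ev_ex: "world w \<Longrightarrow> ev w P \<Longrightarrow> \<exists>n. has w n Nt \<and> P w n"
  unfolding ev_def by (meson extends_refl order_refl)

lemma ev_ge:
  assumes "has w N Nt"
  shows "ev w (\<lambda>w' n. val w' (iota N) \<le> val w' (iota n))"
  by (rule evI[OF assms])

section \<open>Pointwise operations on sequences\<close>

lemma val_const [simp]: "world w \<Longrightarrow> has w q Qt \<Longrightarrow> has w n Nt \<Longrightarrow> val w (rconst q \<bullet> n) = val w q"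
  by (rule val_eqI, assumption, rule forces_ax[of w q Qt n Nt q Qt], assumption+, rule ax_K)
    (auto simp: ht_App)

lemma wfe_EqI: "ht e t \<sigma> \<Longrightarrow> ht e u \<sigma> \<Longrightarrow> wfe e (t \<^bold>= u)"
  by (auto simp: wfe_Eq)

lemma ht_AppI: "ht e t (\<sigma> \<rightarrow> \<tau>) \<Longrightarrow> ht e u \<sigma> \<Longrightarrow> ht e (t \<bullet> u) \<tau>"
  by (auto simp: ht_App)

lemma forces_S:
  assumes w [simp]: "world w" and f: "has w f (Nt \<rightarrow> \<sigma> \<rightarrow> \<tau>)" and y: "has w y (Nt \<rightarrow> \<sigma>)" and n: "has w n Nt"
  shows "w \<tturnstile> Con (Sc Nt \<sigma> \<tau>) \<bullet> f \<bullet> y \<bullet> n \<^bold>= f \<bullet> n \<bullet> (y \<bullet> n)"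
proof (rule forces_ax[OF w f y n], rule ax_S)
  show "lang w (Con (Sc Nt \<sigma> \<tau>) \<bullet> f \<bullet> y \<bullet> n \<^bold>= f \<bullet> n \<bullet> (y \<bullet> n))"
  proof (rule wfe_EqI)
    show "has w (Con (Sc Nt \<sigma> \<tau>) \<bullet> f \<bullet> y \<bullet> n) \<tau>"
      by (rule ht_AppI[OF ht_AppI[OF ht_AppI[OF _ f] y] n]) simp
    show "has w (f \<bullet> n \<bullet> (y \<bullet> n)) \<tau>" by (rule ht_AppI[OF ht_AppI[OF f n] ht_AppI[OF y n]])
  qed
qed

lemma forces_K:
  assumes w [simp]: "world w" and x: "has w x \<sigma>" and n: "has w n \<tau>"
  shows "w \<tturnstile> Con (Kc \<sigma> \<tau>) \<bullet> x \<bullet> n \<^bold>= x"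
proof (rule forces_ax[OF w x n n], rule ax_K)
  show "lang w (Con (Kc \<sigma> \<tau>) \<bullet> x \<bullet> n \<^bold>= x)"
    by (rule wfe_EqI[OF ht_AppI[OF ht_AppI[OF _ x] n] x]) simp
qed

lemma forces_cong_fun:
  "world w \<Longrightarrow> w \<tturnstile> x \<^bold>= y \<Longrightarrow> has w x (\<sigma> \<rightarrow> \<tau>) \<Longrightarrow> has w t \<sigma> \<Longrightarrow> w \<tturnstile> x \<bullet> t \<^bold>= y \<bullet> t"
  by (rule forces_cong) (auto intro: forces_refl)

lemma forces_pw:
  assumes w [simp]: "world w" and x: "has w x Rt" and n: "has w n Nt"
  shows "cty c = Qt \<rightarrow> Qt \<Longrightarrow> w \<tturnstile> pw1 c x \<bullet> n \<^bold>= Con c \<bullet> (x \<bullet> n)"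
    and "cty c = Qt \<rightarrow> Qt \<rightarrow> Qt \<Longrightarrow> has w y Rt \<Longrightarrow> w \<tturnstile> pw2 c x y \<bullet> n \<^bold>= Con c \<bullet> (x \<bullet> n) \<bullet> (y \<bullet> n)"
proof -
  let ?K = "Con (Kc (cty c) Nt) \<bullet> Con c"
  have tc: "has w (Con c) (cty c)" by simp
  have tK: "has w ?K (Nt \<rightarrow> cty c)" by simp
  have K: "w \<tturnstile> ?K \<bullet> n \<^bold>= Con c" by (rule forces_K[OF w tc n])
  have xn: "has w (x \<bullet> n) Qt" by (rule ht_AppI[OF x n])
  have Kx: "w \<tturnstile> ?K \<bullet> n \<bullet> (x \<bullet> n) \<^bold>= Con c \<bullet> (x \<bullet> n)" if "cty c = Qt \<rightarrow> \<tau>" for \<tau>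
    unfolding that by (rule forces_cong_fun[OF w K[unfolded that] ht_AppI[OF tK[unfolded that] n] xn])
  show "w \<tturnstile> pw1 c x \<bullet> n \<^bold>= Con c \<bullet> (x \<bullet> n)" if c: "cty c = Qt \<rightarrow> Qt"
    using forces_trans[OF w forces_S[OF w tK[unfolded c] x n] Kx[unfolded c, OF refl]]
    by (simp add: pw1_def)
  show "w \<tturnstile> pw2 c x y \<bullet> n \<^bold>= Con c \<bullet> (x \<bullet> n) \<bullet> (y \<bullet> n)"
    if c: "cty c = Qt \<rightarrow> Qt \<rightarrow> Qt" and y: "has w y Rt"
  proof -
    let ?f = "Con (Sc Nt Qt (Qt \<rightarrow> Qt)) \<bullet> ?K \<bullet> x"
    have f: "has w ?f (Nt \<rightarrow> Qt \<rightarrow> Qt)"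
      using x by (auto simp: ht_App c)
    have yn: "has w (y \<bullet> n) Qt" by (rule ht_AppI[OF y n])
    have 1: "w \<tturnstile> Con (Sc Nt Qt Qt) \<bullet> ?f \<bullet> y \<bullet> n \<^bold>= ?f \<bullet> n \<bullet> (y \<bullet> n)" by (rule forces_S[OF w f y n])
    have 2: "w \<tturnstile> ?f \<bullet> n \<^bold>= Con c \<bullet> (x \<bullet> n)"
      using forces_trans[OF w forces_S[OF w tK[unfolded c] x n] Kx[unfolded c, OF refl]] by (simp add: c)
    have "w \<tturnstile> ?f \<bullet> n \<bullet> (y \<bullet> n) \<^bold>= Con c \<bullet> (x \<bullet> n) \<bullet> (y \<bullet> n)"
      by (rule forces_cong_fun[OF w 2 ht_AppI[OF f n] yn])
    then show ?thesis using forces_trans[OF w 1] by (simp add: pw2_def c)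
  qed
qed

lemma val_pw [simp]:
  assumes w [simp]: "world w" and [simp]: "has w x Rt" "has w n Nt"
  shows "val w (rneg x \<bullet> n) = - val w (x \<bullet> n)" "val w (rabs x \<bullet> n) = \<bar>val w (x \<bullet> n)\<bar>"
    "has w y Rt \<Longrightarrow> val w (pw2 Plus x y \<bullet> n) = val w (x \<bullet> n) + val w (y \<bullet> n)"
    "has w y Rt \<Longrightarrow> val w (rmul x y \<bullet> n) = val w ((x \<bullet> n) \<^bold>* (y \<bullet> n))"
  using val_eqI[OF w forces_pw(1)[OF assms, of Minus]] val_eqI[OF w forces_pw(1)[OF assms, of Absv]]
    val_eqI[OF w forces_pw(2)[OF assms, of Plus y]] val_eqI[OF w forces_pw(2)[OF assms, of Times y]]
  by simp_all

section \<open>Cauchy sequences and relations between reals\<close>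

text \<open>Being Cauchy amounts to lying eventually within any positive rational distance of some
  rational centre; the entry at the Cauchy index is one. The centre is a term, hence usable in all
  extensions.\<close>

lemma is_realD:
  assumes w [simp]: "world w" and x [simp]: "has w x Rt" and R: "w \<tturnstile> is_real x"
    and d [simp]: "has w d Qt" and pos: "0 < val w d"
  obtains c where "has w c Qt" "ev w (\<lambda>w' n. \<bar>val w' (x \<bullet> n) - val w' c\<bar> < val w' d)"
proof -
  obtain k where k [simp]: "has w k Nt" and kd: "val w (eps_q k) < val w d"
    by (rule eps_archimedean[OF w d pos])
  from forces_AllD[OF w R[unfolded is_real_def] k]
  have "w \<tturnstile> Ex Nt (All Nt (All Nt (le_n (Var 2) (Var 1) \<^bold>\<and> le_n (Var 2) (Var 0) \<^bold>\<longrightarrow>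
      abs_q (shift 3 x \<bullet> Var 1 \<^bold>+ \<^bold>- (shift 3 x \<bullet> Var 0)) \<^bold>< eps_q (shift 3 k))))"
    by simp
  from forces_ExD[OF w this] obtain N where N [simp]: "has w N Nt" and
    "w \<tturnstile> All Nt (All Nt (le_n (shift 2 N) (Var 1) \<^bold>\<and> le_n (shift 2 N) (Var 0) \<^bold>\<longrightarrow>
      abs_q (shift 2 x \<bullet> Var 1 \<^bold>+ \<^bold>- (shift 2 x \<bullet> Var 0)) \<^bold>< eps_q (shift 2 k)))"
    by auto
  note A = this(2)
  show thesis
  proof (rule that[of "x \<bullet> N"], simp, rule evI[OF N])
    fix w' n assume w': "w \<sqsubseteq> w'" and n [simp]: "has w' n Nt" and le: "val w' (iota N) \<le> val w' (iota n)"
    note [simp] = extendsD(1,2)[OF w']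
    from forces_AllD[OF _ extendsD(3)[OF w' A] n]
    have "w' \<tturnstile> All Nt (le_n (shift 1 N) (shift 1 n) \<^bold>\<and> le_n (shift 1 N) (Var 0) \<^bold>\<longrightarrow>
      abs_q (shift 1 x \<bullet> shift 1 n \<^bold>+ \<^bold>- (shift 1 x \<bullet> Var 0)) \<^bold>< eps_q (shift 1 k))"
      by simp
    from forces_AllD[OF _ this, of N]
    have "w' \<tturnstile> (le_n N n \<^bold>\<and> le_n N N \<^bold>\<longrightarrow> abs_q (x \<bullet> n \<^bold>+ \<^bold>- (x \<bullet> N)) \<^bold>< eps_q k)" by simp
    from forces_ImpD[OF _ this] have "w' \<tturnstile> abs_q (x \<bullet> n \<^bold>+ \<^bold>- (x \<bullet> N)) \<^bold>< eps_q k"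
      using le by (simp add: forces_And forces_le)
    moreover have "val w' (eps_q k) < val w' d" by (rule extends_val(1)[OF w w' _ _ kd]) simp_all
    ultimately show "\<bar>val w' (x \<bullet> n) - val w' (x \<bullet> N)\<bar> < val w' d" by (simp add: forces_Lt)
  qed
qed

lemma is_realI:
  assumes w [simp]: "world w" and x [simp]: "has w x Rt"
    and *: "\<And>w' d. w \<sqsubseteq> w' \<Longrightarrow> world w' \<Longrightarrow> has w' x Rt \<Longrightarrow> has w' d Qt \<Longrightarrow> 0 < val w' d \<Longrightarrow>
       \<exists>c. has w' c Qt \<and> ev w' (\<lambda>w'' n. \<bar>val w'' (x \<bullet> n) - val w'' c\<bar> < val w'' d)"
  shows "w \<tturnstile> is_real x"
  unfolding is_real_def
proof (rule forces_AllI[OF w])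
  fix w' k assume w': "w \<sqsubseteq> w'" and k [simp]: "has w' k Nt"
  note [simp] = extendsD(1,2)[OF w']
  \<comment> \<open>Half of the required precision, so that two entries near one centre are near
    each other.\<close>
  let ?d = "eps_q k \<^bold>* inv_q (qnum 2)"
  obtain c where c [simp]: "has w' c Qt" and "ev w' (\<lambda>w'' n. \<bar>val w'' (x \<bullet> n) - val w'' c\<bar> < val w'' ?d)"
    using *[OF w', of ?d] val_eps(2)[of w' k] by auto
  then obtain N where N [simp]: "has w' N Nt" and
    near: "\<And>w'' n. w' \<sqsubseteq> w'' \<Longrightarrow> has w'' n Nt \<Longrightarrow> val w'' (iota N) \<le> val w'' (iota n) \<Longrightarrow>
      \<bar>val w'' (x \<bullet> n) - val w'' c\<bar> < val w'' ?d" unfolding ev_def by blast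
  have "w' \<tturnstile> All Nt (All Nt (le_n (shift 2 N) (Var 1) \<^bold>\<and> le_n (shift 2 N) (Var 0) \<^bold>\<longrightarrow>
      abs_q (shift 2 x \<bullet> Var 1 \<^bold>+ \<^bold>- (shift 2 x \<bullet> Var 0)) \<^bold>< eps_q (shift 2 k)))"
  proof (rule forces_AllI)
      fix w1 m assume w1: "w' \<sqsubseteq> w1" and m [simp]: "has w1 m Nt"
      note [simp] = extendsD(1,2)[OF w1]
      have "w1 \<tturnstile> All Nt (le_n (shift 1 N) (shift 1 m) \<^bold>\<and> le_n (shift 1 N) (Var 0) \<^bold>\<longrightarrow>
          abs_q (shift 1 x \<bullet> shift 1 m \<^bold>+ \<^bold>- (shift 1 x \<bullet> Var 0)) \<^bold>< eps_q (shift 1 k))"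
      proof (rule forces_AllI)
        fix w2 n assume w2: "w1 \<sqsubseteq> w2" and n [simp]: "has w2 n Nt"
        note [simp] = extendsD(1,2)[OF w2]
        have "w2 \<tturnstile> (le_n N m \<^bold>\<and> le_n N n \<^bold>\<longrightarrow> abs_q (x \<bullet> m \<^bold>+ \<^bold>- (x \<bullet> n)) \<^bold>< eps_q k)"
        proof (rule forces_ImpI)
          fix w3 assume w3: "w2 \<sqsubseteq> w3" and h: "w3 \<tturnstile> (le_n N m \<^bold>\<and> le_n N n)"
          note [simp] = extendsD(1,2)[OF w3]
          have w'3: "w' \<sqsubseteq> w3" using w1 w2 w3 extends_trans by blast
          have "\<bar>val w3 (x \<bullet> m) - val w3 c\<bar> < val w3 ?d" "\<bar>val w3 (x \<bullet> n) - val w3 c\<bar> < val w3 ?d"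
            by (rule near[OF w'3]; use h in \<open>simp add: forces_And forces_le\<close>)+
          moreover have "val w3 ?d = val w3 (eps_q k) / 2" by simp
          ultimately have "\<bar>val w3 (x \<bullet> m) - val w3 (x \<bullet> n)\<bar> < val w3 (eps_q k)"
            unfolding abs_less_iff by linarith
          then show "w3 \<tturnstile> abs_q (x \<bullet> m \<^bold>+ \<^bold>- (x \<bullet> n)) \<^bold>< eps_q k"
            by (simp add: forces_Lt)
        qed simp_all
        then show "w2 \<tturnstile> inst (le_n (shift 1 N) (shift 1 m) \<^bold>\<and> le_n (shift 1 N) (Var 0) \<^bold>\<longrightarrow>
            abs_q (shift 1 x \<bullet> shift 1 m \<^bold>+ \<^bold>- (shift 1 x \<bullet> Var 0)) \<^bold>< eps_q (shift 1 k)) n" by simp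
      qed simp_all
      then show "w1 \<tturnstile> inst (All Nt (le_n (shift 2 N) (Var 1) \<^bold>\<and> le_n (shift 2 N) (Var 0) \<^bold>\<longrightarrow>
          abs_q (shift 2 x \<bullet> Var 1 \<^bold>+ \<^bold>- (shift 2 x \<bullet> Var 0)) \<^bold>< eps_q (shift 2 k))) m"
        by simp
  qed simp_all
  then have "w' \<tturnstile> Ex Nt (All Nt (All Nt (le_n (Var 2) (Var 1) \<^bold>\<and> le_n (Var 2) (Var 0) \<^bold>\<longrightarrow>
      abs_q (shift 3 x \<bullet> Var 1 \<^bold>+ \<^bold>- (shift 3 x \<bullet> Var 0)) \<^bold>< eps_q (shift 3 k))))"
    by (intro forces_ExI[OF _ _ N]) simp_all
  then show "w' \<tturnstile> inst (Ex Nt (All Nt (All Nt (le_n (Var 2) (Var 1) \<^bold>\<and> le_n (Var 2) (Var 0) \<^bold>\<longrightarrow>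
      abs_q (shift 4 x \<bullet> Var 1 \<^bold>+ \<^bold>- (shift 4 x \<bullet> Var 0)) \<^bold>< eps_q (Var 3))))) k"
    by simp
qed simp

text \<open>The remaining notions have the shape \<open>Ex Nt (All Nt (le_n (Var 1) (Var 0) \<longrightarrow> A))\<close>, where \<open>A\<close>
  does not mention the bound.\<close>

lemma forces_evI:
  assumes w [simp]: "world w" and L: "lang w (All Nt A)"
    and ev: "ev w (\<lambda>w' n. w' \<tturnstile> inst A n)"
  shows "w \<tturnstile> Ex Nt (All Nt (le_n (Var 1) (Var 0) \<^bold>\<longrightarrow> subst_fm (case_nat (Var 0) (\<lambda>i. Var (i + 2))) A))"
proof -
  from ev obtain N where N: "has w N Nt" and
    h: "\<And>w' n. w \<sqsubseteq> w' \<Longrightarrow> has w' n Nt \<Longrightarrow> val w' (iota N) \<le> val w' (iota n) \<Longrightarrow> w' \<tturnstile> inst A n"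
    unfolding ev_def by blast
  let ?A = "subst_fm (case_nat (Var 0) (\<lambda>i. Var (i + 2))) A"
  have inst: "subst_fm (up (case_nat N Var)) ?A = A"
  proof -
    have "subst_fm (up (case_nat N Var)) ?A = subst_fm Var A"
      unfolding subst_fm_comp by (rule subst_fm_eqI) (simp split: nat.split)
    then show ?thesis by (simp add: subst_fm_Var)
  qed
  have LA: "wfe (case_nat (Some Nt) (case_nat (Some Nt) (env (fst w)))) ?A"
  proof (rule wfe_subst)
    show "wfe (case_nat (Some Nt) (env (fst w))) A" using L by simp
    show "tyof (case_nat (Some Nt) (case_nat (Some Nt) (env (fst w)))) (case_nat (Var 0) (\<lambda>i. Var (i + 2)) i) = Some \<tau>"
      if "case_nat (Some Nt) (env (fst w)) i = Some \<tau>" for i \<tau>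
      using that by (cases i) auto
  qed
  show ?thesis
  proof (rule forces_ExI[OF w _ N])
    show "lang w (Ex Nt (All Nt (le_n (Var 1) (Var 0) \<^bold>\<longrightarrow> ?A)))" using LA by simp
    have "w \<tturnstile> All Nt (le_n (shift 1 N) (Var 0) \<^bold>\<longrightarrow> A)"
    proof (rule forces_AllI[OF w])
      show "lang w (All Nt (le_n (shift 1 N) (Var 0) \<^bold>\<longrightarrow> A))" using L N by simp
      fix w' n assume w': "w \<sqsubseteq> w'" and n [simp]: "has w' n Nt"
      note [simp] = extendsD(1,2)[OF w']
      have "w' \<tturnstile> (le_n N n \<^bold>\<longrightarrow> inst A n)"
      proof (rule forces_ImpI)
        show "w'' \<tturnstile> inst A n" if w'': "w' \<sqsubseteq> w''" "w'' \<tturnstile> (le_n N n)" for w''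
        proof (rule h[OF extends_trans[OF w' w''(1)]])
          show "has w'' n Nt" by (rule extendsD(2)[OF w''(1) n])
          show "val w'' (iota N) \<le> val w'' (iota n)"
            using w''(2) extendsD(1,2)[OF w''(1)] N by (simp add: forces_le)
        qed
        have "lang w' (All Nt A)" by (rule extendsD(4)[OF w' L])
        then have L': "wfe (case_nat (Some Nt) (env (fst w'))) A" by simp
        show "lang w' (inst A n)"
        proof (rule wfe_subst[OF L'])
          show "tyof (env (fst w')) (case_nat n Var i) = Some \<tau>"
            if "case_nat (Some Nt) (env (fst w')) i = Some \<tau>" for i \<tau>
            using that n by (cases i) (auto simp: ht_def)
        qed
      qed (use N in simp_all)
      then show "w' \<tturnstile> inst (le_n (shift 1 N) (Var 0) \<^bold>\<longrightarrow> A) n" by simp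
    qed
    then show "w \<tturnstile> inst (All Nt (le_n (Var 1) (Var 0) \<^bold>\<longrightarrow> ?A)) N" using inst by simp
  qed
qed

lemma forces_evD:
  assumes w [simp]: "world w"
    and F: "w \<tturnstile> Ex Nt (All Nt (le_n (Var 1) (Var 0) \<^bold>\<longrightarrow> subst_fm (case_nat (Var 0) (\<lambda>i. Var (i + 2))) A))"
  shows "ev w (\<lambda>w' n. w' \<tturnstile> inst A n)"
proof -
  let ?A = "subst_fm (case_nat (Var 0) (\<lambda>i. Var (i + 2))) A"
  have inst: "subst_fm (up (case_nat N Var)) ?A = A" for N
  proof -
    have "subst_fm (up (case_nat N Var)) ?A = subst_fm Var A"
      unfolding subst_fm_comp by (rule subst_fm_eqI) (simp split: nat.split)
    then show ?thesis by (simp add: subst_fm_Var)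
  qed
  from forces_ExD[OF w F] obtain N where N [simp]: "has w N Nt"
    and A: "w \<tturnstile> All Nt (le_n (shift 1 N) (Var 0) \<^bold>\<longrightarrow> A)" using inst by auto
  show ?thesis
  proof (rule evI[OF N])
    fix w' n assume w': "w \<sqsubseteq> w'" and n [simp]: "has w' n Nt" and le: "val w' (iota N) \<le> val w' (iota n)"
    note [simp] = extendsD(1,2)[OF w']
    from forces_AllD[OF _ extendsD(3)[OF w' A] n] have "w' \<tturnstile> (le_n N n \<^bold>\<longrightarrow> inst A n)" by simp
    then show "w' \<tturnstile> inst A n" by (rule forces_ImpD[rotated]) (use le in \<open>simp_all add: forces_le\<close>)
  qed
qed

text \<open>The typing and positivity of the margin are repeated inside \<open>ev\<close>, since its
  value in an extension is a separate element of the field.\<close>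

lemma rltD:
  assumes w [simp]: "world w" and [simp]: "has w x Rt" "has w y Rt" and R: "w \<tturnstile> rlt x y"
  obtains d where "has w d Qt" "0 < val w d"
    "ev w (\<lambda>w' n. has w' d Qt \<and> 0 < val w' d \<and> val w' (x \<bullet> n) + val w' d < val w' (y \<bullet> n))"
proof -
  from forces_ExD[OF w R[unfolded rlt_def]] obtain k where k [simp]: "has w k Nt" and
    F: "w \<tturnstile> Ex Nt (All Nt (le_n (Var 1) (Var 0) \<^bold>\<longrightarrow> subst_fm (case_nat (Var 0) (\<lambda>i. Var (i + 2)))
       (shift 1 x \<bullet> Var 0 \<^bold>+ eps_q (shift 1 k) \<^bold>< shift 1 y \<bullet> Var 0)))"
    by auto
  show thesis
  proof (rule that[of "eps_q k"])
    show "0 < val w (eps_q k)" by (simp add: val_eps)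
    show "ev w (\<lambda>w' n. has w' (eps_q k) Qt \<and> 0 < val w' (eps_q k) \<and>
       val w' (x \<bullet> n) + val w' (eps_q k) < val w' (y \<bullet> n))"
    proof (rule ev_mono[OF forces_evD[OF w F]])
      fix w' n assume w': "w \<sqsubseteq> w'" and n [simp]: "has w' n Nt" and
        h: "w' \<tturnstile> inst (shift 1 x \<bullet> Var 0 \<^bold>+ eps_q (shift 1 k) \<^bold>< shift 1 y \<bullet> Var 0) n"
      note [simp] = extendsD(1,2)[OF w']
      show "has w' (eps_q k) Qt \<and> 0 < val w' (eps_q k) \<and> val w' (x \<bullet> n) + val w' (eps_q k) < val w' (y \<bullet> n)"
        using h by (simp add: forces_Lt val_eps)
    qed
  qed simp
qed

lemma rltI:
  assumes w [simp]: "world w" and [simp]: "has w x Rt" "has w y Rt" and d [simp]: "has w d Qt"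
    and pos: "0 < val w d" and ev: "ev w (\<lambda>w' n. val w' (x \<bullet> n) + val w' d < val w' (y \<bullet> n))"
  shows "w \<tturnstile> rlt x y"
proof -
  obtain k where k [simp]: "has w k Nt" and kd: "val w (eps_q k) < val w d"
    by (rule eps_archimedean[OF w d pos])
  let ?A = "shift 1 x \<bullet> Var 0 \<^bold>+ eps_q (shift 1 k) \<^bold>< shift 1 y \<bullet> Var 0"
  have "ev w (\<lambda>w' n. w' \<tturnstile> inst ?A n)"
  proof (rule ev_mono[OF ev])
    fix w' n assume w': "w \<sqsubseteq> w'" and n [simp]: "has w' n Nt" and
      h: "val w' (x \<bullet> n) + val w' d < val w' (y \<bullet> n)"
    note [simp] = extendsD(1,2)[OF w']
    have "val w' (eps_q k) < val w' d" by (rule extends_val(1)[OF w w' _ _ kd]) simp_all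
    then show "w' \<tturnstile> inst ?A n" using h by (simp add: forces_Lt)
  qed
  from forces_evI[OF w _ this] show ?thesis
    unfolding rlt_def by (intro forces_ExI[OF w _ k]) simp_all
qed

lemma reqD:
  assumes w [simp]: "world w" and [simp]: "has w x Rt" "has w y Rt" and R: "w \<tturnstile> req x y"
    and d [simp]: "has w d Qt" and pos: "0 < val w d"
  shows "ev w (\<lambda>w' n. \<bar>val w' (x \<bullet> n) - val w' (y \<bullet> n)\<bar> < val w' d)"
proof -
  obtain k where k [simp]: "has w k Nt" and kd: "val w (eps_q k) < val w d"
    by (rule eps_archimedean[OF w d pos])
  let ?A = "abs_q (shift 1 x \<bullet> Var 0 \<^bold>+ \<^bold>- (shift 1 y \<bullet> Var 0)) \<^bold>< eps_q (shift 1 k)"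
  from forces_AllD[OF w R[unfolded req_def] k]
  have "w \<tturnstile> Ex Nt (All Nt (le_n (Var 1) (Var 0) \<^bold>\<longrightarrow> subst_fm (case_nat (Var 0) (\<lambda>i. Var (i + 2))) ?A))"
    by simp
  from forces_evD[OF w this] show ?thesis
  proof (rule ev_mono)
    fix w' n assume w': "w \<sqsubseteq> w'" and n [simp]: "has w' n Nt" and h: "w' \<tturnstile> inst ?A n"
    note [simp] = extendsD(1,2)[OF w']
    have "val w' (eps_q k) < val w' d" by (rule extends_val(1)[OF w w' _ _ kd]) simp_all
    then show "\<bar>val w' (x \<bullet> n) - val w' (y \<bullet> n)\<bar> < val w' d" using h by (simp add: forces_Lt)
  qed
qed

lemma reqI:
  assumes w [simp]: "world w" and [simp]: "has w x Rt" "has w y Rt"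
    and *: "\<And>w' d. w \<sqsubseteq> w' \<Longrightarrow> world w' \<Longrightarrow> has w' x Rt \<Longrightarrow> has w' y Rt \<Longrightarrow> has w' d Qt \<Longrightarrow> 0 < val w' d \<Longrightarrow>
       ev w' (\<lambda>w'' n. \<bar>val w'' (x \<bullet> n) - val w'' (y \<bullet> n)\<bar> < val w'' d)"
  shows "w \<tturnstile> req x y"
  unfolding req_def
proof (rule forces_AllI[OF w])
  fix w' k assume w': "w \<sqsubseteq> w'" and k [simp]: "has w' k Nt"
  note [simp] = extendsD(1,2)[OF w']
  let ?A = "abs_q (shift 1 x \<bullet> Var 0 \<^bold>+ \<^bold>- (shift 1 y \<bullet> Var 0)) \<^bold>< eps_q (shift 1 k)"
  have "ev w' (\<lambda>w'' n. w'' \<tturnstile> inst ?A n)"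
  proof (rule ev_mono[OF *[OF w', of "eps_q k"]])
    fix w'' n assume w'': "w' \<sqsubseteq> w''" and n [simp]: "has w'' n Nt"
      and h: "\<bar>val w'' (x \<bullet> n) - val w'' (y \<bullet> n)\<bar> < val w'' (eps_q k)"
    note [simp] = extendsD(1,2)[OF w'']
    show "w'' \<tturnstile> inst ?A n" using h by (simp add: forces_Lt)
  qed (simp_all add: val_eps)
  from forces_evI[OF _ _ this]
  show "w' \<tturnstile> inst (Ex Nt (All Nt (le_n (Var 1) (Var 0) \<^bold>\<longrightarrow>
      abs_q (shift 3 x \<bullet> Var 0 \<^bold>+ \<^bold>- (shift 3 y \<bullet> Var 0)) \<^bold>< eps_q (Var 2)))) k"
    by simp
qed simp

lemma rleD: "world w \<Longrightarrow> w \<tturnstile> rle x y \<Longrightarrow> w \<sqsubseteq> w' \<Longrightarrow> \<not> w' \<tturnstile> rlt y x"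
  unfolding rle_def using forces_ImpD[of w'] not_forces_Fls[of w'] extendsD(1,3) by blast

lemma rleI:
  assumes "world w" "has w x Rt" "has w y Rt"
    "\<And>w'. w \<sqsubseteq> w' \<Longrightarrow> world w' \<Longrightarrow> has w' x Rt \<Longrightarrow> has w' y Rt \<Longrightarrow> w' \<tturnstile> rlt y x \<Longrightarrow> False"
  shows "w \<tturnstile> rle x y"
  unfolding rle_def using assms extendsD(1,2) by (intro forces_ImpI) (simp_all, blast)

lemma rconvD:
  assumes w [simp]: "world w" and [simp]: "has w X (Nt \<rightarrow> Rt)" "has w z Rt" and R: "w \<tturnstile> rconv X z"
    and d [simp]: "has w d Qt" and pos: "0 < val w d"
  shows "ev w (\<lambda>w' n. ev w' (\<lambda>w'' m. \<bar>val w'' (X \<bullet> n \<bullet> m) - val w'' (z \<bullet> m)\<bar> < val w'' d))"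
proof -
  obtain k where k [simp]: "has w k Nt" and kd: "val w (eps_q k) < val w d"
    by (rule eps_archimedean[OF w d pos])
  let ?A = "rlt (rabs (rsub (shift 1 X \<bullet> Var 0) (shift 1 z))) (rconst (eps_q (shift 1 k)))"
  from forces_AllD[OF w R[unfolded rconv_def] k]
  have "w \<tturnstile> Ex Nt (All Nt (le_n (Var 1) (Var 0) \<^bold>\<longrightarrow> subst_fm (case_nat (Var 0) (\<lambda>i. Var (i + 2))) ?A))"
    by simp
  from forces_evD[OF w this] show ?thesis
  proof (rule ev_mono)
    fix w' n assume w': "w \<sqsubseteq> w'" and n [simp]: "has w' n Nt" and "w' \<tturnstile> inst ?A n"
    note [simp] = extendsD(1,2)[OF w']
    from \<open>w' \<tturnstile> inst ?A n\<close> have "w' \<tturnstile> rlt (rabs (rsub (X \<bullet> n) z)) (rconst (eps_q k))" by simp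
    then obtain r where "ev w' (\<lambda>w'' m. has w'' r Qt \<and> 0 < val w'' r \<and>
        val w'' (rabs (rsub (X \<bullet> n) z) \<bullet> m) + val w'' r < val w'' (rconst (eps_q k) \<bullet> m))"
      by (rule rltD[rotated 3]) simp_all
    then show "ev w' (\<lambda>w'' m. \<bar>val w'' (X \<bullet> n \<bullet> m) - val w'' (z \<bullet> m)\<bar> < val w'' d)"
    proof (rule ev_mono)
      fix w'' m assume w'': "w' \<sqsubseteq> w''" and m [simp]: "has w'' m Nt" and h: "has w'' r Qt \<and> 0 < val w'' r \<and>
        val w'' (rabs (rsub (X \<bullet> n) z) \<bullet> m) + val w'' r < val w'' (rconst (eps_q k) \<bullet> m)"
      note [simp] = extendsD(1,2)[OF w'']
      have "val w'' (eps_q k) < val w'' d" by (rule extends_val(1)[OF w extends_trans[OF w' w''] _ _ kd]) simp_all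
      then show "\<bar>val w'' (X \<bullet> n \<bullet> m) - val w'' (z \<bullet> m)\<bar> < val w'' d" using h by simp
    qed
  qed
qed

lemma rconvI:
  assumes w [simp]: "world w" and [simp]: "has w X (Nt \<rightarrow> Rt)" "has w z Rt"
    and *: "\<And>w' d. w \<sqsubseteq> w' \<Longrightarrow> world w' \<Longrightarrow> has w' d Qt \<Longrightarrow> 0 < val w' d \<Longrightarrow>
       ev w' (\<lambda>w1 n. ev w1 (\<lambda>w'' m. \<bar>val w'' (X \<bullet> n \<bullet> m) - val w'' (z \<bullet> m)\<bar> < val w'' d))"
  shows "w \<tturnstile> rconv X z"
  unfolding rconv_def
proof (rule forces_AllI[OF w])
  fix w' k assume w': "w \<sqsubseteq> w'" and k [simp]: "has w' k Nt"
  note [simp] = extendsD(1,2)[OF w']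
  let ?A = "rlt (rabs (rsub (shift 1 X \<bullet> Var 0) (shift 1 z))) (rconst (eps_q (shift 1 k)))"
  \<comment> \<open>One half of the tolerance bounds the distance; the other is the margin that a
    strict inequality of reals demands.\<close>
  let ?d = "eps_q k \<^bold>* inv_q (qnum 2)"
  have "ev w' (\<lambda>w1 n. w1 \<tturnstile> inst ?A n)"
  proof (rule ev_mono[OF *[OF w', of ?d]])
    fix w1 n assume w1: "w' \<sqsubseteq> w1" and n [simp]: "has w1 n Nt"
      and h: "ev w1 (\<lambda>w'' m. \<bar>val w'' (X \<bullet> n \<bullet> m) - val w'' (z \<bullet> m)\<bar> < val w'' ?d)"
    note [simp] = extendsD(1,2)[OF w1]
    have "w1 \<tturnstile> rlt (rabs (rsub (X \<bullet> n) z)) (rconst (eps_q k))"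
    proof (rule rltI[of _ _ _ ?d])
      show "ev w1 (\<lambda>w'' m. val w'' (rabs (rsub (X \<bullet> n) z) \<bullet> m) + val w'' ?d < val w'' (rconst (eps_q k) \<bullet> m))"
      proof (rule ev_mono[OF h])
        fix w2 m assume w2: "w1 \<sqsubseteq> w2" and m [simp]: "has w2 m Nt"
          and "\<bar>val w2 (X \<bullet> n \<bullet> m) - val w2 (z \<bullet> m)\<bar> < val w2 ?d"
        note [simp] = extendsD(1,2)[OF w2]
        show "val w2 (rabs (rsub (X \<bullet> n) z) \<bullet> m) + val w2 ?d < val w2 (rconst (eps_q k) \<bullet> m)"
          using \<open>_ < val w2 ?d\<close> by simp
      qed
    qed (simp_all add: val_eps)
    then show "w1 \<tturnstile> inst ?A n" by simp
  qed (simp_all add: val_eps)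
  from forces_evI[OF _ _ this]
  show "w' \<tturnstile> inst (Ex Nt (All Nt (le_n (Var 1) (Var 0) \<^bold>\<longrightarrow>
      rlt (rabs (rsub (shift 3 X \<bullet> Var 0) (shift 3 z))) (rconst (eps_q (Var 2)))))) k"
    by simp
qed simp

text \<open>A rational \<open>c\<close> within \<open>(q - p)/4\<close> of the tail of
  \<open>x\<close> is compared with the midpoint of \<open>p\<close> and \<open>q\<close>, which is
  decidable; either way a quarter of the gap is left as margin.\<close>

lemma rlt_cotrans:
  assumes w [simp]: "world w" and [simp]: "has w x Rt" and R: "w \<tturnstile> is_real x"
    and [simp]: "has w p Qt" "has w q Qt" and pq: "val w p < val w q"
  shows "w \<tturnstile> rlt (rconst p) x \<or> w \<tturnstile> rlt x (rconst q)"
proof -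
  let ?d = "(q \<^bold>+ \<^bold>- p) \<^bold>* inv_q (qnum 4)"
  have pos: "0 < val w ?d" using pq by simp
  obtain c where c [simp]: "has w c Qt" and ev: "ev w (\<lambda>w' n. \<bar>val w' (x \<bullet> n) - val w' c\<bar> < val w' ?d)"
    by (rule is_realD[OF w _ R _ pos]) simp_all
  show ?thesis
  proof (cases "val w c \<le> val w (p \<^bold>+ (?d \<^bold>+ ?d))")
    case True
    have "w \<tturnstile> rlt x (rconst q)"
    proof (rule rltI[OF w _ _ _ pos])
      show "ev w (\<lambda>w' n. val w' (x \<bullet> n) + val w' ?d < val w' (rconst q \<bullet> n))"
      proof (rule ev_mono[OF ev])
        fix w' n assume w': "w \<sqsubseteq> w'" and n [simp]: "has w' n Nt" and h: "\<bar>val w' (x \<bullet> n) - val w' c\<bar> < val w' ?d"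
        note [simp] = extendsD(1,2)[OF w']
        have "val w' c \<le> val w' (p \<^bold>+ (?d \<^bold>+ ?d))" by (rule extends_val(2)[OF w w' _ _ True]) simp_all
        then have "val w' c \<le> val w' p + (val w' ?d + val w' ?d)" by (simp del: val_div_num)
        moreover have "4 * val w' ?d = val w' q - val w' p" "val w' (rconst q \<bullet> n) = val w' q" by simp_all
        ultimately show "val w' (x \<bullet> n) + val w' ?d < val w' (rconst q \<bullet> n)"
          using h unfolding abs_less_iff by linarith
      qed
    qed simp_all
    then show ?thesis ..
  next
    case False
    then have f: "val w (p \<^bold>+ (?d \<^bold>+ ?d)) < val w c" by simp
    have "w \<tturnstile> rlt (rconst p) x"
    proof (rule rltI[OF w _ _ _ pos])
      show "ev w (\<lambda>w' n. val w' (rconst p \<bullet> n) + val w' ?d < val w' (x \<bullet> n))"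
      proof (rule ev_mono[OF ev])
        fix w' n assume w': "w \<sqsubseteq> w'" and n [simp]: "has w' n Nt" and h: "\<bar>val w' (x \<bullet> n) - val w' c\<bar> < val w' ?d"
        note [simp] = extendsD(1,2)[OF w']
        have "val w' (p \<^bold>+ (?d \<^bold>+ ?d)) < val w' c" by (rule extends_val(1)[OF w w' _ _ f]) simp_all
        then have "val w' p + (val w' ?d + val w' ?d) < val w' c" by (simp del: val_div_num)
        moreover have "4 * val w' ?d = val w' q - val w' p" "val w' (rconst p \<bullet> n) = val w' p" by simp_all
        ultimately show "val w' (rconst p \<bullet> n) + val w' ?d < val w' (x \<bullet> n)"
          using h unfolding abs_less_iff by linarith
      qed
    qed simp_all
    then show ?thesis ..
  qed
qed

lemma rlt_req:
  assumes w [simp]: "world w" and [simp]: "has w x Rt" "has w y Rt" "has w x' Rt" "has w y' Rt"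
    and lt: "w \<tturnstile> rlt x y" and eq: "w \<tturnstile> req x x'" "w \<tturnstile> req y y'"
  shows "w \<tturnstile> rlt x' y'"
proof -
  obtain d where d [simp]: "has w d Qt" "0 < val w d" and
    ev: "ev w (\<lambda>w' n. has w' d Qt \<and> 0 < val w' d \<and> val w' (x \<bullet> n) + val w' d < val w' (y \<bullet> n))"
    by (rule rltD[OF w _ _ lt]) simp_all
  let ?e = "d \<^bold>* inv_q (qnum 4)"
  have e: "has w ?e Qt" "0 < val w ?e" by simp_all
  show ?thesis
  proof (rule rltI[OF w _ _ e])
    show "ev w (\<lambda>w' n. val w' (x' \<bullet> n) + val w' ?e < val w' (y' \<bullet> n))"
    proof (rule ev_mono[OF ev_conj[OF w ev ev_conj[OF w reqD[OF w _ _ eq(1) e] reqD[OF w _ _ eq(2) e]]]])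
      fix w' n assume w': "w \<sqsubseteq> w'" and n [simp]: "has w' n Nt" and
       h: "(has w' d Qt \<and> 0 < val w' d \<and> val w' (x \<bullet> n) + val w' d < val w' (y \<bullet> n)) \<and>
         \<bar>val w' (x \<bullet> n) - val w' (x' \<bullet> n)\<bar> < val w' ?e \<and> \<bar>val w' (y \<bullet> n) - val w' (y' \<bullet> n)\<bar> < val w' ?e"
      note [simp] = extendsD(1,2)[OF w']
      have "val w' ?e = val w' d / 4" by simp
      then show "val w' (x' \<bullet> n) + val w' ?e < val w' (y' \<bullet> n)"
        using h unfolding abs_less_iff by linarith
    qed simp_all
  qed simp_all
qed

lemma req_refl:
  assumes "world w" "has w x Rt"
  shows "w \<tturnstile> req x x"
proof (rule reqI[OF assms(1,2,2)])
  fix w' d assume *: "world w'" "has w' d Qt" "0 < val w' d"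
  show "ev w' (\<lambda>w'' n. \<bar>val w'' (x \<bullet> n) - val w'' (x \<bullet> n)\<bar> < val w'' d)"
  proof (rule evI[of _ zero])
    show "\<bar>val w'' (x \<bullet> n) - val w'' (x \<bullet> n)\<bar> < val w'' d" if "w' \<sqsubseteq> w''" for w'' n
      using val_pos_up[OF *(1) that *(2,3)] by simp
  qed simp
qed

text \<open>Both inequalities can be read off at a common late entry of \<open>x\<close>.\<close>

lemma rlt_conflict:
  assumes w [simp]: "world w" and [simp]: "has w x Rt" "has w p Qt" "has w q Qt"
    and lt: "w \<tturnstile> rlt (rconst p) x" "w \<tturnstile> rlt x (rconst q)"
  shows "val w p < val w q"
proof -
  obtain d where d: "has w d Qt" "0 < val w d" and
    ev: "ev w (\<lambda>w' n. has w' d Qt \<and> 0 < val w' d \<and> val w' (rconst p \<bullet> n) + val w' d < val w' (x \<bullet> n))"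
    by (rule rltD[OF w _ _ lt(1)]) simp_all
  obtain e where e: "has w e Qt" "0 < val w e" and
    ev': "ev w (\<lambda>w' n. has w' e Qt \<and> 0 < val w' e \<and> val w' (x \<bullet> n) + val w' e < val w' (rconst q \<bullet> n))"
    by (rule rltD[OF w _ _ lt(2)]) simp_all
  from ev_ex[OF w ev_conj[OF w ev ev']] obtain n where "has w n Nt"
    "val w (rconst p \<bullet> n) + val w d < val w (x \<bullet> n)" "val w (x \<bullet> n) + val w e < val w (rconst q \<bullet> n)" by blast
  then show ?thesis using d e by simp
qed

lemma is_real_const: "world w \<Longrightarrow> has w q Qt \<Longrightarrow> w \<tturnstile> is_real (rconst q)"
proof (rule is_realI)
  fix w' d assume *: "world w" "has w q Qt" "w \<sqsubseteq> w'" "world w'" "has w' d Qt" "0 < val w' d"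
  show "\<exists>c. has w' c Qt \<and> ev w' (\<lambda>w'' n. \<bar>val w'' (rconst q \<bullet> n) - val w'' c\<bar> < val w'' d)"
  proof (intro exI[of _ q] conjI evI[of _ zero])
    show "has w' q Qt" by (rule extendsD(2)[OF *(3,2)])
    fix w'' n assume "w' \<sqsubseteq> w''" "world w''" "has w'' n Nt"
    then show "\<bar>val w'' (rconst q \<bullet> n) - val w'' q\<bar> < val w'' d"
      using \<open>has w' q Qt\<close> val_pos_up[OF *(4) \<open>w' \<sqsubseteq> w''\<close> *(5,6)] by (simp add: extendsD(2))
  qed simp
qed simp_all

lemma in01D:
  assumes "world w" "w \<tturnstile> in01 x"
  shows "w \<tturnstile> is_real x" "w \<tturnstile> rle r0 x" "w \<tturnstile> rle x r1"
  using assms by (simp_all add: in01_def forces_And)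

lemma in01I: "world w \<Longrightarrow> w \<tturnstile> is_real x \<Longrightarrow> w \<tturnstile> rle r0 x \<Longrightarrow> w \<tturnstile> rle x r1 \<Longrightarrow> w \<tturnstile> in01 x"
  by (simp add: in01_def forces_And)

lemma rle_evI:
  assumes w [simp]: "world w" and [simp]: "has w x Rt" "has w y Rt"
    and ev: "ev w (\<lambda>w' n. val w' (x \<bullet> n) \<le> val w' (y \<bullet> n))"
  shows "w \<tturnstile> rle x y"
proof (rule rleI[OF w])
  fix w' assume w': "w \<sqsubseteq> w'" and [simp]: "world w'" and lt: "w' \<tturnstile> rlt y x"
  note [simp] = extendsD(2)[OF w']
  obtain d where
    ev': "ev w' (\<lambda>w1 n. has w1 d Qt \<and> 0 < val w1 d \<and> val w1 (y \<bullet> n) + val w1 d < val w1 (x \<bullet> n))"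
    by (rule rltD[OF _ _ _ lt]) simp_all
  from ev_ex[OF _ ev_conj[OF _ ev_up[OF ev w'] ev']] obtain n where
    "val w' (x \<bullet> n) \<le> val w' (y \<bullet> n)" "0 < val w' d" "val w' (y \<bullet> n) + val w' d < val w' (x \<bullet> n)" by auto
  then show False by linarith
qed simp_all

lemma in01_const:
  assumes w [simp]: "world w" and q [simp]: "has w q Qt" and le: "0 \<le> val w q" "val w q \<le> 1"
  shows "w \<tturnstile> in01 (rconst q)"
proof (rule in01I[OF w is_real_const[OF w q] rle_evI[OF w] rle_evI[OF w]])
  show "ev w (\<lambda>w' n. val w' (r0 \<bullet> n) \<le> val w' (rconst q \<bullet> n))"
  proof (rule evI[of _ zero])
    fix w' n assume w': "w \<sqsubseteq> w'" and n [simp]: "has w' n Nt"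
    note [simp] = extendsD(1,2)[OF w']
    show "val w' (r0 \<bullet> n) \<le> val w' (rconst q \<bullet> n)"
      using extends_val(2)[OF w w', of "iota zero" q] le by simp
  qed simp
  show "ev w (\<lambda>w' n. val w' (rconst q \<bullet> n) \<le> val w' (r1 \<bullet> n))"
  proof (rule evI[of _ zero])
    fix w' n assume w': "w \<sqsubseteq> w'" and n [simp]: "has w' n Nt"
    note [simp] = extendsD(1,2)[OF w']
    show "val w' (rconst q \<bullet> n) \<le> val w' (r1 \<bullet> n)"
      using extends_val(2)[OF w w', of q "qnum 1"] le by simp
  qed simp
qed simp_all

lemma fun01D:
  assumes w [simp]: "world w" and f [simp]: "has w f (Rt \<rightarrow> Rt)" and F: "w \<tturnstile> is_fun01 f"
    and [simp]: "has w x Rt" and x: "w \<tturnstile> in01 x"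
  shows "w \<tturnstile> is_real (f \<bullet> x)"
    "has w y Rt \<Longrightarrow> w \<tturnstile> in01 y \<Longrightarrow> w \<tturnstile> req x y \<Longrightarrow> w \<tturnstile> req (f \<bullet> x) (f \<bullet> y)"
proof -
  from F have 1: "w \<tturnstile> All Rt (in01 (Var 0) \<^bold>\<longrightarrow> is_real (shift 1 f \<bullet> Var 0))"
    and 2: "w \<tturnstile> All Rt (All Rt (in01 (Var 1) \<^bold>\<and> in01 (Var 0) \<^bold>\<and> req (Var 1) (Var 0) \<^bold>\<longrightarrow>
       req (shift 2 f \<bullet> Var 1) (shift 2 f \<bullet> Var 0)))"
    by (simp_all add: is_fun01_def forces_And)
  have "w \<tturnstile> (in01 x \<^bold>\<longrightarrow> is_real (f \<bullet> x))" using forces_AllD[OF w 1, of x] by simp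
  then show "w \<tturnstile> is_real (f \<bullet> x)" using x forces_ImpD[OF w] by blast
  show "w \<tturnstile> req (f \<bullet> x) (f \<bullet> y)" if y [simp]: "has w y Rt" and h: "w \<tturnstile> in01 y" "w \<tturnstile> req x y"
  proof -
    have "w \<tturnstile> All Rt (in01 (shift 1 x) \<^bold>\<and> in01 (Var 0) \<^bold>\<and> req (shift 1 x) (Var 0) \<^bold>\<longrightarrow>
       req (shift 1 f \<bullet> shift 1 x) (shift 1 f \<bullet> Var 0))" using forces_AllD[OF w 2, of x] by simp
    from forces_AllD[OF w this y] have "w \<tturnstile> (in01 x \<^bold>\<and> in01 y \<^bold>\<and> req x y \<^bold>\<longrightarrow> req (f \<bullet> x) (f \<bullet> y))" by simp
    then show ?thesis by (rule forces_ImpD[OF w]) (use x h in \<open>simp add: forces_And\<close>)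
  qed
qed

section \<open>Choice in a world\<close>

text \<open>The witnesses may be found anew in every extension; the choice axiom turns them into a
  single term of \<open>w\<close> that works in all of them.\<close>

lemma forces_choice:
  assumes w [simp]: "world w" and L: "wfe (case_nat (Some \<sigma>) (case_nat (Some Nt) (env (fst w)))) A"
    and ex: "\<And>w' n. w \<sqsubseteq> w' \<Longrightarrow> has w' n Nt \<Longrightarrow> \<exists>x. has w' x \<sigma> \<and> w' \<tturnstile> subst_fm (case_nat x (case_nat n Var)) A"
  obtains g where "has w g (Nt \<rightarrow> \<sigma>)"
    "\<And>w' n. w \<sqsubseteq> w' \<Longrightarrow> has w' n Nt \<Longrightarrow> w' \<tturnstile> subst_fm (case_nat (g \<bullet> n) (case_nat n Var)) A"
proof -
  let ?C = "subst_fm (case_nat (Var 1 \<bullet> Var 0) (case_nat (Var 0) (\<lambda>i. Var (i + 2)))) A"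
  have LC: "lang w (Ex (Nt \<rightarrow> \<sigma>) (All Nt ?C))"
  proof (simp, rule wfe_subst[OF L])
    show "tyof (case_nat (Some Nt) (case_nat (Some (Nt \<rightarrow> \<sigma>)) (env (fst w))))
       (case_nat (Var (Suc 0) \<bullet> Var 0) (case_nat (Var 0) (\<lambda>i. Var (Suc (Suc i)))) i) = Some \<tau>"
      if "case_nat (Some \<sigma>) (case_nat (Some Nt) (env (fst w))) i = Some \<tau>" for i \<tau>
      using that by (auto split: nat.splits simp: tyof_App)
  qed
  have LA: "lang w (All Nt (Ex \<sigma> A))" using L by simp
  let ?F = "All Nt (Ex \<sigma> A) \<^bold>\<longrightarrow> Ex (Nt \<rightarrow> \<sigma>) (All Nt ?C)"
  obtain n0 where n0: "\<forall>n\<ge>n0. wff (ctx n) (All Nt (Ex \<sigma> A))" using wff_ctx[OF LA] by auto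
  have F: "w \<tturnstile> ?F"
  proof (rule forcesI[OF w])
    show "proves (snd w) ?F"
      by (rule proves_base[of n0], rule Ax, rule ax_countable_choice) (use n0 in auto)
    show "lang w ?F" using LA LC by simp
  qed
  have "w \<tturnstile> All Nt (Ex \<sigma> A)"
  proof (rule forces_AllI[OF w LA])
    fix w' n assume w': "w \<sqsubseteq> w'" and n: "has w' n Nt"
    from ex[OF w' n] obtain x where x: "has w' x \<sigma>" "w' \<tturnstile> subst_fm (case_nat x (case_nat n Var)) A" by auto
    have "inst (subst_fm (up (case_nat n Var)) A) x = subst_fm (case_nat x (case_nat n Var)) A"
      unfolding subst_fm_comp by (rule subst_fm_eqI) (simp split: nat.split)
    moreover have "wfe (case_nat (Some \<sigma>) (env (fst w'))) (subst_fm (up (case_nat n Var)) A)"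
    proof (rule wfe_subst)
      show "wfe (case_nat (Some \<sigma>) (case_nat (Some Nt) (env (fst w')))) A"
        using extendsD(4)[OF w' LA] by simp
      show "tyof (case_nat (Some \<sigma>) (env (fst w'))) (up (case_nat n Var) i) = Some \<tau>"
        if "case_nat (Some \<sigma>) (case_nat (Some Nt) (env (fst w'))) i = Some \<tau>" for i \<tau>
        using that n by (auto split: nat.splits simp: tyof_rename ht_def)
    qed
    ultimately have "w' \<tturnstile> Ex \<sigma> (subst_fm (up (case_nat n Var)) A)"
      using x extendsD(1)[OF w'] by (intro forces_ExI[OF _ _ x(1)]) simp_all
    then show "w' \<tturnstile> inst (Ex \<sigma> A) n" by simp
  qed
  from forces_ExD[OF w forces_ImpD[OF w F this]] obtain g where g: "has w g (Nt \<rightarrow> \<sigma>)"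
    "w \<tturnstile> inst (All Nt ?C) g" by auto
  show thesis
  proof (rule that[OF g(1)])
    fix w' n assume w': "w \<sqsubseteq> w'" and n: "has w' n Nt"
    have "w' \<tturnstile> All Nt (subst_fm (up (case_nat g Var)) ?C)" using extendsD(3)[OF w' g(2)] by simp
    from forces_AllD[OF extendsD(1)[OF w'] this n]
    have "w' \<tturnstile> inst (subst_fm (up (case_nat g Var)) ?C) n" .
    moreover have "inst (subst_fm (up (case_nat g Var)) ?C) n = subst_fm (case_nat (g \<bullet> n) (case_nat n Var)) A"
      unfolding subst_fm_comp by (rule subst_fm_eqI) (simp split: nat.split)
    ultimately show "w' \<tturnstile> subst_fm (case_nat (g \<bullet> n) (case_nat n Var)) A" by simp
  qed
qed

text \<open>The predicate \<open>D\<close> marks the admissible states: only for these does a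
  successor have to be found, and all states along \<open>g\<close> are admissible.\<close>

lemma forces_dependent_choice:
  assumes w [simp]: "world w" and LD: "wfe (case_nat (Some \<sigma>) (env (fst w))) D"
    and LA: "wfe (case_nat (Some \<sigma>) (case_nat (Some \<sigma>) (env (fst w)))) A"
    and step: "\<And>w' x. w \<sqsubseteq> w' \<Longrightarrow> has w' x \<sigma> \<Longrightarrow> w' \<tturnstile> inst D x \<Longrightarrow>
      \<exists>y. has w' y \<sigma> \<and> w' \<tturnstile> inst D y \<and> w' \<tturnstile> subst_fm (case_nat y (case_nat x Var)) A"
    and x: "has w x \<sigma>" and start: "w \<tturnstile> inst D x"
  obtains g where "has w g (Nt \<rightarrow> \<sigma>)" "w \<tturnstile> g \<bullet> zero \<^bold>= x"
    "\<And>w' n. w \<sqsubseteq> w' \<Longrightarrow> has w' n Nt \<Longrightarrow> w' \<tturnstile> inst D (g \<bullet> n)"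
    "\<And>w' n. w \<sqsubseteq> w' \<Longrightarrow> has w' n Nt \<Longrightarrow> w' \<tturnstile> subst_fm (case_nat (g \<bullet> succ n) (case_nat (g \<bullet> n) Var)) A"
proof -
  let ?D2 = "subst_fm (case_nat (Var 0) (\<lambda>i. Var (i + 2))) D"
  let ?D3 = "subst_fm (case_nat (Var 1 \<bullet> Var 0) (\<lambda>i. Var (i + 3))) D"
  let ?A3 = "subst_fm (case_nat (Var 1 \<bullet> succ (Var 0)) (case_nat (Var 1 \<bullet> Var 0) (\<lambda>i. Var (i + 3)))) A"
  let ?S = "All \<sigma> (D \<^bold>\<longrightarrow> Ex \<sigma> (?D2 \<^bold>\<and> A))"
  let ?G = "Ex (Nt \<rightarrow> \<sigma>) (Var 0 \<bullet> zero \<^bold>= Var 1 \<^bold>\<and> All Nt (?D3 \<^bold>\<and> ?A3))"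
  let ?F = "?S \<^bold>\<longrightarrow> All \<sigma> (D \<^bold>\<longrightarrow> ?G)"
  have LD2: "wfe (case_nat (Some \<sigma>) (case_nat (Some \<sigma>) (env (fst w)))) ?D2"
    by (rule wfe_subst[OF LD]) (auto split: nat.splits)
  have LD3: "wfe (case_nat (Some Nt) (case_nat (Some (Nt \<rightarrow> \<sigma>)) (case_nat (Some \<sigma>) (env (fst w))))) ?D3"
    by (rule wfe_subst[OF LD]) (auto split: nat.splits)
  have LA3: "wfe (case_nat (Some Nt) (case_nat (Some (Nt \<rightarrow> \<sigma>)) (case_nat (Some \<sigma>) (env (fst w))))) ?A3"
    by (rule wfe_subst[OF LA]) (auto split: nat.splits)
  have LE: "wfe (case_nat (Some (Nt \<rightarrow> \<sigma>)) (case_nat (Some \<sigma>) (env (fst w)))) (Var 0 \<bullet> zero \<^bold>= Var 1)"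
    by (rule wfe_EqI[of _ _ \<sigma>]) (auto simp: ht_App)
  have LG: "wfe (case_nat (Some \<sigma>) (env (fst w))) ?G" using LE LD3 LA3 by simp
  have LS: "lang w ?S" using LD LD2 LA by simp
  obtain n0 where n0: "\<forall>n\<ge>n0. wff (ctx n) (All \<sigma> D)" using wff_ctx[of "fst w" "All \<sigma> D"] LD by auto
  obtain n1 where n1: "\<forall>n\<ge>n1. wff (ctx n) (All \<sigma> (All \<sigma> A))" using wff_ctx[of "fst w" "All \<sigma> (All \<sigma> A)"] LA by auto
  have F: "w \<tturnstile> ?F"
  proof (rule forcesI[OF w])
    show "proves (snd w) ?F"
      by (rule proves_base[of "max n0 n1"], rule Ax, rule ax_dependent_choice) (use n0 n1 in auto)
    show "lang w ?F" using LS LD LG by simp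
  qed
  have "w \<tturnstile> ?S"
  proof (rule forces_AllI[OF w LS])
    fix w' t assume w': "w \<sqsubseteq> w'" and t: "has w' t \<sigma>"
    let ?E = "subst_fm (up (case_nat t Var)) (?D2 \<^bold>\<and> A)"
    have ty: "tyof (case_nat (Some \<sigma>) (env (fst v))) (up (case_nat t Var) i) = Some \<tau>"
      if "has v t \<sigma>" "case_nat (Some \<sigma>) (case_nat (Some \<sigma>) (env (fst v))) i = Some \<tau>" for v i \<tau>
      using that by (auto split: nat.splits simp: tyof_rename ht_def)
    have "lang w' ?S" by (rule extendsD(4)[OF w' LS])
    then have L': "wfe (case_nat (Some \<sigma>) (env (fst w'))) D"
      "wfe (case_nat (Some \<sigma>) (case_nat (Some \<sigma>) (env (fst w')))) (?D2 \<^bold>\<and> A)" by simp_all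
    have LE': "lang w' (Ex \<sigma> ?E)"
      by (unfold wfe.simps(8), rule wfe_subst[OF L'(2) ty[OF t]])
    have LD': "lang w' (inst D t)"
      by (rule wfe_subst[OF L'(1)]) (use t in \<open>auto split: nat.splits simp: ht_def\<close>)
    have "w' \<tturnstile> (inst D t \<^bold>\<longrightarrow> Ex \<sigma> ?E)"
    proof (rule forces_ImpI[OF extendsD(1)[OF w'] LD' LE'])
      fix w'' assume w'': "w' \<sqsubseteq> w''" and d: "w'' \<tturnstile> inst D t"
      from step[OF extends_trans[OF w' w''] extendsD(2)[OF w'' t] d] obtain y where y: "has w'' y \<sigma>"
        "w'' \<tturnstile> inst D y" "w'' \<tturnstile> subst_fm (case_nat y (case_nat t Var)) A" by auto
      have "inst (subst_fm (up (case_nat t Var)) ?D2) y = inst D y"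
        unfolding subst_fm_comp by (rule subst_fm_eqI) (simp split: nat.split)
      moreover have "inst (subst_fm (up (case_nat t Var)) A) y = subst_fm (case_nat y (case_nat t Var)) A"
        unfolding subst_fm_comp by (rule subst_fm_eqI) (simp split: nat.split)
      ultimately show "w'' \<tturnstile> Ex \<sigma> ?E"
        using y extendsD(1)[OF w''] extendsD(4)[OF w'' LE']
        by (intro forces_ExI[OF _ _ y(1)]) (simp_all add: forces_And)
    qed
    then show "w' \<tturnstile> inst (D \<^bold>\<longrightarrow> Ex \<sigma> (?D2 \<^bold>\<and> A)) t" by simp
  qed
  from forces_AllD[OF w forces_ImpD[OF w F this] x] have "w \<tturnstile> (inst D x \<^bold>\<longrightarrow> inst ?G x)" by simp
  from forces_ImpD[OF w this start]
  have "w \<tturnstile> Ex (Nt \<rightarrow> \<sigma>) (Var 0 \<bullet> zero \<^bold>= shift 1 x \<^bold>\<and> All Nt (subst_fm (up (up (case_nat x Var))) (?D3 \<^bold>\<and> ?A3)))"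
    by simp
  from forces_ExD[OF w this] obtain g where g: "has w g (Nt \<rightarrow> \<sigma>)" "w \<tturnstile> g \<bullet> zero \<^bold>= x"
    and all: "w \<tturnstile> All Nt (subst_fm (up (case_nat g Var)) (subst_fm (up (up (case_nat x Var))) (?D3 \<^bold>\<and> ?A3)))"
    by (auto simp: forces_And)
  have *: "w' \<tturnstile> inst D (g \<bullet> n) \<and> w' \<tturnstile> subst_fm (case_nat (g \<bullet> succ n) (case_nat (g \<bullet> n) Var)) A"
    if w': "w \<sqsubseteq> w'" and n: "has w' n Nt" for w' n
  proof -
    from forces_AllD[OF extendsD(1)[OF w'] extendsD(3)[OF w' all] n]
    have "w' \<tturnstile> inst (subst_fm (up (case_nat g Var)) (subst_fm (up (up (case_nat x Var))) ?D3)) n \<and>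
      w' \<tturnstile> inst (subst_fm (up (case_nat g Var)) (subst_fm (up (up (case_nat x Var))) ?A3)) n"
      using extendsD(1)[OF w'] by (simp add: forces_And)
    moreover have "inst (subst_fm (up (case_nat g Var)) (subst_fm (up (up (case_nat x Var))) ?D3)) n = inst D (g \<bullet> n)"
      unfolding subst_fm_comp by (rule subst_fm_eqI) (simp split: nat.split)
    moreover have "inst (subst_fm (up (case_nat g Var)) (subst_fm (up (up (case_nat x Var))) ?A3)) n =
        subst_fm (case_nat (g \<bullet> succ n) (case_nat (g \<bullet> n) Var)) A"
      unfolding subst_fm_comp by (rule subst_fm_eqI) (simp split: nat.split)
    ultimately show ?thesis by simp
  qed
  show thesis by (rule that[OF g]) (use * in blast)+
qed

section \<open>The second alternative implies omniscience principles\<close>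

definition all_zero :: "tm \<Rightarrow> tm \<Rightarrow> fm" where
  "all_zero a m = All Nt (le_n (Var 0) (shift 1 m) \<^bold>\<longrightarrow> shift 1 a \<bullet> Var 0 \<^bold>= zero)"

definition first_one :: "tm \<Rightarrow> tm \<Rightarrow> fm" where
  "first_one a n = (a \<bullet> n \<^bold>= num 1 \<^bold>\<and> All Nt (iota (Var 0) \<^bold>< iota (shift 1 n) \<^bold>\<longrightarrow> shift 1 a \<bullet> Var 0 \<^bold>= zero))"

definition approximates :: "tm \<Rightarrow> tm \<Rightarrow> tm \<Rightarrow> fm" where
  "approximates q x m = Ex Nt (All Nt (le_n (Var 1) (Var 0) \<^bold>\<longrightarrow>
     abs_q (shift 2 x \<bullet> Var 0 \<^bold>+ \<^bold>- shift 2 q) \<^bold>< eps_q (shift 2 m)))"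

text \<open>A rational approximation to the \<open>m\<close>-th term of the switched sequence. Reals
  are sequences of rationals, so choosing one such \<open>q\<close> for each \<open>m\<close>
  directly gives a representative of the limit.\<close>

definition switch :: "tm \<Rightarrow> tm \<Rightarrow> tm \<Rightarrow> tm \<Rightarrow> tm \<Rightarrow> fm" where
  "switch a z X m q = (all_zero a m \<^bold>\<and> approximates q z m \<^bold>\<or>
     Ex Nt (le_n (Var 0) (shift 1 m) \<^bold>\<and> first_one (shift 1 a) (Var 0) \<^bold>\<and>
       approximates (shift 1 q) (shift 1 X \<bullet> Var 0) (shift 1 m)))"

lemma subst_switch_parts [simp]:
  "subst_fm s (all_zero a m) = all_zero (subst_tm s a) (subst_tm s m)"
  "subst_fm s (first_one a m) = first_one (subst_tm s a) (subst_tm s m)"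
  "subst_fm s (approximates q x m) = approximates (subst_tm s q) (subst_tm s x) (subst_tm s m)"
  by (simp_all add: all_zero_def first_one_def approximates_def num_0 num_Suc)

lemma wfe_switch_parts [simp]:
  "ht e a (Nt \<rightarrow> Nt) \<Longrightarrow> ht e m Nt \<Longrightarrow> wfe e (all_zero a m)"
  "ht e a (Nt \<rightarrow> Nt) \<Longrightarrow> ht e m Nt \<Longrightarrow> wfe e (first_one a m)"
  "ht e q Qt \<Longrightarrow> ht e x Rt \<Longrightarrow> ht e m Nt \<Longrightarrow> wfe e (approximates q x m)"
  by (simp_all add: all_zero_def first_one_def approximates_def)

lemma approximatesD:
  assumes w [simp]: "world w" and [simp]: "has w q Qt" "has w x Rt" "has w m Nt"
    and A: "w \<tturnstile> approximates q x m"
  shows "ev w (\<lambda>w' j. \<bar>val w' (x \<bullet> j) - val w' q\<bar> < val w' (eps_q m))"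
proof -
  let ?A = "abs_q (shift 1 x \<bullet> Var 0 \<^bold>+ \<^bold>- (shift 1 q)) \<^bold>< eps_q (shift 1 m)"
  have "w \<tturnstile> Ex Nt (All Nt (le_n (Var 1) (Var 0) \<^bold>\<longrightarrow> subst_fm (case_nat (Var 0) (\<lambda>i. Var (i + 2))) ?A))"
    using A by (simp add: approximates_def)
  from forces_evD[OF w this] show ?thesis
  proof (rule ev_mono)
    fix w' n assume w': "w \<sqsubseteq> w'" and n [simp]: "has w' n Nt" and h: "w' \<tturnstile> inst ?A n"
    note [simp] = extendsD(1,2)[OF w']
    show "\<bar>val w' (x \<bullet> n) - val w' q\<bar> < val w' (eps_q m)" using h by (simp add: forces_Lt)
  qed
qed

lemma approximatesI:
  assumes w [simp]: "world w" and [simp]: "has w q Qt" "has w x Rt" "has w m Nt"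
    and ev: "ev w (\<lambda>w' j. \<bar>val w' (x \<bullet> j) - val w' q\<bar> < val w' (eps_q m))"
  shows "w \<tturnstile> approximates q x m"
proof -
  let ?A = "abs_q (shift 1 x \<bullet> Var 0 \<^bold>+ \<^bold>- (shift 1 q)) \<^bold>< eps_q (shift 1 m)"
  have "ev w (\<lambda>w' n. w' \<tturnstile> inst ?A n)"
  proof (rule ev_mono[OF ev])
    fix w' n assume w': "w \<sqsubseteq> w'" and n [simp]: "has w' n Nt"
      and h: "\<bar>val w' (x \<bullet> n) - val w' q\<bar> < val w' (eps_q m)"
    note [simp] = extendsD(1,2)[OF w']
    show "w' \<tturnstile> inst ?A n" using h by (simp add: forces_Lt)
  qed
  from forces_evI[OF w _ this] show ?thesis by (simp add: approximates_def)
qed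

lemma all_zeroD:
  assumes w [simp]: "world w" and A: "w \<tturnstile> all_zero a m" and [simp]: "has w m Nt" "has w n Nt"
    and le: "val w (iota n) \<le> val w (iota m)"
  shows "w \<tturnstile> a \<bullet> n \<^bold>= zero"
proof -
  have "w \<tturnstile> (le_n n m \<^bold>\<longrightarrow> a \<bullet> n \<^bold>= zero)"
    using forces_AllD[OF w A[unfolded all_zero_def], of n] by simp
  then show ?thesis by (rule forces_ImpD[OF w]) (use le in \<open>simp add: forces_le\<close>)
qed

lemma all_zeroI:
  assumes w [simp]: "world w" and [simp]: "has w a (Nt \<rightarrow> Nt)" "has w m Nt"
    and *: "\<And>w' n. w \<sqsubseteq> w' \<Longrightarrow> has w' n Nt \<Longrightarrow> val w' (iota n) \<le> val w' (iota m) \<Longrightarrow> w' \<tturnstile> a \<bullet> n \<^bold>= zero"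
  shows "w \<tturnstile> all_zero a m"
  unfolding all_zero_def
proof (rule forces_AllI[OF w])
  fix w' n assume w': "w \<sqsubseteq> w'" and n [simp]: "has w' n Nt"
  note [simp] = extendsD(1,2)[OF w']
  have "w' \<tturnstile> (le_n n m \<^bold>\<longrightarrow> a \<bullet> n \<^bold>= zero)"
  proof (rule forces_ImpI)
    fix w'' assume w'': "w' \<sqsubseteq> w''" and h: "w'' \<tturnstile> (le_n n m)"
    note [simp] = extendsD(1,2)[OF w'']
    show "w'' \<tturnstile> a \<bullet> n \<^bold>= zero"
      by (rule *[OF extends_trans[OF w' w'']]) (use h in \<open>simp_all add: forces_le\<close>)
  qed simp_all
  then show "w' \<tturnstile> inst (le_n (Var 0) (shift 1 m) \<^bold>\<longrightarrow> shift 1 a \<bullet> Var 0 \<^bold>= zero) n" by simp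
qed simp

lemma first_oneD:
  assumes w [simp]: "world w" and A: "w \<tturnstile> first_one a n" and [simp]: "has w n Nt"
  shows "w \<tturnstile> a \<bullet> n \<^bold>= num 1"
    "has w i Nt \<Longrightarrow> val w (iota i) < val w (iota n) \<Longrightarrow> w \<tturnstile> a \<bullet> i \<^bold>= zero"
proof -
  from A have 1: "w \<tturnstile> a \<bullet> n \<^bold>= num 1"
    and 2: "w \<tturnstile> All Nt (iota (Var 0) \<^bold>< iota (shift 1 n) \<^bold>\<longrightarrow> shift 1 a \<bullet> Var 0 \<^bold>= zero)"
    by (simp_all add: first_one_def forces_And)
  show "w \<tturnstile> a \<bullet> n \<^bold>= num 1" by (rule 1)
  show "w \<tturnstile> a \<bullet> i \<^bold>= zero" if [simp]: "has w i Nt" and lt: "val w (iota i) < val w (iota n)"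
  proof -
    have "w \<tturnstile> (iota i \<^bold>< iota n \<^bold>\<longrightarrow> a \<bullet> i \<^bold>= zero)" using forces_AllD[OF w 2, of i] by simp
    then show ?thesis by (rule forces_ImpD[OF w]) (use lt in \<open>simp add: forces_Lt\<close>)
  qed
qed

lemma first_oneI:
  assumes w [simp]: "world w" and [simp]: "has w a (Nt \<rightarrow> Nt)" "has w n Nt" and 1: "w \<tturnstile> a \<bullet> n \<^bold>= num 1"
    and *: "\<And>w' i. w \<sqsubseteq> w' \<Longrightarrow> has w' i Nt \<Longrightarrow> val w' (iota i) < val w' (iota n) \<Longrightarrow> w' \<tturnstile> a \<bullet> i \<^bold>= zero"
  shows "w \<tturnstile> first_one a n"
  unfolding first_one_def forces_And[OF w]
proof (intro conjI 1 forces_AllI[OF w])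
  fix w' i assume w': "w \<sqsubseteq> w'" and i [simp]: "has w' i Nt"
  note [simp] = extendsD(1,2)[OF w']
  have "w' \<tturnstile> (iota i \<^bold>< iota n \<^bold>\<longrightarrow> a \<bullet> i \<^bold>= zero)"
  proof (rule forces_ImpI)
    fix w'' assume w'': "w' \<sqsubseteq> w''" and h: "w'' \<tturnstile> iota i \<^bold>< iota n"
    note [simp] = extendsD(1,2)[OF w'']
    show "w'' \<tturnstile> a \<bullet> i \<^bold>= zero"
      by (rule *[OF extends_trans[OF w' w'']]) (use h in \<open>simp_all add: forces_Lt\<close>)
  qed simp_all
  then show "w' \<tturnstile> inst (iota (Var 0) \<^bold>< iota (shift 1 n) \<^bold>\<longrightarrow> shift 1 a \<bullet> Var 0 \<^bold>= zero) i" by simp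
qed simp

lemma zero_neq_one: "world w \<Longrightarrow> w \<tturnstile> t \<^bold>= zero \<Longrightarrow> w \<tturnstile> t \<^bold>= num 1 \<Longrightarrow> False"
proof -
  assume w [simp]: "world w" and h: "w \<tturnstile> t \<^bold>= zero" "w \<tturnstile> t \<^bold>= num 1"
  have "w \<tturnstile> zero \<^bold>= num 1" using forces_trans[OF w forces_sym[OF w h(1)] h(2)] .
  from nat_eq_val[OF w this] show False by simp
qed

lemma binaryD:
  assumes w [simp]: "world w" and B: "w \<tturnstile> binary a" and [simp]: "has w n Nt"
  shows "w \<tturnstile> a \<bullet> n \<^bold>= zero \<or> w \<tturnstile> a \<bullet> n \<^bold>= num 1"
  using forces_AllD[OF w B[unfolded binary_def], of n] forces_OrD[OF w] by simp

lemma app_cong: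
  "world w \<Longrightarrow> w \<tturnstile> n \<^bold>= m \<Longrightarrow> has w x (Nt \<rightarrow> \<sigma>) \<Longrightarrow> has w n Nt \<Longrightarrow> w \<tturnstile> x \<bullet> n \<^bold>= x \<bullet> m"
  by (rule forces_cong) (auto intro: forces_refl)

text \<open>Each entry of \<open>a\<close> is decided, so the search up to \<open>m\<close> is an
  induction in the system, and primeness of the world delivers its outcome.\<close>

lemma bounded_search:
  assumes w [simp]: "world w" and a [simp]: "has w a (Nt \<rightarrow> Nt)" and B: "w \<tturnstile> binary a" and m: "has w m Nt"
  shows "w \<tturnstile> all_zero a m \<or> (\<exists>n. has w n Nt \<and> val w (iota n) \<le> val w (iota m) \<and> w \<tturnstile> first_one a n)"
proof -
  let ?E = "\<lambda>m. Ex Nt (le_n (Var 0) (shift 1 m) \<^bold>\<and> first_one (shift 1 a) (Var 0))"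
  let ?A = "all_zero (shift 1 a) (Var 0) \<^bold>\<or> Ex Nt (le_n (Var 0) (Var 1) \<^bold>\<and> first_one (shift 2 a) (Var 0))"
  have E: "v \<tturnstile> ?E m \<longleftrightarrow> (\<exists>n. has v n Nt \<and> val v (iota n) \<le> val v (iota m) \<and> v \<tturnstile> first_one a n)"
    if [simp]: "world v" "has v m Nt" "has v a (Nt \<rightarrow> Nt)" for v m
  proof
    assume "v \<tturnstile> ?E m"
    then show "\<exists>n. has v n Nt \<and> val v (iota n) \<le> val v (iota m) \<and> v \<tturnstile> first_one a n"
      using forces_ExD[of v Nt "le_n (Var 0) (shift 1 m) \<^bold>\<and> first_one (shift 1 a) (Var 0)"]
      by (auto simp: forces_And forces_le)
  next
    assume "\<exists>n. has v n Nt \<and> val v (iota n) \<le> val v (iota m) \<and> v \<tturnstile> first_one a n"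
    then obtain n where n: "has v n Nt" "val v (iota n) \<le> val v (iota m)" "v \<tturnstile> first_one a n" by auto
    then show "v \<tturnstile> ?E m"
      by (intro forces_ExI[OF _ _ n(1)]) (simp_all add: forces_And forces_le)
  qed
  have A: "v \<tturnstile> inst ?A m \<longleftrightarrow> v \<tturnstile> all_zero a m \<or>
     (\<exists>n. has v n Nt \<and> val v (iota n) \<le> val v (iota m) \<and> v \<tturnstile> first_one a n)"
    if [simp]: "world v" "has v m Nt" "has v a (Nt \<rightarrow> Nt)" for v m
  proof -
    have "inst ?A m = (all_zero a m \<^bold>\<or> ?E m)" by simp
    then show ?thesis using E[OF that] by (simp add: forces_Or)
  qed
  have "w \<tturnstile> inst ?A m"
  proof (rule forces_induct[OF w _ m])
    from binaryD[OF w B, of zero] have "w \<tturnstile> a \<bullet> zero \<^bold>= zero \<or> w \<tturnstile> a \<bullet> zero \<^bold>= num 1" by simp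
    then have "w \<tturnstile> all_zero a zero \<or> (\<exists>n. has w n Nt \<and> val w (iota n) \<le> val w (iota zero) \<and> w \<tturnstile> first_one a n)"
    proof
      assume z: "w \<tturnstile> a \<bullet> zero \<^bold>= zero"
      have "w \<tturnstile> all_zero a zero"
      proof (rule all_zeroI)
        fix w' n assume w': "w \<sqsubseteq> w'" and n [simp]: "has w' n Nt" and le: "val w' (iota n) \<le> val w' (iota zero)"
        note [simp] = extendsD(1,2)[OF w']
        have "val w' (iota n) = val w' (iota zero)" using le by (intro antisym) simp_all
        then have "w' \<tturnstile> n \<^bold>= zero" by (intro nat_eqI) simp_all
        then show "w' \<tturnstile> a \<bullet> n \<^bold>= zero"
          using forces_trans[OF _ app_cong[of w' n zero a Nt] extendsD(3)[OF w' z]] by simp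
      qed simp_all
      then show ?thesis ..
    next
      assume z: "w \<tturnstile> a \<bullet> zero \<^bold>= num 1"
      have "w \<tturnstile> first_one a zero"
      proof (rule first_oneI)
        fix w' i assume "w \<sqsubseteq> w'" "has w' i Nt" "val w' (iota i) < val w' (iota zero)"
        then have False
          using nat_nonneg[OF extendsD(1), of w w' i] val_zero[OF extendsD(1), of w w'] by linarith
        then show "w' \<tturnstile> a \<bullet> i \<^bold>= zero" ..
      qed (use z in simp_all)
      then show ?thesis by (intro disjI2 exI[of _ zero]) simp
    qed
    then show "w \<tturnstile> inst ?A zero" using A by (simp del: subst_fm.simps)
  next
    fix w' n assume w': "w \<sqsubseteq> w'" and n [simp]: "has w' n Nt" and IH: "w' \<tturnstile> inst ?A n"
    note [simp] = extendsD(1,2)[OF w']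
    \<comment> \<open>By discreteness, an index up to \<open>n + 1\<close> is at most
      \<open>n\<close> or equal to \<open>n + 1\<close>.\<close>
    have below: "val w'' (iota i) \<le> val w'' (iota n) \<or> w'' \<tturnstile> i \<^bold>= succ n"
      if "w' \<sqsubseteq> w''" "has w'' i Nt" "val w'' (iota i) \<le> val w'' (iota (succ n))" for w'' i
      using nat_trichotomy[of w'' i "succ n"] that extendsD(1,2)[OF that(1)] by auto
    from IH have "w' \<tturnstile> all_zero a n \<or> (\<exists>k. has w' k Nt \<and> val w' (iota k) \<le> val w' (iota n) \<and> w' \<tturnstile> first_one a k)"
      using A by (simp del: subst_fm.simps)
    then have "w' \<tturnstile> all_zero a (succ n) \<or>
      (\<exists>k. has w' k Nt \<and> val w' (iota k) \<le> val w' (iota (succ n)) \<and> w' \<tturnstile> first_one a k)"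
    proof
      assume z: "w' \<tturnstile> all_zero a n"
      have zz: "w'' \<tturnstile> a \<bullet> i \<^bold>= zero" if "w' \<sqsubseteq> w''" "has w'' i Nt" "val w'' (iota i) \<le> val w'' (iota n)" for w'' i
        using all_zeroD[OF extendsD(1)[OF that(1)] extendsD(3)[OF that(1) z] extendsD(2)[OF that(1) n]] that by blast
      from binaryD[OF _ extendsD(3)[OF w' B], of "succ n"]
      have "w' \<tturnstile> a \<bullet> succ n \<^bold>= zero \<or> w' \<tturnstile> a \<bullet> succ n \<^bold>= num 1" by simp
      then show ?thesis
      proof
        assume s: "w' \<tturnstile> a \<bullet> succ n \<^bold>= zero"
        have "w' \<tturnstile> all_zero a (succ n)"
        proof (rule all_zeroI)
          fix w'' i assume w'': "w' \<sqsubseteq> w''" and i [simp]: "has w'' i Nt" and le: "val w'' (iota i) \<le> val w'' (iota (succ n))"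
          note [simp] = extendsD(1,2)[OF w'']
          from below[OF w'' i le] show "w'' \<tturnstile> a \<bullet> i \<^bold>= zero"
          proof
            assume "w'' \<tturnstile> i \<^bold>= succ n"
            then show ?thesis using forces_trans[OF _ app_cong[of w'' i "succ n" a Nt] extendsD(3)[OF w'' s]] by simp
          qed (use zz w'' in simp)
        qed simp_all
        then show ?thesis ..
      next
        assume s: "w' \<tturnstile> a \<bullet> succ n \<^bold>= num 1"
        have "w' \<tturnstile> first_one a (succ n)"
        proof (rule first_oneI)
          fix w'' i assume w'': "w' \<sqsubseteq> w''" and i [simp]: "has w'' i Nt" and lt: "val w'' (iota i) < val w'' (iota (succ n))"
          note [simp] = extendsD(1,2)[OF w'']
          from below[OF w'' i] lt have "val w'' (iota i) \<le> val w'' (iota n)"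
            using nat_eq_val[of w'' i "succ n"] by auto
          then show "w'' \<tturnstile> a \<bullet> i \<^bold>= zero" using zz w'' by simp
        qed (use s in simp_all)
        then show ?thesis by (intro disjI2 exI[of _ "succ n"]) simp
      qed
    next
      assume "\<exists>k. has w' k Nt \<and> val w' (iota k) \<le> val w' (iota n) \<and> w' \<tturnstile> first_one a k"
      then obtain k where "has w' k Nt" "val w' (iota k) \<le> val w' (iota n)" "w' \<tturnstile> first_one a k" by blast
      then show ?thesis by (intro disjI2 exI[of _ k]) simp
    qed
    then show "w' \<tturnstile> inst ?A (succ n)" using A by (simp del: subst_fm.simps)
  qed simp
  then show ?thesis using A m by (simp del: subst_fm.simps)
qed

lemma first_one_unique:
  assumes w [simp]: "world w" and ty: "has w n Nt" "has w m Nt"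
    and f: "w \<tturnstile> first_one a n" "w \<tturnstile> first_one a m"
  shows "w \<tturnstile> n \<^bold>= m"
proof -
  have *: False if "has w i Nt" "has w j Nt" "w \<tturnstile> first_one a i" "w \<tturnstile> first_one a j"
    "val w (iota i) < val w (iota j)" for i j
    using zero_neq_one[OF w first_oneD(2)[OF w that(4,2,1,5)] first_oneD(1)[OF w that(3,1)]] .
  show ?thesis
    using nat_trichotomy[OF w ty] *[OF ty f] *[OF ty(2,1) f(2,1)] by auto
qed

lemma first_one_not_all_zero:
  assumes w [simp]: "world w" and [simp]: "has w n Nt" "has w m Nt" and "val w (iota n) \<le> val w (iota m)"
    and "w \<tturnstile> first_one a n" "w \<tturnstile> all_zero a m"
  shows False
  using zero_neq_one[OF w all_zeroD[OF w assms(6)] first_oneD(1)[OF w assms(5)]] assms by simp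

section \<open>The limit of the switched sequence\<close>

text \<open>All hypotheses persist to extensions, so that every fact shown in \<open>w\<close> can
  be reinterpreted in a later world by means of \<open>up\<close>.\<close>

locale switching =
  fixes w X z a y
  assumes w [simp]: "world w" and X [simp]: "has w X (Nt \<rightarrow> Rt)" and z [simp]: "has w z Rt"
    and a [simp]: "has w a (Nt \<rightarrow> Nt)" and y [simp]: "has w y Rt"
    and z01: "w \<tturnstile> in01 z" and X01: "w \<tturnstile> All Nt (in01 (shift 1 X \<bullet> Var 0))"
    and conv: "w \<tturnstile> rconv X z" and bin: "w \<tturnstile> binary a"
    and sw: "\<And>w' n. w \<sqsubseteq> w' \<Longrightarrow> has w' n Nt \<Longrightarrow> w' \<tturnstile> switch a z X n (y \<bullet> n)"
begin

lemma up: "w \<sqsubseteq> w' \<Longrightarrow> switching w' X z a y"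
proof (rule switching.intro)
  assume w': "w \<sqsubseteq> w'"
  note e = extendsD[OF w']
  show "world w'" by (rule e(1))
  show "has w' X (Nt \<rightarrow> Rt)" "has w' z Rt" "has w' a (Nt \<rightarrow> Nt)" "has w' y Rt"
    by (rule e(2), simp)+
  show "w' \<tturnstile> in01 z" "w' \<tturnstile> All Nt (in01 (shift 1 X \<bullet> Var 0))" "w' \<tturnstile> rconv X z" "w' \<tturnstile> binary a"
    by (rule e(3), rule z01 X01 conv bin)+
  show "w'' \<tturnstile> switch a z X n (y \<bullet> n)" if "w' \<sqsubseteq> w''" "has w'' n Nt" for w'' n
    by (rule sw[OF extends_trans[OF w' that(1)] that(2)])
qed

lemma X_in01: "has w n Nt \<Longrightarrow> w \<tturnstile> in01 (X \<bullet> n)"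
  using forces_AllD[OF w X01, of n] by simp

text \<open>\<open>y \<bullet> m\<close> approximates a genuine point \<open>W\<close> of the unit
  interval, whichever way the search up to \<open>m\<close> ends.\<close>

lemma pick:
  assumes m [simp]: "has w m Nt"
  obtains W where "has w W Rt" "w \<tturnstile> in01 W"
    "w \<tturnstile> all_zero a m \<and> W = z \<or>
     (\<exists>n. has w n Nt \<and> val w (iota n) \<le> val w (iota m) \<and> w \<tturnstile> first_one a n \<and> W = X \<bullet> n)"
    "ev w (\<lambda>w' j. \<bar>val w' (W \<bullet> j) - val w' (y \<bullet> m)\<bar> < val w' (eps_q m))"
proof -
  let ?A = "le_n (Var 0) (shift 1 m) \<^bold>\<and> first_one (shift 1 a) (Var 0) \<^bold>\<and>
       approximates (shift 1 (y \<bullet> m)) (shift 1 X \<bullet> Var 0) (shift 1 m)"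
  from forces_OrD[OF w sw[OF _ m, unfolded switch_def]]
  consider "w \<tturnstile> (all_zero a m \<^bold>\<and> approximates (y \<bullet> m) z m)" | "w \<tturnstile> Ex Nt ?A" by auto
  then show thesis
  proof cases
    case 1
    then show thesis using approximatesD[OF w, of "y \<bullet> m" z m] z01
      by (intro that[of z]) (simp_all add: forces_And)
  next
    case 2
    from forces_ExD[OF w 2] obtain n where n [simp]: "has w n Nt" and
      h: "val w (iota n) \<le> val w (iota m)" "w \<tturnstile> first_one a n" "w \<tturnstile> approximates (y \<bullet> m) (X \<bullet> n) m"
      by (auto simp: forces_And forces_le)
    show thesis
      by (rule that[of "X \<bullet> n"]) (use approximatesD[OF w _ _ m h(3)] X_in01[OF n] h n in auto)
  qed
qed

text \<open>Carries a bound on the precision through two successive extensions: the one in which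
  \<open>m\<close> appears and the one in which the bound is used.\<close>

lemma eps_below:
  assumes "has w N Nt" "has w d Qt" "val w (eps_q N) < val w d" "w \<sqsubseteq> w'" "has w' m Nt"
    "val w' (iota N) \<le> val w' (iota m)" "w' \<sqsubseteq> w''"
  shows "val w'' (eps_q m) < val w'' d"
proof -
  note [simp] = assms(1,2,5) extendsD(1,2)[OF assms(4)] extendsD(1,2)[OF assms(7)]
  have "val w' (eps_q m) \<le> val w' (eps_q N)" by (rule eps_antimono) (use assms in simp_all)
  moreover have "val w' (eps_q N) < val w' d" by (rule extends_val(1)[OF w assms(4)]) (use assms in simp_all)
  ultimately have "val w' (eps_q m) < val w' d" by (rule le_less_trans)
  then show ?thesis by (intro extends_val(1)[OF _ assms(7)]) simp_all
qed

text \<open>From the first one on the switch has settled: the index of the first one is unique, so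
  the approximated point equals \<open>X \<bullet> n\<close>.\<close>

lemma close_first:
  assumes n [simp]: "has w n Nt" and m [simp]: "has w m Nt" and f: "w \<tturnstile> first_one a n"
    and le: "val w (iota n) \<le> val w (iota m)"
  shows "ev w (\<lambda>w' j. \<bar>val w' (X \<bullet> n \<bullet> j) - val w' (y \<bullet> m)\<bar> < val w' (eps_q m))"
proof -
  from pick[OF m] obtain W where W: "has w W Rt" "w \<tturnstile> in01 W"
    "w \<tturnstile> all_zero a m \<and> W = z \<or>
     (\<exists>n. has w n Nt \<and> val w (iota n) \<le> val w (iota m) \<and> w \<tturnstile> first_one a n \<and> W = X \<bullet> n)"
    "ev w (\<lambda>w' j. \<bar>val w' (W \<bullet> j) - val w' (y \<bullet> m)\<bar> < val w' (eps_q m))" .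
  have "\<not> w \<tturnstile> all_zero a m" using first_one_not_all_zero[OF w n m le f] by blast
  with W(3) obtain n' where n' [simp]: "has w n' Nt" and f': "w \<tturnstile> first_one a n'" and W': "W = X \<bullet> n'" by auto
  have eq: "w \<tturnstile> X \<bullet> n' \<^bold>= X \<bullet> n" by (rule app_cong[OF w first_one_unique[OF w n' n f' f] X n'])
  show ?thesis
  proof (rule ev_mono[OF W(4)])
    fix w' j assume w': "w \<sqsubseteq> w'" and j [simp]: "has w' j Nt"
      and h: "\<bar>val w' (W \<bullet> j) - val w' (y \<bullet> m)\<bar> < val w' (eps_q m)"
    note [simp] = extendsD(1,2)[OF w']
    have "val w' (X \<bullet> n' \<bullet> j) = val w' (X \<bullet> n \<bullet> j)"
      by (rule val_eqI[OF _ forces_cong_fun[where \<sigma> = Nt and \<tau> = Qt, OF _ extendsD(3)[OF w' eq] _ j]]) simp_all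
    then show "\<bar>val w' (X \<bullet> n \<bullet> j) - val w' (y \<bullet> m)\<bar> < val w' (eps_q m)" using h W' by simp
  qed
qed

text \<open>\<open>N\<close> is chosen from the convergence of \<open>X\<close> and from
  \<open>d\<close>, before anything is known about \<open>a\<close>. If \<open>a\<close> vanishes up
  to \<open>N\<close>, a later first one at \<open>n\<close> has \<open>n > N\<close>, and
  \<open>X \<bullet> n\<close> is within \<open>d\<close> of \<open>z\<close>; the approximation
  adds less than another \<open>d\<close>.\<close>

lemma close_zero:
  assumes d [simp]: "has w d Qt" and pos: "0 < val w d"
  obtains N where "has w N Nt" "val w (eps_q N) < val w d"
    "\<And>w' m. w \<sqsubseteq> w' \<Longrightarrow> has w' m Nt \<Longrightarrow> val w' (iota N) \<le> val w' (iota m) \<Longrightarrow> w' \<tturnstile> all_zero a N \<Longrightarrow>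
       ev w' (\<lambda>w'' j. \<bar>val w'' (z \<bullet> j) - val w'' (y \<bullet> m)\<bar> < 2 * val w'' d)"
proof -
  from rconvD[OF w X z conv d pos] obtain N1 where N1 [simp]: "has w N1 Nt" and
    N1c: "\<And>w' n. w \<sqsubseteq> w' \<Longrightarrow> has w' n Nt \<Longrightarrow> val w' (iota N1) \<le> val w' (iota n) \<Longrightarrow>
      ev w' (\<lambda>w'' m. \<bar>val w'' (X \<bullet> n \<bullet> m) - val w'' (z \<bullet> m)\<bar> < val w'' d)"
    unfolding ev_def[of w] by blast
  obtain K where K [simp]: "has w K Nt" and Kd: "val w (eps_q K) < val w d"
    by (rule eps_archimedean[OF w d pos])
  obtain N where N [simp]: "has w N Nt" and le: "val w (iota N1) \<le> val w (iota N)" "val w (iota K) \<le> val w (iota N)"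
    by (rule nat_max[OF w N1 K])
  have Nd: "val w (eps_q N) < val w d" using eps_antimono[OF w K N le(2)] Kd by simp
  show thesis
  proof (rule that[OF N Nd])
    fix w' m assume w': "w \<sqsubseteq> w'" and m [simp]: "has w' m Nt" and Nm: "val w' (iota N) \<le> val w' (iota m)"
      and all0: "w' \<tturnstile> all_zero a N"
    note [simp] = extendsD(1,2)[OF w']
    interpret w': switching w' X z a y by (rule up[OF w'])
    from w'.pick[OF m] obtain W where W: "has w' W Rt" "w' \<tturnstile> in01 W"
      "w' \<tturnstile> all_zero a m \<and> W = z \<or>
       (\<exists>n. has w' n Nt \<and> val w' (iota n) \<le> val w' (iota m) \<and> w' \<tturnstile> first_one a n \<and> W = X \<bullet> n)"
      "ev w' (\<lambda>w'' j. \<bar>val w'' (W \<bullet> j) - val w'' (y \<bullet> m)\<bar> < val w'' (eps_q m))" .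
    have em: "val w'' (eps_q m) < val w'' d" if "w' \<sqsubseteq> w''" for w''
      by (rule eps_below[OF N d Nd w' m Nm that])
    have pd: "0 < val w'' d" if "w' \<sqsubseteq> w''" for w''
      by (rule val_pos_up[OF w extends_trans[OF w' that] d pos])
    from W(3) show "ev w' (\<lambda>w'' j. \<bar>val w'' (z \<bullet> j) - val w'' (y \<bullet> m)\<bar> < 2 * val w'' d)"
    proof (elim disjE exE conjE)
      assume "W = z"
      show ?thesis
      proof (rule ev_mono[OF W(4)])
        fix w'' j assume w'': "w' \<sqsubseteq> w''" and "\<bar>val w'' (W \<bullet> j) - val w'' (y \<bullet> m)\<bar> < val w'' (eps_q m)"
        then show "\<bar>val w'' (z \<bullet> j) - val w'' (y \<bullet> m)\<bar> < 2 * val w'' d"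
          using em[OF w''] pd[OF w''] unfolding \<open>W = z\<close> abs_less_iff by linarith
      qed
    next
      fix n assume n [simp]: "has w' n Nt" and f: "w' \<tturnstile> first_one a n" and W': "W = X \<bullet> n"
      have "\<not> val w' (iota n) \<le> val w' (iota N)"
        using first_one_not_all_zero[OF _ n _ _ f all0] by auto
      moreover have "val w' (iota N1) \<le> val w' (iota N)" by (rule extends_val(2)[OF w w' _ _ le(1)]) simp_all
      ultimately have "val w' (iota N1) \<le> val w' (iota n)" by linarith
      from ev_conj[OF extendsD(1)[OF w'] W(4) N1c[OF w' n this]] show ?thesis
      proof (rule ev_mono)
        fix w'' j assume w'': "w' \<sqsubseteq> w''" and "\<bar>val w'' (W \<bullet> j) - val w'' (y \<bullet> m)\<bar> < val w'' (eps_q m) \<and>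
          \<bar>val w'' (X \<bullet> n \<bullet> j) - val w'' (z \<bullet> j)\<bar> < val w'' d"
        then show "\<bar>val w'' (z \<bullet> j) - val w'' (y \<bullet> m)\<bar> < 2 * val w'' d"
          using em[OF w''] unfolding W' abs_less_iff by linarith
      qed
    qed
  qed
qed

text \<open>Bounded search up to the index from \<open>close_zero\<close> settles whether the tail
  of \<open>y\<close> is near \<open>z\<close> or near one \<open>X \<bullet> n\<close>; a rational
  near that point serves for \<open>y\<close>.\<close>

lemma near_rational:
  assumes [simp]: "has w d Qt" and pos: "0 < val w d"
  shows "\<exists>c. has w c Qt \<and> ev w (\<lambda>w' n. \<bar>val w' (y \<bullet> n) - val w' c\<bar> < val w' d)"
proof -
  let ?e = "d \<^bold>* inv_q (qnum 4)"
  have e: "has w ?e Qt" "0 < val w ?e" using pos by simp_all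
  have ed: "4 * val w' ?e = val w' d" "0 < val w' ?e" if "w \<sqsubseteq> w'" for w'
    using val_pos_up[OF w that e] extendsD(1,2)[OF that] by simp_all
  obtain N where N [simp]: "has w N Nt" and Ne: "val w (eps_q N) < val w ?e" and
    cz: "\<And>w' m. w \<sqsubseteq> w' \<Longrightarrow> has w' m Nt \<Longrightarrow> val w' (iota N) \<le> val w' (iota m) \<Longrightarrow> w' \<tturnstile> all_zero a N \<Longrightarrow>
       ev w' (\<lambda>w'' j. \<bar>val w'' (z \<bullet> j) - val w'' (y \<bullet> m)\<bar> < 2 * val w'' ?e)"
    by (rule close_zero[OF e]) (rule that; blast)
  from bounded_search[OF w a bin N] show ?thesis
  proof (elim disjE exE conjE)
    assume all0: "w \<tturnstile> all_zero a N"
    obtain c where c [simp]: "has w c Qt" and ev: "ev w (\<lambda>w' n. \<bar>val w' (z \<bullet> n) - val w' c\<bar> < val w' ?e)"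
      by (rule is_realD[OF w z in01D(1)[OF w z01] e])
    show ?thesis
    proof (rule exI[of _ c], rule conjI[OF c], rule evI[OF N])
      fix w' m assume w': "w \<sqsubseteq> w'" and m: "has w' m Nt" "val w' (iota N) \<le> val w' (iota m)"
      have [simp]: "world w'" by (rule extendsD(1)[OF w'])
      from ev_ex[OF _ ev_conj[OF _ ev_up[OF ev w'] cz[OF w' m extendsD(3)[OF w' all0]]]]
      obtain j where "\<bar>val w' (z \<bullet> j) - val w' c\<bar> < val w' ?e \<and>
        \<bar>val w' (z \<bullet> j) - val w' (y \<bullet> m)\<bar> < 2 * val w' ?e" by auto
      then show "\<bar>val w' (y \<bullet> m) - val w' c\<bar> < val w' d"
        using ed[OF w'] unfolding abs_less_iff by linarith
    qed
  next
    fix n assume n [simp]: "has w n Nt" and nN: "val w (iota n) \<le> val w (iota N)" and f: "w \<tturnstile> first_one a n"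
    obtain c where c [simp]: "has w c Qt" and ev: "ev w (\<lambda>w' j. \<bar>val w' (X \<bullet> n \<bullet> j) - val w' c\<bar> < val w' ?e)"
      by (rule is_realD[OF w _ in01D(1)[OF w X_in01[OF n]] e]) simp
    show ?thesis
    proof (rule exI[of _ c], rule conjI[OF c], rule evI[OF N])
      fix w' m assume w': "w \<sqsubseteq> w'" and m: "has w' m Nt" and Nm: "val w' (iota N) \<le> val w' (iota m)"
      note [simp] = extendsD(1,2)[OF w']
      interpret w': switching w' X z a y by (rule up[OF w'])
      have "val w' (iota n) \<le> val w' (iota N)" by (rule extends_val(2)[OF w w' _ _ nN]) simp_all
      then have "ev w' (\<lambda>w'' j. \<bar>val w'' (X \<bullet> n \<bullet> j) - val w'' (y \<bullet> m)\<bar> < val w'' (eps_q m))"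
        by (intro w'.close_first[OF _ m extendsD(3)[OF w' f]]) (use Nm in simp_all)
      from ev_ex[OF _ ev_conj[OF _ ev_up[OF ev w'] this]]
      obtain j where "\<bar>val w' (X \<bullet> n \<bullet> j) - val w' c\<bar> < val w' ?e \<and>
        \<bar>val w' (X \<bullet> n \<bullet> j) - val w' (y \<bullet> m)\<bar> < val w' (eps_q m)" by auto
      then show "\<bar>val w' (y \<bullet> m) - val w' c\<bar> < val w' d"
        using ed[OF w'] eps_below[OF N e(1) Ne w' m Nm, of w'] unfolding abs_less_iff by simp
    qed
  qed
qed

lemma real_y: "w \<tturnstile> is_real y"
  by (rule is_realI[OF w y]) (rule switching.near_rational[OF up])

text \<open>Entries of \<open>y\<close> are compared with the tail of \<open>Y\<close>, not with the
  entry of the same index; a rational centre of the real \<open>Y\<close> bridges the two.\<close>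

lemma close_limit:
  assumes n [simp]: "has w n Nt" and [simp]: "has w Y Rt" and Y: "w \<tturnstile> is_real Y" and d [simp]: "has w d Qt" and pos: "0 < val w d"
    and cl: "\<And>w' m. w \<sqsubseteq> w' \<Longrightarrow> has w' m Nt \<Longrightarrow> val w' (iota n) \<le> val w' (iota m) \<Longrightarrow>
       ev w' (\<lambda>w'' j. \<bar>val w'' (Y \<bullet> j) - val w'' (y \<bullet> m)\<bar> < 2 * val w'' (d \<^bold>* inv_q (qnum 4)))"
  shows "ev w (\<lambda>w' m. \<bar>val w' (y \<bullet> m) - val w' (Y \<bullet> m)\<bar> < val w' d)"
proof -
  let ?e = "d \<^bold>* inv_q (qnum 4)"
  have e: "has w ?e Qt" "0 < val w ?e" using pos by simp_all
  have ed: "4 * val w' ?e = val w' d" "0 < val w' ?e" if "w \<sqsubseteq> w'" for w'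
    using val_pos_up[OF w that e] extendsD(1,2)[OF that] by simp_all
  obtain c where c [simp]: "has w c Qt" and ev: "ev w (\<lambda>w' n. \<bar>val w' (Y \<bullet> n) - val w' c\<bar> < val w' ?e)"
    by (rule is_realD[OF w _ Y e]) simp
  show ?thesis
  proof (rule ev_mono[OF ev_conj[OF w ev ev_ge[OF n]]])
    fix w' m assume w': "w \<sqsubseteq> w'" and [simp]: "world w'" and m [simp]: "has w' m Nt"
      and h: "\<bar>val w' (Y \<bullet> m) - val w' c\<bar> < val w' ?e \<and> val w' (iota n) \<le> val w' (iota m)"
    from ev_ex[OF _ ev_conj[OF _ ev_up[OF ev w'] cl[OF w' m]]] h
    obtain j where "\<bar>val w' (Y \<bullet> j) - val w' c\<bar> < val w' ?e \<and>
      \<bar>val w' (Y \<bullet> j) - val w' (y \<bullet> m)\<bar> < 2 * val w' ?e" by auto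
    then show "\<bar>val w' (y \<bullet> m) - val w' (Y \<bullet> m)\<bar> < val w' d"
      using ed[OF w'] h unfolding abs_less_iff by linarith
  qed
qed

lemma eventually_near_first:
  assumes n [simp]: "has w n Nt" and f: "w \<tturnstile> first_one a n" and d [simp]: "has w d Qt" and pos: "0 < val w d"
  shows "ev w (\<lambda>w' m. \<bar>val w' (y \<bullet> m) - val w' (X \<bullet> n \<bullet> m)\<bar> < val w' d)"
proof -
  let ?e = "d \<^bold>* inv_q (qnum 4)"
  have e: "has w ?e Qt" "0 < val w ?e" using pos by simp_all
  obtain K where K [simp]: "has w K Nt" and Ke: "val w (eps_q K) < val w ?e"
    by (rule eps_archimedean[OF w e])
  obtain M where M: "has w M Nt" and le: "val w (iota n) \<le> val w (iota M)" "val w (iota K) \<le> val w (iota M)"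
    by (rule nat_max[OF w n K])
  have Me: "val w (eps_q M) < val w ?e" using eps_antimono[OF w K M le(2)] Ke by (rule le_less_trans)
  show ?thesis
  proof (rule close_limit[OF M _ in01D(1)[OF w X_in01[OF n]] d pos])
    fix w' m assume w': "w \<sqsubseteq> w'" and m: "has w' m Nt" and Mm: "val w' (iota M) \<le> val w' (iota m)"
    note [simp] = extendsD(1,2)[OF w']
    interpret w': switching w' X z a y by (rule up[OF w'])
    have "val w' (iota n) \<le> val w' (iota M)" by (rule extends_val(2)[OF w w' _ _ le(1)]) (simp_all add: M)
    then have "ev w' (\<lambda>w'' j. \<bar>val w'' (X \<bullet> n \<bullet> j) - val w'' (y \<bullet> m)\<bar> < val w'' (eps_q m))"
      by (intro w'.close_first[OF _ m extendsD(3)[OF w' f]]) (use Mm in simp_all)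
    then show "ev w' (\<lambda>w'' j. \<bar>val w'' (X \<bullet> n \<bullet> j) - val w'' (y \<bullet> m)\<bar> < 2 * val w'' ?e)"
    proof (rule ev_mono)
      fix w'' j assume w'': "w' \<sqsubseteq> w''" and "\<bar>val w'' (X \<bullet> n \<bullet> j) - val w'' (y \<bullet> m)\<bar> < val w'' (eps_q m)"
      then show "\<bar>val w'' (X \<bullet> n \<bullet> j) - val w'' (y \<bullet> m)\<bar> < 2 * val w'' ?e"
        using eps_below[OF M e(1) Me w' m Mm w''] val_pos_up[OF w extends_trans[OF w' w''] e] by linarith
    qed
  qed simp
qed

lemma req_first: "has w n Nt \<Longrightarrow> w \<tturnstile> first_one a n \<Longrightarrow> w \<tturnstile> req y (X \<bullet> n)"
proof (rule reqI[OF w y])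
  fix w' d assume n: "has w n Nt" and f: "w \<tturnstile> first_one a n" and w': "w \<sqsubseteq> w'" and d: "has w' d Qt" "0 < val w' d"
  show "ev w' (\<lambda>w'' m. \<bar>val w'' (y \<bullet> m) - val w'' (X \<bullet> n \<bullet> m)\<bar> < val w'' d)"
    by (rule switching.eventually_near_first[OF up[OF w'] extendsD(2)[OF w' n] extendsD(3)[OF w' f] d])
qed simp

lemma eventually_near_z:
  assumes A: "w \<tturnstile> All Nt (shift 1 a \<bullet> Var 0 \<^bold>= zero)" and d [simp]: "has w d Qt" and pos: "0 < val w d"
  shows "ev w (\<lambda>w' m. \<bar>val w' (y \<bullet> m) - val w' (z \<bullet> m)\<bar> < val w' d)"
proof -
  let ?e = "d \<^bold>* inv_q (qnum 4)"
  have e: "has w ?e Qt" "0 < val w ?e" using pos by simp_all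
  obtain N where N [simp]: "has w N Nt" and Ne: "val w (eps_q N) < val w ?e" and
    cz: "\<And>w' m. w \<sqsubseteq> w' \<Longrightarrow> has w' m Nt \<Longrightarrow> val w' (iota N) \<le> val w' (iota m) \<Longrightarrow> w' \<tturnstile> all_zero a N \<Longrightarrow>
       ev w' (\<lambda>w'' j. \<bar>val w'' (z \<bullet> j) - val w'' (y \<bullet> m)\<bar> < 2 * val w'' ?e)"
    by (rule close_zero[OF e]) (rule that; blast)
  have all0: "w \<tturnstile> all_zero a N"
  proof (rule all_zeroI[OF w a N])
    fix w' n assume w': "w \<sqsubseteq> w'" and n: "has w' n Nt"
    from forces_AllD[OF extendsD(1)[OF w'] extendsD(3)[OF w' A] n] show "w' \<tturnstile> a \<bullet> n \<^bold>= zero" by simp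
  qed
  show ?thesis
    by (rule close_limit[OF N z in01D(1)[OF w z01] d pos]) (rule cz, assumption+, rule extendsD(3)[OF _ all0])
qed

lemma req_zero: "w \<tturnstile> All Nt (shift 1 a \<bullet> Var 0 \<^bold>= zero) \<Longrightarrow> w \<tturnstile> req y z"
proof (rule reqI[OF w y z])
  fix w' d assume A: "w \<tturnstile> All Nt (shift 1 a \<bullet> Var 0 \<^bold>= zero)" and w': "w \<sqsubseteq> w'" and d: "has w' d Qt" "0 < val w' d"
  show "ev w' (\<lambda>w'' m. \<bar>val w'' (y \<bullet> m) - val w'' (z \<bullet> m)\<bar> < val w'' d)"
    by (rule switching.eventually_near_z[OF up[OF w'] extendsD(3)[OF w' A] d])
qed

text \<open>Weak inequalities are negated strict ones, so only \<open>y < 0\<close> and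
  \<open>1 < y\<close> have to be refuted: an entry beyond the margin would put a nearby point
  \<open>W\<close> of the unit interval outside of it.\<close>

lemma in01_y: "w \<tturnstile> in01 y"
proof (rule in01I[OF w real_y])
  have *: "\<not> w' \<tturnstile> rlt y r0 \<and> \<not> w' \<tturnstile> rlt r1 y" if w': "w \<sqsubseteq> w'" for w'
  proof -
    note [simp] = extendsD(1,2)[OF w']
    interpret w': switching w' X z a y by (rule up[OF w'])
    \<comment> \<open>An index at which \<open>P\<close> holds and the entry of \<open>y\<close> is
      within \<open>d/2\<close> of a point of the unit interval.\<close>
    have gap: "\<exists>m W. has w' m Nt \<and> P w' m \<and> has w' W Rt \<and> w' \<tturnstile> in01 W \<and>
        ev w' (\<lambda>w'' j. \<bar>val w'' (W \<bullet> j) - val w'' (y \<bullet> m)\<bar> < val w'' (d \<^bold>* inv_q (qnum 2)))"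
      if ev: "ev w' P" and d [simp]: "has w' d Qt" and pos: "0 < val w' d" for P d
    proof -
      let ?e = "d \<^bold>* inv_q (qnum 2)"
      have e: "has w' ?e Qt" "0 < val w' ?e" using pos by simp_all
      obtain K where K [simp]: "has w' K Nt" and Ke: "val w' (eps_q K) < val w' ?e"
        by (rule eps_archimedean[OF _ e]) simp
      from ev_ex[OF _ ev_conj[OF _ ev ev_ge[OF K]]] obtain m where m: "has w' m Nt" "P w' m"
        "val w' (iota K) \<le> val w' (iota m)" by auto
      obtain W where W: "has w' W Rt" "w' \<tturnstile> in01 W"
        "ev w' (\<lambda>w'' j. \<bar>val w'' (W \<bullet> j) - val w'' (y \<bullet> m)\<bar> < val w'' (eps_q m))"
        by (rule w'.pick[OF m(1)]) (rule that)
      have "ev w' (\<lambda>w'' j. \<bar>val w'' (W \<bullet> j) - val w'' (y \<bullet> m)\<bar> < val w'' ?e)"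
      proof (rule ev_mono[OF W(3)])
        fix w'' j assume w'': "w' \<sqsubseteq> w''" and "\<bar>val w'' (W \<bullet> j) - val w'' (y \<bullet> m)\<bar> < val w'' (eps_q m)"
        then show "\<bar>val w'' (W \<bullet> j) - val w'' (y \<bullet> m)\<bar> < val w'' ?e"
          using w'.eps_below[OF K e(1) Ke extends_refl m(1,3) w''] by simp
      qed
      then show ?thesis using m W by blast
    qed
    have "\<not> w' \<tturnstile> rlt y r0"
    proof
      assume "w' \<tturnstile> rlt y r0"
      then obtain d where d [simp]: "has w' d Qt" "0 < val w' d" and
        ev: "ev w' (\<lambda>w'' n. has w'' d Qt \<and> 0 < val w'' d \<and> val w'' (y \<bullet> n) + val w'' d < val w'' (r0 \<bullet> n))"
        by (rule rltD[rotated 3]) simp_all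
      let ?e = "d \<^bold>* inv_q (qnum 2)"
      from gap[OF ev d] obtain m W where m [simp]: "has w' m Nt" and W [simp]: "has w' W Rt" and W01: "w' \<tturnstile> in01 W"
        and lt: "val w' (y \<bullet> m) + val w' d < val w' (r0 \<bullet> m)"
        and cl: "ev w' (\<lambda>w'' j. \<bar>val w'' (W \<bullet> j) - val w'' (y \<bullet> m)\<bar> < val w'' ?e)" by auto
      have lt': "val w' (y \<bullet> m \<^bold>+ (?e \<^bold>+ ?e)) < val w' (iota zero)" using lt by simp
      have "w' \<tturnstile> rlt W r0"
      proof (rule rltI[of w' W r0 ?e])
        show "ev w' (\<lambda>w'' n. val w'' (W \<bullet> n) + val w'' ?e < val w'' (r0 \<bullet> n))"
        proof (rule ev_mono[OF cl])
          fix w'' j assume w'': "w' \<sqsubseteq> w''" and j [simp]: "has w'' j Nt"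
            and h: "\<bar>val w'' (W \<bullet> j) - val w'' (y \<bullet> m)\<bar> < val w'' ?e"
          note [simp] = extendsD(1,2)[OF w'']
          have "val w'' (y \<bullet> m \<^bold>+ (?e \<^bold>+ ?e)) < val w'' (iota zero)" by (rule extends_val(1)[OF _ w'' _ _ lt']) simp_all
          then have "val w'' (y \<bullet> m) + (val w'' ?e + val w'' ?e) < 0" by (simp del: val_div_num)
          then show "val w'' (W \<bullet> j) + val w'' ?e < val w'' (r0 \<bullet> j)"
            using h unfolding abs_less_iff by (simp del: val_div_num)
        qed
      qed simp_all
      then show False using rleD[OF _ in01D(2)[OF _ W01], of w'] by simp
    qed
    moreover have "\<not> w' \<tturnstile> rlt r1 y"
    proof
      assume "w' \<tturnstile> rlt r1 y"
      then obtain d where d [simp]: "has w' d Qt" "0 < val w' d" and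
        ev: "ev w' (\<lambda>w'' n. has w'' d Qt \<and> 0 < val w'' d \<and> val w'' (r1 \<bullet> n) + val w'' d < val w'' (y \<bullet> n))"
        by (rule rltD[rotated 3]) simp_all
      let ?e = "d \<^bold>* inv_q (qnum 2)"
      from gap[OF ev d] obtain m W where m [simp]: "has w' m Nt" and W [simp]: "has w' W Rt" and W01: "w' \<tturnstile> in01 W"
        and lt: "val w' (r1 \<bullet> m) + val w' d < val w' (y \<bullet> m)"
        and cl: "ev w' (\<lambda>w'' j. \<bar>val w'' (W \<bullet> j) - val w'' (y \<bullet> m)\<bar> < val w'' ?e)" by auto
      have lt': "val w' (qnum 1 \<^bold>+ (?e \<^bold>+ ?e)) < val w' (y \<bullet> m)" using lt by simp
      have "w' \<tturnstile> rlt r1 W"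
      proof (rule rltI[of w' r1 W ?e])
        show "ev w' (\<lambda>w'' n. val w'' (r1 \<bullet> n) + val w'' ?e < val w'' (W \<bullet> n))"
        proof (rule ev_mono[OF cl])
          fix w'' j assume w'': "w' \<sqsubseteq> w''" and j [simp]: "has w'' j Nt"
            and h: "\<bar>val w'' (W \<bullet> j) - val w'' (y \<bullet> m)\<bar> < val w'' ?e"
          note [simp] = extendsD(1,2)[OF w'']
          have "val w'' (qnum 1 \<^bold>+ (?e \<^bold>+ ?e)) < val w'' (y \<bullet> m)" by (rule extends_val(1)[OF _ w'' _ _ lt']) simp_all
          then have "1 + (val w'' ?e + val w'' ?e) < val w'' (y \<bullet> m)" by (simp del: val_div_num)
          then show "val w'' (r1 \<bullet> j) + val w'' ?e < val w'' (W \<bullet> j)"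
            using h unfolding abs_less_iff by (simp del: val_div_num)
        qed
      qed simp_all
      then show False using rleD[OF _ in01D(3)[OF _ W01], of w'] by simp
    qed
    ultimately show ?thesis by simp
  qed
  show "w \<tturnstile> rle r0 y" "w \<tturnstile> rle y r1"
    by (rule rleI[OF w]; use * in simp)+
qed

text \<open>A margin \<open>d\<close> for the distance between \<open>y\<close> and \<open>z\<close>
  yields a search bound: if \<open>a\<close> vanished up to the \<open>N\<close> belonging to
  \<open>d/4\<close>, the distance would be less than \<open>d\<close>.\<close>

lemma find_one:
  assumes lt: "w \<tturnstile> rlt r0 (rabs (rsub y z))"
  shows "\<exists>n. has w n Nt \<and> w \<tturnstile> a \<bullet> n \<^bold>= num 1"
proof -
  obtain d where d [simp]: "has w d Qt" "0 < val w d" and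
    ev: "ev w (\<lambda>w' n. has w' d Qt \<and> 0 < val w' d \<and> val w' (r0 \<bullet> n) + val w' d < val w' (rabs (rsub y z) \<bullet> n))"
    by (rule rltD[OF w _ _ lt]) simp_all
  let ?e = "d \<^bold>* inv_q (qnum 4)"
  have e: "has w ?e Qt" "0 < val w ?e" by simp_all
  obtain N where N [simp]: "has w N Nt" and Ne: "val w (eps_q N) < val w ?e" and
    cz: "\<And>w' m. w \<sqsubseteq> w' \<Longrightarrow> has w' m Nt \<Longrightarrow> val w' (iota N) \<le> val w' (iota m) \<Longrightarrow> w' \<tturnstile> all_zero a N \<Longrightarrow>
       ev w' (\<lambda>w'' j. \<bar>val w'' (z \<bullet> j) - val w'' (y \<bullet> m)\<bar> < 2 * val w'' ?e)"
    by (rule close_zero[OF e]) (rule that; blast)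
  have "\<not> w \<tturnstile> all_zero a N"
  proof
    assume all0: "w \<tturnstile> all_zero a N"
    obtain c where c [simp]: "has w c Qt" and evc: "ev w (\<lambda>w' n. \<bar>val w' (z \<bullet> n) - val w' c\<bar> < val w' ?e)"
      by (rule is_realD[OF w z in01D(1)[OF w z01] e])
    from ev_ex[OF w ev_conj[OF w ev ev_conj[OF w evc ev_ge[OF N]]]] obtain m where m [simp]: "has w m Nt" and
      1: "val w d < \<bar>val w (y \<bullet> m) - val w (z \<bullet> m)\<bar>" "\<bar>val w (z \<bullet> m) - val w c\<bar> < val w ?e"
        "val w (iota N) \<le> val w (iota m)" by auto
    from ev_ex[OF w ev_conj[OF w evc cz[OF extends_refl[OF w] m 1(3) all0]]] obtain j where
      2: "\<bar>val w (z \<bullet> j) - val w c\<bar> < val w ?e" "\<bar>val w (z \<bullet> j) - val w (y \<bullet> m)\<bar> < 2 * val w ?e" by auto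
    \<comment> \<open>The summands are \<open>d/4\<close> for \<open>z\<close> at \<open>m\<close>,
      \<open>d/4\<close> for \<open>z\<close> at \<open>j\<close>, and \<open>d/2\<close> between
      \<open>z\<close> at \<open>j\<close> and \<open>y\<close> at \<open>m\<close>.\<close>
    have "\<bar>val w (y \<bullet> m) - val w (z \<bullet> m)\<bar> < 4 * val w ?e" using 1(2) 2 unfolding abs_less_iff by linarith
    then show False using 1(1) by simp
  qed
  with bounded_search[OF w a bin N] obtain n where "has w n Nt" "w \<tturnstile> first_one a n" by auto
  then show ?thesis using first_oneD(1)[OF w] by blast
qed

end

lemma wfe_switch [simp]:
  "ht e a (Nt \<rightarrow> Nt) \<Longrightarrow> ht e z Rt \<Longrightarrow> ht e X (Nt \<rightarrow> Rt) \<Longrightarrow> ht e m Nt \<Longrightarrow> ht e q Qt \<Longrightarrow> wfe e (switch a z X m q)"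
  by (simp add: switch_def)

lemma subst_switch [simp]:
  "subst_fm s (switch a z X m q) = switch (subst_tm s a) (subst_tm s z) (subst_tm s X) (subst_tm s m) (subst_tm s q)"
  by (simp add: switch_def)

text \<open>Countable choice selects for each \<open>m\<close> a rational near \<open>z\<close> or
  near \<open>X \<bullet> n\<close>, according to the outcome of the bounded search.\<close>

lemma switching_exists:
  assumes w [simp]: "world w" and X [simp]: "has w X (Nt \<rightarrow> Rt)" and z [simp]: "has w z Rt"
    and a [simp]: "has w a (Nt \<rightarrow> Nt)"
    and z01: "w \<tturnstile> in01 z" and X01: "w \<tturnstile> All Nt (in01 (shift 1 X \<bullet> Var 0))"
    and conv: "w \<tturnstile> rconv X z" and bin: "w \<tturnstile> binary a"
  obtains y where "switching w X z a y"
proof -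
  let ?A = "switch (shift 2 a) (shift 2 z) (shift 2 X) (Var 1) (Var 0)"
  obtain g where g: "has w g Rt" and
    sw: "\<And>w' n. w \<sqsubseteq> w' \<Longrightarrow> has w' n Nt \<Longrightarrow> w' \<tturnstile> subst_fm (case_nat (g \<bullet> n) (case_nat n Var)) ?A"
  proof (rule forces_choice[OF w, of Qt ?A])
    show "wfe (case_nat (Some Qt) (case_nat (Some Nt) (env (fst w)))) ?A" by simp
    fix w' m assume w': "w \<sqsubseteq> w'" and m [simp]: "has w' m Nt"
    note [simp] = extendsD(1,2)[OF w']
    have pos: "0 < val w' (eps_q m)" by (rule val_eps) simp_all
    have "\<exists>q. has w' q Qt \<and> w' \<tturnstile> switch a z X m q"
      using bounded_search[OF _ _ extendsD(3)[OF w' bin] m, simplified]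
    proof (elim disjE exE conjE)
      assume all0: "w' \<tturnstile> all_zero a m"
      obtain c where c: "has w' c Qt" and ev: "ev w' (\<lambda>w'' n. \<bar>val w'' (z \<bullet> n) - val w'' c\<bar> < val w'' (eps_q m))"
        by (rule is_realD[of w' z "eps_q m"]) (use pos in01D(1)[OF _ extendsD(3)[OF w' z01]] in simp_all)
      have "w' \<tturnstile> approximates c z m" by (rule approximatesI) (use c ev in simp_all)
      then show ?thesis using all0 c
        by (intro exI[of _ c]) (simp add: switch_def forces_Or forces_And)
    next
      fix n assume n [simp]: "has w' n Nt" and le: "val w' (iota n) \<le> val w' (iota m)" and f: "w' \<tturnstile> first_one a n"
      have "w' \<tturnstile> in01 (X \<bullet> n)" using forces_AllD[OF _ extendsD(3)[OF w' X01] n] by simp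
      then obtain c where c [simp]: "has w' c Qt" and
        ev: "ev w' (\<lambda>w'' j. \<bar>val w'' (X \<bullet> n \<bullet> j) - val w'' c\<bar> < val w'' (eps_q m))"
        using is_realD[of w' "X \<bullet> n" "eps_q m"] pos in01D(1)[of w' "X \<bullet> n"] by auto
      have "w' \<tturnstile> approximates c (X \<bullet> n) m" by (rule approximatesI) (use c ev in simp_all)
      then have "w' \<tturnstile> Ex Nt (le_n (Var 0) (shift 1 m) \<^bold>\<and> first_one (shift 1 a) (Var 0) \<^bold>\<and>
         approximates (shift 1 c) (shift 1 X \<bullet> Var 0) (shift 1 m))"
        using le f by (intro forces_ExI[OF _ _ n]) (simp_all add: forces_And forces_le)
      then show ?thesis by (intro exI[of _ c]) (simp add: switch_def forces_Or)
    qed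
    then show "\<exists>q. has w' q Qt \<and> w' \<tturnstile> subst_fm (case_nat q (case_nat m Var)) ?A" by simp
  qed (rule that; blast)
  have "switching w X z a g"
  proof
    show "w' \<tturnstile> switch a z X n (g \<bullet> n)" if "w \<sqsubseteq> w'" "has w' n Nt" for w' n
      using sw[OF that] by simp
  qed (use g z01 X01 conv bin in \<open>simp_all\<close>)
  then show thesis by (rule that)
qed

section \<open>Deciding the binary sequence through the values of the function\<close>

lemma val_square_mono:
  assumes w [simp]: "world w" and [simp]: "has w t Qt" "has w s Qt" and le: "\<bar>val w t\<bar> \<le> val w s"
  shows "val w (t \<^bold>* t) \<le> val w (s \<^bold>* s)"
proof -
  have *: "val w (r \<^bold>* r) \<le> val w (s \<^bold>* s)" if [simp]: "has w r Qt" and "0 \<le> val w r" "val w r \<le> val w s" for r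
  proof -
    have "val w (r \<^bold>* r) \<le> val w (s \<^bold>* r)" by (rule val_mult_mono(2)) (use that in simp_all)
    also have "\<dots> = val w (r \<^bold>* s)" by (rule val_mult_comm) simp_all
    also have "\<dots> \<le> val w (s \<^bold>* s)" by (rule val_mult_mono(2)) (use that in simp_all)
    finally show ?thesis .
  qed
  show ?thesis
  proof (cases "0 \<le> val w t")
    case True
    then show ?thesis using *[of t] le by simp
  next
    case False
    then show ?thesis using *[of "\<^bold>- t"] le by simp
  qed
qed

text \<open>Squares are nonnegative, hence
  \<open>2 u v >= - (u - v)^2 >= - 49 d^2 >= - 49 d\<close>; the bound \<open>d <= 1\<close>
  replaces the square of \<open>d\<close> by \<open>d\<close> itself, which keeps the estimate
  linear.\<close>

lemma product_not_negative:
  assumes w [simp]: "world w" and [simp]: "has w u Qt" "has w v Qt" "has w d Qt"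
    and d: "val w d \<le> 1" "25 * val w d \<le> h" and cl: "\<bar>val w u - val w v\<bar> \<le> 7 * val w d"
  shows "- h \<le> val w (u \<^bold>* v)"
proof -
  let ?t = "u \<^bold>+ \<^bold>- v" and ?s = "iota (num 7) \<^bold>* d"
  have "val w (?t \<^bold>* ?t) \<le> val w (?s \<^bold>* ?s)" by (rule val_square_mono) (use cl in simp_all)
  moreover have "val w (?t \<^bold>* ?t) = val w (u \<^bold>* u) - 2 * val w (u \<^bold>* v) + val w (v \<^bold>* v)"
    using val_mult_comm[OF w, of v u] by simp
  moreover have "val w (?s \<^bold>* ?s) \<le> val w (iota (num 7) \<^bold>* ?s)"
    by (rule val_mult_mono(2)) (use d cl in simp_all)
  moreover have "val w (iota (num 7) \<^bold>* ?s) = 49 * val w d" by simp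
  moreover have "0 \<le> val w (u \<^bold>* u)" "0 \<le> val w (v \<^bold>* v)" by (rule val_square_nonneg; simp)+
  moreover have "0 \<le> val w d" using cl by linarith
  ultimately show ?thesis using d by linarith
qed

lemma eps_le_1: "world w \<Longrightarrow> has w k Nt \<Longrightarrow> val w (eps_q k) \<le> 1"
  using val_eps[of w k] eps_mult_nonneg[of w k "eps_q k"] by simp

context switching
begin

text \<open>Rational approximations \<open>c\<close> of \<open>f z\<close> and \<open>b\<close> of
  \<open>f y\<close> with error \<open>d\<close> are compared. If they differ by at least
  \<open>4 d\<close>, the two values are apart. Otherwise a one in \<open>a\<close> would make
  \<open>f y\<close> equal to \<open>f x\<close> for a member \<open>x\<close> of the sequence and
  put \<open>f x\<close> within \<open>7 d\<close> of \<open>f z\<close>, too close for the product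
  to be that negative.\<close>

lemma decide:
  assumes f [simp]: "has w f (Rt \<rightarrow> Rt)" and F: "w \<tturnstile> is_fun01 f" and h [simp]: "has w h Qt" and pos: "0 < val w h"
    and prod: "\<And>w' n. w \<sqsubseteq> w' \<Longrightarrow> has w' n Nt \<Longrightarrow>
      ev w' (\<lambda>w'' j. val w'' ((f \<bullet> z \<bullet> j) \<^bold>* (f \<bullet> (X \<bullet> n) \<bullet> j)) < - val w'' h)"
  shows "w \<tturnstile> All Nt (shift 1 a \<bullet> Var 0 \<^bold>= zero) \<or> w \<tturnstile> rlt r0 (rabs (rsub (f \<bullet> y) (f \<bullet> z)))"
proof -
  \<comment> \<open>The 25 is half of 49, rounded up, as in
    \<open>product_not_negative\<close>.\<close>
  have "0 < val w (h \<^bold>* inv_q (qnum 25))" using pos by simp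
  then obtain k where k [simp]: "has w k Nt" and kh: "val w (eps_q k) < val w (h \<^bold>* inv_q (qnum 25))"
    using eps_archimedean[OF w, of "h \<^bold>* inv_q (qnum 25)"] by auto
  let ?d = "eps_q k"
  have d: "has w ?d Qt" "0 < val w ?d" by (simp_all add: val_eps)
  have rf: "w \<tturnstile> is_real (f \<bullet> x)" if "has w x Rt" "w \<tturnstile> in01 x" for x
    by (rule fun01D(1)[OF w f F that])
  obtain c where c [simp]: "has w c Qt" and evc: "ev w (\<lambda>w' n. \<bar>val w' (f \<bullet> z \<bullet> n) - val w' c\<bar> < val w' ?d)"
    by (rule is_realD[OF w _ rf[OF z z01] d]) simp
  obtain b where b [simp]: "has w b Qt" and evb: "ev w (\<lambda>w' n. \<bar>val w' (f \<bullet> y \<bullet> n) - val w' b\<bar> < val w' ?d)"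
    by (rule is_realD[OF w _ rf[OF y in01_y] d]) simp
  show ?thesis
  proof (cases "val w (iota (num 4) \<^bold>* ?d) \<le> val w (abs_q (c \<^bold>+ \<^bold>- b))")
    case True
    have "w \<tturnstile> rlt r0 (rabs (rsub (f \<bullet> y) (f \<bullet> z)))"
    proof (rule rltI[OF w _ _ d])
      show "ev w (\<lambda>w' n. val w' (r0 \<bullet> n) + val w' ?d < val w' (rabs (rsub (f \<bullet> y) (f \<bullet> z)) \<bullet> n))"
      proof (rule ev_mono[OF ev_conj[OF w evc evb]])
        fix w' n assume w': "w \<sqsubseteq> w'" and n [simp]: "has w' n Nt" and
          e: "\<bar>val w' (f \<bullet> z \<bullet> n) - val w' c\<bar> < val w' ?d \<and> \<bar>val w' (f \<bullet> y \<bullet> n) - val w' b\<bar> < val w' ?d"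
        note [simp] = extendsD(1,2)[OF w']
        have "val w' (iota (num 4) \<^bold>* ?d) \<le> val w' (abs_q (c \<^bold>+ \<^bold>- b))"
          by (rule extends_val(2)[OF w w' _ _ True]) simp_all
        then have "4 * val w' ?d \<le> \<bar>val w' c - val w' b\<bar>" by simp
        then have "val w' ?d < \<bar>val w' (f \<bullet> y \<bullet> n) - val w' (f \<bullet> z \<bullet> n)\<bar>" using e by linarith
        then show "val w' (r0 \<bullet> n) + val w' ?d < val w' (rabs (rsub (f \<bullet> y) (f \<bullet> z)) \<bullet> n)" by simp
      qed
    qed simp_all
    then show ?thesis ..
  next
    case False
    then have lt: "val w (abs_q (c \<^bold>+ \<^bold>- b)) < val w (iota (num 4) \<^bold>* ?d)" by simp
    have "w \<tturnstile> All Nt (shift 1 a \<bullet> Var 0 \<^bold>= zero)"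
    proof (rule forces_AllI[OF w])
      fix w' n assume w': "w \<sqsubseteq> w'" and n [simp]: "has w' n Nt"
      note [simp] = extendsD(1,2)[OF w']
      interpret w': switching w' X z a y by (rule up[OF w'])
      have "w' \<tturnstile> a \<bullet> n \<^bold>= zero"
      proof (cases "w' \<tturnstile> all_zero a n")
        case True
        then show ?thesis by (intro all_zeroD[of w' a n]) simp_all
      next
        case no: False
        with bounded_search[OF _ _ w'.bin n] obtain m where m [simp]: "has w' m Nt" and fm: "w' \<tturnstile> first_one a m" by auto
        have "w' \<tturnstile> req (f \<bullet> y) (f \<bullet> (X \<bullet> m))"
          by (rule fun01D(2)[OF _ _ extendsD(3)[OF w' F]])
            (use w'.in01_y w'.X_in01[OF m] w'.req_first[OF m fm] in simp_all)
        then have "ev w' (\<lambda>w'' j. \<bar>val w'' (f \<bullet> y \<bullet> j) - val w'' (f \<bullet> (X \<bullet> m) \<bullet> j)\<bar> < val w'' ?d)"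
          by (intro reqD) (simp_all add: val_eps)
        from ev_ex[OF _ ev_conj[OF _ this ev_conj[OF _ prod[OF w' m] ev_conj[OF _ ev_up[OF evc w'] ev_up[OF evb w']]]]]
        obtain j where j [simp]: "has w' j Nt" and
          e: "\<bar>val w' (f \<bullet> y \<bullet> j) - val w' (f \<bullet> (X \<bullet> m) \<bullet> j)\<bar> < val w' ?d"
            "\<bar>val w' (f \<bullet> z \<bullet> j) - val w' c\<bar> < val w' ?d" "\<bar>val w' (f \<bullet> y \<bullet> j) - val w' b\<bar> < val w' ?d"
          and neg: "val w' ((f \<bullet> z \<bullet> j) \<^bold>* (f \<bullet> (X \<bullet> m) \<bullet> j)) < - val w' h" by auto
        have "val w' (abs_q (c \<^bold>+ \<^bold>- b)) < val w' (iota (num 4) \<^bold>* ?d)" by (rule extends_val(1)[OF w w' _ _ lt]) simp_all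
        then have "\<bar>val w' c - val w' b\<bar> < 4 * val w' ?d" by simp
        \<comment> \<open>Error \<open>d\<close> at \<open>f z\<close>, less than \<open>4 d\<close>
          between the approximations, \<open>d\<close> at \<open>f y\<close>, and \<open>d\<close>
          between the representatives of \<open>f y\<close> and of \<open>f\<close> at
          \<open>X \<bullet> m\<close>.\<close>
        then have "\<bar>val w' (f \<bullet> z \<bullet> j) - val w' (f \<bullet> (X \<bullet> m) \<bullet> j)\<bar> \<le> 7 * val w' ?d"
          using e unfolding abs_less_iff abs_le_iff by linarith
        moreover have "val w' ?d < val w' (h \<^bold>* inv_q (qnum 25))" by (rule extends_val(1)[OF w w' _ _ kh]) simp_all
        then have "25 * val w' ?d \<le> val w' h" by simp
        ultimately have "- val w' h \<le> val w' ((f \<bullet> z \<bullet> j) \<^bold>* (f \<bullet> (X \<bullet> m) \<bullet> j))"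
          by (intro product_not_negative[of w' _ _ ?d]) (simp_all add: eps_le_1)
        then show ?thesis using neg by simp
      qed
      then show "w' \<tturnstile> inst (shift 1 a \<bullet> Var 0 \<^bold>= zero) n" by simp
    qed simp
    then show ?thesis ..
  qed
qed

end

lemma forces_not_rlt_req:
  assumes w [simp]: "world w" and [simp]: "has w x Rt" "has w y Rt" and eq: "w \<tturnstile> req x y"
  shows "\<not> w \<tturnstile> rlt r0 (rabs (rsub x y))"
proof
  assume "w \<tturnstile> rlt r0 (rabs (rsub x y))"
  then obtain d where d [simp]: "has w d Qt" "0 < val w d" and
    ev: "ev w (\<lambda>w' n. has w' d Qt \<and> 0 < val w' d \<and> val w' (r0 \<bullet> n) + val w' d < val w' (rabs (rsub x y) \<bullet> n))"
    by (rule rltD[OF w, rotated 2]) simp_all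
  from ev_ex[OF w ev_conj[OF w ev reqD[OF w _ _ eq d]]] obtain n where "has w n Nt"
    "val w (r0 \<bullet> n) + val w d < val w (rabs (rsub x y) \<bullet> n)" "\<bar>val w (x \<bullet> n) - val w (y \<bullet> n)\<bar> < val w d" by auto
  then show False by simp
qed

text \<open>The real bound \<open>e^2/8\<close> is weakened to a rational one, \<open>d^2/8\<close>
  with \<open>0 < d < e\<close>, as \<open>decide\<close> works with a rational bound.\<close>

lemma jump_decides:
  assumes w [simp]: "world w" and f [simp]: "has w f (Rt \<rightarrow> Rt)" and e [simp]: "has w e Rt" and z [simp]: "has w z Rt"
    and a [simp]: "has w a (Nt \<rightarrow> Nt)" and F: "w \<tturnstile> is_fun01 f" and E: "w \<tturnstile> rlt r0 e"
    and Z: "w \<tturnstile> in01 z" and J: "w \<tturnstile> jump_seq f e z" and bin: "w \<tturnstile> binary a"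
  obtains X y where "switching w X z a y"
    "w \<tturnstile> All Nt (shift 1 a \<bullet> Var 0 \<^bold>= zero) \<or> w \<tturnstile> rlt r0 (rabs (rsub (f \<bullet> y) (f \<bullet> z)))"
proof -
  from forces_ExD[OF w J[unfolded jump_seq_def]] obtain X where X [simp]: "has w X (Nt \<rightarrow> Rt)" and
    X01: "w \<tturnstile> All Nt (in01 (shift 1 X \<bullet> Var 0))" and conv: "w \<tturnstile> rconv X z" and
    P: "w \<tturnstile> All Nt (rlt (rmul (shift 1 f \<bullet> shift 1 z) (shift 1 f \<bullet> (shift 1 X \<bullet> Var 0)))
                 (rneg (rmul (rmul (shift 1 e) (shift 1 e)) (rconst (inv_q (qnum 8))))))"
    by (auto simp: forces_And)
  obtain y where y: "switching w X z a y"
    by (rule switching_exists[OF w X z a Z X01 conv bin])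
  obtain d where d [simp]: "has w d Qt" and dpos: "0 < val w d" and
    ev: "ev w (\<lambda>w' n. has w' d Qt \<and> 0 < val w' d \<and> val w' (r0 \<bullet> n) + val w' d < val w' (e \<bullet> n))"
    by (rule rltD[OF w _ _ E]) simp_all
  let ?h = "d \<^bold>* d \<^bold>* inv_q (qnum 8)"
  have "w \<tturnstile> All Nt (shift 1 a \<bullet> Var 0 \<^bold>= zero) \<or> w \<tturnstile> rlt r0 (rabs (rsub (f \<bullet> y) (f \<bullet> z)))"
  proof (rule switching.decide[OF y f F, of ?h])
    show "has w ?h Qt" by simp
    show "0 < val w ?h" using val_mult_pos[OF w d d dpos dpos] by simp
    fix w' n assume w': "w \<sqsubseteq> w'" and n [simp]: "has w' n Nt"
    note [simp] = extendsD(1,2)[OF w']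
    have "w' \<tturnstile> rlt (rmul (f \<bullet> z) (f \<bullet> (X \<bullet> n))) (rneg (rmul (rmul e e) (rconst (inv_q (qnum 8)))))"
      using forces_AllD[OF _ extendsD(3)[OF w' P] n] by simp
    then obtain r where
      ev': "ev w' (\<lambda>w'' j. has w'' r Qt \<and> 0 < val w'' r \<and> val w'' (rmul (f \<bullet> z) (f \<bullet> (X \<bullet> n)) \<bullet> j) + val w'' r <
        val w'' (rneg (rmul (rmul e e) (rconst (inv_q (qnum 8)))) \<bullet> j))"
      by (rule rltD[rotated 3]) simp_all
    show "ev w' (\<lambda>w'' j. val w'' ((f \<bullet> z \<bullet> j) \<^bold>* (f \<bullet> (X \<bullet> n) \<bullet> j)) < - val w'' ?h)"
    proof (rule ev_mono[OF ev_conj[OF _ ev' ev_up[OF ev w']]])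
      fix w'' j assume w'': "w' \<sqsubseteq> w''" and j [simp]: "has w'' j Nt" and
        h: "(has w'' r Qt \<and> 0 < val w'' r \<and> val w'' (rmul (f \<bullet> z) (f \<bullet> (X \<bullet> n)) \<bullet> j) + val w'' r <
        val w'' (rneg (rmul (rmul e e) (rconst (inv_q (qnum 8)))) \<bullet> j)) \<and>
        has w'' d Qt \<and> 0 < val w'' d \<and> val w'' (r0 \<bullet> j) + val w'' d < val w'' (e \<bullet> j)"
      note [simp] = extendsD(1,2)[OF w'']
      have "val w'' ((rmul e e \<bullet> j) \<^bold>* (rconst (inv_q (qnum 8)) \<bullet> j)) = val w'' ((e \<bullet> j) \<^bold>* (e \<bullet> j) \<^bold>* inv_q (qnum 8))"
        by (rule val_mult_cong) simp_all
      moreover have "val w'' (d \<^bold>* d) \<le> val w'' ((e \<bullet> j) \<^bold>* (e \<bullet> j))"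
        by (rule val_square_mono) (use h in simp_all)
      ultimately show "val w'' ((f \<bullet> z \<bullet> j) \<^bold>* (f \<bullet> (X \<bullet> n) \<bullet> j)) < - val w'' ?h" using h by simp
    qed simp
  qed
  with y show thesis by (rule that)
qed

theorem jump_omniscience:
  assumes w [simp]: "world w" and f [simp]: "has w f (Rt \<rightarrow> Rt)" and e [simp]: "has w e Rt" and z [simp]: "has w z Rt"
    and F: "w \<tturnstile> is_fun01 f" and E: "w \<tturnstile> rlt r0 e"
    and Z: "w \<tturnstile> in01 z" and J: "w \<tturnstile> jump_seq f e z"
  shows "w \<tturnstile> WLPO" "w \<tturnstile> (strongly_ext f \<^bold>\<longrightarrow> LPO)"
proof -
  let ?Z = "\<lambda>a. All Nt (shift 1 a \<bullet> Var 0 \<^bold>= zero)"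
  have main: "\<exists>y. has w' y Rt \<and> w' \<tturnstile> in01 y \<and> (\<forall>w1. w' \<sqsubseteq> w1 \<longrightarrow> w1 \<tturnstile> ?Z a \<longrightarrow> w1 \<tturnstile> req y z) \<and>
      (w' \<tturnstile> rlt r0 (rabs (rsub y z)) \<longrightarrow> (\<exists>n. has w' n Nt \<and> w' \<tturnstile> a \<bullet> n \<^bold>= num 1)) \<and>
      (w' \<tturnstile> ?Z a \<or> w' \<tturnstile> rlt r0 (rabs (rsub (f \<bullet> y) (f \<bullet> z))))"
    if w': "w \<sqsubseteq> w'" and a: "has w' a (Nt \<rightarrow> Nt)" and bin: "w' \<tturnstile> binary a" for w' a
  proof -
    note x = extendsD(1,2,3)[OF w']
    obtain X y where y: "switching w' X z a y" and d: "w' \<tturnstile> ?Z a \<or> w' \<tturnstile> rlt r0 (rabs (rsub (f \<bullet> y) (f \<bullet> z)))"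
      by (rule jump_decides[OF x(1) x(2)[OF f] x(2)[OF e] x(2)[OF z] a x(3)[OF F] x(3)[OF E] x(3)[OF Z] x(3)[OF J] bin])
    show ?thesis
      using y d switching.in01_y[OF y] switching.find_one[OF y] switching.req_zero[OF switching.up[OF y]] switching.y[OF y] by blast
  qed
  show "w \<tturnstile> WLPO"
    unfolding WLPO_def
  proof (rule forces_AllI[OF w])
    fix w1 a assume w1: "w \<sqsubseteq> w1" and a: "has w1 a (Nt \<rightarrow> Nt)"
    note [simp] = extendsD(1,2)[OF w1] a
    have "w1 \<tturnstile> (binary a \<^bold>\<longrightarrow> ?Z a \<^bold>\<or> \<^bold>\<not> ?Z a)"
    proof (rule forces_ImpI)
      fix w2 assume w2: "w1 \<sqsubseteq> w2" and bin: "w2 \<tturnstile> binary a"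
      note [simp] = extendsD(1,2)[OF w2]
      have w02: "w \<sqsubseteq> w2" by (rule extends_trans[OF w1 w2])
      from main[OF w02 _ bin] obtain y where y [simp]: "has w2 y Rt" and y01: "w2 \<tturnstile> in01 y"
        and eq: "\<And>w3. w2 \<sqsubseteq> w3 \<Longrightarrow> w3 \<tturnstile> ?Z a \<Longrightarrow> w3 \<tturnstile> req y z"
        and alt: "w2 \<tturnstile> ?Z a \<or> w2 \<tturnstile> rlt r0 (rabs (rsub (f \<bullet> y) (f \<bullet> z)))" by auto
      \<comment> \<open>If \<open>a\<close> vanished throughout, \<open>y\<close> would equal
        \<open>z\<close> and, as \<open>f\<close> respects equality of reals, \<open>f y\<close>
        would equal \<open>f z\<close>.\<close>
      have "w2 \<tturnstile> (\<^bold>\<not> ?Z a)" if lt: "w2 \<tturnstile> rlt r0 (rabs (rsub (f \<bullet> y) (f \<bullet> z)))"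
      proof (rule forces_ImpI)
        fix w3 assume w3: "w2 \<sqsubseteq> w3" and za: "w3 \<tturnstile> ?Z a"
        note [simp] = extendsD(1,2)[OF w3]
        have w03: "w \<sqsubseteq> w3" by (rule extends_trans[OF w02 w3])
        have "w3 \<tturnstile> req (f \<bullet> y) (f \<bullet> z)"
          by (rule fun01D(2)[OF _ _ extendsD(3)[OF w03 F]])
            (use extendsD(3)[OF w3 y01] extendsD(3)[OF w03 Z] eq[OF w3 za] in simp_all)
        then show "w3 \<tturnstile> Fls" using forces_not_rlt_req[of w3 "f \<bullet> y" "f \<bullet> z"] extendsD(3)[OF w3 lt] by simp
      qed simp_all
      then show "w2 \<tturnstile> (?Z a \<^bold>\<or> \<^bold>\<not> ?Z a)" using alt by (auto simp: forces_Or)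
    qed simp_all
    then show "w1 \<tturnstile> inst (binary (Var 0) \<^bold>\<longrightarrow> All Nt (Var 1 \<bullet> Var 0 \<^bold>= zero) \<^bold>\<or> \<^bold>\<not> All Nt (Var 1 \<bullet> Var 0 \<^bold>= zero)) a"
      by simp
  qed simp
  show "w \<tturnstile> (strongly_ext f \<^bold>\<longrightarrow> LPO)"
  proof (rule forces_ImpI)
    fix w0 assume w0: "w \<sqsubseteq> w0" and S: "w0 \<tturnstile> strongly_ext f"
    note [simp] = extendsD(1,2)[OF w0]
    show "w0 \<tturnstile> LPO"
      unfolding LPO_def
    proof (rule forces_AllI)
      fix w1 a assume w1: "w0 \<sqsubseteq> w1" and a: "has w1 a (Nt \<rightarrow> Nt)"
      note [simp] = extendsD(1,2)[OF w1] a
      let ?O = "Ex Nt (shift 1 a \<bullet> Var 0 \<^bold>= num 1)"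
      have "w1 \<tturnstile> (binary a \<^bold>\<longrightarrow> ?Z a \<^bold>\<or> ?O)"
      proof (rule forces_ImpI)
        fix w2 assume w2: "w1 \<sqsubseteq> w2" and bin: "w2 \<tturnstile> binary a"
        note [simp] = extendsD(1,2)[OF w2]
        have w02: "w0 \<sqsubseteq> w2" and w2': "w \<sqsubseteq> w2" using extends_trans w0 w1 w2 by blast+
        from main[OF w2' _ bin] obtain y where y [simp]: "has w2 y Rt" and y01: "w2 \<tturnstile> in01 y"
          and one: "w2 \<tturnstile> rlt r0 (rabs (rsub y z)) \<Longrightarrow> \<exists>n. has w2 n Nt \<and> w2 \<tturnstile> a \<bullet> n \<^bold>= num 1"
          and alt: "w2 \<tturnstile> ?Z a \<or> w2 \<tturnstile> rlt r0 (rabs (rsub (f \<bullet> y) (f \<bullet> z)))" by auto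
        have "w2 \<tturnstile> ?O" if lt: "w2 \<tturnstile> rlt r0 (rabs (rsub (f \<bullet> y) (f \<bullet> z)))"
        proof -
          have "w2 \<tturnstile> All Rt (in01 (shift 1 y) \<^bold>\<and> in01 (Var 0) \<^bold>\<longrightarrow>
             rlt r0 (rabs (rsub (shift 1 f \<bullet> shift 1 y) (shift 1 f \<bullet> Var 0))) \<^bold>\<longrightarrow>
             rlt r0 (rabs (rsub (shift 1 y) (Var 0))))"
            using forces_AllD[OF _ extendsD(3)[OF w02 S[unfolded strongly_ext_def]], of y] by simp
          from forces_AllD[OF _ this, of z]
          have "w2 \<tturnstile> (in01 y \<^bold>\<and> in01 z \<^bold>\<longrightarrow> rlt r0 (rabs (rsub (f \<bullet> y) (f \<bullet> z))) \<^bold>\<longrightarrow> rlt r0 (rabs (rsub y z)))"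
            by simp
          from forces_ImpD[OF _ forces_ImpD[OF _ this] lt]
          have "w2 \<tturnstile> rlt r0 (rabs (rsub y z))" using y01 extendsD(3)[OF w2' Z] by (simp add: forces_And)
          from one[OF this] obtain n where n: "has w2 n Nt" "w2 \<tturnstile> a \<bullet> n \<^bold>= num 1" by auto
          then show ?thesis by (intro forces_ExI[OF _ _ n(1)]) simp_all
        qed
        then show "w2 \<tturnstile> (?Z a \<^bold>\<or> ?O)" using alt by (auto simp: forces_Or)
      qed simp_all
      then show "w1 \<tturnstile> inst (binary (Var 0) \<^bold>\<longrightarrow> All Nt (Var 1 \<bullet> Var 0 \<^bold>= zero) \<^bold>\<or> Ex Nt (Var 1 \<bullet> Var 0 \<^bold>= num 1)) a"
        by simp
    qed simp_all
  qed simp_all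
qed

section \<open>Interval halving\<close>

text \<open>Rational sequences serve as pairs of rationals.\<close>

abbreviation lo :: "tm \<Rightarrow> tm" where "lo s \<equiv> s \<bullet> zero"
abbreviation hi :: "tm \<Rightarrow> tm" where "hi s \<equiv> s \<bullet> succ zero"

definition pos_at :: "tm \<Rightarrow> tm \<Rightarrow> tm \<Rightarrow> fm" where
  "pos_at f b q = rlt (rconst b) (f \<bullet> rconst q)"

definition neg_at :: "tm \<Rightarrow> tm \<Rightarrow> tm \<Rightarrow> fm" where
  "neg_at f b q = rlt (f \<bullet> rconst q) (rconst (\<^bold>- b))"

definition small_at :: "tm \<Rightarrow> tm \<Rightarrow> tm \<Rightarrow> fm" where
  "small_at f c q = (rlt (rconst (\<^bold>- c)) (f \<bullet> rconst q) \<^bold>\<and> rlt (f \<bullet> rconst q) (rconst c))"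

text \<open>A state \<open>s\<close> codes the rational interval from \<open>lo s\<close> to \<open>hi s\<close>. The search stops at a degenerate
  interval, at which \<open>f\<close> is small; otherwise \<open>f\<close> has opposite signs at the end points.\<close>

definition bracket :: "tm \<Rightarrow> tm \<Rightarrow> tm \<Rightarrow> tm \<Rightarrow> fm" where
  "bracket f c b s = ((qnum 0 \<^bold>\<le> lo s) \<^bold>\<and> (hi s \<^bold>\<le> qnum 1) \<^bold>\<and>
     (lo s \<^bold>= hi s \<^bold>\<and> small_at f c (lo s) \<^bold>\<or>
      (lo s \<^bold>\<le> hi s) \<^bold>\<and> (pos_at f b (lo s) \<^bold>\<and> neg_at f b (hi s) \<^bold>\<or> neg_at f b (lo s) \<^bold>\<and> pos_at f b (hi s))))"

text \<open>The condition on widths is an inequality, since a degenerate interval is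
  repeated.\<close>

definition halves :: "tm \<Rightarrow> tm \<Rightarrow> fm" where
  "halves s t = ((lo s \<^bold>\<le> lo t) \<^bold>\<and> (lo t \<^bold>\<le> hi t) \<^bold>\<and> (hi t \<^bold>\<le> hi s) \<^bold>\<and>
     ((hi t \<^bold>+ \<^bold>- lo t) \<^bold>+ (hi t \<^bold>+ \<^bold>- lo t) \<^bold>\<le> hi s \<^bold>+ \<^bold>- lo s))"

lemma subst_at [simp]:
  "subst_fm s (pos_at f b q) = pos_at (subst_tm s f) (subst_tm s b) (subst_tm s q)"
  "subst_fm s (neg_at f b q) = neg_at (subst_tm s f) (subst_tm s b) (subst_tm s q)"
  "subst_fm s (small_at f b q) = small_at (subst_tm s f) (subst_tm s b) (subst_tm s q)"
  "subst_fm s (halves q r) = halves (subst_tm s q) (subst_tm s r)"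
  by (simp_all add: pos_at_def neg_at_def small_at_def halves_def)

lemma subst_bracket [simp]:
  "subst_fm s (bracket f c b q) = bracket (subst_tm s f) (subst_tm s c) (subst_tm s b) (subst_tm s q)"
  by (simp add: bracket_def)

lemma wfe_at [simp]:
  assumes "ht e f (Rt \<rightarrow> Rt)" "ht e b Qt" "ht e q Qt"
  shows "wfe e (pos_at f b q)" "wfe e (neg_at f b q)" "wfe e (small_at f b q)"
  using assms by (simp_all add: pos_at_def neg_at_def small_at_def)

lemma wfe_bracket [simp]:
  "ht e f (Rt \<rightarrow> Rt) \<Longrightarrow> ht e c Qt \<Longrightarrow> ht e b Qt \<Longrightarrow> ht e s Rt \<Longrightarrow> wfe e (bracket f c b s)"
  "ht e s Rt \<Longrightarrow> ht e t Rt \<Longrightarrow> wfe e (halves s t)"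
  by (simp_all add: bracket_def halves_def)

lemma forces_bracket:
  assumes [simp]: "world w" "has w f (Rt \<rightarrow> Rt)" "has w c Qt" "has w b Qt" "has w s Rt"
  shows "w \<tturnstile> bracket f c b s \<longleftrightarrow> 0 \<le> val w (lo s) \<and> val w (hi s) \<le> 1 \<and>
    (val w (lo s) = val w (hi s) \<and> w \<tturnstile> small_at f c (lo s) \<or>
     val w (lo s) \<le> val w (hi s) \<and> (w \<tturnstile> pos_at f b (lo s) \<and> w \<tturnstile> neg_at f b (hi s) \<or>
       w \<tturnstile> neg_at f b (lo s) \<and> w \<tturnstile> pos_at f b (hi s)))"
proof -
  let ?P = "pos_at f b (lo s) \<^bold>\<and> neg_at f b (hi s) \<^bold>\<or> neg_at f b (lo s) \<^bold>\<and> pos_at f b (hi s)"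
  have 1: "w \<tturnstile> ?P \<longleftrightarrow> (w \<tturnstile> pos_at f b (lo s) \<and> w \<tturnstile> neg_at f b (hi s) \<or>
       w \<tturnstile> neg_at f b (lo s) \<and> w \<tturnstile> pos_at f b (hi s))"
    by (subst forces_Or) (simp_all add: forces_And)
  have 2: "w \<tturnstile> (lo s \<^bold>= hi s \<^bold>\<and> small_at f c (lo s) \<^bold>\<or> (lo s \<^bold>\<le> hi s) \<^bold>\<and> ?P) \<longleftrightarrow>
      val w (lo s) = val w (hi s) \<and> w \<tturnstile> small_at f c (lo s) \<or> val w (lo s) \<le> val w (hi s) \<and> w \<tturnstile> ?P"
    by (subst forces_Or) (simp_all add: forces_And forces_le forces_Eq)
  show ?thesis
    unfolding bracket_def forces_And[OF assms(1)] 2 1 by (simp add: forces_le)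
qed

lemma forces_halves:
  assumes [simp]: "world w" "has w s Rt" "has w t Rt"
  shows "w \<tturnstile> halves s t \<longleftrightarrow> val w (lo s) \<le> val w (lo t) \<and> val w (lo t) \<le> val w (hi t) \<and> val w (hi t) \<le> val w (hi s) \<and>
    2 * (val w (hi t) - val w (lo t)) \<le> val w (hi s) - val w (lo s)"
  unfolding halves_def by (simp add: forces_And forces_le)

text \<open>The sequence \<open>p\<close>, \<open>q\<close>, \<open>q\<close>, and so on: recursion
  from \<open>p\<close> with a step that ignores both of its arguments.\<close>

definition pair :: "tm \<Rightarrow> tm \<Rightarrow> tm" where
  "pair p q = Con (Rec Qt) \<bullet> p \<bullet> (Con (Kc (Qt \<rightarrow> Qt) Nt) \<bullet> (Con (Kc Qt Qt) \<bullet> q))"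

lemma has_pair [simp]: "has w p Qt \<Longrightarrow> has w q Qt \<Longrightarrow> has w (pair p q) Rt"
  unfolding pair_def by (auto simp: ht_App)

lemma val_pair [simp]:
  assumes w [simp]: "world w" and p [simp]: "has w p Qt" and q [simp]: "has w q Qt"
  shows "val w (lo (pair p q)) = val w p" "val w (hi (pair p q)) = val w q"
proof -
  let ?y = "Con (Kc (Qt \<rightarrow> Qt) Nt) \<bullet> (Con (Kc Qt Qt) \<bullet> q)"
  have y: "has w ?y (Nt \<rightarrow> Qt \<rightarrow> Qt)" by simp
  have z: "has w zero Nt" by simp
  have lt: "has w (lo (pair p q)) Qt" "has w (hi (pair p q)) Qt" by simp_all
  have "w \<tturnstile> lo (pair p q) \<^bold>= p"
    unfolding pair_def by (rule forces_ax[OF w p y y ax_Rec_0]) (use lt in \<open>simp_all add: pair_def\<close>)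
  then show "val w (lo (pair p q)) = val w p" by (rule val_eqI[OF w _ lt(1)])
  have yz: "has w (?y \<bullet> zero) (Qt \<rightarrow> Qt)" by (rule ht_AppI[OF y z])
  have 1: "w \<tturnstile> hi (pair p q) \<^bold>= ?y \<bullet> zero \<bullet> lo (pair p q)"
    unfolding pair_def
    by (rule forces_ax[OF w p y z ax_Rec_S]) (use lt ht_AppI[OF yz lt(1)] in \<open>simp_all add: pair_def wfe_EqI[of _ _ Qt]\<close>)
  have 2: "w \<tturnstile> ?y \<bullet> zero \<bullet> lo (pair p q) \<^bold>= Con (Kc Qt Qt) \<bullet> q \<bullet> lo (pair p q)"
    by (rule forces_cong_fun[OF w forces_K[OF w _ z] yz lt(1)]) simp
  have 3: "w \<tturnstile> Con (Kc Qt Qt) \<bullet> q \<bullet> lo (pair p q) \<^bold>= q" by (rule forces_K[OF w q lt(1)])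
  show "val w (hi (pair p q)) = val w q"
    by (rule val_eqI[OF w forces_trans[OF w 1 forces_trans[OF w 2 3]] lt(2)])
qed

lemma req_const:
  assumes w [simp]: "world w" and [simp]: "has w p Qt" "has w q Qt" and eq: "val w p = val w q"
  shows "w \<tturnstile> req (rconst p) (rconst q)"
proof (rule reqI[OF w])
  fix w' d assume w': "w \<sqsubseteq> w'" and [simp]: "world w'" "has w' d Qt" and d: "0 < val w' d"
  note [simp] = extendsD(2)[OF w']
  show "ev w' (\<lambda>w'' n. \<bar>val w'' (rconst p \<bullet> n) - val w'' (rconst q \<bullet> n)\<bar> < val w'' d)"
  proof (rule evI[of _ zero])
    fix w'' n assume w'': "w' \<sqsubseteq> w''" and n [simp]: "has w'' n Nt"
    note [simp] = extendsD(1,2)[OF w'']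
    have "val w'' p = val w'' q" by (rule extends_val(3)[OF w extends_trans[OF w' w'']]) (use eq in simp_all)
    then show "\<bar>val w'' (rconst p \<bullet> n) - val w'' (rconst q \<bullet> n)\<bar> < val w'' d"
      using val_pos_up[of w' w'' d] w'' d by simp
  qed simp
qed simp_all

text \<open>End points are recovered from a coded interval only up to equality of rationals;
  \<open>f\<close> respects equality of reals in the unit interval, so the sign predicates
  follow.\<close>

lemma at_cong:
  assumes w [simp]: "world w" and f [simp]: "has w f (Rt \<rightarrow> Rt)" and F: "w \<tturnstile> is_fun01 f"
    and [simp]: "has w p Qt" "has w q Qt" "has w b Qt" and eq: "val w p = val w q" and q01: "0 \<le> val w q" "val w q \<le> 1"
  shows "w \<tturnstile> pos_at f b p \<Longrightarrow> w \<tturnstile> pos_at f b q" "w \<tturnstile> neg_at f b p \<Longrightarrow> w \<tturnstile> neg_at f b q"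
    "w \<tturnstile> small_at f b p \<Longrightarrow> w \<tturnstile> small_at f b q"
proof -
  have r: "w \<tturnstile> req (f \<bullet> rconst p) (f \<bullet> rconst q)"
    by (rule fun01D(2)[OF w f F]) (use in01_const[OF w] req_const[OF w] eq q01 in simp_all)
  have c: "w \<tturnstile> req (rconst s) (rconst s)" if "has w s Qt" for s by (rule req_refl) (use that in simp_all)
  show "w \<tturnstile> pos_at f b p \<Longrightarrow> w \<tturnstile> pos_at f b q"
    unfolding pos_at_def by (rule rlt_req[OF w, rotated 4, OF _ c r]) simp_all
  show "w \<tturnstile> neg_at f b p \<Longrightarrow> w \<tturnstile> neg_at f b q"
    unfolding neg_at_def by (rule rlt_req[OF w, rotated 4, OF _ r c]) simp_all
  show "w \<tturnstile> small_at f b p \<Longrightarrow> w \<tturnstile> small_at f b q"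
    unfolding small_at_def forces_And[OF w]
    by (intro conjI rlt_req[OF w, rotated 4, OF _ c r] rlt_req[OF w, rotated 4, OF _ r c]) simp_all
qed

text \<open>Cotransitivity twice, between \<open>b\<close> and \<open>c\<close> and between
  \<open>-c\<close> and \<open>-b\<close>; the overlap of the alternatives is what makes the case
  distinction constructive.\<close>

lemma colour:
  assumes w [simp]: "world w" and f [simp]: "has w f (Rt \<rightarrow> Rt)" and F: "w \<tturnstile> is_fun01 f"
    and [simp]: "has w q Qt" "has w b Qt" "has w c Qt" and q01: "0 \<le> val w q" "val w q \<le> 1"
    and bc: "val w b < val w c"
  shows "w \<tturnstile> pos_at f b q \<or> w \<tturnstile> neg_at f b q \<or> w \<tturnstile> small_at f c q"
proof -
  have R: "w \<tturnstile> is_real (f \<bullet> rconst q)" by (rule fun01D(1)[OF w f F]) (simp_all add: in01_const q01)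
  have "w \<tturnstile> rlt (rconst b) (f \<bullet> rconst q) \<or> w \<tturnstile> rlt (f \<bullet> rconst q) (rconst c)"
    by (rule rlt_cotrans[OF w _ R]) (use bc in simp_all)
  moreover have "w \<tturnstile> rlt (rconst (\<^bold>- c)) (f \<bullet> rconst q) \<or> w \<tturnstile> rlt (f \<bullet> rconst q) (rconst (\<^bold>- b))"
    by (rule rlt_cotrans[OF w _ R]) (use bc in simp_all)
  ultimately show ?thesis by (auto simp: pos_at_def neg_at_def small_at_def forces_And)
qed

text \<open>The colour of the midpoint decides: a sign selects a half whose end points have opposite
  signs, a small value collapses the interval to the midpoint.\<close>

lemma halving_step:
  assumes w [simp]: "world w" and f [simp]: "has w f (Rt \<rightarrow> Rt)" and F: "w \<tturnstile> is_fun01 f"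
    and b [simp]: "has w b Qt" and c [simp]: "has w c Qt" and bc: "val w b < val w c"
    and s [simp]: "has w s Rt" and B: "w \<tturnstile> bracket f c b s"
  shows "\<exists>t. has w t Rt \<and> w \<tturnstile> bracket f c b t \<and> w \<tturnstile> halves s t"
proof -
  note B' = B[unfolded forces_bracket[OF w f c b s]]
  show ?thesis
  proof (cases "val w (lo s) = val w (hi s) \<and> w \<tturnstile> small_at f c (lo s)")
    case True
    then show ?thesis using B by (intro exI[of _ s]) (simp add: forces_halves)
  next
    case False
    with B' have le: "val w (lo s) \<le> val w (hi s)" and
      op: "w \<tturnstile> pos_at f b (lo s) \<and> w \<tturnstile> neg_at f b (hi s) \<or> w \<tturnstile> neg_at f b (lo s) \<and> w \<tturnstile> pos_at f b (hi s)"
      and I: "0 \<le> val w (lo s)" "val w (hi s) \<le> 1" by auto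
    let ?m = "(lo s \<^bold>+ hi s) \<^bold>* inv_q (qnum 2)"
    have m: "2 * val w ?m = val w (lo s) + val w (hi s)" by simp
    then have m01: "0 \<le> val w ?m" "val w ?m \<le> 1" "val w (lo s) \<le> val w ?m" "val w ?m \<le> val w (hi s)"
      using le I by linarith+
    have gap: "2 * (val w (hi s) - val w ?m) \<le> val w (hi s) - val w (lo s)"
      "2 * (val w ?m - val w (lo s)) \<le> val w (hi s) - val w (lo s)"
      "2 * (val w ?m - val w ?m) \<le> val w (hi s) - val w (lo s)"
      using m le unfolding right_diff_distrib by linarith+
    have tyl: "has w (lo s) Qt" "has w (hi s) Qt" "has w ?m Qt" by simp_all
    have cong: "w \<tturnstile> pos_at f b p \<longleftrightarrow> w \<tturnstile> pos_at f b q" "w \<tturnstile> neg_at f b p \<longleftrightarrow> w \<tturnstile> neg_at f b q"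
       "w \<tturnstile> small_at f c p \<longleftrightarrow> w \<tturnstile> small_at f c q"
      if eq: "val w p = val w q" and p: "has w p Qt" and q: "has w q Qt" and q01: "0 \<le> val w q" "val w q \<le> 1" for p q
    proof -
      have p01: "0 \<le> val w p" "val w p \<le> 1" using eq q01 by simp_all
      note pq = at_cong[OF w f F p q _ eq q01] and qp = at_cong[OF w f F q p _ eq[symmetric] p01]
      show "w \<tturnstile> pos_at f b p \<longleftrightarrow> w \<tturnstile> pos_at f b q" using pq(1)[OF b] qp(1)[OF b] by (rule iffI)
      show "w \<tturnstile> neg_at f b p \<longleftrightarrow> w \<tturnstile> neg_at f b q" using pq(2)[OF b] qp(2)[OF b] by (rule iffI)
      show "w \<tturnstile> small_at f c p \<longleftrightarrow> w \<tturnstile> small_at f c q" using pq(3)[OF c] qp(3)[OF c] by (rule iffI)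
    qed
    have pairI: "\<exists>t. has w t Rt \<and> w \<tturnstile> bracket f c b t \<and> w \<tturnstile> halves s t"
      if [simp]: "has w p Qt" "has w q Qt" and pq: "val w (lo s) \<le> val w p" "val w p \<le> val w q" "val w q \<le> val w (hi s)"
        "2 * (val w q - val w p) \<le> val w (hi s) - val w (lo s)"
        and st: "val w p = val w q \<and> w \<tturnstile> small_at f c p \<or> w \<tturnstile> pos_at f b p \<and> w \<tturnstile> neg_at f b q \<or>
          w \<tturnstile> neg_at f b p \<and> w \<tturnstile> pos_at f b q" for p q
    proof (intro exI[of _ "pair p q"] conjI)
      have p: "w \<tturnstile> pos_at f b (lo (pair p q)) \<longleftrightarrow> w \<tturnstile> pos_at f b p" "w \<tturnstile> neg_at f b (lo (pair p q)) \<longleftrightarrow> w \<tturnstile> neg_at f b p"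
        "w \<tturnstile> small_at f c (lo (pair p q)) \<longleftrightarrow> w \<tturnstile> small_at f c p"
        by (rule cong; use pq I in simp)+
      have q: "w \<tturnstile> pos_at f b (hi (pair p q)) \<longleftrightarrow> w \<tturnstile> pos_at f b q" "w \<tturnstile> neg_at f b (hi (pair p q)) \<longleftrightarrow> w \<tturnstile> neg_at f b q"
        by (rule cong; use pq I in simp)+
      show "w \<tturnstile> bracket f c b (pair p q)"
        using st pq I by (auto simp: forces_bracket p q)
      show "w \<tturnstile> halves s (pair p q)" using pq by (simp add: forces_halves)
    qed simp
    from colour[OF w f F tyl(3) _ _ m01(1,2) bc]
    consider "w \<tturnstile> pos_at f b ?m" | "w \<tturnstile> neg_at f b ?m" | "w \<tturnstile> small_at f c ?m" by auto
    then show ?thesis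
    proof cases
      case 1
      from op show ?thesis
      proof
        assume "w \<tturnstile> pos_at f b (lo s) \<and> w \<tturnstile> neg_at f b (hi s)"
        then show ?thesis using 1 by (intro pairI[OF tyl(3) tyl(2) m01(3,4) order_refl gap(1)]) blast
      next
        assume "w \<tturnstile> neg_at f b (lo s) \<and> w \<tturnstile> pos_at f b (hi s)"
        then show ?thesis using 1 by (intro pairI[OF tyl(1) tyl(3) order_refl m01(3,4) gap(2)]) blast
      qed
    next
      case 2
      from op show ?thesis
      proof
        assume "w \<tturnstile> pos_at f b (lo s) \<and> w \<tturnstile> neg_at f b (hi s)"
        then show ?thesis using 2 by (intro pairI[OF tyl(1) tyl(3) order_refl m01(3,4) gap(2)]) blast
      next
        assume "w \<tturnstile> neg_at f b (lo s) \<and> w \<tturnstile> pos_at f b (hi s)"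
        then show ?thesis using 2 by (intro pairI[OF tyl(3) tyl(2) m01(3,4) order_refl gap(1)]) blast
      qed
    next
      case 3
      then show ?thesis by (intro pairI[OF tyl(3) tyl(3) m01(3) order_refl m01(4) gap(3)]) blast
    qed
  qed
qed

lemma val_mult_less:
  assumes w [simp]: "world w" and [simp]: "has w p Qt" "has w q Qt" "has w u Qt" "has w v Qt"
    and lt: "0 < val w p" "0 < val w q" "val w p < val w u" "val w q < val w v"
  shows "val w (p \<^bold>* q) < val w (u \<^bold>* v)"
proof -
  have "val w (p \<^bold>* q) < val w (u \<^bold>* q)" by (rule val_mult_mono(1)) (use lt in simp_all)
  also have "\<dots> = val w (q \<^bold>* u)" by (rule val_mult_comm) simp_all
  also have "\<dots> < val w (v \<^bold>* u)" by (rule val_mult_mono(1)) (use lt in simp_all)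
  also have "\<dots> = val w (u \<^bold>* v)" by (rule val_mult_comm) simp_all
  finally show ?thesis .
qed

text \<open>Equal signs at 0 and 1 would make the product exceed \<open>b^2 > 0\<close>, contrary to
  the sign condition; so the colours give either a small value at an end point or opposite
  signs.\<close>

lemma start_bracket:
  assumes w [simp]: "world w" and f [simp]: "has w f (Rt \<rightarrow> Rt)" and F: "w \<tturnstile> is_fun01 f"
    and b [simp]: "has w b Qt" and c [simp]: "has w c Qt" and bc: "0 < val w b" "val w b < val w c"
    and S: "w \<tturnstile> rle (rmul (f \<bullet> r0) (f \<bullet> r1)) r0"
  shows "\<exists>s. has w s Rt \<and> w \<tturnstile> bracket f c b s"
proof -
  have np: "\<not> w \<tturnstile> rlt r0 (rmul (f \<bullet> r0) (f \<bullet> r1))" by (rule rleD[OF w S extends_refl[OF w]])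
  have bb: "0 < val w (b \<^bold>* b)" by (rule val_mult_pos) (use bc in simp_all)
  have 1: "\<not> (w \<tturnstile> pos_at f b (qnum 0) \<and> w \<tturnstile> pos_at f b (qnum 1))"
  proof
    assume h: "w \<tturnstile> pos_at f b (qnum 0) \<and> w \<tturnstile> pos_at f b (qnum 1)"
    obtain d0 where e0: "ev w (\<lambda>w' n. has w' d0 Qt \<and> 0 < val w' d0 \<and> val w' (rconst b \<bullet> n) + val w' d0 < val w' (f \<bullet> r0 \<bullet> n))"
      by (rule rltD[OF w, of "rconst b" "f \<bullet> r0"]) (use h in \<open>simp_all add: pos_at_def\<close>)
    obtain d1 where e1: "ev w (\<lambda>w' n. has w' d1 Qt \<and> 0 < val w' d1 \<and> val w' (rconst b \<bullet> n) + val w' d1 < val w' (f \<bullet> r1 \<bullet> n))"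
      by (rule rltD[OF w, of "rconst b" "f \<bullet> r1"]) (use h in \<open>simp_all add: pos_at_def\<close>)
    have "w \<tturnstile> rlt r0 (rmul (f \<bullet> r0) (f \<bullet> r1))"
    proof (rule rltI[OF w _ _ _ bb])
      show "ev w (\<lambda>w' n. val w' (r0 \<bullet> n) + val w' (b \<^bold>* b) < val w' (rmul (f \<bullet> r0) (f \<bullet> r1) \<bullet> n))"
      proof (rule ev_mono[OF ev_conj[OF w e0 e1]])
        fix w' n assume w': "w \<sqsubseteq> w'" and n [simp]: "has w' n Nt" and
          e: "(has w' d0 Qt \<and> 0 < val w' d0 \<and> val w' (rconst b \<bullet> n) + val w' d0 < val w' (f \<bullet> r0 \<bullet> n)) \<and>
             has w' d1 Qt \<and> 0 < val w' d1 \<and> val w' (rconst b \<bullet> n) + val w' d1 < val w' (f \<bullet> r1 \<bullet> n)"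
        note [simp] = extendsD(1,2)[OF w']
        have "val w' (b \<^bold>* b) < val w' ((f \<bullet> r0 \<bullet> n) \<^bold>* (f \<bullet> r1 \<bullet> n))"
          by (rule val_mult_less) (use e val_pos_up[OF w w' b bc(1)] in simp_all)
        then show "val w' (r0 \<bullet> n) + val w' (b \<^bold>* b) < val w' (rmul (f \<bullet> r0) (f \<bullet> r1) \<bullet> n)" by simp
      qed
    qed simp_all
    then show False using np by simp
  qed
  have 2: "\<not> (w \<tturnstile> neg_at f b (qnum 0) \<and> w \<tturnstile> neg_at f b (qnum 1))"
  proof
    assume h: "w \<tturnstile> neg_at f b (qnum 0) \<and> w \<tturnstile> neg_at f b (qnum 1)"
    obtain d0 where e0: "ev w (\<lambda>w' n. has w' d0 Qt \<and> 0 < val w' d0 \<and> val w' (f \<bullet> r0 \<bullet> n) + val w' d0 < val w' (rconst (\<^bold>- b) \<bullet> n))"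
      by (rule rltD[OF w, of "f \<bullet> r0" "rconst (\<^bold>- b)"]) (use h in \<open>simp_all add: neg_at_def\<close>)
    obtain d1 where e1: "ev w (\<lambda>w' n. has w' d1 Qt \<and> 0 < val w' d1 \<and> val w' (f \<bullet> r1 \<bullet> n) + val w' d1 < val w' (rconst (\<^bold>- b) \<bullet> n))"
      by (rule rltD[OF w, of "f \<bullet> r1" "rconst (\<^bold>- b)"]) (use h in \<open>simp_all add: neg_at_def\<close>)
    have "w \<tturnstile> rlt r0 (rmul (f \<bullet> r0) (f \<bullet> r1))"
    proof (rule rltI[OF w _ _ _ bb])
      show "ev w (\<lambda>w' n. val w' (r0 \<bullet> n) + val w' (b \<^bold>* b) < val w' (rmul (f \<bullet> r0) (f \<bullet> r1) \<bullet> n))"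
      proof (rule ev_mono[OF ev_conj[OF w e0 e1]])
        fix w' n assume w': "w \<sqsubseteq> w'" and n [simp]: "has w' n Nt" and
          e: "(has w' d0 Qt \<and> 0 < val w' d0 \<and> val w' (f \<bullet> r0 \<bullet> n) + val w' d0 < val w' (rconst (\<^bold>- b) \<bullet> n)) \<and>
             has w' d1 Qt \<and> 0 < val w' d1 \<and> val w' (f \<bullet> r1 \<bullet> n) + val w' d1 < val w' (rconst (\<^bold>- b) \<bullet> n)"
        note [simp] = extendsD(1,2)[OF w']
        have "val w' (b \<^bold>* b) < val w' (\<^bold>- (f \<bullet> r0 \<bullet> n) \<^bold>* \<^bold>- (f \<bullet> r1 \<bullet> n))"
          by (rule val_mult_less) (use e val_pos_up[OF w w' b bc(1)] in simp_all)
        then show "val w' (r0 \<bullet> n) + val w' (b \<^bold>* b) < val w' (rmul (f \<bullet> r0) (f \<bullet> r1) \<bullet> n)" by simp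
      qed
    qed simp_all
    then show False using np by simp
  qed
  have cong: "w \<tturnstile> pos_at f b q \<Longrightarrow> w \<tturnstile> pos_at f b p" "w \<tturnstile> neg_at f b q \<Longrightarrow> w \<tturnstile> neg_at f b p"
       "w \<tturnstile> small_at f c q \<Longrightarrow> w \<tturnstile> small_at f c p"
      if eq: "val w p = val w q" and p: "has w p Qt" and q: "has w q Qt" and q01: "0 \<le> val w q" "val w q \<le> 1" for p q
  proof -
    have p01: "0 \<le> val w p" "val w p \<le> 1" using eq q01 by simp_all
    note qp = at_cong[OF w f F q p _ eq[symmetric] p01]
    show "w \<tturnstile> pos_at f b q \<Longrightarrow> w \<tturnstile> pos_at f b p" by (rule qp(1)[OF b])
    show "w \<tturnstile> neg_at f b q \<Longrightarrow> w \<tturnstile> neg_at f b p" by (rule qp(2)[OF b])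
    show "w \<tturnstile> small_at f c q \<Longrightarrow> w \<tturnstile> small_at f c p" by (rule qp(3)[OF c])
  qed
  have pairI: "\<exists>s. has w s Rt \<and> w \<tturnstile> bracket f c b s"
    if [simp]: "has w p Qt" "has w q Qt" and pq: "0 \<le> val w p" "val w p \<le> val w q" "val w q \<le> 1"
      and st: "val w p = val w q \<and> w \<tturnstile> small_at f c p \<or> w \<tturnstile> pos_at f b p \<and> w \<tturnstile> neg_at f b q \<or>
          w \<tturnstile> neg_at f b p \<and> w \<tturnstile> pos_at f b q" for p q
  proof (intro exI[of _ "pair p q"] conjI)
    have p: "w \<tturnstile> pos_at f b p \<Longrightarrow> w \<tturnstile> pos_at f b (lo (pair p q))" "w \<tturnstile> neg_at f b p \<Longrightarrow> w \<tturnstile> neg_at f b (lo (pair p q))"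
      "w \<tturnstile> small_at f c p \<Longrightarrow> w \<tturnstile> small_at f c (lo (pair p q))"
      by (erule cong[rotated 5]; use pq in simp)+
    have q: "w \<tturnstile> pos_at f b q \<Longrightarrow> w \<tturnstile> pos_at f b (hi (pair p q))" "w \<tturnstile> neg_at f b q \<Longrightarrow> w \<tturnstile> neg_at f b (hi (pair p q))"
      by (erule cong[rotated 5]; use pq in simp)+
    show "w \<tturnstile> bracket f c b (pair p q)"
      using st pq p q by (auto simp: forces_bracket)
  qed simp
  have "w \<tturnstile> pos_at f b (qnum 0) \<or> w \<tturnstile> neg_at f b (qnum 0) \<or> w \<tturnstile> small_at f c (qnum 0)"
    "w \<tturnstile> pos_at f b (qnum 1) \<or> w \<tturnstile> neg_at f b (qnum 1) \<or> w \<tturnstile> small_at f c (qnum 1)"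
    by (rule colour[OF w f F]; use bc in simp)+
  then consider "w \<tturnstile> small_at f c (qnum 0)" | "w \<tturnstile> small_at f c (qnum 1)" |
    "w \<tturnstile> pos_at f b (qnum 0) \<and> w \<tturnstile> neg_at f b (qnum 1) \<or> w \<tturnstile> neg_at f b (qnum 0) \<and> w \<tturnstile> pos_at f b (qnum 1)"
    using 1 2 by blast
  then show ?thesis
  proof cases
    case 1
    show ?thesis by (rule pairI[of "qnum 0" "qnum 0"]) (use 1 in simp_all)
  next
    case 2
    show ?thesis by (rule pairI[of "qnum 1" "qnum 1"]) (use 2 in simp_all)
  next
    case 3
    show ?thesis by (rule pairI[of "qnum 0" "qnum 1"]) (use 3 in simp_all)
  qed
qed

section \<open>The limit point of the halving\<close>

text \<open>The sequence of lower end points, obtained by combinators; a sequence of rationals is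
  itself the representative of a real.\<close>

definition limit_of :: "tm \<Rightarrow> tm" where
  "limit_of g = Con (Sc Nt Nt Qt) \<bullet> g \<bullet> (Con (Kc Nt Nt) \<bullet> zero)"

lemma has_limit_of [simp]: "has w g (Nt \<rightarrow> Rt) \<Longrightarrow> has w (limit_of g) Rt"
  unfolding limit_of_def by (auto simp: ht_App)

lemma val_limit_of [simp]:
  assumes w [simp]: "world w" and g: "has w g (Nt \<rightarrow> Rt)" and n: "has w n Nt"
  shows "val w (limit_of g \<bullet> n) = val w (lo (g \<bullet> n))"
proof -
  have z: "has w zero Nt" by simp
  have K: "has w (Con (Kc Nt Nt) \<bullet> zero) (Nt \<rightarrow> Nt)" by simp
  have gn: "has w (g \<bullet> n) Rt" by (rule ht_AppI[OF g n])
  have "w \<tturnstile> limit_of g \<bullet> n \<^bold>= g \<bullet> n \<bullet> (Con (Kc Nt Nt) \<bullet> zero \<bullet> n)"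
    unfolding limit_of_def by (rule forces_S[OF w g K n])
  moreover have "w \<tturnstile> g \<bullet> n \<bullet> (Con (Kc Nt Nt) \<bullet> zero \<bullet> n) \<^bold>= lo (g \<bullet> n)"
    by (rule app_cong[OF w forces_K[OF w z n] gn ht_AppI[OF K n]])
  ultimately have "w \<tturnstile> limit_of g \<bullet> n \<^bold>= lo (g \<bullet> n)" by (rule forces_trans[OF w])
  then show ?thesis by (rule val_eqI[OF w]) (use g n in simp)
qed

locale halving =
  fixes w f c b g
  assumes w [simp]: "world w" and f [simp]: "has w f (Rt \<rightarrow> Rt)" and F: "w \<tturnstile> is_fun01 f"
    and c [simp]: "has w c Qt" and b [simp]: "has w b Qt" and g [simp]: "has w g (Nt \<rightarrow> Rt)"
    and br: "\<And>w' n. w \<sqsubseteq> w' \<Longrightarrow> has w' n Nt \<Longrightarrow> w' \<tturnstile> bracket f c b (g \<bullet> n)"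
    and hv: "\<And>w' n. w \<sqsubseteq> w' \<Longrightarrow> has w' n Nt \<Longrightarrow> w' \<tturnstile> halves (g \<bullet> n) (g \<bullet> succ n)"
begin

lemma up: "w \<sqsubseteq> w' \<Longrightarrow> halving w' f c b g"
proof (rule halving.intro)
  assume w': "w \<sqsubseteq> w'"
  note e = extendsD[OF w']
  show "world w'" by (rule e(1))
  show "has w' f (Rt \<rightarrow> Rt)" "has w' c Qt" "has w' b Qt" "has w' g (Nt \<rightarrow> Rt)" by (rule e(2), simp)+
  show "w' \<tturnstile> is_fun01 f" by (rule e(3)[OF F])
  show "w'' \<tturnstile> bracket f c b (g \<bullet> n)" if "w' \<sqsubseteq> w''" "has w'' n Nt" for w'' n
    by (rule br[OF extends_trans[OF w' that(1)] that(2)])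
  show "w'' \<tturnstile> halves (g \<bullet> n) (g \<bullet> succ n)" if "w' \<sqsubseteq> w''" "has w'' n Nt" for w'' n
    by (rule hv[OF extends_trans[OF w' that(1)] that(2)])
qed

lemma bounds:
  assumes n [simp]: "has w n Nt"
  shows "0 \<le> val w (lo (g \<bullet> n))" "val w (lo (g \<bullet> n)) \<le> val w (hi (g \<bullet> n))" "val w (hi (g \<bullet> n)) \<le> 1"
  using br[OF extends_refl[OF w] n] by (auto simp: forces_bracket)

lemma steps:
  assumes n [simp]: "has w n Nt"
  shows "val w (lo (g \<bullet> n)) \<le> val w (lo (g \<bullet> succ n))" "val w (hi (g \<bullet> succ n)) \<le> val w (hi (g \<bullet> n))"
    "2 * (val w (hi (g \<bullet> succ n)) - val w (lo (g \<bullet> succ n))) \<le> val w (hi (g \<bullet> n)) - val w (lo (g \<bullet> n))"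
  using hv[OF extends_refl[OF w] n] by (simp_all add: forces_halves)

lemma val_cong_g:
  assumes eq: "w \<tturnstile> n \<^bold>= m" and n [simp]: "has w n Nt" and k [simp]: "has w k Nt"
  shows "val w (g \<bullet> n \<bullet> k) = val w (g \<bullet> m \<bullet> k)"
  by (rule val_eqI[OF w forces_cong_fun[where \<sigma> = Nt and \<tau> = Qt, OF w app_cong[OF w eq g n] _ k]]) simp_all

text \<open>Halving is compared with \<open>1/(n+1)\<close> rather than with a power of two, which
  would first have to be defined by recursion.\<close>

lemma width: "has w n Nt \<Longrightarrow> val w (hi (g \<bullet> n)) - val w (lo (g \<bullet> n)) \<le> val w (eps_q n)"
proof -
  assume n: "has w n Nt"
  let ?A = "hi (shift 1 g \<bullet> Var 0) \<^bold>+ \<^bold>- lo (shift 1 g \<bullet> Var 0) \<^bold>\<le> eps_q (Var 0)"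
  have "w \<tturnstile> inst ?A n"
  proof (rule forces_induct[OF w _ n])
    have "val w (eps_q zero) = 1"
      using val_eps(1)[OF w, of zero] val_mult_num(2)[OF w, of "eps_q zero" 0] by (simp add: num_0)
    moreover have "val w (hi (g \<bullet> zero)) - val w (lo (g \<bullet> zero)) \<le> 1"
      using bounds[of zero] by (simp add: algebra_simps)
    ultimately show "w \<tturnstile> inst ?A zero" by (simp add: forces_le)
  next
    fix w' n assume w': "w \<sqsubseteq> w'" and n [simp]: "has w' n Nt" and IH: "w' \<tturnstile> inst ?A n"
    interpret w': halving w' f c b g by (rule up[OF w'])
    have "val w' (hi (g \<bullet> n)) - val w' (lo (g \<bullet> n)) \<le> val w' (eps_q n)" using IH by (simp add: forces_le)
    then have "val w' (hi (g \<bullet> succ n)) - val w' (lo (g \<bullet> succ n)) \<le> val w' (eps_q (succ n))"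
      using w'.steps(3)[OF n] eps_succ[of w' n] by simp
    then show "w' \<tturnstile> inst ?A (succ n)" by (simp add: forces_le)
  qed simp
  then show ?thesis using n by (simp add: forces_le)
qed

text \<open>The induction on \<open>m\<close> starts at zero, so the formula carries the alternative
  \<open>m < n\<close>; by discreteness it gives way at the step where \<open>m\<close> becomes
  equal to \<open>n\<close>.\<close>

lemma nested:
  assumes n [simp]: "has w n Nt" and m: "has w m Nt" and nm: "val w (iota n) \<le> val w (iota m)"
  shows "val w (lo (g \<bullet> n)) \<le> val w (lo (g \<bullet> m))" "val w (hi (g \<bullet> m)) \<le> val w (hi (g \<bullet> n))"
proof -
  let ?A = "(iota (Var 0) \<^bold>< iota (shift 1 n)) \<^bold>\<or>
    (lo (shift 1 g \<bullet> shift 1 n) \<^bold>\<le> lo (shift 1 g \<bullet> Var 0)) \<^bold>\<and> (hi (shift 1 g \<bullet> Var 0) \<^bold>\<le> hi (shift 1 g \<bullet> shift 1 n))"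
  have A: "v \<tturnstile> inst ?A m \<longleftrightarrow> val v (iota m) < val v (iota n) \<or>
      val v (lo (g \<bullet> n)) \<le> val v (lo (g \<bullet> m)) \<and> val v (hi (g \<bullet> m)) \<le> val v (hi (g \<bullet> n))"
    if [simp]: "world v" "has v m Nt" "has v n Nt" "has v g (Nt \<rightarrow> Rt)" for v m
  proof -
    have "inst ?A m = ((iota m \<^bold>< iota n) \<^bold>\<or> (lo (g \<bullet> n) \<^bold>\<le> lo (g \<bullet> m)) \<^bold>\<and> (hi (g \<bullet> m) \<^bold>\<le> hi (g \<bullet> n)))" by simp
    moreover have "v \<tturnstile> ((iota m \<^bold>< iota n) \<^bold>\<or> (lo (g \<bullet> n) \<^bold>\<le> lo (g \<bullet> m)) \<^bold>\<and> (hi (g \<bullet> m) \<^bold>\<le> hi (g \<bullet> n))) \<longleftrightarrow>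
      val v (iota m) < val v (iota n) \<or>
      val v (lo (g \<bullet> n)) \<le> val v (lo (g \<bullet> m)) \<and> val v (hi (g \<bullet> m)) \<le> val v (hi (g \<bullet> n))"
      by (subst forces_Or) (simp_all add: forces_And forces_le forces_Lt)
    ultimately show ?thesis by simp
  qed
  have "w \<tturnstile> inst ?A m"
  proof (rule forces_induct[OF w _ m])
    have "val w (iota zero) < val w (iota n) \<or> w \<tturnstile> n \<^bold>= zero"
      using nat_trichotomy[OF w n, of zero] nat_nonneg[OF w n] by (auto simp del: nat_nonneg)
    then show "w \<tturnstile> inst ?A zero"
      by (subst A) (use val_cong_g[of n zero] in auto)
  next
    fix w' m assume w': "w \<sqsubseteq> w'" and m [simp]: "has w' m Nt" and IH: "w' \<tturnstile> inst ?A m"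
    interpret w': halving w' f c b g by (rule up[OF w'])
    have n' [simp]: "has w' n Nt" by (rule extendsD(2)[OF w' n])
    from IH have "val w' (iota m) < val w' (iota n) \<or>
      val w' (lo (g \<bullet> n)) \<le> val w' (lo (g \<bullet> m)) \<and> val w' (hi (g \<bullet> m)) \<le> val w' (hi (g \<bullet> n))"
      using A[of w' m] by (simp del: subst_fm.simps)
    then have "val w' (iota (succ m)) < val w' (iota n) \<or>
      val w' (lo (g \<bullet> n)) \<le> val w' (lo (g \<bullet> succ m)) \<and> val w' (hi (g \<bullet> succ m)) \<le> val w' (hi (g \<bullet> n))"
    proof
      assume lt: "val w' (iota m) < val w' (iota n)"
      have "val w' (iota (succ m)) < val w' (iota n) \<or> w' \<tturnstile> n \<^bold>= succ m"
        using nat_trichotomy[of w' n "succ m"] lt by auto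
      then show ?thesis using w'.val_cong_g[of n "succ m"] by auto
    next
      assume "val w' (lo (g \<bullet> n)) \<le> val w' (lo (g \<bullet> m)) \<and> val w' (hi (g \<bullet> m)) \<le> val w' (hi (g \<bullet> n))"
      then show ?thesis using w'.steps(1,2)[OF m] by (meson order_trans)
    qed
    then show "w' \<tturnstile> inst ?A (succ m)" using A[of w' "succ m"] by (simp del: subst_fm.simps)
  qed simp
  then have "val w (iota m) < val w (iota n) \<or>
      val w (lo (g \<bullet> n)) \<le> val w (lo (g \<bullet> m)) \<and> val w (hi (g \<bullet> m)) \<le> val w (hi (g \<bullet> n))"
    using A[of w m] m by (simp del: subst_fm.simps)
  then show "val w (lo (g \<bullet> n)) \<le> val w (lo (g \<bullet> m))" "val w (hi (g \<bullet> m)) \<le> val w (hi (g \<bullet> n))"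
    using nm by auto
qed

lemma limit_between:
  assumes n: "has w n Nt" and m: "has w m Nt" and nm: "val w (iota n) \<le> val w (iota m)"
  shows "val w (lo (g \<bullet> n)) \<le> val w (limit_of g \<bullet> m)" "val w (limit_of g \<bullet> m) \<le> val w (hi (g \<bullet> n))"
  using nested[OF n m nm] bounds(2)[OF m] val_limit_of[OF w g m] by simp_all

lemma is_real_limit: "w \<tturnstile> is_real (limit_of g)"
proof (rule is_realI[OF w])
  fix w' d assume w': "w \<sqsubseteq> w'" and d: "has w' d Qt" "0 < val w' d"
  interpret w': halving w' f c b g by (rule up[OF w'])
  obtain K where K [simp]: "has w' K Nt" and Kd: "val w' (eps_q K) < val w' d"
    by (rule eps_archimedean[OF w'.w d])
  have "ev w' (\<lambda>w'' n. \<bar>val w'' (limit_of g \<bullet> n) - val w'' (lo (g \<bullet> K))\<bar> < val w'' d)"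
  proof (rule evI[OF K])
    fix w'' n assume w'': "w' \<sqsubseteq> w''" and K' [simp]: "has w'' K Nt" and n [simp]: "has w'' n Nt"
      and le: "val w'' (iota K) \<le> val w'' (iota n)"
    interpret w'': halving w'' f c b g by (rule w'.up[OF w''])
    have "val w'' (eps_q K) < val w'' d" by (rule extends_val(1)[OF w'.w w'' _ d(1) Kd]) simp
    then show "\<bar>val w'' (limit_of g \<bullet> n) - val w'' (lo (g \<bullet> K))\<bar> < val w'' d"
      using w''.limit_between[OF K' n le] w''.width[OF K'] unfolding abs_less_iff by linarith
  qed
  then show "\<exists>c. has w' c Qt \<and> ev w' (\<lambda>w'' n. \<bar>val w'' (limit_of g \<bullet> n) - val w'' c\<bar> < val w'' d)"
    by (intro exI[of _ "lo (g \<bullet> K)"]) simp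
qed simp

lemma limit_in01: "w \<tturnstile> in01 (limit_of g)"
proof (rule in01I[OF w is_real_limit rle_evI[OF w] rle_evI[OF w]])
  have *: "0 \<le> val w' (limit_of g \<bullet> n)" "val w' (limit_of g \<bullet> n) \<le> 1" if "w \<sqsubseteq> w'" "has w' n Nt" for w' n
  proof -
    interpret w': halving w' f c b g by (rule up[OF that(1)])
    show "0 \<le> val w' (limit_of g \<bullet> n)" "val w' (limit_of g \<bullet> n) \<le> 1"
      using w'.bounds[OF that(2)] that(2) by simp_all
  qed
  show "ev w (\<lambda>w' n. val w' (r0 \<bullet> n) \<le> val w' (limit_of g \<bullet> n))"
  proof (rule evI[of _ zero])
    fix w' n assume "w \<sqsubseteq> w'" "world w'" "has w' n Nt"
    then show "val w' (r0 \<bullet> n) \<le> val w' (limit_of g \<bullet> n)" using *(1)[of w' n] by (simp del: val_limit_of)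
  qed simp
  show "ev w (\<lambda>w' n. val w' (limit_of g \<bullet> n) \<le> val w' (r1 \<bullet> n))"
  proof (rule evI[of _ zero])
    fix w' n assume "w \<sqsubseteq> w'" "world w'" "has w' n Nt"
    then show "val w' (limit_of g \<bullet> n) \<le> val w' (r1 \<bullet> n)" using *(2)[of w' n] by (simp del: val_limit_of)
  qed simp
qed simp_all

text \<open>Intervals nested in a single point stay at that point.\<close>

lemma req_limit:
  assumes n [simp]: "has w n Nt" and eq: "val w (lo (g \<bullet> n)) = val w (hi (g \<bullet> n))"
  shows "w \<tturnstile> req (rconst (lo (g \<bullet> n))) (limit_of g)"
proof (rule reqI[OF w])
  fix w' d assume w': "w \<sqsubseteq> w'" and d: "has w' d Qt" "0 < val w' d"
  interpret w': halving w' f c b g by (rule up[OF w'])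
  have n' [simp]: "has w' n Nt" by (rule extendsD(2)[OF w' n])
  show "ev w' (\<lambda>w'' m. \<bar>val w'' (rconst (lo (g \<bullet> n)) \<bullet> m) - val w'' (limit_of g \<bullet> m)\<bar> < val w'' d)"
  proof (rule evI[OF n'])
    fix w'' m assume w'': "w' \<sqsubseteq> w''" and n'' [simp]: "has w'' n Nt" and m [simp]: "has w'' m Nt"
      and le: "val w'' (iota n) \<le> val w'' (iota m)"
    interpret w'': halving w'' f c b g by (rule w'.up[OF w''])
    have "val w'' (lo (g \<bullet> n)) = val w'' (hi (g \<bullet> n))"
      by (rule extends_val(3)[OF w extends_trans[OF w' w''] _ _ eq]) simp_all
    then have "val w'' (limit_of g \<bullet> m) = val w'' (lo (g \<bullet> n))"
      using w''.limit_between[OF n'' m le] by simp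
    then show "\<bar>val w'' (rconst (lo (g \<bullet> n)) \<bullet> m) - val w'' (limit_of g \<bullet> m)\<bar> < val w'' d"
      using val_pos_up[OF w'.w w'' d] by (simp del: val_limit_of)
  qed
qed simp_all

text \<open>A degenerate interval with a small value is impossible: its point would equal the limit,
  where \<open>f\<close> is not small. So the end points have opposite signs, and one of them has
  the sign opposite to that at the limit.\<close>

lemma opposite_point:
  assumes n [simp]: "has w n Nt"
    and big: "w \<tturnstile> rlt (rconst c) (f \<bullet> limit_of g) \<or> w \<tturnstile> rlt (f \<bullet> limit_of g) (rconst (\<^bold>- c))"
  obtains q where "has w q Qt" "val w (lo (g \<bullet> n)) \<le> val w q" "val w q \<le> val w (hi (g \<bullet> n))"
    "w \<tturnstile> rlt (rconst c) (f \<bullet> limit_of g) \<and> w \<tturnstile> neg_at f b q \<or>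
     w \<tturnstile> rlt (f \<bullet> limit_of g) (rconst (\<^bold>- c)) \<and> w \<tturnstile> pos_at f b q"
proof -
  let ?z = "limit_of g" and ?l = "lo (g \<bullet> n)" and ?h = "hi (g \<bullet> n)"
  have l: "has w ?l Qt" and h: "has w ?h Qt" by simp_all
  have "\<not> (val w ?l = val w ?h \<and> w \<tturnstile> small_at f c ?l)"
  proof
    assume s: "val w ?l = val w ?h \<and> w \<tturnstile> small_at f c ?l"
    have r: "w \<tturnstile> req (f \<bullet> rconst ?l) (f \<bullet> ?z)"
      by (rule fun01D(2)[OF w f F])
        (use s req_limit[OF n] limit_in01 in01_const[OF w l] bounds[OF n] in simp_all)
    have rc: "w \<tturnstile> req (rconst q) (rconst q)" if "has w q Qt" for q by (rule req_refl) (use that in simp_all)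
    have "w \<tturnstile> rlt (rconst (\<^bold>- c)) (f \<bullet> ?z)"
      by (rule rlt_req[OF w _ _ _ _ _ rc r]) (use s in \<open>simp_all add: small_at_def forces_And\<close>)
    moreover have "w \<tturnstile> rlt (f \<bullet> ?z) (rconst c)"
      by (rule rlt_req[OF w _ _ _ _ _ r rc]) (use s in \<open>simp_all add: small_at_def forces_And\<close>)
    ultimately show False
      using big rlt_conflict[of w "f \<bullet> ?z" c c] rlt_conflict[of w "f \<bullet> ?z" "\<^bold>- c" "\<^bold>- c"] by auto
  qed
  then have "w \<tturnstile> pos_at f b ?l \<and> w \<tturnstile> neg_at f b ?h \<or> w \<tturnstile> neg_at f b ?l \<and> w \<tturnstile> pos_at f b ?h"
    using br[OF extends_refl[OF w] n] by (auto simp: forces_bracket)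
  then show thesis
    using big that[OF l order_refl bounds(2)[OF n]] that[OF h bounds(2)[OF n] order_refl] by blast
qed

end

section \<open>The root or the jump\<close>

text \<open>The precision is tied to the index \<open>n\<close>, so that choice can impose the
  condition on the \<open>n\<close>-th point and convergence follows.\<close>

definition stays_near :: "tm \<Rightarrow> tm \<Rightarrow> tm \<Rightarrow> fm" where
  "stays_near x z n = All Nt (le_n (shift 1 n) (Var 0) \<^bold>\<longrightarrow>
     (abs_q (shift 1 x \<bullet> Var 0 \<^bold>+ \<^bold>- (shift 1 z \<bullet> Var 0)) \<^bold>\<le> eps_q (shift 1 n)))"

lemma subst_stays_near [simp]: "subst_fm s (stays_near x z n) = stays_near (subst_tm s x) (subst_tm s z) (subst_tm s n)"
  by (simp add: stays_near_def)

lemma wfe_stays_near [simp]: "ht e x Rt \<Longrightarrow> ht e z Rt \<Longrightarrow> ht e n Nt \<Longrightarrow> wfe e (stays_near x z n)"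
  by (simp add: stays_near_def)

lemma stays_nearI:
  assumes w [simp]: "world w" and [simp]: "has w x Rt" "has w z Rt" "has w n Nt"
    and *: "\<And>w' m. w \<sqsubseteq> w' \<Longrightarrow> has w' m Nt \<Longrightarrow> val w' (iota n) \<le> val w' (iota m) \<Longrightarrow>
       \<bar>val w' (x \<bullet> m) - val w' (z \<bullet> m)\<bar> \<le> val w' (eps_q n)"
  shows "w \<tturnstile> stays_near x z n"
  unfolding stays_near_def
proof (rule forces_AllI[OF w])
  fix w' m assume w': "w \<sqsubseteq> w'" and m [simp]: "has w' m Nt"
  note [simp] = extendsD(1,2)[OF w']
  have "w' \<tturnstile> (le_n n m \<^bold>\<longrightarrow> (abs_q (x \<bullet> m \<^bold>+ \<^bold>- (z \<bullet> m)) \<^bold>\<le> eps_q n))"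
  proof (rule forces_ImpI)
    fix w'' assume w'': "w' \<sqsubseteq> w''" and h: "w'' \<tturnstile> (le_n n m)"
    note [simp] = extendsD(1,2)[OF w'']
    show "w'' \<tturnstile> (abs_q (x \<bullet> m \<^bold>+ \<^bold>- (z \<bullet> m)) \<^bold>\<le> eps_q n)"
      using *[OF extends_trans[OF w' w''], of m] h by (simp add: forces_le)
  qed simp_all
  then show "w' \<tturnstile> inst (le_n (shift 1 n) (Var 0) \<^bold>\<longrightarrow>
     (abs_q (shift 1 x \<bullet> Var 0 \<^bold>+ \<^bold>- (shift 1 z \<bullet> Var 0)) \<^bold>\<le> eps_q (shift 1 n))) m" by simp
qed simp

lemma stays_nearD:
  assumes w [simp]: "world w" and [simp]: "has w x Rt" "has w z Rt" "has w n Nt" "has w m Nt"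
    and A: "w \<tturnstile> stays_near x z n" and le: "val w (iota n) \<le> val w (iota m)"
  shows "\<bar>val w (x \<bullet> m) - val w (z \<bullet> m)\<bar> \<le> val w (eps_q n)"
proof -
  have "w \<tturnstile> (le_n n m \<^bold>\<longrightarrow> (abs_q (x \<bullet> m \<^bold>+ \<^bold>- (z \<bullet> m)) \<^bold>\<le> eps_q n))"
    using forces_AllD[OF w A[unfolded stays_near_def], of m] by simp
  from forces_ImpD[OF w this] show ?thesis using le by (simp add: forces_le)
qed

lemma val_num_mult: "world w \<Longrightarrow> has w t Qt \<Longrightarrow> has w u Qt \<Longrightarrow>
  val w (iota (num k) \<^bold>* t \<^bold>* u) = of_nat k * val w (t \<^bold>* u)"
  by (simp add: val_mult_assoc)

lemma val_mult_num_right: "world w \<Longrightarrow> has w t Qt \<Longrightarrow> has w u Qt \<Longrightarrow>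
  val w (t \<^bold>* (iota (num k) \<^bold>* u)) = of_nat k * val w (t \<^bold>* u)"
  using val_mult_comm[of w t "iota (num k) \<^bold>* u"] val_mult_comm[of w t u] by (simp add: val_num_mult)

text \<open>\<open>u v > 42 r^2\<close> and \<open>e^2/8 <= 32 r^2\<close>; out of the gap of
  \<open>10 r^2\<close>, a single \<open>r^2\<close> is kept as the margin of a strict inequality of
  reals.\<close>

lemma product_jump:
  assumes w [simp]: "world w" and [simp]: "has w u Qt" "has w v Qt" "has w e Qt" "has w r Qt"
    and r: "0 < val w r" and u: "7 * val w r < val w u" and v: "6 * val w r < val w v"
    and e: "\<bar>val w e\<bar> \<le> 16 * val w r"
  shows "val w (r \<^bold>* r) < val w (u \<^bold>* v) - val w (e \<^bold>* e) / 8"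
proof -
  have "val w ((iota (num 7) \<^bold>* r) \<^bold>* (iota (num 6) \<^bold>* r)) < val w (u \<^bold>* v)"
    by (rule val_mult_less) (use r u v in simp_all)
  then have "42 * val w (r \<^bold>* r) < val w (u \<^bold>* v)" by (simp add: val_num_mult val_mult_num_right)
  moreover have "val w (e \<^bold>* e) \<le> val w ((iota (num 16) \<^bold>* r) \<^bold>* (iota (num 16) \<^bold>* r))"
    by (rule val_square_mono) (use e in simp_all)
  then have "val w (e \<^bold>* e) \<le> 256 * val w (r \<^bold>* r)" by (simp add: val_num_mult val_mult_num_right)
  moreover have "0 < val w (r \<^bold>* r)" by (rule val_mult_pos) (use r in simp_all)
  ultimately show ?thesis by (simp add: field_simps)
qed

text \<open>\<open>c\<close> is within \<open>\<delta> = d/8\<close> of the tail of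
  \<open>e\<close>, where \<open>d < e\<close>, hence \<open>c > 7 \<delta>\<close>. With
  \<open>8 r = c - \<delta>\<close> the lower bound is immediate, and
  \<open>e < c + \<delta> < 2 (c - \<delta>)\<close> because \<open>c > 3 \<delta>\<close>.\<close>

lemma epsilon_scale:
  assumes w [simp]: "world w" and e [simp]: "has w e Rt" and R: "w \<tturnstile> is_real e" and E: "w \<tturnstile> rlt r0 e"
  obtains r where "has w r Qt" "0 < val w r"
    "ev w (\<lambda>w' n. 8 * val w' r < val w' (e \<bullet> n) \<and> val w' (e \<bullet> n) < 16 * val w' r)"
proof -
  obtain d where d [simp]: "has w d Qt" and pos: "0 < val w d" and
    ev: "ev w (\<lambda>w' n. has w' d Qt \<and> 0 < val w' d \<and> val w' (r0 \<bullet> n) + val w' d < val w' (e \<bullet> n))"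
    by (rule rltD[OF w _ _ E]) simp_all
  let ?\<delta> = "d \<^bold>* inv_q (qnum 8)"
  have \<delta>: "has w ?\<delta> Qt" "0 < val w ?\<delta>" "8 * val w ?\<delta> = val w d" using pos by simp_all
  obtain c where c [simp]: "has w c Qt" and evc: "ev w (\<lambda>w' n. \<bar>val w' (e \<bullet> n) - val w' c\<bar> < val w' ?\<delta>)"
    by (rule is_realD[OF w e R \<delta>(1,2)])
  from ev_ex[OF w ev_conj[OF w ev evc]] obtain n where [simp]: "has w n Nt" and
    n: "val w (r0 \<bullet> n) + val w d < val w (e \<bullet> n)" "\<bar>val w (e \<bullet> n) - val w c\<bar> < val w ?\<delta>" by auto
  have big: "7 * val w ?\<delta> < val w c" using n \<delta>(3) unfolding abs_less_iff by simp
  let ?r = "(c \<^bold>+ \<^bold>- ?\<delta>) \<^bold>* inv_q (qnum 8)"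
  show thesis
  proof (rule that[of ?r])
    show "has w ?r Qt" by simp
    show "0 < val w ?r" using big \<delta> by simp
    show "ev w (\<lambda>w' n. 8 * val w' ?r < val w' (e \<bullet> n) \<and> val w' (e \<bullet> n) < 16 * val w' ?r)"
    proof (rule ev_mono[OF evc])
      fix w' n assume w': "w \<sqsubseteq> w'" and n [simp]: "has w' n Nt" and h: "\<bar>val w' (e \<bullet> n) - val w' c\<bar> < val w' ?\<delta>"
      note [simp] = extendsD(1,2)[OF w']
      have "val w (iota (num 7) \<^bold>* ?\<delta>) < val w c" using big by simp
      then have "val w' (iota (num 7) \<^bold>* ?\<delta>) < val w' c" by (rule extends_val(1)[OF w w', rotated 2]) simp_all
      then have 1: "7 * val w' ?\<delta> < val w' c" by simp
      have 2: "0 < val w' ?\<delta>" by (rule val_pos_up[OF w w' \<delta>(1,2)])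
      have 3: "8 * val w' ?r = val w' c - val w' ?\<delta>" by simp
      show "8 * val w' ?r < val w' (e \<bullet> n) \<and> val w' (e \<bullet> n) < 16 * val w' ?r"
        using 1 2 3 h unfolding abs_less_iff by linarith
    qed
  qed
qed

theorem root_or_jump:
  assumes w [simp]: "world w" and f [simp]: "has w f (Rt \<rightarrow> Rt)" and e [simp]: "has w e Rt"
    and F: "w \<tturnstile> is_fun01 f" and S: "w \<tturnstile> rle (rmul (f \<bullet> r0) (f \<bullet> r1)) r0"
    and R: "w \<tturnstile> is_real e" and E: "w \<tturnstile> rlt r0 e"
  shows "\<exists>z. has w z Rt \<and> w \<tturnstile> in01 z \<and> (w \<tturnstile> rlt (rabs (f \<bullet> z)) e \<or> w \<tturnstile> jump_seq f e z)"
proof -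
  obtain r where r [simp]: "has w r Qt" and rpos: "0 < val w r" and
    scale: "ev w (\<lambda>w' n. 8 * val w' r < val w' (e \<bullet> n) \<and> val w' (e \<bullet> n) < 16 * val w' r)"
    by (rule epsilon_scale[OF w e R E])
  \<comment> \<open>Signs at rational points are decided with \<open>6 r\<close> against
    \<open>7 r\<close>, the value at the limit with \<open>7 r\<close> against
    \<open>8 r\<close>.\<close>
  let ?b = "iota (num 6) \<^bold>* r" and ?c = "iota (num 7) \<^bold>* r" and ?m = "iota (num 8) \<^bold>* r"
  have b: "has w ?b Qt" and c: "has w ?c Qt" by simp_all
  have bc: "0 < val w ?b" "val w ?b < val w ?c" using rpos by simp_all
  obtain s where s: "has w s Rt" "w \<tturnstile> bracket f ?c ?b s"
    using start_bracket[OF w f F b c bc S] by blast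
  let ?D = "bracket (shift 1 f) (shift 1 ?c) (shift 1 ?b) (Var 0)"
  obtain g where g: "has w g (Nt \<rightarrow> Rt)"
    and br: "\<And>w' n. w \<sqsubseteq> w' \<Longrightarrow> has w' n Nt \<Longrightarrow> w' \<tturnstile> inst ?D (g \<bullet> n)"
    and hv: "\<And>w' n. w \<sqsubseteq> w' \<Longrightarrow> has w' n Nt \<Longrightarrow>
      w' \<tturnstile> subst_fm (case_nat (g \<bullet> succ n) (case_nat (g \<bullet> n) Var)) (halves (Var 1) (Var 0))"
  proof (rule forces_dependent_choice[OF w, of Rt ?D "halves (Var 1) (Var 0)" s])
    fix w' x assume w': "w \<sqsubseteq> w'" and x: "has w' x Rt" and B: "w' \<tturnstile> inst ?D x"
    note [simp] = extendsD(1,2)[OF w']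
    have "val w' ?b < val w' ?c" by (rule extends_val(1)[OF w w' b c bc(2)])
    then show "\<exists>y. has w' y Rt \<and> w' \<tturnstile> inst ?D y \<and> w' \<tturnstile> subst_fm (case_nat y (case_nat x Var)) (halves (Var 1) (Var 0))"
      using halving_step[of w' f ?b ?c x] extendsD(3)[OF w' F] B x by simp
  next
    show "wfe (case_nat (Some Rt) (env (fst w))) ?D" by simp
    show "wfe (case_nat (Some Rt) (case_nat (Some Rt) (env (fst w)))) (halves (Var 1) (Var 0))" by simp
    show "has w s Rt" by (rule s(1))
    show "w \<tturnstile> inst ?D s" using s by simp
  qed (rule that; blast)
  interpret halving w f ?c ?b g
  proof
    show "w' \<tturnstile> bracket f ?c ?b (g \<bullet> n)" if "w \<sqsubseteq> w'" "has w' n Nt" for w' n using br[OF that] by simp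
    show "w' \<tturnstile> halves (g \<bullet> n) (g \<bullet> succ n)" if "w \<sqsubseteq> w'" "has w' n Nt" for w' n using hv[OF that] by simp
  qed (use g F in simp_all)
  let ?z = "limit_of g"
  have z [simp]: "has w ?z Rt" using g by simp
  have fz: "w \<tturnstile> is_real (f \<bullet> ?z)" by (rule fun01D(1)[OF w f F z limit_in01])
  have "w \<tturnstile> rlt (rconst ?c) (f \<bullet> ?z) \<or> w \<tturnstile> rlt (f \<bullet> ?z) (rconst ?m)"
    by (rule rlt_cotrans[OF w _ fz]) (use rpos in simp_all)
  moreover have "w \<tturnstile> rlt (rconst (\<^bold>- ?m)) (f \<bullet> ?z) \<or> w \<tturnstile> rlt (f \<bullet> ?z) (rconst (\<^bold>- ?c))"
    by (rule rlt_cotrans[OF w _ fz]) (use rpos in simp_all)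
  ultimately consider "w \<tturnstile> rlt (f \<bullet> ?z) (rconst ?m)" "w \<tturnstile> rlt (rconst (\<^bold>- ?m)) (f \<bullet> ?z)" |
    "w \<tturnstile> rlt (rconst ?c) (f \<bullet> ?z) \<or> w \<tturnstile> rlt (f \<bullet> ?z) (rconst (\<^bold>- ?c))" by blast
  then have "w \<tturnstile> rlt (rabs (f \<bullet> ?z)) e \<or> w \<tturnstile> jump_seq f e ?z"
  proof cases
    case 1
    obtain p where p [simp]: "has w p Qt" "0 < val w p" and
      evp: "ev w (\<lambda>w' n. has w' p Qt \<and> 0 < val w' p \<and> val w' (f \<bullet> ?z \<bullet> n) + val w' p < val w' (rconst ?m \<bullet> n))"
      by (rule rltD[OF w _ _ 1(1)]) simp_all
    obtain q where q [simp]: "has w q Qt" "0 < val w q" and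
      evq: "ev w (\<lambda>w' n. has w' q Qt \<and> 0 < val w' q \<and> val w' (rconst (\<^bold>- ?m) \<bullet> n) + val w' q < val w' (f \<bullet> ?z \<bullet> n))"
      by (rule rltD[OF w _ _ 1(2)]) simp_all
    \<comment> \<open>The smaller of the two margins, picked as a term by the totality of the order
      of values.\<close>
    obtain d where d [simp]: "has w d Qt" "0 < val w d" "val w d \<le> val w p" "val w d \<le> val w q"
      using p q by (metis linear order_refl)
    have "w \<tturnstile> rlt (rabs (f \<bullet> ?z)) e"
    proof (rule rltI[OF w _ _ d(1,2)])
      show "ev w (\<lambda>w' n. val w' (rabs (f \<bullet> ?z) \<bullet> n) + val w' d < val w' (e \<bullet> n))"
      proof (rule ev_mono[OF ev_conj[OF w scale ev_conj[OF w evp evq]]])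
        fix w' n assume w': "w \<sqsubseteq> w'" and n [simp]: "has w' n Nt" and
          h: "(8 * val w' r < val w' (e \<bullet> n) \<and> val w' (e \<bullet> n) < 16 * val w' r) \<and>
            (has w' p Qt \<and> 0 < val w' p \<and> val w' (f \<bullet> ?z \<bullet> n) + val w' p < val w' (rconst ?m \<bullet> n)) \<and>
            has w' q Qt \<and> 0 < val w' q \<and> val w' (rconst (\<^bold>- ?m) \<bullet> n) + val w' q < val w' (f \<bullet> ?z \<bullet> n)"
        note [simp] = extendsD(1,2)[OF w']
        have dd: "val w' d \<le> val w' p" "val w' d \<le> val w' q"
          by (rule extends_val(2)[OF w w' d(1)]; simp)+
        have m: "val w' (rconst ?m \<bullet> n) = 8 * val w' r" "val w' (rconst (\<^bold>- ?m) \<bullet> n) = - (8 * val w' r)" by simp_all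
        have "\<bar>val w' (f \<bullet> ?z \<bullet> n)\<bar> < val w' (e \<bullet> n) - val w' d"
          using h dd unfolding m abs_less_iff by linarith
        then show "val w' (rabs (f \<bullet> ?z) \<bullet> n) + val w' d < val w' (e \<bullet> n)" by simp
      qed
    qed simp_all
    then show ?thesis ..
  next
    case 2
    let ?P = "\<lambda>x. rlt (rmul (f \<bullet> ?z) (f \<bullet> x)) (rneg (rmul (rmul e e) (rconst (inv_q (qnum 8)))))"
    \<comment> \<open>Choice is applied to the three requirements on the \<open>n\<close>-th point
      at once: membership in the unit interval, product bound and closeness to the limit.\<close>
    let ?A = "in01 (Var 0) \<^bold>\<and> rlt (rmul (shift 2 f \<bullet> shift 2 ?z) (shift 2 f \<bullet> Var 0))
        (rneg (rmul (rmul (shift 2 e) (shift 2 e)) (rconst (inv_q (qnum 8))))) \<^bold>\<and> stays_near (Var 0) (shift 2 ?z) (Var 1)"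
    have A: "subst_fm (case_nat x (case_nat n Var)) ?A = (in01 x \<^bold>\<and> ?P x \<^bold>\<and> stays_near x ?z n)" for x n by simp
    have rr: "0 < val w (r \<^bold>* r)" by (rule val_mult_pos) (use rpos in simp_all)
    obtain X where X: "has w X (Nt \<rightarrow> Rt)" and
      XA: "\<And>w' n. w \<sqsubseteq> w' \<Longrightarrow> has w' n Nt \<Longrightarrow> w' \<tturnstile> subst_fm (case_nat (X \<bullet> n) (case_nat n Var)) ?A"
    proof (rule forces_choice[OF w, of Rt ?A])
      show "wfe (case_nat (Some Rt) (case_nat (Some Nt) (env (fst w)))) ?A" using z by simp
      fix w' n assume w': "w \<sqsubseteq> w'" and n [simp]: "has w' n Nt"
      note [simp] = extendsD(1,2)[OF w']
      interpret w': halving w' f ?c ?b g by (rule up[OF w'])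
      have rpos': "0 < val w' r" by (rule val_pos_up[OF w w' r rpos])
      \<comment> \<open>A rational of the \<open>n\<close>-th interval, which also contains the
        limit and whose width is at most \<open>1/(n+1)\<close>.\<close>
      obtain q where q [simp]: "has w' q Qt" and lq: "val w' (lo (g \<bullet> n)) \<le> val w' q" and
        qh: "val w' q \<le> val w' (hi (g \<bullet> n))" and
        sgn: "w' \<tturnstile> rlt (rconst ?c) (f \<bullet> ?z) \<and> w' \<tturnstile> neg_at f ?b q \<or>
          w' \<tturnstile> rlt (f \<bullet> ?z) (rconst (\<^bold>- ?c)) \<and> w' \<tturnstile> pos_at f ?b q"
        by (rule w'.opposite_point[OF n]) (use 2 extendsD(3)[OF w'] in blast)+
      have 1: "w' \<tturnstile> in01 (rconst q)"
        by (rule in01_const) (use w'.bounds[OF n] lq qh in simp_all)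
      have 3: "w' \<tturnstile> stays_near (rconst q) ?z n"
      proof (rule stays_nearI)
        fix w'' m assume w'': "w' \<sqsubseteq> w''" and m [simp]: "has w'' m Nt" and le: "val w'' (iota n) \<le> val w'' (iota m)"
        note [simp] = extendsD(1,2)[OF w'']
        interpret w'': halving w'' f ?c ?b g by (rule w'.up[OF w''])
        have n'': "has w'' n Nt" by simp
        have "val w'' (lo (g \<bullet> n)) \<le> val w'' q" "val w'' q \<le> val w'' (hi (g \<bullet> n))"
          by (rule extends_val(2)[OF _ w'']; use lq qh in simp)+
        moreover have "val w'' (rconst q \<bullet> m) = val w'' q" by simp
        ultimately show "\<bar>val w'' (rconst q \<bullet> m) - val w'' (?z \<bullet> m)\<bar> \<le> val w'' (eps_q n)"
          using w''.limit_between[OF n'' m le] w''.width[OF n''] unfolding abs_le_iff by linarith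
      qed simp_all
      have "ev w' (\<lambda>w'' j. 7 * val w'' r < val w'' (f \<bullet> ?z \<bullet> j) \<and> 6 * val w'' r < - val w'' (f \<bullet> rconst q \<bullet> j) \<or>
         7 * val w'' r < - val w'' (f \<bullet> ?z \<bullet> j) \<and> 6 * val w'' r < val w'' (f \<bullet> rconst q \<bullet> j))"
        using sgn
      proof (elim disjE conjE)
        assume h: "w' \<tturnstile> rlt (rconst ?c) (f \<bullet> ?z)" "w' \<tturnstile> neg_at f ?b q"
        obtain d1 where d1: "ev w' (\<lambda>w'' j. has w'' d1 Qt \<and> 0 < val w'' d1 \<and> val w'' (rconst ?c \<bullet> j) + val w'' d1 < val w'' (f \<bullet> ?z \<bullet> j))"
          by (rule rltD[OF w'.w _ _ h(1)]) simp_all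
        obtain d2 where d2: "ev w' (\<lambda>w'' j. has w'' d2 Qt \<and> 0 < val w'' d2 \<and> val w'' (f \<bullet> rconst q \<bullet> j) + val w'' d2 < val w'' (rconst (\<^bold>- ?b) \<bullet> j))"
          by (rule rltD[OF w'.w _ _ h(2)[unfolded neg_at_def]]) simp_all
        show ?thesis
        proof (rule ev_mono[OF ev_conj[OF w'.w d1 d2]], rule disjI1)
          fix w'' j assume w'': "w' \<sqsubseteq> w''" and [simp]: "has w'' j Nt" and
           h: "(has w'' d1 Qt \<and> 0 < val w'' d1 \<and> val w'' (rconst ?c \<bullet> j) + val w'' d1 < val w'' (f \<bullet> ?z \<bullet> j)) \<and>
              has w'' d2 Qt \<and> 0 < val w'' d2 \<and> val w'' (f \<bullet> rconst q \<bullet> j) + val w'' d2 < val w'' (rconst (\<^bold>- ?b) \<bullet> j)"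
          note [simp] = extendsD(1,2)[OF w'']
          have "val w'' (rconst ?c \<bullet> j) = 7 * val w'' r" "val w'' (rconst (\<^bold>- ?b) \<bullet> j) = - (6 * val w'' r)" by simp_all
          then show "7 * val w'' r < val w'' (f \<bullet> ?z \<bullet> j) \<and> 6 * val w'' r < - val w'' (f \<bullet> rconst q \<bullet> j)"
            using h by linarith
        qed
      next
        assume h: "w' \<tturnstile> rlt (f \<bullet> ?z) (rconst (\<^bold>- ?c))" "w' \<tturnstile> pos_at f ?b q"
        obtain d1 where d1: "ev w' (\<lambda>w'' j. has w'' d1 Qt \<and> 0 < val w'' d1 \<and> val w'' (f \<bullet> ?z \<bullet> j) + val w'' d1 < val w'' (rconst (\<^bold>- ?c) \<bullet> j))"
          by (rule rltD[OF w'.w _ _ h(1)]) simp_all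
        obtain d2 where d2: "ev w' (\<lambda>w'' j. has w'' d2 Qt \<and> 0 < val w'' d2 \<and> val w'' (rconst ?b \<bullet> j) + val w'' d2 < val w'' (f \<bullet> rconst q \<bullet> j))"
          by (rule rltD[OF w'.w _ _ h(2)[unfolded pos_at_def]]) simp_all
        show ?thesis
        proof (rule ev_mono[OF ev_conj[OF w'.w d1 d2]], rule disjI2)
          fix w'' j assume w'': "w' \<sqsubseteq> w''" and [simp]: "has w'' j Nt" and
           h: "(has w'' d1 Qt \<and> 0 < val w'' d1 \<and> val w'' (f \<bullet> ?z \<bullet> j) + val w'' d1 < val w'' (rconst (\<^bold>- ?c) \<bullet> j)) \<and>
              has w'' d2 Qt \<and> 0 < val w'' d2 \<and> val w'' (rconst ?b \<bullet> j) + val w'' d2 < val w'' (f \<bullet> rconst q \<bullet> j)"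
          note [simp] = extendsD(1,2)[OF w'']
          have "val w'' (rconst (\<^bold>- ?c) \<bullet> j) = - (7 * val w'' r)" "val w'' (rconst ?b \<bullet> j) = 6 * val w'' r" by simp_all
          then show "7 * val w'' r < - val w'' (f \<bullet> ?z \<bullet> j) \<and> 6 * val w'' r < val w'' (f \<bullet> rconst q \<bullet> j)"
            using h by linarith
        qed
      qed
      note ev_sgn = this
      have 2: "w' \<tturnstile> ?P (rconst q)"
      proof (rule rltI[of w' _ _ "r \<^bold>* r"])
        show "0 < val w' (r \<^bold>* r)" by (rule val_pos_up[OF w w' _ rr]) simp
        show "ev w' (\<lambda>w'' j. val w'' (rmul (f \<bullet> ?z) (f \<bullet> rconst q) \<bullet> j) + val w'' (r \<^bold>* r) <
           val w'' (rneg (rmul (rmul e e) (rconst (inv_q (qnum 8)))) \<bullet> j))"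
        proof (rule ev_mono[OF ev_conj[OF w'.w ev_up[OF scale w'] ev_sgn]])
          fix w'' j assume w'': "w' \<sqsubseteq> w''" and j [simp]: "has w'' j Nt" and
            h: "(8 * val w'' r < val w'' (e \<bullet> j) \<and> val w'' (e \<bullet> j) < 16 * val w'' r) \<and>
             (7 * val w'' r < val w'' (f \<bullet> ?z \<bullet> j) \<and> 6 * val w'' r < - val w'' (f \<bullet> rconst q \<bullet> j) \<or>
              7 * val w'' r < - val w'' (f \<bullet> ?z \<bullet> j) \<and> 6 * val w'' r < val w'' (f \<bullet> rconst q \<bullet> j))"
          note [simp] = extendsD(1,2)[OF w'']
          have r'': "0 < val w'' r" by (rule val_pos_up[OF w'.w w'' _ rpos']) simp
          have "val w'' ((rmul e e \<bullet> j) \<^bold>* (rconst (inv_q (qnum 8)) \<bullet> j)) = val w'' ((e \<bullet> j) \<^bold>* (e \<bullet> j) \<^bold>* inv_q (qnum 8))"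
            by (rule val_mult_cong) simp_all
          then have rhs: "val w'' (rneg (rmul (rmul e e) (rconst (inv_q (qnum 8)))) \<bullet> j) = - (val w'' ((e \<bullet> j) \<^bold>* (e \<bullet> j)) / 8)"
            by simp
          have ee: "\<bar>val w'' (e \<bullet> j)\<bar> \<le> 16 * val w'' r" using h r'' by (simp add: abs_le_iff)
          have "val w'' (r \<^bold>* r) < - val w'' ((f \<bullet> ?z \<bullet> j) \<^bold>* (f \<bullet> rconst q \<bullet> j)) - val w'' ((e \<bullet> j) \<^bold>* (e \<bullet> j)) / 8"
          \<comment> \<open>Changing the sign of the negative factor reduces both cases to
            \<open>product_jump\<close>.\<close>
          proof (cases "7 * val w'' r < val w'' (f \<bullet> ?z \<bullet> j) \<and> 6 * val w'' r < - val w'' (f \<bullet> rconst q \<bullet> j)")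
            case True
            then show ?thesis
              using product_jump[of w'' "f \<bullet> ?z \<bullet> j" "\<^bold>- (f \<bullet> rconst q \<bullet> j)" "e \<bullet> j" r] r'' ee by simp
          next
            case False
            with h have "7 * val w'' r < - val w'' (f \<bullet> ?z \<bullet> j)" "6 * val w'' r < val w'' (f \<bullet> rconst q \<bullet> j)" by blast+
            then show ?thesis
              using product_jump[of w'' "\<^bold>- (f \<bullet> ?z \<bullet> j)" "f \<bullet> rconst q \<bullet> j" "e \<bullet> j" r] r'' ee by simp
          qed
          then show "val w'' (rmul (f \<bullet> ?z) (f \<bullet> rconst q) \<bullet> j) + val w'' (r \<^bold>* r) <
            val w'' (rneg (rmul (rmul e e) (rconst (inv_q (qnum 8)))) \<bullet> j)"
            unfolding rhs by simp
        qed
      qed simp_all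
      show "\<exists>x. has w' x Rt \<and> w' \<tturnstile> subst_fm (case_nat x (case_nat n Var)) ?A"
        unfolding A forces_And[OF w'.w] using 1 2 3 by (intro exI[of _ "rconst q"]) simp
    qed (rule that; blast)
    have XA': "w' \<tturnstile> in01 (X \<bullet> n)" "w' \<tturnstile> ?P (X \<bullet> n)" "w' \<tturnstile> stays_near (X \<bullet> n) ?z n"
      if "w \<sqsubseteq> w'" "has w' n Nt" for w' n
      using XA[OF that] unfolding A by (simp_all add: forces_And[OF extendsD(1)[OF that(1)]])
    have "w \<tturnstile> All Nt (in01 (shift 1 X \<bullet> Var 0))"
      by (rule forces_AllI[OF w]) (use XA' X in simp_all)
    moreover have "w \<tturnstile> All Nt (rlt (rmul (shift 1 f \<bullet> shift 1 ?z) (shift 1 f \<bullet> (shift 1 X \<bullet> Var 0)))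
        (rneg (rmul (rmul (shift 1 e) (shift 1 e)) (rconst (inv_q (qnum 8))))))"
      by (rule forces_AllI[OF w]) (use XA' X z in simp_all)
    moreover have "w \<tturnstile> rconv X ?z"
    proof (rule rconvI[OF w X z])
      fix w' d assume w': "w \<sqsubseteq> w'" and w'w [simp]: "world w'" and d: "has w' d Qt" "0 < val w' d"
      obtain K where K: "has w' K Nt" and Kd: "val w' (eps_q K) < val w' d"
        by (rule eps_archimedean[OF w'w d])
      show "ev w' (\<lambda>w1 n. ev w1 (\<lambda>w'' m. \<bar>val w'' (X \<bullet> n \<bullet> m) - val w'' (?z \<bullet> m)\<bar> < val w'' d))"
      proof (rule evI[OF K])
        fix w1 n assume w1: "w' \<sqsubseteq> w1" and w1w [simp]: "world w1" and K1: "has w1 K Nt" and n: "has w1 n Nt"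
          and Kn: "val w1 (iota K) \<le> val w1 (iota n)"
        have ww1: "w \<sqsubseteq> w1" by (rule extends_trans[OF w' w1])
        have "val w1 (eps_q K) < val w1 d" by (rule extends_val(1)[OF w'w w1 _ d(1) Kd]) (use K in simp)
        then have nd: "val w1 (eps_q n) < val w1 d" using eps_antimono[OF w1w K1 n Kn] by simp
        show "ev w1 (\<lambda>w'' m. \<bar>val w'' (X \<bullet> n \<bullet> m) - val w'' (?z \<bullet> m)\<bar> < val w'' d)"
        proof (rule evI[OF n])
          fix w2 m assume w2: "w1 \<sqsubseteq> w2" and w2w: "world w2" and n2: "has w2 n Nt" and m: "has w2 m Nt"
            and le: "val w2 (iota n) \<le> val w2 (iota m)"
          have ww2: "w \<sqsubseteq> w2" by (rule extends_trans[OF ww1 w2])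
          have "\<bar>val w2 (X \<bullet> n \<bullet> m) - val w2 (?z \<bullet> m)\<bar> \<le> val w2 (eps_q n)"
            by (rule stays_nearD[OF w2w _ _ n2 m XA'(3)[OF ww2 n2] le])
              (use extendsD(2)[OF ww2] X z n2 in simp_all)
          also have "val w2 (eps_q n) < val w2 d"
            by (rule extends_val(1)[OF w1w w2 _ _ nd]) (use n extendsD(2)[OF w1] d in simp_all)
          finally show "\<bar>val w2 (X \<bullet> n \<bullet> m) - val w2 (?z \<bullet> m)\<bar> < val w2 d" .
        qed
      qed
    qed
    ultimately have "w \<tturnstile> jump_seq f e ?z"
      unfolding jump_seq_def
      by (intro forces_ExI[OF w _ X]) (use z in \<open>simp_all add: forces_And\<close>)
    then show ?thesis ..
  qed
  then show ?thesis using limit_in01 z by blast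
qed

theorem proposition4p1:
  shows "[]; [] \<turnstile>
    All (Rt \<rightarrow> Rt) (is_fun01 (Var 0) \<^bold>\<and> rle (rmul (Var 0 \<bullet> r0) (Var 0 \<bullet> r1)) r0 \<^bold>\<longrightarrow>
      All Rt (is_real (Var 0) \<^bold>\<and> rlt r0 (Var 0) \<^bold>\<longrightarrow>
        Ex Rt (in01 (Var 0) \<^bold>\<and>
          (rlt (rabs (Var 2 \<bullet> Var 0)) (Var 1) \<^bold>\<or> jump_seq (Var 2) (Var 1) (Var 0)))
        \<^bold>\<and>
        All Rt (in01 (Var 0) \<^bold>\<and> jump_seq (Var 2) (Var 1) (Var 0) \<^bold>\<longrightarrow>
          WLPO \<^bold>\<and> (strongly_ext (Var 2) \<^bold>\<longrightarrow> LPO))))"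
  (is "[]; [] \<turnstile> All (Rt \<rightarrow> Rt) (?H \<^bold>\<longrightarrow> All Rt (?K \<^bold>\<longrightarrow> ?C))")
proof (rule completeness)
  show "wfe (\<lambda>_. None) (All (Rt \<rightarrow> Rt) (?H \<^bold>\<longrightarrow> All Rt (?K \<^bold>\<longrightarrow> ?C)))" by simp
  fix w assume w [simp]: "world w"
  have L': "lang w (All (Rt \<rightarrow> Rt) (?H \<^bold>\<longrightarrow> All Rt (?K \<^bold>\<longrightarrow> ?C)))" by simp
  have "w \<tturnstile> All (Rt \<rightarrow> Rt) (?H \<^bold>\<longrightarrow> All Rt (?K \<^bold>\<longrightarrow> ?C))"
  proof (rule forces_AllI[OF w L'])
    fix w1 f assume w1: "w \<sqsubseteq> w1" and f: "has w1 f (Rt \<rightarrow> Rt)"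
    note [simp] = extendsD(1)[OF w1] f
    let ?A = "\<lambda>e. Ex Rt (in01 (Var 0) \<^bold>\<and> (rlt (rabs (shift 1 f \<bullet> Var 0)) (shift 1 e) \<^bold>\<or> jump_seq (shift 1 f) (shift 1 e) (Var 0)))"
    let ?B = "\<lambda>e. All Rt (in01 (Var 0) \<^bold>\<and> jump_seq (shift 1 f) (shift 1 e) (Var 0) \<^bold>\<longrightarrow>
          WLPO \<^bold>\<and> (strongly_ext (shift 1 f) \<^bold>\<longrightarrow> LPO))"
    have "w1 \<tturnstile> (is_fun01 f \<^bold>\<and> rle (rmul (f \<bullet> r0) (f \<bullet> r1)) r0 \<^bold>\<longrightarrow>
       All Rt (is_real (Var 0) \<^bold>\<and> rlt r0 (Var 0) \<^bold>\<longrightarrow> subst_fm (up (case_nat f Var)) ?C))"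
    proof (rule forces_ImpI)
      fix w2 assume w2: "w1 \<sqsubseteq> w2" and h2: "w2 \<tturnstile> (is_fun01 f \<^bold>\<and> rle (rmul (f \<bullet> r0) (f \<bullet> r1)) r0)"
      note [simp] = extendsD(1,2)[OF w2]
      show "w2 \<tturnstile> All Rt (is_real (Var 0) \<^bold>\<and> rlt r0 (Var 0) \<^bold>\<longrightarrow> subst_fm (up (case_nat f Var)) ?C)"
      proof (rule forces_AllI)
        fix w3 e assume w3: "w2 \<sqsubseteq> w3" and e: "has w3 e Rt"
        note [simp] = extendsD(1,2)[OF w3] e
        have "w3 \<tturnstile> (is_real e \<^bold>\<and> rlt r0 e \<^bold>\<longrightarrow> ?A e \<^bold>\<and> ?B e)"
        proof (rule forces_ImpI)
          fix w4 assume w4: "w3 \<sqsubseteq> w4" and h4: "w4 \<tturnstile> (is_real e \<^bold>\<and> rlt r0 e)"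
          note [simp] = extendsD(1,2)[OF w4]
          have F: "w4 \<tturnstile> is_fun01 f" and S: "w4 \<tturnstile> rle (rmul (f \<bullet> r0) (f \<bullet> r1)) r0"
            and R: "w4 \<tturnstile> is_real e" and E: "w4 \<tturnstile> rlt r0 e"
            using extendsD(3)[OF w4 extendsD(3)[OF w3 h2]] h4 by (simp_all add: forces_And)
          obtain z where z: "has w4 z Rt" "w4 \<tturnstile> in01 z"
            "w4 \<tturnstile> rlt (rabs (f \<bullet> z)) e \<or> w4 \<tturnstile> jump_seq f e z"
            using root_or_jump[OF _ _ _ F S R E] by auto
          have "w4 \<tturnstile> ?A e"
            by (rule forces_ExI[OF _ _ z(1)]) (use z in \<open>simp_all add: forces_And forces_Or\<close>)
          moreover have "w4 \<tturnstile> ?B e"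
          proof (rule forces_AllI)
            fix w5 z assume w5: "w4 \<sqsubseteq> w5" and z: "has w5 z Rt"
            note [simp] = extendsD(1,2)[OF w5] z
            have "w5 \<tturnstile> (in01 z \<^bold>\<and> jump_seq f e z \<^bold>\<longrightarrow> WLPO \<^bold>\<and> (strongly_ext f \<^bold>\<longrightarrow> LPO))"
            proof (rule forces_ImpI)
              fix w6 assume w6: "w5 \<sqsubseteq> w6" and h6: "w6 \<tturnstile> (in01 z \<^bold>\<and> jump_seq f e z)"
              note [simp] = extendsD(1,2)[OF w6]
              have "w6 \<tturnstile> is_fun01 f" "w6 \<tturnstile> rlt r0 e"
                using extendsD(3)[OF w6 extendsD(3)[OF w5 F]] extendsD(3)[OF w6 extendsD(3)[OF w5 E]] by simp_all
              then show "w6 \<tturnstile> (WLPO \<^bold>\<and> (strongly_ext f \<^bold>\<longrightarrow> LPO))"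
                using jump_omniscience[of w6 f e z] h6 by (simp add: forces_And)
            qed simp_all
            then show "w5 \<tturnstile> inst (in01 (Var 0) \<^bold>\<and> jump_seq (shift 1 f) (shift 1 e) (Var 0) \<^bold>\<longrightarrow>
              WLPO \<^bold>\<and> (strongly_ext (shift 1 f) \<^bold>\<longrightarrow> LPO)) z" by simp
          qed simp_all
          ultimately show "w4 \<tturnstile> (?A e \<^bold>\<and> ?B e)" by (simp add: forces_And)
        qed simp_all
        then show "w3 \<tturnstile> inst (is_real (Var 0) \<^bold>\<and> rlt r0 (Var 0) \<^bold>\<longrightarrow> subst_fm (up (case_nat f Var)) ?C) e"
          by simp
      qed simp_all
    qed simp_all
    then show "w1 \<tturnstile> inst (?H \<^bold>\<longrightarrow> All Rt (?K \<^bold>\<longrightarrow> ?C)) f" by simp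
  qed
  then show "All (Rt \<rightarrow> Rt) (?H \<^bold>\<longrightarrow> All Rt (?K \<^bold>\<longrightarrow> ?C)) \<in> snd w" by (simp add: forces_def)
qed

end
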